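(* Let $C\subseteq\mathbb{R}^n$ be an open convex cone and let $r>0$. Suppose that $F$ is holomorphic on the tube $T^{C(r)}$, that $F(\,\cdot\,+iy)\in\mathcal{D}'_{E'_\ast}$ for every $y\in C(r)$, and that for each $r'>0$ the set $\{F(\,\cdot\,+iy):\ r'<|y|<r,\ y\in C\}$ is bounded in $\mathcal{D}'_{E'_\ast}$. Then the following three statements are equivalent: (i) $F(\,\cdot\,+iy)\in E'$ for all $y\in C(r)$, and there are constants $M>0$, $\kappa\ge 0$ such that $$\|F(\,\cdot\,+iy)\|_{E'}\le \frac{M}{(d_{C(r)}(y))^{\kappa}},\qquad y\in C(r).$$ (ii) $F$ has boundary values in $\mathcal{D}'_{E'_\ast}$, namely, there is $f\in\mathcal{D}'_{E'_\ast}$ such that $f=\lim_{y\to0,\ y\in C}F(\,\cdot\,+iy)$ strongly in $\mathcal{D}'_{E'_\ast}$. (iii) The set $\{F(\,\cdot\,+iy):\ y\in C(r)\}$ is bounded in $\mathcal{D}'_{E'_\ast}$. In addition, if any of these equivalent conditions is satisfied, then $F(\,\cdot\,+iy)\in E'_\ast$ for every $y\in C(r)$.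
   Context: Throughout, $E$ is a translation-invariant Banach space of tempered distributions on $\mathbb{R}^n$, i.e. a Banach space such that: (a) $\mathcal{S}(\mathbb{R}^n)\hookrightarrow E\hookrightarrow\mathcal{S}'(\mathbb{R}^n)$ with continuous dense inclusions; (b) $T_h(E)=E$ for all $h\in\mathbb{R}^n$, where $(T_hg)(x)=g(x+h)$; (c) there are $M'>0$, $\tau\ge0$ with $\omega(h):=\|T_{-h}\|_{L(E)}\le M'(1+|h|)^{\tau}$ for all $h\in\mathbb{R}^n$. $E'$ is the dual Banach space, regarded as a subspace of $\mathcal{S}'(\mathbb{R}^n)$ (by restricting functionals to the dense subspace $\mathcal{S}(\mathbb{R}^n)$); a function belongs to $E'$ (or another distribution space) if the distribution it defines does. Put $\check\omega(x)=\omega(-x)$, $\check u(x)=u(-x)$, and let $L^1_{\check\omega}$ be the Beurling algebra of measurable $u$ with $\int|u(x)|\check\omega(x)\,dx<\infty$ (similarly $L^1_\omega$). Convolution extends to $L^1_\omega\times E\to E$, and for $u\in L^1_{\check\omega}$, $f\in E'$ one defines $u\ast f\in E'$ by $\langle u\ast f,g\rangle=\langle f,\check u\ast g\rangle$, $g\in E$. Set $E'_\ast=L^1_{\check\omega}\ast E'$; this is a closed subspace of $E'$ and equals $\{f\in E':\lim_{h\to0}\|T_hf-f\|_{E'}=0\}$. $\mathcal{D}_E$ is the Fréchet space of all $\varphi\in E$ with $\varphi^{(\alpha)}\in E$ for all $\alpha\in\mathbb{N}^n$, topologized by the norms $\max_{|\alpha|\le N}\|\varphi^{(\alpha)}\|_E$,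 $N\in\mathbb{N}$. $\mathcal{D}'_{E'_\ast}$ denotes the strong dual of $\mathcal{D}_E$; since $\mathcal{S}(\mathbb{R}^n)$ is dense in $\mathcal{D}_E$, it is continuously included in $\mathcal{S}'(\mathbb{R}^n)$. For open $V\subseteq\mathbb{R}^n$, $T^V=\mathbb{R}^n+iV\subseteq\mathbb{C}^n$ and $d_V(y)=\operatorname{dist}(y,\partial V)$ for $y\in V$. Cones have vertex at the origin ($C$ may be $\mathbb{R}^n$), and $C(r)=C\cap\{y\in\mathbb{R}^n:|y|<r\}$. *)

theory Defs
  imports "HOL-Analysis.Analysis" "HOL-Library.Function_Algebras"
begin

section \<open>Locally convex spaces of complex-valued functions\<close>

text \<open>
  All spaces below (test functions, distributions, their duals) are complex subspaces \<open>V\<close> of some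
  function space \<open>'a \<Rightarrow> complex\<close>, with the pointwise operations and a
  family \<open>P\<close> of seminorms. The seminorms are only meaningful on \<open>V\<close>. Functionals on \<open>V\<close>
  are made total by the value 0 outside \<open>V\<close>, so that equal functionals are equal as functions.
\<close>

definition csubspace :: "('a \<Rightarrow> complex) set \<Rightarrow> bool" where
  "csubspace V \<longleftrightarrow> 0 \<in> V \<and> (\<forall>f\<in>V. \<forall>g\<in>V. f + g \<in> V) \<and> (\<forall>c. \<forall>f\<in>V. (\<lambda>x. c * f x) \<in> V)"

definition clinear_functional_on :: "('a \<Rightarrow> complex) set \<Rightarrow> (('a \<Rightarrow> complex) \<Rightarrow> complex) \<Rightarrow> bool" where
  "clinear_functional_on V L \<longleftrightarrow>
     (\<forall>f\<in>V. \<forall>g\<in>V. L (f + g) = L f + L g) \<and> (\<forall>c. \<forall>f\<in>V. L (\<lambda>x. c * f x) = c * L f)"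

definition lc_topology ::
    "('a \<Rightarrow> complex) set \<Rightarrow> (('a \<Rightarrow> complex) \<Rightarrow> real) set \<Rightarrow> ('a \<Rightarrow> complex) topology" where
  "lc_topology V P =
     topology_generated_by {{g \<in> V. p (g - f) < \<epsilon>} | f p \<epsilon>. f \<in> V \<and> p \<in> P \<and> \<epsilon> > 0}"

definition lc_bounded ::
    "('a \<Rightarrow> complex) set \<Rightarrow> (('a \<Rightarrow> complex) \<Rightarrow> real) set \<Rightarrow> ('a \<Rightarrow> complex) set \<Rightarrow> bool" where
  "lc_bounded V P B \<longleftrightarrow> B \<subseteq> V \<and> (\<forall>p\<in>P. bdd_above (p ` B))"

definition lc_dual ::
    "('a \<Rightarrow> complex) set \<Rightarrow> (('a \<Rightarrow> complex) \<Rightarrow> real) set \<Rightarrow> (('a \<Rightarrow> complex) \<Rightarrow> complex) set" where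
  "lc_dual V P = {L. (\<forall>f. f \<notin> V \<longrightarrow> L f = 0) \<and> clinear_functional_on V L \<and>
                     continuous_map (lc_topology V P) euclidean L}"

text \<open>The seminorms of uniform convergence on bounded sets; the empty set is excluded because
  the supremum of the empty set of reals is unspecified.\<close>

definition strong_seminorms ::
    "('a \<Rightarrow> complex) set \<Rightarrow> (('a \<Rightarrow> complex) \<Rightarrow> real) set \<Rightarrow> ((('a \<Rightarrow> complex) \<Rightarrow> complex) \<Rightarrow> real) set" where
  "strong_seminorms V P = {(\<lambda>L. SUP f\<in>B. cmod (L f)) | B. lc_bounded V P B \<and> B \<noteq> {}}"

definition strong_dual_topology ::
    "('a \<Rightarrow> complex) set \<Rightarrow> (('a \<Rightarrow> complex) \<Rightarrow> real) set \<Rightarrow> (('a \<Rightarrow> complex) \<Rightarrow> complex) topology" where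
  "strong_dual_topology V P = lc_topology (lc_dual V P) (strong_seminorms V P)"

definition strong_dual_bounded ::
    "('a \<Rightarrow> complex) set \<Rightarrow> (('a \<Rightarrow> complex) \<Rightarrow> real) set \<Rightarrow> (('a \<Rightarrow> complex) \<Rightarrow> complex) set \<Rightarrow> bool" where
  "strong_dual_bounded V P = lc_bounded (lc_dual V P) (strong_seminorms V P)"

definition cbanach_on :: "('a \<Rightarrow> complex) set \<Rightarrow> (('a \<Rightarrow> complex) \<Rightarrow> real) \<Rightarrow> bool" where
  "cbanach_on E nE \<longleftrightarrow> csubspace E \<and>
     (\<forall>f\<in>E. 0 \<le> nE f \<and> (nE f = 0 \<longleftrightarrow> f = 0)) \<and>
     (\<forall>f\<in>E. \<forall>g\<in>E. nE (f + g) \<le> nE f + nE g) \<and>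
     (\<forall>c. \<forall>f\<in>E. nE (\<lambda>x. c * f x) = cmod c * nE f) \<and>
     (\<forall>\<sigma> :: nat \<Rightarrow> 'a \<Rightarrow> complex.
        (\<forall>k. \<sigma> k \<in> E) \<and> (\<forall>\<epsilon>>0. \<exists>N. \<forall>m\<ge>N. \<forall>k\<ge>N. nE (\<sigma> m - \<sigma> k) < \<epsilon>) \<longrightarrow>
        (\<exists>f\<in>E. (\<lambda>k. nE (\<sigma> k - f)) \<longlonglongrightarrow> 0))"

definition dual_norm ::
    "('a \<Rightarrow> complex) set \<Rightarrow> (('a \<Rightarrow> complex) \<Rightarrow> real) \<Rightarrow> (('a \<Rightarrow> complex) \<Rightarrow> complex) \<Rightarrow> real" where
  "dual_norm E nE L = (SUP f\<in>{f\<in>E. nE f \<le> 1}. cmod (L f))"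


section \<open>Test functions and tempered distributions\<close>

type_synonym 'n test_fun = "real ^ 'n \<Rightarrow> complex"
type_synonym 'n tdist = "'n test_fun \<Rightarrow> complex"

definition partial_deriv :: "'n::finite \<Rightarrow> 'n test_fun \<Rightarrow> 'n test_fun" where
  "partial_deriv j f = (\<lambda>x. frechet_derivative f (at x) (axis j 1))"

text \<open>A multi-index is encoded by a list of coordinate directions, its order being the length of
  the list. Lists that are permutations of each other give the same derivative, so ranging
  over all lists (of length at most \<open>N\<close>) is ranging over all multi-indices (of order at most \<open>N\<close>).\<close>

definition partial_derivs :: "'n::finite list \<Rightarrow> 'n test_fun \<Rightarrow> 'n test_fun" where
  "partial_derivs js f = foldr partial_deriv js f"

definition smooth :: "'n::finite test_fun \<Rightarrow> bool" where
  "smooth f \<longleftrightarrow> (\<forall>js x. partial_derivs js f differentiable (at x))"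

definition test_functions :: "'n::finite test_fun set" where
  "test_functions = {f. smooth f \<and> (\<exists>K. compact K \<and> (\<forall>x. x \<notin> K \<longrightarrow> f x = 0))}"

definition schwartz :: "'n::finite test_fun set" where
  "schwartz = {f. smooth f \<and>
     (\<forall>js k. bdd_above (range (\<lambda>x. (1 + norm x) ^ k * cmod (partial_derivs js f x))))}"

definition schwartz_norm :: "nat \<Rightarrow> 'n::finite test_fun \<Rightarrow> real" where
  "schwartz_norm k f =
     (SUP (js, x)\<in>{js. length js \<le> k} \<times> UNIV. (1 + norm x) ^ k * cmod (partial_derivs js f x))"

abbreviation schwartz_seminorms :: "('n::finite test_fun \<Rightarrow> real) set" where
  "schwartz_seminorms \<equiv> range schwartz_norm"

definition tempered :: "'n::finite tdist set" where
  "tempered = lc_dual schwartz schwartz_seminorms"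

definition schwartz_dist :: "'n::finite test_fun \<Rightarrow> 'n tdist" where
  "schwartz_dist f = (\<lambda>\<phi>. if \<phi> \<in> schwartz then LINT x|lborel. f x * \<phi> x else 0)"

text \<open>The distribution \<open>T\<^sub>h u\<close>, which for a function \<open>u\<close> is \<open>x \<mapsto> u (x + h)\<close>.\<close>

definition transl :: "real ^ 'n \<Rightarrow> 'n::finite tdist \<Rightarrow> 'n tdist" where
  "transl h u = (\<lambda>\<phi>. u (\<lambda>x. \<phi> (x - h)))"

definition dist_deriv :: "'n::finite \<Rightarrow> 'n tdist \<Rightarrow> 'n tdist" where
  "dist_deriv j u = (\<lambda>\<phi>. if \<phi> \<in> schwartz then - u (partial_deriv j \<phi>) else 0)"

definition dist_derivs :: "'n::finite list \<Rightarrow> 'n tdist \<Rightarrow> 'n tdist" where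
  "dist_derivs js u = foldr dist_deriv js u"


section \<open>Translation-invariant Banach spaces of tempered distributions\<close>

definition transl_weight :: "'n::finite tdist set \<Rightarrow> ('n tdist \<Rightarrow> real) \<Rightarrow> real ^ 'n \<Rightarrow> real" where
  "transl_weight E nE h = (SUP f\<in>{f\<in>E. nE f \<le> 1}. nE (transl (- h) f))"

text \<open>\<open>transl_bounded\<close> says that the translations are bounded operators on \<open>E\<close>; without it the
  operator norm \<open>transl_weight\<close> would be an unspecified supremum.\<close>

locale transl_inv_banach =
  fixes E :: "'n::finite tdist set" and nE :: "'n tdist \<Rightarrow> real"
  assumes sub_tempered: "E \<subseteq> tempered"
    and banach: "cbanach_on E nE"
    and schwartz_incl: "schwartz_dist ` schwartz \<subseteq> E"
    and schwartz_cont: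
      "continuous_map (lc_topology schwartz schwartz_seminorms) (lc_topology E {nE}) schwartz_dist"
    and schwartz_dense: "lc_topology E {nE} closure_of (schwartz_dist ` schwartz) = E"
    and tempered_cont:
      "continuous_map (lc_topology E {nE}) (strong_dual_topology schwartz schwartz_seminorms) (\<lambda>f. f)"
    and tempered_dense:
      "strong_dual_topology schwartz schwartz_seminorms closure_of E = tempered"
    and transl_invariant: "\<And>h. transl h ` E = E"
    and transl_bounded: "\<And>h. bdd_above ((\<lambda>f. nE (transl h f)) ` {f\<in>E. nE f \<le> 1})"
    and weight_growth:
      "\<exists>M>0. \<exists>\<tau>\<ge>0. \<forall>h. transl_weight E nE h \<le> M * (1 + norm h) powr \<tau>"

definition dual_space :: "'n::finite tdist set \<Rightarrow> ('n tdist \<Rightarrow> real) \<Rightarrow> ('n tdist \<Rightarrow> complex) set" where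
  "dual_space E nE = lc_dual E {nE}"


subsection \<open>Convolution and the space $E'_*$\<close>

definition weighted_L1 :: "(real ^ 'n::finite \<Rightarrow> real) \<Rightarrow> 'n test_fun set" where
  "weighted_L1 w = {u. u \<in> borel_measurable lebesgue \<and> integrable lebesgue (\<lambda>x. cmod (u x) * w x)}"

definition weighted_L1_norm :: "(real ^ 'n::finite \<Rightarrow> real) \<Rightarrow> 'n test_fun \<Rightarrow> real" where
  "weighted_L1_norm w u = (LINT x|lebesgue. cmod (u x) * w x)"

definition convolution :: "'n::finite test_fun \<Rightarrow> 'n test_fun \<Rightarrow> 'n test_fun" where
  "convolution \<phi> \<psi> = (\<lambda>x. LINT t|lborel. \<phi> (x - t) * \<psi> t)"

text \<open>The extension by continuity of the convolution of Schwartz functions to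
  \<open>L\<^sup>1\<^sub>\<omega> \<times> E \<rightarrow> E\<close>, for \<open>u\<close> in \<open>L\<^sup>1\<^sub>\<omega>\<close> and \<open>f\<close> in \<open>E\<close>.\<close>

definition conv_ext ::
    "'n::finite tdist set \<Rightarrow> ('n tdist \<Rightarrow> real) \<Rightarrow> 'n test_fun \<Rightarrow> 'n tdist \<Rightarrow> 'n tdist" where
  "conv_ext E nE u f = (THE g. g \<in> E \<and>
     (\<forall>\<phi> \<psi> :: nat \<Rightarrow> 'n test_fun.
        (\<forall>k. \<phi> k \<in> schwartz \<and> \<psi> k \<in> schwartz) \<and>
        (\<lambda>k. weighted_L1_norm (transl_weight E nE) (\<phi> k - u)) \<longlonglongrightarrow> 0 \<and>
        (\<lambda>k. nE (schwartz_dist (\<psi> k) - f)) \<longlonglongrightarrow> 0 \<longrightarrow>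
        (\<lambda>k. nE (schwartz_dist (convolution (\<phi> k) (\<psi> k)) - g)) \<longlonglongrightarrow> 0))"

definition conv_dual ::
    "'n::finite tdist set \<Rightarrow> ('n tdist \<Rightarrow> real) \<Rightarrow> 'n test_fun \<Rightarrow> ('n tdist \<Rightarrow> complex) \<Rightarrow> ('n tdist \<Rightarrow> complex)"
  where
  "conv_dual E nE u f = (\<lambda>g. if g \<in> E then f (conv_ext E nE (\<lambda>x. u (- x)) g) else 0)"

definition dual_space_star ::
    "'n::finite tdist set \<Rightarrow> ('n tdist \<Rightarrow> real) \<Rightarrow> ('n tdist \<Rightarrow> complex) set" where
  "dual_space_star E nE =
     {conv_dual E nE u f | u f. u \<in> weighted_L1 (\<lambda>x. transl_weight E nE (- x)) \<and> f \<in> dual_space E nE}"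


subsection \<open>The space $D_E$ and its strong dual\<close>

definition DE_space :: "'n::finite tdist set \<Rightarrow> 'n tdist set" where
  "DE_space E = {u \<in> E. \<forall>js. dist_derivs js u \<in> E}"

definition DE_norm :: "('n::finite tdist \<Rightarrow> real) \<Rightarrow> nat \<Rightarrow> 'n tdist \<Rightarrow> real" where
  "DE_norm nE N u = Max ((\<lambda>js. nE (dist_derivs js u)) ` {js. length js \<le> N})"

abbreviation DE_seminorms :: "('n::finite tdist \<Rightarrow> real) \<Rightarrow> ('n tdist \<Rightarrow> real) set" where
  "DE_seminorms nE \<equiv> range (DE_norm nE)"

definition DE_dual :: "'n::finite tdist set \<Rightarrow> ('n tdist \<Rightarrow> real) \<Rightarrow> ('n tdist \<Rightarrow> complex) set" where
  "DE_dual E nE = lc_dual (DE_space E) (DE_seminorms nE)"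

definition DE_dual_topology ::
    "'n::finite tdist set \<Rightarrow> ('n tdist \<Rightarrow> real) \<Rightarrow> ('n tdist \<Rightarrow> complex) topology" where
  "DE_dual_topology E nE = strong_dual_topology (DE_space E) (DE_seminorms nE)"

definition DE_dual_bounded ::
    "'n::finite tdist set \<Rightarrow> ('n tdist \<Rightarrow> real) \<Rightarrow> ('n tdist \<Rightarrow> complex) set \<Rightarrow> bool" where
  "DE_dual_bounded E nE = strong_dual_bounded (DE_space E) (DE_seminorms nE)"


subsection \<open>Functions as elements of the dual spaces\<close>

text \<open>An element \<open>L\<close> of a dual space of \<open>E\<close> or \<open>D\<^sub>E\<close> is viewed as the distribution
  \<open>\<phi> \<mapsto> L (schwartz_dist \<phi>)\<close>. A function \<open>g\<close> defines a distribution on compactly supported test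
  functions; it belongs to a set \<open>X\<close> of functionals if that distribution comes from some
  \<open>L\<close> in \<open>X\<close>, and \<open>func_in X g\<close> is that \<open>L\<close> (unique for subsets of the duals of \<open>E\<close> and \<open>D\<^sub>E\<close>,
  by density of the test functions).\<close>

definition represents :: "('n::finite tdist \<Rightarrow> complex) \<Rightarrow> 'n test_fun \<Rightarrow> bool" where
  "represents L g \<longleftrightarrow> (\<forall>\<phi>\<in>test_functions.
     integrable lborel (\<lambda>x. g x * \<phi> x) \<and> L (schwartz_dist \<phi>) = (LINT x|lborel. g x * \<phi> x))"

definition belongs :: "'n::finite test_fun \<Rightarrow> ('n tdist \<Rightarrow> complex) set \<Rightarrow> bool" where
  "belongs g X \<longleftrightarrow> (\<exists>L\<in>X. represents L g)"

definition func_in :: "('n::finite tdist \<Rightarrow> complex) set \<Rightarrow> 'n test_fun \<Rightarrow> ('n tdist \<Rightarrow> complex)" where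
  "func_in X g = (THE L. L \<in> X \<and> represents L g)"


section \<open>Cones, tubes, and holomorphic functions of several variables\<close>

text \<open>The library's \<open>cone\<close> and \<open>conic\<close> require the vertex to belong to the set, which an open cone
  other than the whole space does not satisfy.\<close>

definition open_convex_cone :: "'a::real_normed_vector set \<Rightarrow> bool" where
  "open_convex_cone C \<longleftrightarrow> open C \<and> convex C \<and> (\<forall>y\<in>C. \<forall>t>0. t *\<^sub>R y \<in> C)"

definition cone_trunc :: "'a::real_normed_vector set \<Rightarrow> real \<Rightarrow> 'a set" where
  "cone_trunc C r = C \<inter> {y. norm y < r}"

definition tube :: "(real ^ 'n) set \<Rightarrow> (complex ^ 'n::finite) set" where
  "tube V = {z. (\<chi> i. Im (z $ i)) \<in> V}"

definition cvec :: "real ^ 'n \<Rightarrow> real ^ 'n \<Rightarrow> complex ^ 'n::finite" where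
  "cvec x y = (\<chi> i. Complex (x $ i) (y $ i))"

definition holomorphic_several_on :: "(complex ^ 'n::finite \<Rightarrow> complex) \<Rightarrow> (complex ^ 'n) set \<Rightarrow> bool" where
  "holomorphic_several_on F U \<longleftrightarrow>
     (\<forall>z\<in>U. \<exists>F'. (F has_derivative F') (at z) \<and> (\<forall>c v. F' (c *s v) = c * F' v))"

definition hslice :: "(complex ^ 'n::finite \<Rightarrow> complex) \<Rightarrow> real ^ 'n \<Rightarrow> 'n test_fun" where
  "hslice F y = (\<lambda>x. F (cvec x y))"

definition bdry_dist :: "'a::metric_space set \<Rightarrow> 'a \<Rightarrow> real" where
  "bdry_dist V y = infdist y (frontier V)"

end

theory Submission
  imports Defs "HOL-Complex_Analysis.Cauchy_Integral_Formula"
begin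

text \<open>
  Write \<open>u y\<close> for \<open>F(. + i y)\<close> as a functional on \<open>D\<^sub>E\<close>. Boundedness in the strong dual means a
  uniform estimate \<open>cmod (u y f) \<le> K * DE_norm nE N f\<close>.

  Holomorphy gives \<open>d/dt \<langle>u (y + t v), \<psi>\<rangle> = - i \<langle>u (y + t v), \<partial>\<^sub>v \<psi>\<rangle>\<close>. Hence equicontinuity makes
  \<open>u\<close> Lipschitz in \<open>y\<close>, with one more derivative in the norm, so that a boundary value exists. Conversely,
  a convergent net is bounded near 0 in each seminorm. If \<open>u y\<close> grows like a negative power of the distance
  to the boundary, integrating this identity along a direction interior to the cone removes one power of
  the distance after the other, at the cost of finitely many derivatives, until a uniform estimate remains.

  For the estimate in \<open>E'\<close>, the value of a function at the centre of a strip of half-width \<open>a\<close> is the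
  integral of its values on the two boundary lines against \<open>1 / (4 a cosh (\<pi> s / (2 a)))\<close>.
  Iterated over the coordinates, this gives \<open>u y = \<Sum>\<^sub>T k * u (y + \<sigma>\<^sub>T)\<close>, where \<open>\<sigma>\<^sub>T\<close> ranges over the
  corners of a cube of half-width \<open>a\<close> proportional to the distance of \<open>y\<close> to the boundary. The kernel \<open>k\<close>
  is a Schwartz function, so convolution with it maps \<open>E\<close> to \<open>D\<^sub>E\<close>, with norms bounded by a power of
  \<open>1 / a\<close>. This yields the growth estimate and, once \<open>u (y + \<sigma>\<^sub>T)\<close> is known to be in \<open>E'\<close>, also that
  \<open>u y\<close> lies in \<open>E'\<^sub>*\<close>.
\<close>

section \<open>Locally convex topologies generated by seminorms\<close>

text \<open>Elements of \<open>E\<close> are only functionals on Schwartz functions, so convolutions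
  in \<open>E\<close> are reached through limits of finite combinations of translates. These limits
  hold in every Schwartz norm, hence in \<open>E\<close>, and the norm of such a combination is
  controlled by the translation bound alone. What is known directly about \<open>u y\<close>
  concerns integrals against test functions; density in \<open>D\<^sub>E\<close> carries identities
  and estimates to the whole space.

  The sech kernel is the harmonic measure of a strip seen from its middle line. Cauchy integrals
  over circles would mix real and imaginary displacements, whereas here the imaginary displacement
  takes finitely many values and the real one becomes a convolution. Exponential decay makes the
  polynomially growing pairings integrable, and each derivative lost in an estimate on
  \<open>D\<^sub>E\<close> falls on the kernel, where it costs a power of
  \<open>1 / a\<close>.\<close>

locale seminormed_space =
  fixes V :: "('a \<Rightarrow> complex) set" and P :: "(('a \<Rightarrow> complex) \<Rightarrow> real) set"
  assumes csub: "csubspace V"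
    and triangle: "\<And>p f g. p \<in> P \<Longrightarrow> f \<in> V \<Longrightarrow> g \<in> V \<Longrightarrow> p (f + g) \<le> p f + p g"
    and scale: "\<And>p c f. p \<in> P \<Longrightarrow> f \<in> V \<Longrightarrow> p (\<lambda>x. c * f x) = cmod c * p f"
    and P_nonempty: "P \<noteq> {}"
begin

lemma zero_mem: "0 \<in> V"
  and add_mem: "f \<in> V \<Longrightarrow> g \<in> V \<Longrightarrow> f + g \<in> V"
  and scale_mem: "f \<in> V \<Longrightarrow> (\<lambda>x. c * f x) \<in> V"
  using csub by (auto simp: csubspace_def)

lemma uminus_mem: "f \<in> V \<Longrightarrow> - f \<in> V"
  using scale_mem[of f "-1"] by (simp add: fun_Compl_def)

lemma diff_mem: "f \<in> V \<Longrightarrow> g \<in> V \<Longrightarrow> f - g \<in> V"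
  using add_mem[OF _ uminus_mem, of f g] by (simp only: diff_conv_add_uminus)

lemma uminus_eq: "p \<in> P \<Longrightarrow> f \<in> V \<Longrightarrow> p (- f) = p f"
  using scale[of p f "-1"] by (simp add: fun_Compl_def)

lemma zero_eq: "p \<in> P \<Longrightarrow> p 0 = 0"
  using scale[of p 0 0] zero_mem by (simp add: zero_fun_def)

lemma nonneg: "p \<in> P \<Longrightarrow> f \<in> V \<Longrightarrow> 0 \<le> p f"
  using triangle[of p f "- f"] uminus_eq[of p f] uminus_mem[of f] zero_eq[of p] by simp

lemma triangle_diff: "p \<in> P \<Longrightarrow> f \<in> V \<Longrightarrow> g \<in> V \<Longrightarrow> p (f - g) \<le> p f + p g"
  using triangle[of p f "- g"] uminus_eq[of p g] uminus_mem[of g] by simp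

lemma minus_swap: "p \<in> P \<Longrightarrow> f \<in> V \<Longrightarrow> g \<in> V \<Longrightarrow> p (f - g) = p (g - f)"
  using uminus_eq[of p "f - g"] diff_mem[of f g] by simp

lemma triangle_mid:
  assumes "p \<in> P" "f \<in> V" "g \<in> V" "h \<in> V"
  shows "p (f - h) \<le> p (f - g) + p (g - h)"
  using triangle[of p "f - g" "g - h"] assms by (simp add: diff_mem)

lemma sum_mem: "(\<And>i. i \<in> I \<Longrightarrow> f i \<in> V) \<Longrightarrow> sum f I \<in> V"
  by (induction I rule: infinite_finite_induct) (auto simp: zero_mem add_mem)

lemma sum_le: "p \<in> P \<Longrightarrow> (\<And>i. i \<in> I \<Longrightarrow> f i \<in> V) \<Longrightarrow> p (sum f I) \<le> (\<Sum>i\<in>I. p (f i))"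
proof (induction I rule: infinite_finite_induct)
  case (insert x F)
  have "p (f x + sum f F) \<le> p (f x) + p (sum f F)"
    using insert by (intro triangle sum_mem) auto
  also have "\<dots> \<le> p (f x) + (\<Sum>i\<in>F. p (f i))" using insert by simp
  finally show ?case unfolding sum.insert[OF insert(1,2)] .
qed (auto simp: zero_eq)

text \<open>This is where \<open>P_nonempty\<close> enters: with no seminorm at all the subbasis,
  and with it the underlying set of the topology, would be empty.\<close>

lemma topspace_lc: "topspace (lc_topology V P) = V"
proof -
  obtain p where p: "p \<in> P" using P_nonempty by blast
  have "f \<in> \<Union> {{g \<in> V. p (g - f) < \<epsilon>} | f p \<epsilon>. f \<in> V \<and> p \<in> P \<and> \<epsilon> > 0}" if "f \<in> V" for f
  proof (rule UnionI)
    show "{g \<in> V. p (g - f) < 1} \<in> {{g \<in> V. p (g - f) < \<epsilon>} | f p \<epsilon>. f \<in> V \<and> p \<in> P \<and> \<epsilon> > 0}"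
      using p that by (intro CollectI exI[of _ f] exI[of _ p] exI[of _ "1::real"]) simp
    show "f \<in> {g \<in> V. p (g - f) < 1}" using that zero_eq[OF p] by simp
  qed
  then show ?thesis unfolding lc_topology_def topology_generated_by_topspace by blast
qed

lemma openin_ball: "f \<in> V \<Longrightarrow> p \<in> P \<Longrightarrow> \<epsilon> > 0 \<Longrightarrow> openin (lc_topology V P) {g \<in> V. p (g - f) < \<epsilon>}"
  unfolding lc_topology_def by (rule topology_generated_by_Basis) blast

text \<open>The topology is known only through its subbasis, so neighbourhoods of \<open>l\<close>
  are handled by induction on their generation. A subbasic ball about another point \<open>f\<close>
  contains the ball about \<open>l\<close> whose radius is smaller by
  \<open>p (l - f)\<close>.\<close>

lemma limitin_lc:
  assumes "l \<in> V" and ev: "\<And>p \<epsilon>. p \<in> P \<Longrightarrow> \<epsilon> > 0 \<Longrightarrow> eventually (\<lambda>x. u x \<in> V \<and> p (u x - l) < \<epsilon>) F"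
  shows "limitin (lc_topology V P) u l F"
  unfolding limitin_def
proof (intro conjI allI impI)
  show "l \<in> topspace (lc_topology V P)" using assms(1) topspace_lc by simp
next
  fix U assume U: "openin (lc_topology V P) U \<and> l \<in> U"
  then have "generate_topology_on {{g \<in> V. p (g - f) < \<epsilon>} | f p \<epsilon>. f \<in> V \<and> p \<in> P \<and> \<epsilon> > 0} U"
    by (simp add: lc_topology_def openin_topology_generated_by_iff)
  then have "l \<in> U \<longrightarrow> eventually (\<lambda>x. u x \<in> U) F"
  proof (induction rule: generate_topology_on.induct)
    case (UN K)
    show ?case
    proof
      assume "l \<in> \<Union> K"
      then obtain k where "k \<in> K" "l \<in> k" by blast
      moreover then have "eventually (\<lambda>x. u x \<in> k) F" using UN.IH by blast
      ultimately show "eventually (\<lambda>x. u x \<in> \<Union> K) F" by (auto elim: eventually_mono)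
    qed
  next
    case (Basis s)
    then obtain f p \<epsilon> where s: "s = {g \<in> V. p (g - f) < \<epsilon>}" "f \<in> V" "p \<in> P" by blast
    show ?case
    proof
      assume "l \<in> s"
      then have "\<epsilon> - p (l - f) > 0" using s by simp
      from ev[OF s(3) this] show "eventually (\<lambda>x. u x \<in> s) F"
        by (rule eventually_mono) (use triangle_mid[of p _ l f] s assms(1) in fastforce)
    qed
  qed (auto simp: eventually_conj_iff)
  with U show "eventually (\<lambda>x. u x \<in> U) F" by blast
qed

lemma limitin_lcD:
  assumes "limitin (lc_topology V P) u l F" "p \<in> P" "\<epsilon> > 0"
  shows "l \<in> V" "eventually (\<lambda>x. u x \<in> V \<and> p (u x - l) < \<epsilon>) F"
proof -
  show l: "l \<in> V" using assms topspace_lc by (auto simp: limitin_def)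
  have "l \<in> {g \<in> V. p (g - l) < \<epsilon>}" using l assms by (simp add: zero_eq)
  then show "eventually (\<lambda>x. u x \<in> V \<and> p (u x - l) < \<epsilon>) F"
    using limitinD[OF assms(1) openin_ball[OF l assms(2,3)]] by simp
qed

end

text \<open>Directedness makes the balls of single seminorms a neighbourhood base instead of a
  subbase. This is what turns continuity of a functional into a bound by one seminorm.\<close>

locale directed_seminormed_space = seminormed_space +
  assumes directed: "\<And>p q. p \<in> P \<Longrightarrow> q \<in> P \<Longrightarrow> \<exists>s\<in>P. \<forall>f\<in>V. p f \<le> s f \<and> q f \<le> s f"
begin

lemma openin_contains_ball:
  assumes "openin (lc_topology V P) U" "l \<in> U"
  shows "\<exists>p\<in>P. \<exists>\<epsilon>>0. {g \<in> V. p (g - l) < \<epsilon>} \<subseteq> U"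
proof -
  have "generate_topology_on {{g \<in> V. p (g - f) < \<epsilon>} | f p \<epsilon>. f \<in> V \<and> p \<in> P \<and> \<epsilon> > 0} U"
    using assms by (simp add: lc_topology_def openin_topology_generated_by_iff)
  then have "\<forall>l\<in>U. \<exists>p\<in>P. \<exists>\<epsilon>>0. {g \<in> V. p (g - l) < \<epsilon>} \<subseteq> U"
  proof (induction rule: generate_topology_on.induct)
    case (Int a b)
    show ?case
    proof
      fix l assume l: "l \<in> a \<inter> b"
      obtain p \<epsilon> where p: "p \<in> P" "\<epsilon> > 0" "{g \<in> V. p (g - l) < \<epsilon>} \<subseteq> a" using Int l by blast
      obtain q \<delta> where q: "q \<in> P" "\<delta> > 0" "{g \<in> V. q (g - l) < \<delta>} \<subseteq> b" using Int l by blast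
      obtain s where s: "s \<in> P" "\<And>f. f \<in> V \<Longrightarrow> p f \<le> s f \<and> q f \<le> s f" using directed[OF p(1) q(1)] by blast
      have lV: "l \<in> V"
        using Int.hyps(1) l topspace_lc openin_subset[of "lc_topology V P" a]
        by (auto simp: lc_topology_def openin_topology_generated_by_iff)
      have "{g \<in> V. s (g - l) < min \<epsilon> \<delta>} \<subseteq> a \<inter> b"
      proof
        fix g assume g: "g \<in> {g \<in> V. s (g - l) < min \<epsilon> \<delta>}"
        then have "p (g - l) < \<epsilon>" "q (g - l) < \<delta>" using s(2)[OF diff_mem[of g l]] lV by auto
        then show "g \<in> a \<inter> b" using p(3) q(3) g by auto
      qed
      then show "\<exists>p\<in>P. \<exists>\<epsilon>>0. {g \<in> V. p (g - l) < \<epsilon>} \<subseteq> a \<inter> b"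
        using s p q by (intro bexI[of _ s] exI[of _ "min \<epsilon> \<delta>"]) auto
    qed
  next
    case (UN K)
    show ?case
    proof
      fix l assume "l \<in> \<Union> K"
      then obtain k where k: "k \<in> K" "l \<in> k" by blast
      then obtain p \<epsilon> where "p \<in> P" "\<epsilon> > 0" "{g \<in> V. p (g - l) < \<epsilon>} \<subseteq> k" using UN.IH by blast
      with k show "\<exists>p\<in>P. \<exists>\<epsilon>>0. {g \<in> V. p (g - l) < \<epsilon>} \<subseteq> \<Union> K"
        by (intro bexI[of _ p] exI[of _ \<epsilon>]) auto
    qed
  next
    case (Basis s)
    then obtain f p \<epsilon> where s: "s = {g \<in> V. p (g - f) < \<epsilon>}" "f \<in> V" "p \<in> P" by blast
    show ?case
    proof
      fix l assume l: "l \<in> s"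
      have "{g \<in> V. p (g - l) < \<epsilon> - p (l - f)} \<subseteq> s"
        using triangle_mid[of p _ l f] s l by fastforce
      then show "\<exists>p\<in>P. \<exists>\<epsilon>>0. {g \<in> V. p (g - l) < \<epsilon>} \<subseteq> s"
        using s l by (intro bexI[of _ p] exI[of _ "\<epsilon> - p (l - f)"]) auto
    qed
  qed auto
  with assms show ?thesis by blast
qed

text \<open>Rescaling \<open>f\<close> to \<open>p f = \<epsilon> / 2\<close>, strictly inside the
  ball, produces the factor 2. If \<open>p f\<close> vanishes, every multiple of \<open>f\<close>
  lies in the ball, and only \<open>q f \<le> 0\<close> is compatible with that.\<close>

lemma bound_of_ball:
  assumes p: "p \<in> P" "\<epsilon> > 0"
    and q: "\<And>c f. f \<in> V \<Longrightarrow> q (\<lambda>x. c * f x) = cmod c * q f"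
    and ball: "\<And>f. f \<in> V \<Longrightarrow> p f < \<epsilon> \<Longrightarrow> q f \<le> (1::real)"
    and f: "f \<in> V"
  shows "q f \<le> 2 / \<epsilon> * p f"
proof (cases "p f = 0")
  case True
  show ?thesis
  proof (rule ccontr)
    assume "\<not> ?thesis"
    then have pos: "q f > 0" using True by simp
    \<comment> \<open>On this multiple of \<open>f\<close> homogeneity gives \<open>q\<close> the
      value 2.\<close>
    have "q (\<lambda>x. of_real (2 / q f) * f x) \<le> 1"
      using True by (intro ball scale_mem f) (simp only: scale[OF p(1) f] p, simp add: p)
    then show False using q[OF f, of "of_real (2 / q f)"] pos by (simp add: norm_divide)
  qed
next
  case False
  then have pos: "p f > 0" using nonneg[OF p(1) f] by simp
  have "q (\<lambda>x. of_real (\<epsilon> / (2 * p f)) * f x) \<le> 1"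
    using pos p by (intro ball scale_mem f) (simp only: scale[OF p(1) f], simp add: norm_divide norm_mult)
  then have "\<epsilon> / (2 * p f) * q f \<le> 1" using q[OF f, of "of_real (\<epsilon> / (2 * p f))"] pos p by (simp add: norm_divide norm_mult)
  then show ?thesis using pos p by (simp add: field_simps)
qed

lemma dual_bound:
  assumes "L \<in> lc_dual V P"
  obtains p K where "p \<in> P" "K \<ge> 0" "\<And>f. f \<in> V \<Longrightarrow> cmod (L f) \<le> K * p f"
proof -
  have lin: "clinear_functional_on V L" and cont: "continuous_map (lc_topology V P) euclidean L"
    using assms by (auto simp: lc_dual_def)
  have L0: "L 0 = 0" using lin zero_mem unfolding clinear_functional_on_def
    by (metis add_0 add_cancel_right_right)
  have "openin (lc_topology V P) {f \<in> topspace (lc_topology V P). L f \<in> ball 0 1}"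
    using cont by (intro openin_continuous_map_preimage[OF cont]) auto
  then obtain p \<epsilon> where p: "p \<in> P" "\<epsilon> > 0" "{g \<in> V. p (g - 0) < \<epsilon>} \<subseteq> {f \<in> V. L f \<in> ball 0 1}"
    using openin_contains_ball[of _ 0] zero_mem L0 unfolding topspace_lc by fastforce
  have "cmod (L f) \<le> 2 / \<epsilon> * p f" if "f \<in> V" for f
    using p lin
    by (intro bound_of_ball[where q="\<lambda>f. cmod (L f)" and p=p and \<epsilon>=\<epsilon>] that)
      (auto simp: clinear_functional_on_def norm_mult intro: less_imp_le)
  with p show ?thesis by (intro that[of p "2/\<epsilon>"]) auto
qed

end

lemma linear_on_zero: "clinear_functional_on V L \<Longrightarrow> 0 \<in> V \<Longrightarrow> L 0 = 0"
  unfolding clinear_functional_on_def by (metis add_0 add_cancel_right_right)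

lemma (in seminormed_space) linear_on_diff:
  "clinear_functional_on V L \<Longrightarrow> f \<in> V \<Longrightarrow> g \<in> V \<Longrightarrow> L (f - g) = L f - L g"
  unfolding clinear_functional_on_def
  by (metis (no_types) diff_mem add_diff_cancel_right' diff_add_cancel)

lemma (in seminormed_space) linear_on_sum:
  "clinear_functional_on V L \<Longrightarrow> (\<And>i. i \<in> I \<Longrightarrow> f i \<in> V) \<Longrightarrow> L (sum f I) = (\<Sum>i\<in>I. L (f i))"
proof (induction I rule: infinite_finite_induct)
  case (insert x F)
  have "L (f x + sum f F) = L (f x) + L (sum f F)"
    using insert.prems sum_mem[of F f] unfolding clinear_functional_on_def by blast
  moreover have "L (sum f F) = (\<Sum>i\<in>F. L (f i))" using insert by simp
  ultimately show ?case unfolding sum.insert[OF insert(1,2)] by (rule trans[OF _ arg_cong])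
qed (auto simp: linear_on_zero zero_mem)

lemma (in seminormed_space) dualI:
  assumes "\<And>f. f \<notin> V \<Longrightarrow> L f = 0" and lin: "clinear_functional_on V L"
    and p: "p \<in> P" and K: "\<And>f. f \<in> V \<Longrightarrow> cmod (L f) \<le> K * p f"
  shows "L \<in> lc_dual V P"
proof -
  \<comment> \<open>A strictly positive constant is wanted, since it becomes the denominator of the
    radius of \<open>?T\<close>.\<close>
  have K': "cmod (L f) \<le> (\<bar>K\<bar> + 1) * p f" if "f \<in> V" for f
    using K[OF that] nonneg[OF p that] by (smt (verit) mult_right_mono)
  have "openin (lc_topology V P) {f \<in> V. L f \<in> U}" if "open U" for U
  proof (subst openin_subopen, intro ballI)
    fix f assume f: "f \<in> {f \<in> V. L f \<in> U}"
    then obtain e where e: "e > 0" "ball (L f) e \<subseteq> U" using \<open>open U\<close> unfolding open_contains_ball by auto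
    let ?T = "{g \<in> V. p (g - f) < e / (\<bar>K\<bar> + 1)}"
    have "openin (lc_topology V P) ?T" using f e by (intro openin_ball p) auto
    moreover have "f \<in> ?T" using f e by (simp add: zero_eq p)
    moreover have "?T \<subseteq> {f \<in> V. L f \<in> U}"
    proof
      fix g assume g: "g \<in> ?T"
      then have "cmod (L g - L f) \<le> (\<bar>K\<bar> + 1) * p (g - f)"
        using K'[of "g - f"] f diff_mem[of g f] linear_on_diff[OF lin, of g f] by auto
      also have "\<dots> < e" using g by (simp add: field_simps add_pos_nonneg)
      finally show "g \<in> {f \<in> V. L f \<in> U}"
        using e g by (auto simp: dist_norm norm_minus_commute)
    qed
    ultimately show "\<exists>T. openin (lc_topology V P) T \<and> f \<in> T \<and> T \<subseteq> {f \<in> V. L f \<in> U}" by blast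
  qed
  then have "continuous_map (lc_topology V P) euclidean L"
    by (auto simp: continuous_map_def topspace_lc)
  with assms show ?thesis by (auto simp: lc_dual_def)
qed

lemma lc_dualD:
  assumes "L \<in> lc_dual V P"
  shows "clinear_functional_on V L" "f \<notin> V \<Longrightarrow> L f = 0"
    "f \<in> V \<Longrightarrow> g \<in> V \<Longrightarrow> L (f + g) = L f + L g" "f \<in> V \<Longrightarrow> L (\<lambda>x. c * f x) = c * L f"
  using assms by (auto simp: lc_dual_def clinear_functional_on_def)

section \<open>Strong duals and equicontinuity\<close>

context directed_seminormed_space
begin

text \<open>Guards the suprema in \<open>strong_seminorms\<close> and in \<open>dual_norm\<close>,
  which would be unspecified for unbounded sets of values.\<close>

lemma dual_bounded_on:
  assumes "L \<in> lc_dual V P" "lc_bounded V P B"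
  shows "bdd_above ((\<lambda>f. cmod (L f)) ` B)"
proof -
  obtain p K where p: "p \<in> P" "K \<ge> 0" "\<And>f. f \<in> V \<Longrightarrow> cmod (L f) \<le> K * p f"
    using dual_bound[OF assms(1)] by blast
  obtain M where M: "\<And>f. f \<in> B \<Longrightarrow> p f \<le> M" and BV: "B \<subseteq> V"
    using assms(2) p(1) unfolding lc_bounded_def bdd_above_def by (metis imageI)
  show ?thesis
  proof (rule bdd_aboveI2)
    fix f assume "f \<in> B"
    then show "cmod (L f) \<le> K * M" using p M[of f] BV by (meson mult_left_mono order_trans subsetD)
  qed
qed

lemma csubspace_dual: "csubspace (lc_dual V P)"
  unfolding csubspace_def
proof (intro conjI ballI allI)
  obtain p where p: "p \<in> P" using P_nonempty by blast
  show "0 \<in> lc_dual V P"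
    by (rule dualI[of _ p 0]) (auto simp: p clinear_functional_on_def)
next
  fix L M assume L: "L \<in> lc_dual V P" and M: "M \<in> lc_dual V P"
  obtain p K where p: "p \<in> P" "K \<ge> 0" "\<And>f. f \<in> V \<Longrightarrow> cmod (L f) \<le> K * p f"
    using dual_bound[OF L] by blast
  obtain q K' where q: "q \<in> P" "K' \<ge> 0" "\<And>f. f \<in> V \<Longrightarrow> cmod (M f) \<le> K' * q f"
    using dual_bound[OF M] by blast
  obtain s where s: "s \<in> P" "\<And>f. f \<in> V \<Longrightarrow> p f \<le> s f \<and> q f \<le> s f" using directed[OF p(1) q(1)] by blast
  show "L + M \<in> lc_dual V P"
  proof (rule dualI[OF _ _ s(1)])
    fix f assume f: "f \<in> V"
    have "cmod ((L + M) f) \<le> K * p f + K' * q f"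
      using p(3)[OF f] q(3)[OF f] norm_triangle_ineq[of "L f" "M f"] by simp
    also have "\<dots> \<le> K * s f + K' * s f"
      using s(2)[OF f] p(2) q(2) by (intro add_mono mult_left_mono) auto
    finally show "cmod ((L + M) f) \<le> (K + K') * s f" by (simp add: algebra_simps)
  qed (use lc_dualD[OF L] lc_dualD[OF M] in \<open>auto simp: clinear_functional_on_def algebra_simps\<close>)
next
  fix c L assume L: "L \<in> lc_dual V P"
  obtain p K where p: "p \<in> P" "K \<ge> 0" "\<And>f. f \<in> V \<Longrightarrow> cmod (L f) \<le> K * p f"
    using dual_bound[OF L] by blast
  show "(\<lambda>x. c * L x) \<in> lc_dual V P"
  proof (rule dualI[OF _ _ p(1)])
    fix f assume f: "f \<in> V"
    show "cmod (c * L f) \<le> (cmod c * K) * p f"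
      using p(3)[OF f] by (simp add: norm_mult mult.assoc mult_left_mono)
  qed (use lc_dualD[OF L] in \<open>auto simp: clinear_functional_on_def algebra_simps\<close>)
qed

lemma strong_dual_seminormed: "seminormed_space (lc_dual V P) (strong_seminorms V P)"
proof
  show "csubspace (lc_dual V P)" by (rule csubspace_dual)
next
  fix p L M assume p: "p \<in> strong_seminorms V P" and L: "L \<in> lc_dual V P" and M: "M \<in> lc_dual V P"
  from p obtain B where B: "p = (\<lambda>L. SUP f\<in>B. cmod (L f))" "lc_bounded V P B" "B \<noteq> {}"
    by (auto simp: strong_seminorms_def)
  note bL = dual_bounded_on[OF L B(2)] and bM = dual_bounded_on[OF M B(2)]
  show "p (L + M) \<le> p L + p M"
    unfolding B(1)
  proof (rule cSUP_least[OF B(3)])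
    fix f assume f: "f \<in> B"
    have "cmod ((L + M) f) \<le> cmod (L f) + cmod (M f)" by (simp add: norm_triangle_ineq)
    also have "\<dots> \<le> (SUP f\<in>B. cmod (L f)) + (SUP f\<in>B. cmod (M f))"
      by (intro add_mono cSUP_upper f bL bM)
    finally show "cmod ((L + M) f) \<le> (SUP f\<in>B. cmod (L f)) + (SUP f\<in>B. cmod (M f))" .
  qed
next
  fix p c L assume p: "p \<in> strong_seminorms V P" and L: "L \<in> lc_dual V P"
  from p obtain B where B: "p = (\<lambda>L. SUP f\<in>B. cmod (L f))" "lc_bounded V P B" "B \<noteq> {}"
    by (auto simp: strong_seminorms_def)
  have "(SUP f\<in>B. cmod (c * L f)) = (SUP x\<in>(\<lambda>f. cmod (L f)) ` B. cmod c * x)"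
    by (simp add: image_image norm_mult)
  also have "\<dots> = cmod c * Sup ((\<lambda>f. cmod (L f)) ` B)"
    by (rule continuous_at_Sup_mono[symmetric])
      (use B dual_bounded_on[OF L B(2)] in \<open>auto intro!: monoI mult_left_mono continuous_intros\<close>)
  finally show "p (\<lambda>x. c * L x) = cmod c * p L" unfolding B(1) .
next
  have "lc_bounded V P {0}" using zero_mem by (auto simp: lc_bounded_def)
  then show "strong_seminorms V P \<noteq> {}" unfolding strong_seminorms_def by blast
qed

text \<open>Since \<open>V\<close> is metrizable, strong boundedness already gives equicontinuity; no Baire category
  argument is needed.\<close>

lemma strong_bounded_equicontinuous:
  fixes p :: "nat \<Rightarrow> ('a \<Rightarrow> complex) \<Rightarrow> real"
  assumes P: "P = range p" and mono: "\<And>m n f. m \<le> n \<Longrightarrow> f \<in> V \<Longrightarrow> p m f \<le> p n f"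
    and B: "strong_dual_bounded V P B"
  obtains N K where "K \<ge> 0" "\<And>L f. L \<in> B \<Longrightarrow> f \<in> V \<Longrightarrow> cmod (L f) \<le> K * p N f"
proof (rule ccontr)
  note obtained = that
  assume no: "\<not> thesis"
  have BV: "B \<subseteq> lc_dual V P" using B by (simp add: strong_dual_bounded_def lc_bounded_def)
  have pP: "p n \<in> P" for n using P by simp
  have "\<exists>L f. L \<in> B \<and> f \<in> V \<and> cmod (L f) > real n \<and> p n f \<le> 1" for n
  proof -
    \<comment> \<open>The constant \<open>2 n + 2\<close> is what \<open>bound_of_ball\<close>
      yields for radius 1 once the functional is divided by \<open>n + 1\<close>.\<close>
    have "\<exists>L f. L \<in> B \<and> f \<in> V \<and> \<not> cmod (L f) \<le> (2 * real n + 2) * p n f"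
      using obtained[of "2 * real n + 2" n] no by fastforce
    then obtain L f where Lf: "L \<in> B" "f \<in> V" "\<not> cmod (L f) \<le> (2 * real n + 2) * p n f" by blast
    have "\<exists>f\<in>V. \<not> cmod (L f) \<le> real n + 1 \<and> p n f < 1"
    proof (rule ccontr)
      assume "\<not> ?thesis"
      then have *: "f \<in> V \<Longrightarrow> p n f < 1 \<Longrightarrow> cmod (L f) \<le> real n + 1" for f by blast
      have "cmod (L f) / (real n + 1) \<le> 2 / 1 * p n f"
      proof (rule bound_of_ball[OF pP, where q="\<lambda>f. cmod (L f) / (real n + 1)"])
        show "cmod (L (\<lambda>x. c * f x)) / (real n + 1) = cmod c * (cmod (L f) / (real n + 1))" if "f \<in> V" for c f
          using lc_dualD(4)[of L V P f c] BV Lf(1) that by (auto simp: norm_mult)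
        show "cmod (L f) / (real n + 1) \<le> 1" if "f \<in> V" "p n f < 1" for f
          using *[OF that] by (simp add: divide_simps)
      qed (use Lf in auto)
      then show False using Lf(3) by (simp add: field_simps)
    qed
    then show ?thesis using Lf(1) by fastforce
  qed
  then obtain L f where Lf: "\<And>n. L n \<in> B" "\<And>n. f n \<in> V" "\<And>n. cmod (L n (f n)) > real n" "\<And>n. p n (f n) \<le> 1"
    by metis
  \<comment> \<open>For fixed \<open>m\<close>, all but finitely many terms satisfy
    \<open>p m (f n) \<le> p n (f n) \<le> 1\<close>. So one bounded set witnesses the growth of
    \<open>L n (f n)\<close>, against the strong boundedness of \<open>B\<close>.\<close>
  have bd: "lc_bounded V P (range f)"
    unfolding lc_bounded_def
  proof (intro conjI ballI)
    show "range f \<subseteq> V" using Lf by blast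
    fix q assume "q \<in> P"
    then obtain m where q: "q = p m" using P by blast
    have "p m (f n) \<le> Max ((\<lambda>n. p m (f n)) ` {..m}) + 1" for n
    proof (cases "n \<le> m")
      case True
      then have "p m (f n) \<le> Max ((\<lambda>n. p m (f n)) ` {..m})" by (intro Max_ge) auto
      then show ?thesis by simp
    next
      case False
      have "0 \<le> p m (f 0)" using nonneg pP Lf by blast
      also have "\<dots> \<le> Max ((\<lambda>n. p m (f n)) ` {..m})" by (intro Max_ge) auto
      finally have "0 \<le> Max ((\<lambda>n. p m (f n)) ` {..m})" .
      moreover have "p m (f n) \<le> 1" using mono[of m n "f n"] Lf(2,4)[of n] False by linarith
      ultimately show ?thesis by simp
    qed
    then show "bdd_above (q ` range f)" unfolding q by (auto intro!: bdd_aboveI)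
  qed
  then have "(\<lambda>L. SUP f\<in>range f. cmod (L f)) \<in> strong_seminorms V P"
    unfolding strong_seminorms_def by blast
  then obtain M where M: "\<And>L. L \<in> B \<Longrightarrow> (SUP f\<in>range f. cmod (L f)) \<le> M"
    using B unfolding strong_dual_bounded_def lc_bounded_def bdd_above_def by fastforce
  obtain n where n: "real n > M" using reals_Archimedean2 by blast
  have "cmod (L n (f n)) \<le> (SUP f\<in>range f. cmod (L n f))"
    using BV Lf bd by (intro cSUP_upper dual_bounded_on) auto
  also have "\<dots> \<le> M" using M Lf by blast
  finally show False using Lf(3)[of n] n by simp
qed

lemma strong_boundedI:
  assumes "B \<subseteq> lc_dual V P" "p \<in> P" "\<And>L f. L \<in> B \<Longrightarrow> f \<in> V \<Longrightarrow> cmod (L f) \<le> K * p f"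
  shows "strong_dual_bounded V P B"
  unfolding strong_dual_bounded_def lc_bounded_def
proof (intro conjI ballI)
  fix q assume "q \<in> strong_seminorms V P"
  then obtain A where A: "q = (\<lambda>L. SUP f\<in>A. cmod (L f))" "lc_bounded V P A" "A \<noteq> {}"
    by (auto simp: strong_seminorms_def)
  obtain M where M: "\<And>f. f \<in> A \<Longrightarrow> p f \<le> M" and AV: "A \<subseteq> V"
    using A(2) assms(2) unfolding lc_bounded_def bdd_above_def by (metis imageI)
  show "bdd_above (q ` B)"
  proof (rule bdd_aboveI2)
    fix L assume L: "L \<in> B"
    show "q L \<le> \<bar>K\<bar> * M"
      unfolding A(1)
    proof (rule cSUP_least[OF A(3)])
      fix f assume f: "f \<in> A"
      have "cmod (L f) \<le> K * p f" using assms(3)[OF L] f AV by blast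
      also have "\<dots> \<le> \<bar>K\<bar> * p f" using nonneg[OF assms(2), of f] f AV by (intro mult_right_mono) auto
      also have "\<dots> \<le> \<bar>K\<bar> * M" using M[OF f] by (intro mult_left_mono) auto
      finally show "cmod (L f) \<le> \<bar>K\<bar> * M" .
    qed
  qed
qed (rule assms)

end

section \<open>Smooth functions\<close>

lemma partial_derivI: "(f has_derivative f') (at x) \<Longrightarrow> partial_deriv j f x = f' (axis j 1)"
  unfolding partial_deriv_def by (metis frechet_derivative_at)

lemma has_derivative_partial:
  fixes f :: "'n::finite test_fun"
  assumes "f differentiable (at x)"
  shows "(f has_derivative (\<lambda>v. \<Sum>j\<in>UNIV. of_real (v $ j) * partial_deriv j f x)) (at x)"
proof -
  have f: "(f has_derivative frechet_derivative f (at x)) (at x)"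
    using assms frechet_derivative_works by blast
  then have lin: "linear (frechet_derivative f (at x))" by (rule has_derivative_linear)
  have "frechet_derivative f (at x) = (\<lambda>v. \<Sum>j\<in>UNIV. of_real (v $ j) * partial_deriv j f x)"
  proof
    fix v :: "real ^ 'n"
    have "v = (\<Sum>j\<in>UNIV. (v $ j) *\<^sub>R axis j 1)"
      by (simp add: vec_eq_iff axis_def if_distrib cong: if_cong)
    then have "frechet_derivative f (at x) v = frechet_derivative f (at x) (\<Sum>j\<in>UNIV. (v $ j) *\<^sub>R axis j 1)"
      by simp
    also have "\<dots> = (\<Sum>j\<in>UNIV. (v $ j) *\<^sub>R frechet_derivative f (at x) (axis j 1))"
      by (simp add: linear_sum[OF lin] linear_scale[OF lin])
    finally show "frechet_derivative f (at x) v = (\<Sum>j\<in>UNIV. of_real (v $ j) * partial_deriv j f x)"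
      by (simp add: partial_deriv_def scaleR_conv_of_real)
  qed
  with f show ?thesis by simp
qed

lemma has_vector_derivative_line:
  fixes f :: "'n::finite test_fun"
  assumes "f differentiable (at (x + t *\<^sub>R v))"
  shows "((\<lambda>t. f (x + t *\<^sub>R v)) has_vector_derivative
    (\<Sum>j\<in>UNIV. of_real (v $ j) * partial_deriv j f (x + t *\<^sub>R v))) (at t within S)"
proof -
  have "((\<lambda>t. x + t *\<^sub>R v) has_derivative (\<lambda>s. s *\<^sub>R v)) (at t within S)"
    by (auto intro!: derivative_eq_intros)
  from has_derivative_compose[OF this has_derivative_partial[OF assms]]
  show ?thesis
    unfolding has_vector_derivative_def
    by (simp add: sum_distrib_left scaleR_conv_of_real[where 'a=complex] mult.assoc)
qed

lemma partial_derivs_Nil [simp]: "partial_derivs [] f = f"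
  and partial_derivs_Cons: "partial_derivs (j # js) f = partial_deriv j (partial_derivs js f)"
  and partial_derivs_append: "partial_derivs (js @ ks) f = partial_derivs js (partial_derivs ks f)"
  by (simp_all add: partial_derivs_def)

text \<open>Smoothness speaks of all iterated derivatives; a class closed under differentiation
  replaces formulas for them by a single induction.\<close>

lemma smooth_class:
  assumes "\<And>f x. f \<in> A \<Longrightarrow> f differentiable (at x)" "\<And>f j. f \<in> A \<Longrightarrow> partial_deriv j f \<in> A" "f \<in> A"
  shows "partial_derivs js f \<in> A" "smooth f"
proof -
  show *: "partial_derivs js f \<in> A" for js
    by (induction js) (auto simp: partial_derivs_Cons assms)
  then show "smooth f" unfolding smooth_def using assms(1) by blast
qed

lemma smooth_differentiable: "smooth f \<Longrightarrow> f differentiable (at x)"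
  unfolding smooth_def by (metis partial_derivs_Nil)

lemma smooth_partial_derivs: "smooth f \<Longrightarrow> smooth (partial_derivs js f)"
  unfolding smooth_def by (metis partial_derivs_append)

lemma smooth_partial_deriv: "smooth f \<Longrightarrow> smooth (partial_deriv j f)"
  using smooth_partial_derivs[of f "[j]"] by (simp add: partial_derivs_Cons)

lemma smooth_continuous: "smooth f \<Longrightarrow> continuous_on S f"
  by (meson continuous_at_imp_continuous_on differentiable_imp_continuous_within smooth_differentiable)

lemma smooth_measurable: "smooth f \<Longrightarrow> f \<in> borel_measurable borel"
  by (simp add: borel_measurable_continuous_onI smooth_continuous)

lemma partial_deriv_add:
  assumes "f differentiable (at x)" "g differentiable (at x)"
  shows "partial_deriv j (\<lambda>x. f x + g x) x = partial_deriv j f x + partial_deriv j g x"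
  using partial_derivI[OF has_derivative_add[OF assms[unfolded frechet_derivative_works]], of j]
  by (simp add: partial_deriv_def)

lemma partial_deriv_mult:
  assumes "f differentiable (at x)" "g differentiable (at x)"
  shows "partial_deriv j (\<lambda>x. f x * g x) x = partial_deriv j f x * g x + f x * partial_deriv j g x"
  using partial_derivI[OF has_derivative_mult[OF assms[unfolded frechet_derivative_works]], of j]
  by (simp add: partial_deriv_def add.commute)

lemma partial_deriv_const: "partial_deriv j (\<lambda>x. c) = (\<lambda>x. 0)"
  by (rule ext, subst partial_derivI[OF has_derivative_const]) simp

lemma partial_deriv_cmult:
  assumes "f differentiable (at x)"
  shows "partial_deriv j (\<lambda>x. c * f x) x = c * partial_deriv j f x"
  using partial_deriv_mult[OF differentiable_const assms, of j c] by (simp add: partial_deriv_const)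

lemma partial_derivs_add:
  assumes "smooth f" "smooth g"
  shows "partial_derivs js (\<lambda>x. f x + g x) = (\<lambda>x. partial_derivs js f x + partial_derivs js g x)"
proof (induction js)
  case (Cons j js)
  show ?case
    using assms by (simp add: partial_derivs_Cons Cons.IH partial_deriv_add smooth_differentiable smooth_partial_derivs)
qed simp

lemma smooth_add: "smooth f \<Longrightarrow> smooth g \<Longrightarrow> smooth (\<lambda>x. f x + g x)"
  unfolding smooth_def[of "\<lambda>x. f x + g x"] partial_derivs_add
  by (intro allI differentiable_add smooth_differentiable smooth_partial_derivs)

lemma partial_derivs_cmult:
  assumes "smooth f"
  shows "partial_derivs js (\<lambda>x. c * f x) = (\<lambda>x. c * partial_derivs js f x)"
proof (induction js)
  case (Cons j js)
  show ?case
    using assms by (simp add: partial_derivs_Cons Cons.IH partial_deriv_cmult smooth_differentiable smooth_partial_derivs)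
qed simp

lemma smooth_cmult: "smooth f \<Longrightarrow> smooth (\<lambda>x. c * f x)"
  unfolding smooth_def[of "\<lambda>x. c * f x"] partial_derivs_cmult
  by (intro allI differentiable_mult differentiable_const smooth_differentiable smooth_partial_derivs)

lemma smooth_const: "smooth (\<lambda>x. c)"
  by (rule smooth_class(2)[of "range (\<lambda>c x. c)"]) (auto simp: partial_deriv_const)

lemma smooth_sum: "(\<And>i. i \<in> I \<Longrightarrow> smooth (f i)) \<Longrightarrow> smooth (\<lambda>x. \<Sum>i\<in>I. f i x)"
proof (induction I rule: infinite_finite_induct)
  case (infinite A)
  then show ?case by (simp add: smooth_const)
next
  case empty
  then show ?case by (simp add: smooth_const)
next
  case (insert i I)
  then show ?case using smooth_add[of "f i" "\<lambda>x. \<Sum>i\<in>I. f i x"] by simp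
qed

lemma partial_derivs_sum:
  assumes "\<And>i. i \<in> I \<Longrightarrow> smooth (f i)"
  shows "partial_derivs js (\<lambda>x. \<Sum>i\<in>I. f i x) = (\<lambda>x. \<Sum>i\<in>I. partial_derivs js (f i) x)"
  using assms
proof (induction I rule: infinite_finite_induct)
  case (insert i I)
  then show ?case
    using partial_derivs_add[of "f i" "\<lambda>x. \<Sum>i\<in>I. f i x" js] smooth_sum[of I f] by simp
next
  case (infinite A)
  show ?case using infinite
    by (induction js) (auto simp: partial_derivs_Cons partial_deriv_const)
next
  case empty
  show ?case by (induction js) (auto simp: partial_derivs_Cons partial_deriv_const)
qed

text \<open>The Leibniz rule without binomial coefficients: finite sums of products of smooth
  functions form a class closed under differentiation.\<close>

lemma smooth_mult:
  fixes f g :: "'n::finite test_fun"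
  assumes "smooth f" "smooth g"
  shows "smooth (\<lambda>x. f x * g x)"
proof -
  define A :: "'n test_fun set" where
    "A = {\<lambda>x. \<Sum>p\<leftarrow>ps. fst p x * snd p x | ps. \<forall>p\<in>set ps. smooth (fst p) \<and> smooth (snd p)}"
  have "partial_deriv j h \<in> A \<and> (\<forall>x. h differentiable (at x))" if h: "h \<in> A" for h j
  proof -
    obtain ps where ps: "h = (\<lambda>x. \<Sum>p\<leftarrow>ps. fst p x * snd p x)" "\<forall>p\<in>set ps. smooth (fst p) \<and> smooth (snd p)"
      using h by (auto simp: A_def)
    define qs where "qs = concat (map (\<lambda>p. [(partial_deriv j (fst p), snd p), (fst p, partial_deriv j (snd p))]) ps)"
    have "(\<forall>x. (\<lambda>x. \<Sum>p\<leftarrow>ps. fst p x * snd p x) differentiable (at x)) \<and>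
      partial_deriv j (\<lambda>x. \<Sum>p\<leftarrow>ps. fst p x * snd p x) = (\<lambda>x. \<Sum>p\<leftarrow>qs. fst p x * snd p x)"
      using ps(2) unfolding qs_def
    proof (induction ps)
      case (Cons p ps)
      then have d: "(\<lambda>x. \<Sum>p\<leftarrow>ps. fst p x * snd p x) differentiable (at x)"
        "fst p differentiable (at x)" "snd p differentiable (at x)" for x
        by (auto intro: smooth_differentiable)
      show ?case
        using Cons d by (auto simp: fun_eq_iff partial_deriv_add partial_deriv_mult differentiable_mult
            intro!: differentiable_add)
    qed (auto simp: partial_deriv_const)
    moreover have "\<forall>p\<in>set qs. smooth (fst p) \<and> smooth (snd p)"
      using ps by (auto simp: qs_def smooth_partial_deriv)
    ultimately show ?thesis unfolding A_def ps(1) by blast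
  qed
  moreover have "(\<lambda>x. f x * g x) \<in> A"
    unfolding A_def using assms by (intro CollectI exI[of _ "[(f, g)]"]) simp
  ultimately show ?thesis using smooth_class(2)[of A] by blast
qed

lemma partial_deriv_affine:
  fixes f :: "'n::finite test_fun"
  assumes "f differentiable (at (c *\<^sub>R x + b))"
  shows "partial_deriv j (\<lambda>x. f (c *\<^sub>R x + b)) x = of_real c * partial_deriv j f (c *\<^sub>R x + b)"
proof -
  have "((\<lambda>x. c *\<^sub>R x + b) has_derivative (\<lambda>v. c *\<^sub>R v)) (at x)"
    by (auto intro!: derivative_eq_intros)
  from has_derivative_compose[OF this has_derivative_partial[OF assms]]
  have "partial_deriv j (\<lambda>x. f (c *\<^sub>R x + b)) x =
    (\<Sum>i\<in>UNIV. of_real ((c *\<^sub>R axis j 1 :: real^'n) $ i) * partial_deriv i f (c *\<^sub>R x + b))"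
    by (rule partial_derivI)
  also have "\<dots> = (\<Sum>i\<in>UNIV. if i = j then of_real c * partial_deriv j f (c *\<^sub>R x + b) else 0)"
    by (intro sum.cong) (auto simp: axis_def)
  finally show ?thesis by simp
qed

lemma partial_derivs_affine:
  fixes f :: "'n::finite test_fun"
  assumes "smooth f"
  shows "partial_derivs js (\<lambda>x. f (c *\<^sub>R x + b)) = (\<lambda>x. of_real c ^ length js * partial_derivs js f (c *\<^sub>R x + b))"
proof (induction js)
  case (Cons j js)
  let ?g = "partial_derivs js f"
  have g: "?g differentiable (at x)" for x using assms by (intro smooth_differentiable smooth_partial_derivs)
  have "(\<lambda>x. ?g (c *\<^sub>R x + b)) differentiable (at x)" for x
    by (rule differentiable_compose[of ?g]) (auto intro!: g derivative_intros)
  then show ?case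
    by (simp add: Cons.IH partial_derivs_Cons partial_deriv_cmult partial_deriv_affine[OF g] fun_eq_iff)
qed simp

lemma smooth_affine:
  fixes f :: "'n::finite test_fun"
  assumes "smooth f"
  shows "smooth (\<lambda>x. f (c *\<^sub>R x + b))"
  unfolding smooth_def partial_derivs_affine[OF assms]
proof (intro allI differentiable_mult differentiable_const)
  fix js x
  show "(\<lambda>x. partial_derivs js f (c *\<^sub>R x + b)) differentiable (at x)"
    by (rule differentiable_compose[of "partial_derivs js f"])
      (auto intro!: smooth_differentiable smooth_partial_derivs assms derivative_intros)
qed

text \<open>Meant for families in which \<open>q (Suc k)\<close> is the derivative of
  \<open>q k\<close>. A partial derivative then just raises one entry of \<open>\<alpha>\<close>, so
  all derivatives keep the same shape. Both the bump function and the sech kernel are built this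
  way.\<close>

definition tensor_fun :: "(nat \<Rightarrow> real \<Rightarrow> real) \<Rightarrow> ('n \<Rightarrow> nat) \<Rightarrow> 'n::finite test_fun" where
  "tensor_fun q \<alpha> = (\<lambda>x. \<Prod>i\<in>UNIV. of_real (q (\<alpha> i) (x $ i)))"

lemma tensor_fun_deriv:
  fixes \<alpha> :: "'n::finite \<Rightarrow> nat"
  assumes q: "\<And>k t. (q k has_real_derivative q (Suc k) t) (at t)"
  shows "tensor_fun q \<alpha> differentiable (at x)"
    "partial_deriv j (tensor_fun q \<alpha>) x = tensor_fun q (\<alpha>(j := Suc (\<alpha> j))) x"
proof -
  have "((\<lambda>x. complex_of_real (q (\<alpha> i) (x $ i))) has_derivative
      (\<lambda>v. of_real (q (Suc (\<alpha> i)) (x $ i) * v $ i))) (at x)" for i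
  proof -
    have 1: "((\<lambda>x :: real^'n. x $ i) has_derivative (\<lambda>v. v $ i)) (at x)"
      by (intro bounded_linear_imp_has_derivative bounded_linear_vec_nth)
    have "(q (\<alpha> i) has_derivative (\<lambda>s. q (Suc (\<alpha> i)) (x $ i) * s)) (at (x $ i))"
      using q[of "\<alpha> i" "x $ i"] by (simp add: has_field_derivative_def mult_commute_abs)
    from has_derivative_compose[OF 1 this]
    show ?thesis by (rule has_derivative_of_real)
  qed
  then have *: "(tensor_fun q \<alpha> has_derivative (\<lambda>v. \<Sum>i\<in>UNIV. of_real (q (Suc (\<alpha> i)) (x $ i) * v $ i) *
      (\<Prod>k\<in>UNIV - {i}. of_real (q (\<alpha> k) (x $ k))))) (at x)"
    unfolding tensor_fun_def by (intro has_derivative_prod) auto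
  then show "tensor_fun q \<alpha> differentiable (at x)" by (auto simp: differentiable_def)
  have "partial_deriv j (tensor_fun q \<alpha>) x = (\<Sum>i\<in>UNIV. of_real (q (Suc (\<alpha> i)) (x $ i) * (axis j 1 :: real^'n) $ i) *
      (\<Prod>k\<in>UNIV - {i}. of_real (q (\<alpha> k) (x $ k))))"
    by (rule partial_derivI[OF *])
  also have "\<dots> = (\<Sum>i\<in>UNIV. if i = j then of_real (q (Suc (\<alpha> j)) (x $ j)) *
      (\<Prod>k\<in>UNIV - {j}. of_real (q (\<alpha> k) (x $ k))) else 0)"
    by (intro sum.cong) (auto simp: axis_def)
  also have "\<dots> = tensor_fun q (\<alpha>(j := Suc (\<alpha> j))) x"
    unfolding tensor_fun_def by (subst (2) prod.remove[of _ j]) (auto intro!: prod.cong)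
  finally show "partial_deriv j (tensor_fun q \<alpha>) x = tensor_fun q (\<alpha>(j := Suc (\<alpha> j))) x" .
qed

lemma tensor_fun_derivs:
  fixes \<alpha> :: "'n::finite \<Rightarrow> nat"
  assumes q: "\<And>k t. (q k has_real_derivative q (Suc k) t) (at t)"
  shows "smooth (tensor_fun q \<alpha>)" "\<exists>\<beta>. partial_derivs js (tensor_fun q \<alpha>) = tensor_fun q \<beta>"
proof -
  have *: "f \<in> range (tensor_fun q) \<Longrightarrow> f differentiable (at x)"
    "f \<in> range (tensor_fun q) \<Longrightarrow> partial_deriv j f \<in> range (tensor_fun q)" for f :: "'n test_fun" and x j
  proof -
    assume "f \<in> range (tensor_fun q)"
    then obtain \<beta> where f: "f = tensor_fun q \<beta>" by blast
    show "f differentiable (at x)" unfolding f by (rule tensor_fun_deriv) (rule q)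
    have "partial_deriv j f = tensor_fun q (\<beta>(j := Suc (\<beta> j)))"
      unfolding f by (rule ext, rule tensor_fun_deriv) (rule q)
    then show "partial_deriv j f \<in> range (tensor_fun q)" by blast
  qed
  show "smooth (tensor_fun q \<alpha>)"
    by (rule smooth_class(2)[of "range (tensor_fun q)"]) (use * in auto)
  have "partial_derivs js (tensor_fun q \<alpha>) \<in> range (tensor_fun q)"
    by (rule smooth_class(1)[of "range (tensor_fun q)"]) (use * in auto)
  then show "\<exists>\<beta>. partial_derivs js (tensor_fun q \<alpha>) = tensor_fun q \<beta>" by blast
qed

section \<open>Schwartz functions\<close>

lemma finite_lists_le: "finite {js :: 'n::finite list. length js \<le> k}"
  using finite_lists_length_le[of "UNIV :: 'n set" k] by simp

lemma schwartz_smooth: "f \<in> schwartz \<Longrightarrow> smooth f"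
  by (simp add: schwartz_def)

lemma schwartz_bdd:
  fixes f :: "'n::finite test_fun"
  assumes "f \<in> schwartz"
  shows "bdd_above ((\<lambda>(js, x). (1 + norm x) ^ k * cmod (partial_derivs js f x)) ` ({js. length js \<le> k} \<times> UNIV))"
proof -
  have "\<forall>js. \<exists>B. \<forall>x. (1 + norm x) ^ k * cmod (partial_derivs js f x) \<le> B"
    using assms by (auto simp: schwartz_def bdd_above_def)
  then obtain B where B: "\<And>js x. (1 + norm x) ^ k * cmod (partial_derivs js f x) \<le> B js" by metis
  show ?thesis
  proof (rule bdd_aboveI2)
    fix z :: "'n list \<times> (real^'n)" assume z: "z \<in> {js. length js \<le> k} \<times> UNIV"
    then have "B (fst z) \<le> Max (B ` {js. length js \<le> k})"
      by (intro Max_ge finite_imageI finite_lists_le) auto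
    then show "(case z of (js, x) \<Rightarrow> (1 + norm x) ^ k * cmod (partial_derivs js f x)) \<le> Max (B ` {js. length js \<le> k})"
      using B[of "snd z" "fst z"] by (auto simp: case_prod_beta)
  qed
qed

lemma schwartz_norm_ge:
  assumes "f \<in> schwartz" "length js \<le> k"
  shows "(1 + norm x) ^ k * cmod (partial_derivs js f x) \<le> schwartz_norm k f"
  using cSUP_upper[OF _ schwartz_bdd[OF assms(1)], of "(js, x)" k] assms(2)
  by (simp add: schwartz_norm_def)

lemma schwartz_norm_le:
  assumes "\<And>js x. length js \<le> k \<Longrightarrow> (1 + norm x) ^ k * cmod (partial_derivs js f x) \<le> B"
  shows "schwartz_norm k f \<le> B"
  unfolding schwartz_norm_def
proof (rule cSUP_least)
  show "{js. length js \<le> k} \<times> UNIV \<noteq> {}" by (auto intro: exI[of _ "[]"])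
qed (use assms in auto)

lemma schwartz_pointwise:
  assumes "f \<in> schwartz"
  shows "(1 + norm x) ^ k * cmod (f x) \<le> schwartz_norm k f"
    "cmod (f x) \<le> schwartz_norm k f / (1 + norm x) ^ k"
    "cmod (f x) \<le> schwartz_norm k f"
proof -
  show 1: "(1 + norm x) ^ k * cmod (f x) \<le> schwartz_norm k f"
    using schwartz_norm_ge[OF assms, of "[]" k x] by simp
  have ge1: "(1 + norm x) ^ k \<ge> 1" by (rule one_le_power) simp
  then show "cmod (f x) \<le> schwartz_norm k f / (1 + norm x) ^ k"
    using 1 by (simp add: pos_le_divide_eq mult.commute add_pos_nonneg)
  have "1 * cmod (f x) \<le> (1 + norm x) ^ k * cmod (f x)" using ge1 by (rule mult_right_mono) simp
  then show "cmod (f x) \<le> schwartz_norm k f" using 1 by simp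
qed

lemma schwartzI:
  assumes "smooth f" "\<And>js k. \<exists>B. \<forall>x. (1 + norm x) ^ k * cmod (partial_derivs js f x) \<le> B"
  shows "f \<in> schwartz"
  using assms by (auto simp: schwartz_def bdd_above_def)

lemma schwartz_add: "f \<in> schwartz \<Longrightarrow> g \<in> schwartz \<Longrightarrow> (\<lambda>x. f x + g x) \<in> schwartz"
  and schwartz_norm_add: "f \<in> schwartz \<Longrightarrow> g \<in> schwartz \<Longrightarrow>
    schwartz_norm k (\<lambda>x. f x + g x) \<le> schwartz_norm k f + schwartz_norm k g"
proof -
  assume f: "f \<in> schwartz" and g: "g \<in> schwartz"
  note sm = f[THEN schwartz_smooth] g[THEN schwartz_smooth]
  have *: "(1 + norm x) ^ k * cmod (partial_derivs js (\<lambda>x. f x + g x) x) \<le> schwartz_norm k f + schwartz_norm k g"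
    if "length js \<le> k" for js k x
  proof -
    have "(1 + norm x) ^ k * cmod (partial_derivs js (\<lambda>x. f x + g x) x) \<le>
      (1 + norm x) ^ k * (cmod (partial_derivs js f x) + cmod (partial_derivs js g x))"
      unfolding partial_derivs_add[OF sm] by (intro mult_left_mono norm_triangle_ineq) simp
    then show ?thesis
      using schwartz_norm_ge[OF f that, of x] schwartz_norm_ge[OF g that, of x] by (simp add: distrib_left)
  qed
  show "schwartz_norm k (\<lambda>x. f x + g x) \<le> schwartz_norm k f + schwartz_norm k g"
    by (rule schwartz_norm_le) (rule *)
  show "(\<lambda>x. f x + g x) \<in> schwartz"
  proof (rule schwartzI)
    fix js :: "'a list" and k
    \<comment> \<open>A single index of \<open>schwartz_norm\<close> bounds both the power of the
      weight and the order of the derivative; \<open>k + length js\<close> is large enough for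
      both.\<close>
    have "(1 + norm x) ^ k * cmod (partial_derivs js (\<lambda>x. f x + g x) x) \<le>
      schwartz_norm (k + length js) f + schwartz_norm (k + length js) g" for x
      by (rule order_trans[OF mult_right_mono *[of js "k + length js"]])
        (auto intro: power_increasing)
    then show "\<exists>B. \<forall>x. (1 + norm x) ^ k * cmod (partial_derivs js (\<lambda>x. f x + g x) x) \<le> B" by blast
  qed (use sm in \<open>rule smooth_add\<close>)
qed

lemma schwartz_cmult: "f \<in> schwartz \<Longrightarrow> (\<lambda>x. c * f x) \<in> schwartz"
proof (rule schwartzI)
  assume f: "f \<in> schwartz"
  then show "smooth (\<lambda>x. c * f x)" by (intro smooth_cmult schwartz_smooth)
  fix js :: "'a list" and k
  have "(1 + norm x) ^ k * cmod (partial_derivs js (\<lambda>x. c * f x) x) \<le> cmod c * schwartz_norm (k + length js) f" for x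
  proof -
    have "(1 + norm x) ^ k * cmod (partial_derivs js f x) \<le> (1 + norm x) ^ (k + length js) * cmod (partial_derivs js f x)"
      by (intro mult_right_mono power_increasing) auto
    also have "\<dots> \<le> schwartz_norm (k + length js) f" by (intro schwartz_norm_ge f) simp
    finally have "cmod c * ((1 + norm x) ^ k * cmod (partial_derivs js f x)) \<le> cmod c * schwartz_norm (k + length js) f"
      by (rule mult_left_mono) simp
    then show ?thesis
      by (simp add: partial_derivs_cmult[OF schwartz_smooth[OF f]] norm_mult mult_ac)
  qed
  then show "\<exists>B. \<forall>x. (1 + norm x) ^ k * cmod (partial_derivs js (\<lambda>x. c * f x) x) \<le> B" by blast
qed

lemma schwartz_norm_cmult:
  fixes f :: "'n::finite test_fun"
  assumes "f \<in> schwartz"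
  shows "schwartz_norm k (\<lambda>x. c * f x) = cmod c * schwartz_norm k f"
proof -
  have le: "schwartz_norm k (\<lambda>x. c * f x) \<le> cmod c * schwartz_norm k f" if "f \<in> schwartz"
    for c and f :: "'n test_fun"
  proof (rule schwartz_norm_le)
    fix js :: "'n list" and x assume "length js \<le> k"
    from mult_left_mono[OF schwartz_norm_ge[OF that this, of x], of "cmod c"]
    show "(1 + norm x) ^ k * cmod (partial_derivs js (\<lambda>x. c * f x) x) \<le> cmod c * schwartz_norm k f"
      by (simp add: partial_derivs_cmult[OF schwartz_smooth[OF that]] norm_mult mult_ac)
  qed
  show ?thesis
  proof (cases "c = 0")
    case True
    have "schwartz_norm k (\<lambda>x. c * f x) \<ge> 0"
      using schwartz_pointwise(3)[OF schwartz_cmult[OF assms, of c], of 0 k] norm_ge_zero order_trans by blast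
    then show ?thesis using le[OF assms, of c] True by simp
  next
    case False
    have "schwartz_norm k f = schwartz_norm k (\<lambda>x. inverse c * (c * f x))"
      using False by (simp add: mult.assoc[symmetric])
    also have "\<dots> \<le> cmod (inverse c) * schwartz_norm k (\<lambda>x. c * f x)" by (intro le schwartz_cmult assms)
    finally show ?thesis using le[OF assms, of c] False
      by (simp add: norm_inverse norm_divide field_simps)
  qed
qed

lemma schwartz_norm_mono:
  fixes f :: "'n::finite test_fun"
  assumes "f \<in> schwartz" "k \<le> m"
  shows "schwartz_norm k f \<le> schwartz_norm m f"
proof (rule schwartz_norm_le)
  fix js :: "'n list" and x assume "length js \<le> k"
  have "(1 + norm x) ^ k * cmod (partial_derivs js f x) \<le> (1 + norm x) ^ m * cmod (partial_derivs js f x)"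
    by (intro mult_right_mono power_increasing assms) auto
  also have "\<dots> \<le> schwartz_norm m f"
    using \<open>length js \<le> k\<close> assms by (intro schwartz_norm_ge) auto
  finally show "(1 + norm x) ^ k * cmod (partial_derivs js f x) \<le> schwartz_norm m f" .
qed

interpretation SW: directed_seminormed_space "schwartz :: 'n::finite test_fun set" schwartz_seminorms
proof
  have "(\<lambda>x. 0) \<in> (schwartz :: 'n test_fun set)"
  proof (rule schwartzI)
    show "smooth (\<lambda>x::real^'n. 0)" by (rule smooth_const)
    have "partial_derivs js (\<lambda>x::real^'n. 0) = (\<lambda>x. 0)" for js
      by (induction js) (auto simp: partial_derivs_Cons partial_deriv_const)
    then show "\<exists>B. \<forall>x. (1 + norm x) ^ k * cmod (partial_derivs js (\<lambda>x::real^'n. 0) x) \<le> B" for js k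
      by auto
  qed
  then show "csubspace (schwartz :: 'n test_fun set)"
    by (auto simp: csubspace_def zero_fun_def plus_fun_def schwartz_add schwartz_cmult)
next
  fix p q :: "'n test_fun \<Rightarrow> real" assume "p \<in> schwartz_seminorms" "q \<in> schwartz_seminorms"
  then obtain k m where "p = schwartz_norm k" "q = schwartz_norm m" by blast
  then show "\<exists>s\<in>schwartz_seminorms. \<forall>f\<in>schwartz. p f \<le> s f \<and> q f \<le> s f"
    by (intro bexI[of _ "schwartz_norm (max k m)"]) (auto intro: schwartz_norm_mono)
qed (auto simp: schwartz_norm_add plus_fun_def schwartz_norm_cmult)

lemma schwartz_norm_nonneg: "f \<in> schwartz \<Longrightarrow> 0 \<le> schwartz_norm k f"
  by (rule SW.nonneg) auto

lemma schwartz_diff: "f \<in> schwartz \<Longrightarrow> g \<in> schwartz \<Longrightarrow> (\<lambda>x. f x - g x) \<in> schwartz"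
  using SW.diff_mem[of f g] by (simp add: fun_diff_def)

lemma schwartz_partial_derivs:
  assumes "f \<in> schwartz"
  shows "partial_derivs js f \<in> schwartz" "schwartz_norm k (partial_derivs js f) \<le> schwartz_norm (k + length js) f"
proof -
  have f: "smooth f" using assms by (rule schwartz_smooth)
  show "partial_derivs js f \<in> schwartz"
    using assms smooth_partial_derivs[OF f, of js] by (auto simp: schwartz_def partial_derivs_append[symmetric])
  show "schwartz_norm k (partial_derivs js f) \<le> schwartz_norm (k + length js) f"
  proof (rule schwartz_norm_le)
    fix ks :: "'a list" and x assume "length ks \<le> k"
    have "(1 + norm x) ^ k * cmod (partial_derivs ks (partial_derivs js f) x) \<le>
      (1 + norm x) ^ (k + length js) * cmod (partial_derivs (ks @ js) f x)"
      unfolding partial_derivs_append by (intro mult_right_mono power_increasing) auto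
    also have "\<dots> \<le> schwartz_norm (k + length js) f"
      using \<open>length ks \<le> k\<close> by (intro schwartz_norm_ge assms) simp
    finally show "(1 + norm x) ^ k * cmod (partial_derivs ks (partial_derivs js f) x) \<le> schwartz_norm (k + length js) f" .
  qed
qed

lemma schwartz_partial_deriv:
  assumes "f \<in> schwartz"
  shows "partial_deriv j f \<in> schwartz" "schwartz_norm k (partial_deriv j f) \<le> schwartz_norm (Suc k) f"
  using schwartz_partial_derivs(1)[OF assms, of "[j]"] schwartz_partial_derivs(2)[OF assms, of k "[j]"]
  by (auto simp: partial_derivs_Cons)

text \<open>A Peetre-type inequality: a weight is moved from a point to a translated point at the
  price of the weight of the translation.\<close>

lemma weight_submult: "1 + norm (x + y) \<le> (1 + norm x) * (1 + norm (y :: 'a::real_normed_vector))"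
proof -
  have "0 \<le> norm x * norm y" by simp
  with norm_triangle_ineq[of x y] show ?thesis unfolding distrib_left distrib_right by linarith
qed

lemma weight_submult_power:
  "(1 + norm (x :: 'a::real_normed_vector)) ^ k \<le> (1 + norm (x - y)) ^ k * (1 + norm y) ^ k"
  using power_mono[OF weight_submult[of "x - y" y], of k] by (simp add: power_mult_distrib)

lemma partial_derivs_shift:
  "smooth f \<Longrightarrow> partial_derivs js (\<lambda>x. f (x - h)) = (\<lambda>x. partial_derivs js f (x - h))"
  using partial_derivs_affine[of f js 1 "- h"] by simp

lemma smooth_shift: "smooth f \<Longrightarrow> smooth (\<lambda>x. f (x - h))"
  using smooth_affine[of f 1 "- h"] by simp

lemma schwartz_affine:
  fixes f :: "'n::finite test_fun"
  assumes "f \<in> schwartz" "c \<noteq> 0"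
  shows "(\<lambda>x. f (c *\<^sub>R x + b)) \<in> schwartz"
proof (rule schwartzI)
  have f: "smooth f" using assms by (intro schwartz_smooth)
  then show "smooth (\<lambda>x. f (c *\<^sub>R x + b))" by (rule smooth_affine)
  fix js :: "'n list" and k
  define A where "A = (1 + 1 / \<bar>c\<bar>) * (1 + norm b)"
  have "(1 + norm x) ^ k * cmod (partial_derivs js (\<lambda>x. f (c *\<^sub>R x + b)) x) \<le>
      A ^ k * \<bar>c\<bar> ^ length js * schwartz_norm (k + length js) f" for x
  proof -
    let ?y = "c *\<^sub>R x + b"
    have 1: "1 + norm (c *\<^sub>R x) \<le> (1 + norm ?y) * (1 + norm b)"
      using weight_submult[of ?y "- b"] by simp
    have "norm x \<le> 1 / \<bar>c\<bar> * norm (c *\<^sub>R x)" using assms by simp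
    moreover have "0 \<le> 1 / \<bar>c\<bar>" "0 \<le> norm (c *\<^sub>R x)" by (simp_all del: norm_scaleR)
    ultimately have "1 + norm x \<le> (1 + 1 / \<bar>c\<bar>) * (1 + norm (c *\<^sub>R x))"
      unfolding distrib_left distrib_right by linarith
    also have "\<dots> \<le> (1 + 1 / \<bar>c\<bar>) * ((1 + norm ?y) * (1 + norm b))"
      by (intro mult_left_mono 1) (simp add: add_nonneg_nonneg)
    finally have "1 + norm x \<le> A * (1 + norm ?y)" by (simp add: A_def mult_ac)
    then have "(1 + norm x) ^ k \<le> A ^ k * (1 + norm ?y) ^ k"
      by (metis power_mult_distrib power_mono add_nonneg_nonneg norm_ge_zero zero_le_one)
    also have "\<dots> \<le> A ^ k * (1 + norm ?y) ^ (k + length js)"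
      by (intro mult_left_mono power_increasing) (auto simp: A_def)
    finally have "(1 + norm x) ^ k * cmod (partial_derivs js (\<lambda>x. f (c *\<^sub>R x + b)) x) \<le>
      (A ^ k * (1 + norm ?y) ^ (k + length js)) * cmod (partial_derivs js (\<lambda>x. f (c *\<^sub>R x + b)) x)"
      by (rule mult_right_mono) simp
    also have "\<dots> = A ^ k * \<bar>c\<bar> ^ length js * ((1 + norm ?y) ^ (k + length js) * cmod (partial_derivs js f ?y))"
      by (simp add: partial_derivs_affine[OF f] norm_mult norm_power)
    also have "\<dots> \<le> A ^ k * \<bar>c\<bar> ^ length js * schwartz_norm (k + length js) f"
      by (intro mult_left_mono schwartz_norm_ge assms) (auto simp: A_def)
    finally show ?thesis .
  qed
  then show "\<exists>B. \<forall>x. (1 + norm x) ^ k * cmod (partial_derivs js (\<lambda>x. f (c *\<^sub>R x + b)) x) \<le> B" by blast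
qed

lemma schwartz_shift: "f \<in> schwartz \<Longrightarrow> (\<lambda>x. f (x - h)) \<in> schwartz"
  using schwartz_affine[of f 1 "- h"] by simp

lemma schwartz_shift_plus: "f \<in> schwartz \<Longrightarrow> (\<lambda>x. f (x + h)) \<in> schwartz"
  using schwartz_affine[of f 1 h] by simp

lemma schwartz_reflect: "f \<in> schwartz \<Longrightarrow> (\<lambda>x. f (- x)) \<in> schwartz"
  using schwartz_affine[of f "-1" 0] by simp

lemma schwartz_norm_shift:
  fixes f :: "'n::finite test_fun"
  assumes "f \<in> schwartz"
  shows "schwartz_norm k (\<lambda>x. f (x - h)) \<le> (1 + norm h) ^ k * schwartz_norm k f"
proof (rule schwartz_norm_le)
  fix js :: "'n list" and x assume js: "length js \<le> k"
  have "(1 + norm x) ^ k * cmod (partial_derivs js f (x - h)) \<le>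
    ((1 + norm (x - h)) ^ k * (1 + norm h) ^ k) * cmod (partial_derivs js f (x - h))"
    by (intro mult_right_mono weight_submult_power) simp
  also have "\<dots> = (1 + norm h) ^ k * ((1 + norm (x - h)) ^ k * cmod (partial_derivs js f (x - h)))" by simp
  also have "\<dots> \<le> (1 + norm h) ^ k * schwartz_norm k f"
    by (intro mult_left_mono schwartz_norm_ge assms js) simp
  finally show "(1 + norm x) ^ k * cmod (partial_derivs js (\<lambda>x. f (x - h)) x) \<le> (1 + norm h) ^ k * schwartz_norm k f"
    by (simp add: partial_derivs_shift[OF schwartz_smooth[OF assms]])
qed

text \<open>Mean value inequality along a segment in which the partial derivatives are compared with
  freely chosen numbers \<open>c j\<close>. Zero gives a Lipschitz bound, the gradient at
  \<open>x\<close> gives the first-order Taylor remainder.\<close>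

lemma smooth_increment:
  fixes f :: "'n::finite test_fun"
  assumes "smooth f" and B: "\<And>t j. 0 \<le> t \<Longrightarrow> t \<le> 1 \<Longrightarrow> cmod (partial_deriv j f (x + t *\<^sub>R v) - c j) \<le> B"
  shows "cmod (f (x + v) - f x - (\<Sum>j\<in>UNIV. of_real (v $ j) * c j)) \<le> real CARD('n) * B * norm v"
proof -
  let ?D = "\<lambda>t. (\<Sum>j\<in>UNIV. of_real (v $ j) * partial_deriv j f (x + t *\<^sub>R v))"
  let ?c = "\<Sum>j\<in>UNIV. of_real (v $ j) * c j"
  have der: "((\<lambda>t. f (x + t *\<^sub>R v) - t *\<^sub>R ?c) has_vector_derivative (?D t - ?c)) (at t within {0..1})" for t
    by (intro has_vector_derivative_diff has_vector_derivative_line smooth_differentiable assms)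
      (auto intro!: derivative_eq_intros)
  have "norm ((f (x + 1 *\<^sub>R v) - 1 *\<^sub>R ?c) - (f (x + 0 *\<^sub>R v) - 0 *\<^sub>R ?c)) \<le> (real CARD('n) * B * norm v) * norm (1 - 0 :: real)"
  proof (rule differentiable_bound[where S="{0..1}" and f'="\<lambda>t s. s *\<^sub>R (?D t - ?c)"])
    show "((\<lambda>t. f (x + t *\<^sub>R v) - t *\<^sub>R ?c) has_derivative (\<lambda>s. s *\<^sub>R (?D t - ?c))) (at t within {0..1})" for t
      using der[of t] by (simp add: has_vector_derivative_def)
    fix t :: real assume t: "t \<in> {0..1}"
    have "cmod (?D t - ?c) = cmod (\<Sum>j\<in>UNIV. of_real (v $ j) * (partial_deriv j f (x + t *\<^sub>R v) - c j))"
      by (simp add: sum_subtractf right_diff_distrib)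
    also have "\<dots> \<le> (\<Sum>j\<in>(UNIV::'n set). norm v * B)"
    proof (rule sum_norm_le)
      fix j
      have "\<bar>v $ j\<bar> * cmod (partial_deriv j f (x + t *\<^sub>R v) - c j) \<le> norm v * B"
        using t by (intro mult_mono B component_le_norm_cart) auto
      then show "norm (of_real (v $ j) * (partial_deriv j f (x + t *\<^sub>R v) - c j)) \<le> norm v * B"
        by (simp add: norm_mult)
    qed
    finally have "cmod (?D t - ?c) \<le> real CARD('n) * B * norm v" by (simp add: mult_ac)
    then show "onorm (\<lambda>s. s *\<^sub>R (?D t - ?c)) \<le> real CARD('n) * B * norm v"
      by (subst onorm_scaleR_left) (auto simp: onorm_id bounded_linear_ident intro: order_trans)
  qed auto
  then show ?thesis by (simp add: algebra_simps)
qed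

lemma schwartz_norm_shift_diff:
  fixes f :: "'n::finite test_fun"
  assumes "f \<in> schwartz"
  shows "schwartz_norm k (\<lambda>x. f (x - h) - f x) \<le> real CARD('n) * norm h * (1 + norm h) ^ k * schwartz_norm (Suc k) f"
proof (rule schwartz_norm_le)
  fix js :: "'n list" and x :: "real^'n" assume js: "length js \<le> k"
  let ?g = "partial_derivs js f"
  have f: "smooth f" using assms by (rule schwartz_smooth)
  have g: "smooth ?g" using f by (rule smooth_partial_derivs)
  define B where "B = (1 + norm h) ^ k * schwartz_norm (Suc k) f / (1 + norm x) ^ k"
  have "cmod (?g (x + (- h)) - ?g x - (\<Sum>j\<in>UNIV. of_real ((- h) $ j) * 0)) \<le> real CARD('n) * B * norm (- h)"
  proof (rule smooth_increment[OF g])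
    fix t :: real and j assume t: "0 \<le> t" "t \<le> 1"
    let ?y = "x + t *\<^sub>R (- h)"
    have "(1 + norm x) ^ k * cmod (partial_deriv j ?g ?y) \<le> ((1 + norm ?y) ^ k * (1 + norm (t *\<^sub>R h)) ^ k) * cmod (partial_deriv j ?g ?y)"
      using weight_submult_power[of x k "t *\<^sub>R h"] by (intro mult_right_mono) auto
    also have "\<dots> \<le> ((1 + norm ?y) ^ Suc k * (1 + norm h) ^ k) * cmod (partial_deriv j ?g ?y)"
      using t by (intro mult_right_mono mult_mono power_increasing power_mono) (auto simp: mult_left_le_one_le)
    also have "\<dots> = (1 + norm h) ^ k * ((1 + norm ?y) ^ Suc k * cmod (partial_derivs (j # js) f ?y))"
      by (simp add: partial_derivs_Cons)
    also have "\<dots> \<le> (1 + norm h) ^ k * schwartz_norm (Suc k) f"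
      using js by (intro mult_left_mono schwartz_norm_ge assms) auto
    finally show "cmod (partial_deriv j ?g ?y - 0) \<le> B"
      by (simp add: B_def pos_le_divide_eq mult.commute add_pos_nonneg)
  qed
  then have "cmod (?g (x - h) - ?g x) \<le> real CARD('n) * B * norm h" by simp
  then have "(1 + norm x) ^ k * cmod (?g (x - h) - ?g x) \<le> (1 + norm x) ^ k * (real CARD('n) * B * norm h)"
    by (intro mult_left_mono) auto
  also have "\<dots> = real CARD('n) * norm h * (1 + norm h) ^ k * schwartz_norm (Suc k) f"
  proof -
    have "1 + norm x \<noteq> 0" using norm_ge_zero[of x] by linarith
    then show ?thesis by (simp add: B_def)
  qed
  finally show "(1 + norm x) ^ k * cmod (partial_derivs js (\<lambda>x. f (x - h) - f x) x) \<le> real CARD('n) * norm h * (1 + norm h) ^ k * schwartz_norm (Suc k) f"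
    using partial_derivs_add[OF smooth_shift[OF f] smooth_cmult[OF f, of "-1"], of js h]
    by (simp add: partial_derivs_shift[OF f] partial_derivs_cmult[OF f, of js "-1", simplified])
qed

lemma schwartz_taylor:
  fixes f :: "'n::finite test_fun"
  assumes "f \<in> schwartz"
  shows "cmod (f (x + v) - f x - (\<Sum>j\<in>UNIV. of_real (v $ j) * partial_deriv j f x)) \<le>
    (real CARD('n))\<^sup>2 * (norm v)\<^sup>2 * schwartz_norm 2 f"
proof -
  have f: "smooth f" using assms by (rule schwartz_smooth)
  have "cmod (partial_deriv j f (x + t *\<^sub>R v) - partial_deriv j f x) \<le> real CARD('n) * schwartz_norm 2 f * norm v"
    if t: "0 \<le> t" "t \<le> 1" for t j
  proof -
    let ?g = "partial_deriv j f"
    have g: "?g \<in> schwartz" using assms by (rule schwartz_partial_deriv)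
    have "cmod (?g (x + t *\<^sub>R v) - ?g x - (\<Sum>i\<in>UNIV. of_real ((t *\<^sub>R v) $ i) * 0)) \<le>
        real CARD('n) * schwartz_norm 2 f * norm (t *\<^sub>R v)"
    proof (rule smooth_increment[OF schwartz_smooth[OF g]])
      fix s i
      have "cmod (partial_deriv i ?g (x + s *\<^sub>R t *\<^sub>R v)) \<le> schwartz_norm 0 (partial_deriv i ?g)"
        by (intro schwartz_pointwise schwartz_partial_deriv g)
      also have "\<dots> \<le> schwartz_norm 2 f"
        using schwartz_partial_derivs(2)[OF assms, of 0 "[i, j]"] by (simp add: partial_derivs_Cons numeral_2_eq_2)
      finally show "cmod (partial_deriv i ?g (x + s *\<^sub>R t *\<^sub>R v) - 0) \<le> schwartz_norm 2 f" by simp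
    qed
    also have "\<dots> \<le> real CARD('n) * schwartz_norm 2 f * norm v"
      using t schwartz_norm_nonneg[OF assms, of 2] by (intro mult_left_mono) (auto simp: mult_left_le_one_le)
    finally show ?thesis by simp
  qed
  from smooth_increment[OF f this] show ?thesis by (simp add: power2_eq_square mult_ac)
qed

subsection \<open>Integrability\<close>

text \<open>Comparison with a series over balls of integer radius: the volumes grow like
  \<open>(1 + m) ^ DIM('a)\<close>, so the two extra powers leave the convergent series of
  \<open>1 / (1 + m)\<^sup>2\<close>. For each point the single term with
  \<open>m = \<lfloor>norm x\<rfloor>\<close> already dominates.\<close>

lemma integrable_weight_euclidean:
  "integrable lborel (\<lambda>x :: 'a::euclidean_space. 1 / (1 + norm x) ^ (DIM('a) + 2))"
proof (rule integrableI_bounded)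
  let ?N = "DIM('a) + 2"
  define v where "v = unit_ball_vol (real DIM('a))"
  have v: "v \<ge> 0" by (simp add: v_def)
  have "(\<integral>\<^sup>+x. ennreal (norm (1 / (1 + norm (x :: 'a)) ^ ?N)) \<partial>lborel) \<le>
     (\<integral>\<^sup>+x. (\<Sum>m. ennreal (1 / (1 + real m) ^ ?N) * indicator (cball 0 (1 + real m)) x) \<partial>(lborel :: ('a) measure))"
  proof (rule nn_integral_mono)
    fix x :: "'a"
    define m where "m = nat \<lfloor>norm x\<rfloor>"
    have m: "real m \<le> norm x" "norm x \<le> 1 + real m" by (auto simp: m_def) linarith
    have "ennreal (norm (1 / (1 + norm x) ^ ?N)) \<le> ennreal (1 / (1 + real m) ^ ?N)"
    proof (rule ennreal_leI)
      have "norm (1 / (1 + norm x) ^ ?N) = 1 / (1 + norm x) ^ ?N" by (subst real_norm_def, rule abs_of_nonneg) simp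
      also have "\<dots> \<le> 1 / (1 + real m) ^ ?N"
        by (intro divide_left_mono power_mono mult_pos_pos zero_less_power) (use m in auto)
      finally show "norm (1 / (1 + norm x) ^ ?N) \<le> 1 / (1 + real m) ^ ?N" .
    qed
    also have "\<dots> = (\<Sum>m\<in>{m}. ennreal (1 / (1 + real m) ^ ?N) * indicator (cball 0 (1 + real m)) x)"
      using m by simp
    also have "\<dots> \<le> (\<Sum>m. ennreal (1 / (1 + real m) ^ ?N) * indicator (cball 0 (1 + real m)) x)"
      by (rule sum_le_suminf) auto
    finally show "ennreal (norm (1 / (1 + norm x) ^ ?N)) \<le> (\<Sum>m. ennreal (1 / (1 + real m) ^ ?N) * indicator (cball 0 (1 + real m)) x)" .
  qed
  also have "\<dots> = (\<Sum>m. \<integral>\<^sup>+x. ennreal (1 / (1 + real m) ^ ?N) * indicator (cball 0 (1 + real m)) x \<partial>(lborel :: ('a) measure))"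
    by (intro nn_integral_suminf borel_measurable_times_ennreal borel_measurable_const
        borel_measurable_indicator) (simp add: borel_closed)
  also have "\<dots> = (\<Sum>m. ennreal (v / (1 + real m)\<^sup>2))"
  proof (rule suminf_cong)
    fix m :: nat
    have "(\<integral>\<^sup>+x. ennreal (1 / (1 + real m) ^ ?N) * indicator (cball 0 (1 + real m)) x \<partial>(lborel :: ('a) measure)) =
      ennreal (1 / (1 + real m) ^ ?N) * ennreal (v * (1 + real m) ^ DIM('a))"
      by (simp add: nn_integral_cmult_indicator emeasure_cball v_def)
    also have "\<dots> = ennreal (1 / (1 + real m) ^ ?N * (v * (1 + real m) ^ DIM('a)))"
      using v by (intro ennreal_mult[symmetric]) auto
    also have "1 / (1 + real m) ^ ?N * (v * (1 + real m) ^ DIM('a)) = v / (1 + real m)\<^sup>2"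
    proof -
      define b c where "b = (1 + real m) ^ DIM('a)" and "c = (1 + real m)\<^sup>2"
      have "b \<noteq> 0" by (simp add: b_def add_pos_nonneg less_imp_neq[symmetric])
      moreover have "(1 + real m) ^ ?N = b * c" by (simp only: power_add b_def c_def)
      ultimately show ?thesis unfolding b_def[symmetric] c_def[symmetric] by simp
    qed
    finally show "(\<integral>\<^sup>+x. ennreal (1 / (1 + real m) ^ ?N) * indicator (cball 0 (1 + real m)) x \<partial>(lborel :: ('a) measure)) = ennreal (v / (1 + real m)\<^sup>2)" .
  qed
  also have "\<dots> < \<infinity>"
  proof -
    have "summable (\<lambda>m. inverse (real (Suc m) ^ 2))"
      by (subst summable_Suc_iff) (rule inverse_power_summable, simp)
    then have "summable (\<lambda>m. v / (1 + real m)\<^sup>2)"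
      using summable_mult[of "\<lambda>m. inverse (real (Suc m) ^ 2)" v] by (simp add: field_simps)
    then show ?thesis using v by (subst suminf_ennreal2) auto
  qed
  finally show "(\<integral>\<^sup>+x. ennreal (norm (1 / (1 + norm (x :: 'a)) ^ ?N)) \<partial>lborel) < \<infinity>" .
qed simp

lemma integrable_weight:
  "integrable lborel (\<lambda>x :: real ^ 'n::finite. 1 / (1 + norm x) ^ (CARD('n) + 2))"
  using integrable_weight_euclidean[where 'a="real ^ 'n"] by simp

lemma integrable_schwartz_mult:
  fixes f :: "'n::finite test_fun" and g :: "real ^ 'n \<Rightarrow> complex"
  assumes f: "f \<in> schwartz" and g: "g \<in> borel_measurable borel" and B: "\<And>x. cmod (g x) \<le> B * (1 + norm x) ^ k"
  shows "integrable lborel (\<lambda>x. g x * f x)"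
    and "cmod (LINT x|lborel. g x * f x) \<le>
      B * schwartz_norm (k + CARD('n) + 2) f * (LINT x:: real ^ 'n|lborel. 1 / (1 + norm x) ^ (CARD('n) + 2))"
proof -
  let ?K = "k + CARD('n) + 2"
  let ?C = "B * schwartz_norm ?K f"
  have bd: "cmod (g x * f x) \<le> ?C * (1 / (1 + norm x) ^ (CARD('n) + 2))" for x
  proof -
    have p: "1 + norm x > 0" by (simp add: add_pos_nonneg)
    have "cmod (g x * f x) \<le> (B * (1 + norm x) ^ k) * (schwartz_norm ?K f / (1 + norm x) ^ ?K)"
      unfolding norm_mult using B[of x] by (intro mult_mono schwartz_pointwise f) (auto intro: order_trans[OF norm_ge_zero])
    also have "\<dots> = ?C * (1 / (1 + norm x) ^ (CARD('n) + 2))"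
    proof -
      define a b where "a = (1 + norm x) ^ k" and "b = (1 + norm x) ^ (CARD('n) + 2)"
      have "a > 0" "b > 0" unfolding a_def b_def using p by (intro zero_less_power; assumption)+
      moreover have "(1 + norm x) ^ ?K = a * b" by (simp only: a_def b_def power_add[symmetric] add.assoc)
      ultimately show ?thesis unfolding a_def[symmetric] b_def[symmetric] by simp
    qed
    finally show ?thesis .
  qed
  have int: "integrable lborel (\<lambda>x :: real ^ 'n. ?C * (1 / (1 + norm x) ^ (CARD('n) + 2)))"
    by (intro integrable_mult_right integrable_weight)
  show *: "integrable lborel (\<lambda>x. g x * f x)"
  proof (rule Bochner_Integration.integrable_bound[OF int])
    show "(\<lambda>x. g x * f x) \<in> borel_measurable lborel"
      using g smooth_measurable[OF schwartz_smooth[OF f]] by simp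
    show "AE x in lborel. norm (g x * f x) \<le> norm (?C * (1 / (1 + norm x) ^ (CARD('n) + 2)))"
      using bd by (intro AE_I2) (metis abs_ge_self order_trans real_norm_def)
  qed
  have "cmod (LINT x|lborel. g x * f x) \<le> (LINT x|lborel. cmod (g x * f x))" by (rule integral_norm_bound)
  also have "\<dots> \<le> (LINT x|lborel. ?C * (1 / (1 + norm (x::real^'n)) ^ (CARD('n) + 2)))"
    by (intro integral_mono int integrable_norm * bd)
  finally show "cmod (LINT x|lborel. g x * f x) \<le> ?C * (LINT x:: real ^ 'n|lborel. 1 / (1 + norm x) ^ (CARD('n) + 2))"
    by (simp only: integral_mult_right_zero)
qed

lemma schwartz_integrable: "f \<in> schwartz \<Longrightarrow> integrable lborel f"
  using integrable_schwartz_mult(1)[of f "\<lambda>_. 1" 1 0] by simp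

lemma schwartz_weighted_integrable:
  fixes f :: "'n::finite test_fun"
  assumes f: "f \<in> schwartz" and w: "w \<in> borel_measurable borel" "\<And>x. 0 \<le> w x" "\<And>x. w x \<le> B * (1 + norm x) ^ k"
  shows "integrable lborel (\<lambda>x. cmod (f x) * w x)"
proof -
  have "integrable lborel (\<lambda>x. complex_of_real (w x) * f x)"
    using w by (intro integrable_schwartz_mult(1)[OF f, where B=B and k=k]) auto
  from integrable_norm[OF this] show ?thesis using w(2) by (simp add: norm_mult mult.commute)
qed

lemma schwartz_bounded_mult_integrable:
  assumes "f \<in> schwartz" "g \<in> schwartz"
  shows "integrable lborel (\<lambda>x. g x * f x)"
  using assms by (intro integrable_schwartz_mult(1)[where B="schwartz_norm 0 g" and k=0])
    (auto intro: smooth_measurable schwartz_smooth schwartz_pointwise(3))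

section \<open>Convolution of Schwartz functions\<close>

text \<open>If \<open>f\<close> fails to be integrable, its integral is 0 by default, and
  \<open>w\<close> is nonnegative because it dominates a norm.\<close>

lemma integral_norm_le:
  fixes f :: "'a \<Rightarrow> 'b::{banach, second_countable_topology}"
  assumes "integrable M w" "\<And>x. norm (f x) \<le> w x"
  shows "norm (integral\<^sup>L M f) \<le> integral\<^sup>L M w"
proof -
  have "norm (integral\<^sup>L M f) \<le> (LINT x|M. norm (f x))" by (rule integral_norm_bound)
  also have "\<dots> \<le> integral\<^sup>L M w"
    using assms order_trans[OF norm_ge_zero assms(2)] by (intro integral_mono') auto
  finally show ?thesis .
qed

lemma sum_fun_apply: "(\<Sum>i\<in>I. f i) x = (\<Sum>i\<in>I. f i x)" for f :: "'i \<Rightarrow> 'a \<Rightarrow> 'b::comm_monoid_add"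
proof (induction I rule: infinite_finite_induct)
  case (insert i I)
  then show ?case unfolding sum.insert[OF insert(1,2)] plus_fun_apply by simp
qed simp_all

lemma lborel_reflect_shift:
  fixes f :: "'a::euclidean_space \<Rightarrow> 'b::{banach, second_countable_topology}"
  assumes [measurable]: "f \<in> borel_measurable borel"
  shows "integrable lborel (\<lambda>x. f (a - x)) \<longleftrightarrow> integrable lborel f"
    "(LINT x|lborel. f (a - x)) = (LINT x|lborel. f x)"
proof -
  have *: "lborel = distr lborel borel (\<lambda>x::'a. a - x)"
    using lborel_affine[of "-1" a] by (simp add: density_1)
  have m: "(\<lambda>x::'a. a - x) \<in> measurable lborel borel" by simp
  show "integrable lborel (\<lambda>x. f (a - x)) \<longleftrightarrow> integrable lborel f"
    by (subst (2) *) (rule integrable_distr_eq[OF m assms, symmetric])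
  show "(LINT x|lborel. f (a - x)) = (LINT x|lborel. f x)"
    by (subst (2) *) (rule integral_distr[OF m assms, symmetric])
qed

lemma lborel_shift:
  fixes f :: "'a::euclidean_space \<Rightarrow> 'b::{banach, second_countable_topology}"
  assumes [measurable]: "f \<in> borel_measurable borel"
  shows "(LINT x|lborel. f (x + a)) = (LINT x|lborel. f x)"
  using lborel_reflect_shift(2)[of "\<lambda>x. f (- x)" "- a"] lborel_reflect_shift(2)[OF assms, of 0]
  by (simp add: add.commute)

lemma schwartz_measurable: "f \<in> schwartz \<Longrightarrow> f \<in> borel_measurable borel"
  by (intro smooth_measurable schwartz_smooth)

lemma convolution_swap:
  assumes "f \<in> schwartz" "g \<in> schwartz"
  shows "convolution f g x = (LINT t|lborel. f t * g (x - t))"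
proof -
  have [measurable]: "f \<in> borel_measurable borel" "g \<in> borel_measurable borel"
    using assms by (auto intro: schwartz_measurable)
  show ?thesis unfolding convolution_def
    using lborel_reflect_shift(2)[of "\<lambda>t. f t * g (x - t)" x] by simp
qed

lemma convolution_integrable:
  fixes f g :: "'n::finite test_fun"
  assumes "f \<in> schwartz" "g \<in> schwartz"
  shows "integrable lborel (\<lambda>t. f t * g (x - t))"
proof -
  have "integrable lborel (\<lambda>t. g (x - t) * f t)"
  proof (rule integrable_schwartz_mult(1)[OF assms(1), where B="schwartz_norm 0 g" and k=0])
    have [measurable]: "g \<in> borel_measurable borel" by (rule schwartz_measurable) fact
    show "(\<lambda>t. g (x - t)) \<in> borel_measurable borel" by measurable
    show "cmod (g (x - t)) \<le> schwartz_norm 0 g * (1 + norm t) ^ 0" for t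
      using schwartz_pointwise(3)[OF assms(2)] by simp
  qed
  then show ?thesis by (simp add: mult.commute)
qed

lemma convolution_commute:
  assumes "f \<in> schwartz" "g \<in> schwartz"
  shows "convolution f g = convolution g f"
  using convolution_swap[OF assms] by (auto simp: convolution_def mult.commute fun_eq_iff)

text \<open>Differentiation under the integral sign: the Taylor remainder of \<open>\<phi>\<close>
  is quadratic uniformly in the base point \<open>x - t\<close>, so it may be integrated against
  \<open>g\<close>.\<close>

lemma convolution_has_derivative:
  fixes g \<phi> :: "'n::finite test_fun"
  assumes g: "g \<in> schwartz" and \<phi>: "\<phi> \<in> schwartz"
  shows "(convolution g \<phi> has_derivative (\<lambda>v. \<Sum>j\<in>UNIV. of_real (v $ j) * convolution g (partial_deriv j \<phi>) x)) (at x)"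
  unfolding has_derivative_at_alt
proof (intro conjI allI impI)
  show "bounded_linear (\<lambda>v :: real^'n. \<Sum>j\<in>UNIV. of_real (v $ j) * convolution g (partial_deriv j \<phi>) x)"
    by (intro bounded_linear_sum bounded_linear_mult_const bounded_linear_compose[OF bounded_linear_of_real]
        bounded_linear_vec_nth)
next
  fix e :: real assume e: "e > 0"
  define C where "C = (real CARD('n))\<^sup>2 * schwartz_norm 2 \<phi> * (LINT t|lborel. cmod (g t))"
  have Ig: "integrable lborel (\<lambda>t. cmod (g t))" using g by (intro integrable_norm schwartz_integrable)
  have C: "C \<ge> 0" unfolding C_def by (intro mult_nonneg_nonneg schwartz_norm_nonneg \<phi>) auto
  have bd: "norm (convolution g \<phi> y - convolution g \<phi> x - (\<Sum>j\<in>UNIV. of_real ((y - x) $ j) * convolution g (partial_deriv j \<phi>) x))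
    \<le> C * (norm (y - x))\<^sup>2" for y
  proof -
    let ?r = "\<lambda>t. \<phi> (y - t) - \<phi> (x - t) - (\<Sum>j\<in>UNIV. of_real ((y - x) $ j) * partial_deriv j \<phi> (x - t))"
    note I = convolution_integrable[OF g]
    have d: "partial_deriv j \<phi> \<in> schwartz" for j by (intro schwartz_partial_deriv \<phi>)
    have "convolution g \<phi> y - convolution g \<phi> x - (\<Sum>j\<in>UNIV. of_real ((y - x) $ j) * convolution g (partial_deriv j \<phi>) x)
      = (LINT t|lborel. g t * \<phi> (y - t)) - (LINT t|lborel. g t * \<phi> (x - t))
        - (\<Sum>j\<in>UNIV. of_real ((y - x) $ j) * (LINT t|lborel. g t * partial_deriv j \<phi> (x - t)))"
      by (simp add: convolution_swap g \<phi> d)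
    also have "\<dots> = (LINT t|lborel. g t * \<phi> (y - t) - g t * \<phi> (x - t)
        - (\<Sum>j\<in>UNIV. of_real ((y - x) $ j) * (g t * partial_deriv j \<phi> (x - t))))"
      by (simp add: I[OF \<phi>] I[OF d])
    also have "\<dots> = (LINT t|lborel. g t * ?r t)"
      by (intro Bochner_Integration.integral_cong refl) (simp add: algebra_simps sum_distrib_left)
    finally have eq: "convolution g \<phi> y - convolution g \<phi> x - (\<Sum>j\<in>UNIV. of_real ((y - x) $ j) * convolution g (partial_deriv j \<phi>) x)
      = (LINT t|lborel. g t * ?r t)" .
    have "norm (LINT t|lborel. g t * ?r t) \<le> (LINT t|lborel. cmod (g t) * ((real CARD('n))\<^sup>2 * (norm (y - x))\<^sup>2 * schwartz_norm 2 \<phi>))"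
    proof (rule integral_norm_le)
      show "integrable lborel (\<lambda>t. cmod (g t) * ((real CARD('n))\<^sup>2 * (norm (y - x))\<^sup>2 * schwartz_norm 2 \<phi>))"
        by (intro integrable_mult_left Ig)
      show "norm (g t * ?r t) \<le> cmod (g t) * ((real CARD('n))\<^sup>2 * (norm (y - x))\<^sup>2 * schwartz_norm 2 \<phi>)" for t
        using schwartz_taylor[OF \<phi>, of "x - t" "y - x"] unfolding norm_mult
        by (intro mult_left_mono) auto
    qed
    also have "\<dots> = C * (norm (y - x))\<^sup>2" by (simp add: C_def)
    finally show ?thesis unfolding eq .
  qed
  show "\<exists>d>0. \<forall>y. norm (y - x) < d \<longrightarrow>
    norm (convolution g \<phi> y - convolution g \<phi> x - (\<Sum>j\<in>UNIV. of_real ((y - x) $ j) * convolution g (partial_deriv j \<phi>) x))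
    \<le> e * norm (y - x)"
  proof (intro exI[of _ "e / (C + 1)"] conjI allI impI)
    show "e / (C + 1) > 0" using e C by simp
    fix y assume "norm (y - x) < e / (C + 1)"
    then have "(C + 1) * norm (y - x) \<le> e" using C by (simp add: field_simps)
    moreover have "C * norm (y - x) \<le> (C + 1) * norm (y - x)" by (intro mult_right_mono) auto
    ultimately have "C * norm (y - x) \<le> e" by linarith
    then have "C * norm (y - x) * norm (y - x) \<le> e * norm (y - x)" by (rule mult_right_mono) simp
    with bd[of y] show "norm (convolution g \<phi> y - convolution g \<phi> x - (\<Sum>j\<in>UNIV. of_real ((y - x) $ j) * convolution g (partial_deriv j \<phi>) x))
      \<le> e * norm (y - x)" by (simp add: power2_eq_square mult.assoc)
  qed
qed

lemma convolution_partial_deriv: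
  fixes g \<phi> :: "'n::finite test_fun"
  assumes g: "g \<in> schwartz" and \<phi>: "\<phi> \<in> schwartz"
  shows "partial_deriv j (convolution g \<phi>) = convolution g (partial_deriv j \<phi>)"
proof
  fix x
  have "partial_deriv j (convolution g \<phi>) x = (\<Sum>i\<in>UNIV. of_real ((axis j 1 :: real^'n) $ i) * convolution g (partial_deriv i \<phi>) x)"
    by (rule partial_derivI[OF convolution_has_derivative[OF assms]])
  also have "\<dots> = (\<Sum>i\<in>UNIV. if i = j then convolution g (partial_deriv j \<phi>) x else 0)"
    by (intro sum.cong) (auto simp: axis_def)
  finally show "partial_deriv j (convolution g \<phi>) x = convolution g (partial_deriv j \<phi>) x" by simp
qed

lemma convolution_partial_derivs:
  assumes g: "g \<in> schwartz" and \<phi>: "\<phi> \<in> schwartz"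
  shows "partial_derivs js (convolution g \<phi>) = convolution g (partial_derivs js \<phi>)"
  by (induction js)
    (auto simp: partial_derivs_Cons convolution_partial_deriv[OF g schwartz_partial_derivs(1)[OF \<phi>]])

lemma convolution_smooth:
  fixes g \<phi> :: "'n::finite test_fun"
  assumes g: "g \<in> schwartz" and \<phi>: "\<phi> \<in> schwartz"
  shows "smooth (convolution g \<phi>)"
proof (rule smooth_class(2)[of "convolution g ` schwartz"])
  show "f differentiable (at x)" if "f \<in> convolution g ` schwartz" for f x
    using that convolution_has_derivative[OF g] unfolding differentiable_def by blast
  show "partial_deriv j f \<in> convolution g ` schwartz" if "f \<in> convolution g ` schwartz" for f j
    using that convolution_partial_deriv[OF g] schwartz_partial_deriv(1) by blast
qed (use \<phi> in blast)

lemma convolution_bound: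
  fixes g \<phi> :: "'n::finite test_fun"
  assumes g: "g \<in> schwartz" and \<phi>: "\<phi> \<in> schwartz"
  shows "(1 + norm x) ^ k * cmod (convolution g \<phi> x) \<le> (LINT t|lborel. cmod (g t) * (1 + norm t) ^ k) * schwartz_norm k \<phi>"
proof -
  have pos: "(1 + norm y) ^ k > 0" for y :: "real^'n" by (intro zero_less_power) (simp add: add_pos_nonneg)
  have int: "integrable lborel (\<lambda>t. cmod (g t) * (1 + norm t) ^ k)"
    by (rule schwartz_weighted_integrable[OF g, where B=1 and k=k]) auto
  have "cmod (convolution g \<phi> x) \<le> (LINT t|lborel. cmod (g t) * (1 + norm t) ^ k * (schwartz_norm k \<phi> / (1 + norm x) ^ k))"
    unfolding convolution_swap[OF assms]
  proof (rule integral_norm_le)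
    show "integrable lborel (\<lambda>t. cmod (g t) * (1 + norm t) ^ k * (schwartz_norm k \<phi> / (1 + norm x) ^ k))"
      by (intro integrable_mult_left int)
    fix t :: "real^'n"
    have "(1 + norm x) ^ k * cmod (\<phi> (x - t)) \<le> ((1 + norm (x - t)) ^ k * (1 + norm t) ^ k) * cmod (\<phi> (x - t))"
      by (intro mult_right_mono weight_submult_power) simp
    also have "\<dots> = (1 + norm t) ^ k * ((1 + norm (x - t)) ^ k * cmod (\<phi> (x - t)))" by simp
    also have "\<dots> \<le> (1 + norm t) ^ k * schwartz_norm k \<phi>" by (intro mult_left_mono schwartz_pointwise \<phi>) simp
    finally have "cmod (\<phi> (x - t)) \<le> (1 + norm t) ^ k * (schwartz_norm k \<phi> / (1 + norm x) ^ k)"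
      using pos[of x] by (simp add: pos_le_divide_eq mult.commute)
    then show "norm (g t * \<phi> (x - t)) \<le> cmod (g t) * (1 + norm t) ^ k * (schwartz_norm k \<phi> / (1 + norm x) ^ k)"
      unfolding norm_mult mult.assoc by (intro mult_left_mono) auto
  qed
  also have "\<dots> = (LINT t|lborel. cmod (g t) * (1 + norm t) ^ k) * (schwartz_norm k \<phi> / (1 + norm x) ^ k)"
    by (rule integral_mult_left_zero)
  finally have "cmod (convolution g \<phi> x) \<le> (LINT t|lborel. cmod (g t) * (1 + norm t) ^ k) * schwartz_norm k \<phi> / (1 + norm x) ^ k"
    by simp
  then show ?thesis using pos[of x] by (simp add: pos_le_divide_eq mult.commute)
qed

lemma convolution_schwartz:
  fixes g \<phi> :: "'n::finite test_fun"
  assumes g: "g \<in> schwartz" and \<phi>: "\<phi> \<in> schwartz"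
  shows "convolution g \<phi> \<in> schwartz"
proof (rule schwartzI[OF convolution_smooth[OF assms]])
  fix js :: "'n list" and k
  show "\<exists>B. \<forall>x. (1 + norm x) ^ k * cmod (partial_derivs js (convolution g \<phi>) x) \<le> B"
    using convolution_bound[OF g schwartz_partial_derivs(1)[OF \<phi>, of js]]
    unfolding convolution_partial_derivs[OF assms] by blast
qed

lemma convolution_partial_derivs_left:
  assumes g: "g \<in> schwartz" and \<phi>: "\<phi> \<in> schwartz"
  shows "partial_derivs js (convolution g \<phi>) = convolution (partial_derivs js g) \<phi>"
  by (simp add: convolution_commute[of _ \<phi>] convolution_partial_derivs assms schwartz_partial_derivs)

lemma convolution_cmult_left: "convolution (\<lambda>x. c * f x) \<phi> = (\<lambda>x. c * convolution f \<phi> x)"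
  by (simp add: fun_eq_iff convolution_def mult.assoc)

lemma convolution_diff_left:
  assumes "f \<in> schwartz" "g \<in> schwartz" "\<phi> \<in> schwartz"
  shows "convolution (\<lambda>x. f x - g x) \<phi> = (\<lambda>x. convolution f \<phi> x - convolution g \<phi> x)"
  using assms by (simp add: fun_eq_iff convolution_swap schwartz_diff left_diff_distrib convolution_integrable)

lemma convolution_diff_right:
  assumes "f \<in> schwartz" "g \<in> schwartz" "\<phi> \<in> schwartz"
  shows "convolution \<phi> (\<lambda>x. f x - g x) = (\<lambda>x. convolution \<phi> f x - convolution \<phi> g x)"
  using assms by (simp add: fun_eq_iff convolution_swap schwartz_diff right_diff_distrib convolution_integrable)

subsection \<open>Convolutions as limits of linear combinations of translates\<close>

text \<open>The integral is split over the level sets of \<open>q\<close>. The left-hand form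
  appears when a seminorm or a functional is applied to a Riemann sum term by term, the right-hand
  form is the one in which limits can be taken.\<close>

lemma simple_function_integral_sum:
  fixes g :: "'a \<Rightarrow> 'b::{real_normed_field, banach, second_countable_topology}" and H :: "'c \<Rightarrow> 'b"
  assumes g: "integrable M g" and q: "simple_function M q"
  shows "(\<Sum>v\<in>q ` space M. (LINT t|M. g t * indicator (q -` {v} \<inter> space M) t) * H v) = (LINT t|M. g t * H (q t))"
    "integrable M (\<lambda>t. g t * H (q t))"
proof -
  have fin: "finite (q ` space M)" and s: "q -` {v} \<inter> space M \<in> sets M" if "v \<in> q ` space M" for v
    using q that by (auto simp: simple_function_def)
  have fin: "finite (q ` space M)" using q by (auto simp: simple_function_def)
  have int: "integrable M (\<lambda>t. g t * indicator (q -` {v} \<inter> space M) t)" if "v \<in> q ` space M" for v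
    using integrable_mult_indicator[OF s[OF that] g] by (simp add: indicator_scaleR_eq_if indicator_times_eq_if if_distrib mult.commute cong: if_cong)
  have eq: "g t * H (q t) = (\<Sum>v\<in>q ` space M. (g t * indicator (q -` {v} \<inter> space M) t) * H v)"
    if "t \<in> space M" for t
  proof -
    have "(\<Sum>v\<in>q ` space M. (g t * indicator (q -` {v} \<inter> space M) t) * H v) = (\<Sum>v\<in>q ` space M. if v = q t then g t * H (q t) else 0)"
      using that by (intro sum.cong) (auto simp: indicator_def)
    also have "\<dots> = g t * H (q t)" using that fin by simp
    finally show ?thesis by simp
  qed
  have I: "integrable M (\<lambda>t. \<Sum>v\<in>q ` space M. (g t * indicator (q -` {v} \<inter> space M) t) * H v)"
    by (intro Bochner_Integration.integrable_sum integrable_mult_left int)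
  then show "integrable M (\<lambda>t. g t * H (q t))"
    by (subst Bochner_Integration.integrable_cong[OF refl eq])
  show "(\<Sum>v\<in>q ` space M. (LINT t|M. g t * indicator (q -` {v} \<inter> space M) t) * H v) = (LINT t|M. g t * H (q t))"
    by (subst Bochner_Integration.integral_cong[OF refl eq])
      (auto simp: int Bochner_Integration.integral_sum)
qed

text \<open>Simple functions tending pointwise to the identity of an unbounded space, so the cells
  cannot be uniformly small. The bound \<open>2 * norm t\<close> is what the standard simple
  approximation provides, and it supplies the majorants for dominated convergence.\<close>

definition quantizers :: "(nat \<Rightarrow> real ^ 'n \<Rightarrow> real ^ 'n::finite) \<Rightarrow> bool" where
  "quantizers q \<longleftrightarrow> (\<forall>k. simple_function lborel (q k)) \<and> (\<forall>t. (\<lambda>k. q k t) \<longlonglongrightarrow> t) \<and>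
     (\<forall>k t. norm (q k t) \<le> 2 * norm t)"

lemma quantizers_exist: "\<exists>q. quantizers (q :: nat \<Rightarrow> real ^ 'n \<Rightarrow> real ^ 'n::finite)"
proof -
  have "(\<lambda>x. x) \<in> borel_measurable (lborel :: (real^'n) measure)" by simp
  from borel_measurable_implies_sequence_metric[OF this, of 0]
  show ?thesis unfolding quantizers_def by (simp add: dist_norm)
qed

text \<open>Approximates the convolution of \<open>g\<close> and \<open>\<phi>\<close>: each
  translate of \<open>\<phi>\<close> is weighted by the mass of \<open>g\<close> on the cell sent to
  its node. As a finite combination of translates it is accessible to the translation bound on
  \<open>E\<close>.\<close>

definition riemann_sum :: "'n::finite test_fun \<Rightarrow> 'n test_fun \<Rightarrow> (real ^ 'n \<Rightarrow> real ^ 'n) \<Rightarrow> 'n test_fun" where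
  "riemann_sum g \<phi> q = (\<lambda>x. \<Sum>v\<in>range q. (LINT t|lborel. g t * indicator (q -` {v}) t) * \<phi> (x - v))"

lemma riemann_sum_schwartz:
  assumes "\<phi> \<in> schwartz"
  shows "riemann_sum g \<phi> q \<in> schwartz"
proof -
  have "(\<Sum>v\<in>range q. (\<lambda>x. (LINT t|lborel. g t * indicator (q -` {v}) t) * \<phi> (x - v))) \<in> schwartz"
    by (intro SW.sum_mem schwartz_cmult schwartz_shift assms)
  moreover have "(\<Sum>v\<in>range q. (\<lambda>x. (LINT t|lborel. g t * indicator (q -` {v}) t) * \<phi> (x - v))) = riemann_sum g \<phi> q"
    by (rule ext) (simp add: riemann_sum_def sum_fun_apply)
  ultimately show ?thesis by simp
qed


text \<open>The error is the integral of \<open>g t\<close> against the difference of two translates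
  of a derivative of \<open>\<phi>\<close>. The majorant \<open>w\<close> is left open because the
  lemma serves twice: for quantizers tending to the identity, and for the constant 0 when
  \<open>g\<close> is a mollifier.\<close>

lemma riemann_sum_error:
  fixes g \<phi> :: "'n::finite test_fun"
  assumes g: "g \<in> schwartz" and \<phi>: "\<phi> \<in> schwartz" and q: "simple_function lborel q"
    and w: "w \<in> borel_measurable borel" "\<And>t. w t \<le> B * (1 + norm t) ^ l"
    and le: "\<And>t. schwartz_norm m (\<lambda>x. \<phi> (x - t) - \<phi> (x - q t)) \<le> w t"
  shows "schwartz_norm m (\<lambda>x. convolution g \<phi> x - riemann_sum g \<phi> q x) \<le> (LINT t|lborel. cmod (g t) * w t)"
proof (rule schwartz_norm_le)
  fix js :: "'n list" and x assume js: "length js \<le> m"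
  let ?f = "partial_derivs js \<phi>"
  have f: "?f \<in> schwartz" by (intro schwartz_partial_derivs \<phi>)
  have sm: "smooth \<phi>" using \<phi> by (rule schwartz_smooth)
  have d: "(\<lambda>x. \<phi> (x - t) - \<phi> (x - s)) \<in> schwartz" for s t by (intro schwartz_diff schwartz_shift \<phi>)
  have w0: "0 \<le> w t" for t using schwartz_norm_nonneg[OF d] le[of t] order_trans by blast
  have Iw: "integrable lborel (\<lambda>t. cmod (g t) * w t)"
    by (rule schwartz_weighted_integrable[OF g w(1) w0 w(2)])
  have "partial_derivs js (riemann_sum g \<phi> q) x =
      (\<Sum>v\<in>range q. (LINT t|lborel. g t * indicator (q -` {v}) t) * ?f (x - v))"
    unfolding riemann_sum_def
    by (subst partial_derivs_sum)
      (auto intro!: smooth_cmult smooth_shift sm simp: partial_derivs_cmult[OF smooth_shift[OF sm]] partial_derivs_shift[OF sm])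
  also have "\<dots> = (LINT t|lborel. g t * ?f (x - q t))"
    using simple_function_integral_sum(1)[OF schwartz_integrable[OF g] q, of "\<lambda>v. ?f (x - v)"] by simp
  finally have R: "partial_derivs js (riemann_sum g \<phi> q) x = (LINT t|lborel. g t * ?f (x - q t))" .
  have "partial_derivs js (\<lambda>x. convolution g \<phi> x - riemann_sum g \<phi> q x) x =
    partial_derivs js (convolution g \<phi>) x - partial_derivs js (riemann_sum g \<phi> q) x"
  proof -
    have r: "smooth (riemann_sum g \<phi> q)" by (intro schwartz_smooth riemann_sum_schwartz \<phi>)
    show ?thesis
      using partial_derivs_add[OF convolution_smooth[OF g \<phi>] smooth_cmult[OF r, of "-1"], of js]
      by (simp add: partial_derivs_cmult[OF r, of js "-1", simplified])
  qed
  also have "\<dots> = (LINT t|lborel. g t * ?f (x - t)) - (LINT t|lborel. g t * ?f (x - q t))"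
    by (simp only: R convolution_partial_derivs[OF g \<phi>] convolution_swap[OF g f])
  also have "\<dots> = (LINT t|lborel. g t * (?f (x - t) - ?f (x - q t)))"
    using convolution_integrable[OF g f, of x]
      simple_function_integral_sum(2)[OF schwartz_integrable[OF g] q, of "\<lambda>v. ?f (x - v)"]
    by (simp add: right_diff_distrib)
  finally have eq: "partial_derivs js (\<lambda>x. convolution g \<phi> x - riemann_sum g \<phi> q x) x =
    (LINT t|lborel. g t * (?f (x - t) - ?f (x - q t)))" .
  have pos: "(1 + norm x) ^ m > 0" by (intro zero_less_power) (simp add: add_pos_nonneg)
  have "cmod (LINT t|lborel. g t * (?f (x - t) - ?f (x - q t))) \<le> (LINT t|lborel. cmod (g t) * w t / (1 + norm x) ^ m)"
  proof (rule integral_norm_le)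
    show "integrable lborel (\<lambda>t. cmod (g t) * w t / (1 + norm x) ^ m)" by (intro integrable_divide Iw)
    fix t
    have "(1 + norm x) ^ m * cmod (partial_derivs js (\<lambda>x. \<phi> (x - t) - \<phi> (x - q t)) x) \<le> w t"
      using schwartz_norm_ge[OF d js, of x t "q t"] le[of t] by linarith
    moreover have "partial_derivs js (\<lambda>x. \<phi> (x - t) - \<phi> (x - q t)) x = ?f (x - t) - ?f (x - q t)"
      using partial_derivs_add[OF smooth_shift[OF sm] smooth_cmult[OF smooth_shift[OF sm], of "-1"], of js t "q t"]
      by (simp add: partial_derivs_shift[OF sm] partial_derivs_cmult[OF smooth_shift[OF sm], of js "-1", simplified])
    ultimately have "cmod (?f (x - t) - ?f (x - q t)) \<le> w t / (1 + norm x) ^ m"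
      using pos by (simp add: pos_le_divide_eq mult.commute)
    then show "norm (g t * (?f (x - t) - ?f (x - q t))) \<le> cmod (g t) * w t / (1 + norm x) ^ m"
      using mult_left_mono[of "cmod (?f (x - t) - ?f (x - q t))" "w t / (1 + norm x) ^ m" "cmod (g t)"]
      by (simp add: norm_mult)
  qed
  then show "(1 + norm x) ^ m * cmod (partial_derivs js (\<lambda>x. convolution g \<phi> x - riemann_sum g \<phi> q x) x)
      \<le> (LINT t|lborel. cmod (g t) * w t)"
    unfolding eq using pos by (simp add: pos_le_divide_eq mult.commute)
qed

lemma schwartz_norm_shift_shift:
  fixes \<phi> :: "'n::finite test_fun"
  assumes "\<phi> \<in> schwartz"
  shows "schwartz_norm m (\<lambda>x. \<phi> (x - t) - \<phi> (x - s)) \<le>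
    real CARD('n) * norm (t - s) * (1 + norm (t - s)) ^ m * schwartz_norm (Suc m) \<phi> * (1 + norm s) ^ m"
proof -
  have d: "(\<lambda>x. \<phi> (x - (t - s)) - \<phi> x) \<in> schwartz" by (intro schwartz_diff schwartz_shift assms)
  have "schwartz_norm m (\<lambda>x. \<phi> (x - t) - \<phi> (x - s)) = schwartz_norm m (\<lambda>x. (\<lambda>x. \<phi> (x - (t - s)) - \<phi> x) (x - s))"
    by (simp add: algebra_simps)
  also have "\<dots> \<le> (1 + norm s) ^ m * schwartz_norm m (\<lambda>x. \<phi> (x - (t - s)) - \<phi> x)"
    by (rule schwartz_norm_shift[OF d])
  also have "\<dots> \<le> (1 + norm s) ^ m * (real CARD('n) * norm (t - s) * (1 + norm (t - s)) ^ m * schwartz_norm (Suc m) \<phi>)"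
    by (intro mult_left_mono schwartz_norm_shift_diff assms) simp
  finally show ?thesis by (simp add: mult_ac)
qed

lemma riemann_sum_tendsto:
  fixes g \<phi> :: "'n::finite test_fun"
  assumes g: "g \<in> schwartz" and \<phi>: "\<phi> \<in> schwartz" and q: "quantizers q"
  shows "(\<lambda>k. schwartz_norm m (\<lambda>x. convolution g \<phi> x - riemann_sum g \<phi> (q k) x)) \<longlonglongrightarrow> 0"
proof -
  define w where "w k t = real CARD('n) * norm (q k t - t) * (1 + norm (q k t - t)) ^ m * schwartz_norm (Suc m) \<phi> * (1 + norm t) ^ m" for k t
  define C where "C = real CARD('n) * 3 ^ Suc m * schwartz_norm (Suc m) \<phi>"
  have sn: "schwartz_norm (Suc m) \<phi> \<ge> 0" by (rule schwartz_norm_nonneg[OF \<phi>])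
  have sf: "simple_function lborel (q k)" and lim: "(\<lambda>k. q k t) \<longlonglongrightarrow> t" and qb: "norm (q k t) \<le> 2 * norm t" for k t
    using q by (auto simp: quantizers_def)
  have qm [measurable]: "q k \<in> borel_measurable borel" for k
    using borel_measurable_simple_function[OF sf[of k]] by simp
  have wb: "w k t \<le> C * (1 + norm t) ^ (2 * m + 1)" and w0: "0 \<le> w k t" for k t
  proof -
    have 3: "norm (q k t - t) \<le> 3 * (1 + norm t)" "1 + norm (q k t - t) \<le> 3 * (1 + norm t)"
      using norm_triangle_ineq4[of "q k t" t] qb[of k t] norm_ge_zero[of t] by auto
    have "w k t \<le> real CARD('n) * (3 * (1 + norm t)) * (3 * (1 + norm t)) ^ m * schwartz_norm (Suc m) \<phi> * (1 + norm t) ^ m"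
      unfolding w_def using 3 sn by (intro mult_right_mono mult_mono power_mono) auto
    also have "\<dots> = C * (1 + norm t) ^ (2 * m + 1)"
    proof -
      obtain a where a: "1 + norm t = a" by blast
      show ?thesis unfolding a by (simp add: C_def power_mult_distrib power_add power_mult power2_eq_square mult_ac)
    qed
    finally show "w k t \<le> C * (1 + norm t) ^ (2 * m + 1)" .
    show "0 \<le> w k t" unfolding w_def using sn by (intro mult_nonneg_nonneg) auto
  qed
  have [measurable]: "g \<in> borel_measurable borel" by (rule schwartz_measurable[OF g])
  have wm [measurable]: "w k \<in> borel_measurable borel" for k unfolding w_def by measurable
  have dom: "integrable lborel (\<lambda>t. cmod (g t) * (C * (1 + norm t) ^ (2 * m + 1)))"
    by (rule schwartz_weighted_integrable[OF g, where B=C and k="2*m+1"]) (auto simp: C_def sn)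
  have "(\<lambda>k. LINT t|lborel. cmod (g t) * w k t) \<longlonglongrightarrow> (LINT t:: real ^ 'n|lborel. (0::real))"
  proof (rule integral_dominated_convergence[OF _ _ dom])
    show "AE t in lborel. (\<lambda>k. cmod (g t) * w k t) \<longlonglongrightarrow> 0"
    proof (rule AE_I2)
      fix t :: "real^'n"
      have "(\<lambda>k. cmod (g t) * w k t) \<longlonglongrightarrow> cmod (g t) *
        (real CARD('n) * norm (t - t) * (1 + norm (t - t)) ^ m * schwartz_norm (Suc m) \<phi> * (1 + norm t) ^ m)"
        unfolding w_def by (intro tendsto_intros lim)
      then show "(\<lambda>k. cmod (g t) * w k t) \<longlonglongrightarrow> 0" by simp
    qed
    show "AE t in lborel. norm (cmod (g t) * w k t) \<le> cmod (g t) * (C * (1 + norm t) ^ (2 * m + 1))" for k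
      using wb w0 by (intro AE_I2) (auto intro!: mult_left_mono)
  qed auto
  then have lim0: "(\<lambda>k. LINT t|lborel. cmod (g t) * w k t) \<longlonglongrightarrow> 0" by simp
  show ?thesis
  proof (rule tendsto_sandwich[OF always_eventually always_eventually tendsto_const lim0]; intro allI)
    fix k
    show "0 \<le> schwartz_norm m (\<lambda>x. convolution g \<phi> x - riemann_sum g \<phi> (q k) x)"
      by (intro schwartz_norm_nonneg schwartz_diff convolution_schwartz riemann_sum_schwartz g \<phi>)
    show "schwartz_norm m (\<lambda>x. convolution g \<phi> x - riemann_sum g \<phi> (q k) x) \<le> (LINT t|lborel. cmod (g t) * w k t)"
    proof (rule riemann_sum_error[OF g \<phi> sf wm wb])
      fix t
      show "schwartz_norm m (\<lambda>x. \<phi> (x - t) - \<phi> (x - q k t)) \<le> w k t"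
        using schwartz_norm_shift_shift[OF \<phi>, of m "q k t" t] SW.minus_swap[of "schwartz_norm m" "\<lambda>x. \<phi> (x - t)" "\<lambda>x. \<phi> (x - q k t)"]
        by (simp add: w_def schwartz_shift[OF \<phi>] fun_diff_def)
    qed
  qed
qed

text \<open>Translates vary continuously in every Schwartz norm, and those norms grow polynomially
  in the shift. Continuity makes the scalar integrals below measurable, polynomial growth makes them
  converge.\<close>

lemma shift_functional_continuous:
  fixes \<phi> :: "'n::finite test_fun"
  assumes \<phi>: "\<phi> \<in> schwartz" and L: "clinear_functional_on schwartz L"
    and K: "\<And>f. f \<in> schwartz \<Longrightarrow> cmod (L f) \<le> K * schwartz_norm m f"
  shows "continuous_on S (\<lambda>t. L (\<lambda>x. \<phi> (x - t)))"
    "cmod (L (\<lambda>x. \<phi> (x - t))) \<le> \<bar>K\<bar> * schwartz_norm m \<phi> * (1 + norm t) ^ m"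
proof -
  have K': "cmod (L f) \<le> \<bar>K\<bar> * schwartz_norm m f" if "f \<in> schwartz" for f
    using K[OF that] schwartz_norm_nonneg[OF that, of m] by (smt (verit) abs_ge_self mult_right_mono)
  have sh: "(\<lambda>x. \<phi> (x - t)) \<in> schwartz" for t by (intro schwartz_shift \<phi>)
  have "cmod (L (\<lambda>x. \<phi> (x - t))) \<le> \<bar>K\<bar> * ((1 + norm t) ^ m * schwartz_norm m \<phi>)"
    by (intro order_trans[OF K'[OF sh]] mult_left_mono schwartz_norm_shift \<phi>) simp
  then show "cmod (L (\<lambda>x. \<phi> (x - t))) \<le> \<bar>K\<bar> * schwartz_norm m \<phi> * (1 + norm t) ^ m" by (simp add: mult_ac)
  have "((\<lambda>t. L (\<lambda>x. \<phi> (x - t))) \<longlongrightarrow> L (\<lambda>x. \<phi> (x - s))) (at s within S)" for s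
  proof (rule metric_tendsto_imp_tendsto)
    let ?w = "\<lambda>t. \<bar>K\<bar> * (real CARD('n) * norm (t - s) * (1 + norm (t - s)) ^ m * schwartz_norm (Suc m) \<phi> * (1 + norm s) ^ m)"
    have "(?w \<longlongrightarrow> \<bar>K\<bar> * (real CARD('n) * norm (s - s) * (1 + norm (s - s)) ^ m * schwartz_norm (Suc m) \<phi> * (1 + norm s) ^ m)) (at s within S)"
      by (intro tendsto_intros)
    then show "(?w \<longlongrightarrow> 0) (at s within S)" by simp
    show "\<forall>\<^sub>F t in at s within S. dist (L (\<lambda>x. \<phi> (x - t))) (L (\<lambda>x. \<phi> (x - s))) \<le> dist (?w t) 0"
    proof (rule always_eventually, rule allI)
      fix t
      have "dist (L (\<lambda>x. \<phi> (x - t))) (L (\<lambda>x. \<phi> (x - s))) = cmod (L (\<lambda>x. \<phi> (x - t) - \<phi> (x - s)))"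
        using SW.linear_on_diff[OF L sh sh, of t s] by (simp add: dist_norm fun_diff_def)
      also have "\<dots> \<le> \<bar>K\<bar> * schwartz_norm m (\<lambda>x. \<phi> (x - t) - \<phi> (x - s))" by (intro K' schwartz_diff sh)
      also have "\<dots> \<le> ?w t" by (intro mult_left_mono schwartz_norm_shift_shift \<phi>) simp
      also have "\<dots> \<le> dist (?w t) 0" by simp
      finally show "dist (L (\<lambda>x. \<phi> (x - t))) (L (\<lambda>x. \<phi> (x - s))) \<le> dist (?w t) 0" .
    qed
  qed
  then show "continuous_on S (\<lambda>t. L (\<lambda>x. \<phi> (x - t)))" by (simp add: continuous_on_def)
qed

text \<open>Replaces a vector-valued integral. For Riemann sums the identity is linearity; they
  converge to the convolution in the Schwartz norm that bounds \<open>L\<close>, while the scalar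
  integrals converge by domination.\<close>

theorem functional_convolution:
  fixes g \<phi> :: "'n::finite test_fun"
  assumes g: "g \<in> schwartz" and \<phi>: "\<phi> \<in> schwartz" and L: "clinear_functional_on schwartz L"
    and K: "\<And>f. f \<in> schwartz \<Longrightarrow> cmod (L f) \<le> K * schwartz_norm m f"
  shows "L (convolution g \<phi>) = (LINT t|lborel. g t * L (\<lambda>x. \<phi> (x - t)))"
    "integrable lborel (\<lambda>t. g t * L (\<lambda>x. \<phi> (x - t)))"
proof -
  obtain q where q: "quantizers (q :: nat \<Rightarrow> real^'n \<Rightarrow> real^'n)" using quantizers_exist by blast
  have sf: "simple_function lborel (q k)" and lim: "(\<lambda>k. q k t) \<longlonglongrightarrow> t" and qb: "norm (q k t) \<le> 2 * norm t" for k t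
    using q by (auto simp: quantizers_def)
  have qm [measurable]: "q k \<in> borel_measurable borel" for k
    using borel_measurable_simple_function[OF sf[of k]] by simp
  have sh: "(\<lambda>x. \<phi> (x - t)) \<in> schwartz" for t by (intro schwartz_shift \<phi>)
  define H where "H t = L (\<lambda>x. \<phi> (x - t))" for t
  note cont = shift_functional_continuous[OF \<phi> L K]
  have Hc: "continuous_on UNIV H" unfolding H_def by (rule cont(1))
  define C where "C = \<bar>K\<bar> * schwartz_norm m \<phi>"
  have C: "C \<ge> 0" by (simp add: C_def schwartz_norm_nonneg[OF \<phi>])
  have Hb: "cmod (H t) \<le> C * (1 + norm t) ^ m" for t unfolding H_def C_def by (rule cont(2))
  have [measurable]: "H \<in> borel_measurable borel" using Hc by (rule borel_measurable_continuous_onI)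
  have [measurable]: "g \<in> borel_measurable borel" by (rule schwartz_measurable[OF g])
  have R: "L (riemann_sum g \<phi> (q k)) = (LINT t|lborel. g t * H (q k t))" for k
  proof -
    have "riemann_sum g \<phi> (q k) = (\<Sum>v\<in>range (q k). (\<lambda>x. (LINT t|lborel. g t * indicator (q k -` {v}) t) * \<phi> (x - v)))"
      by (rule ext) (simp add: riemann_sum_def sum_fun_apply)
    then have "L (riemann_sum g \<phi> (q k)) = (\<Sum>v\<in>range (q k). L (\<lambda>x. (LINT t|lborel. g t * indicator (q k -` {v}) t) * \<phi> (x - v)))"
      using SW.linear_on_sum[OF L schwartz_cmult[OF sh]] by simp
    also have "\<dots> = (\<Sum>v\<in>range (q k). (LINT t|lborel. g t * indicator (q k -` {v}) t) * H v)"
      using L sh by (simp add: clinear_functional_on_def H_def)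
    also have "\<dots> = (LINT t|lborel. g t * H (q k t))"
      using simple_function_integral_sum(1)[OF schwartz_integrable[OF g] sf, of k H] by simp
    finally show ?thesis .
  qed
  have dom: "integrable lborel (\<lambda>t. cmod (g t) * (C * 2 ^ m * (1 + norm t) ^ m))"
    using C by (intro schwartz_weighted_integrable[OF g, where B="C * 2 ^ m" and k=m]) auto
  have lim1: "(\<lambda>k. LINT t|lborel. g t * H (q k t)) \<longlonglongrightarrow> (LINT t|lborel. g t * H t)"
  proof (rule integral_dominated_convergence[OF _ _ dom])
    show "AE t in lborel. (\<lambda>k. g t * H (q k t)) \<longlonglongrightarrow> g t * H t"
      using lim Hc by (intro AE_I2 tendsto_mult tendsto_const) (auto intro!: continuous_on_tendsto_compose[OF Hc])
    show "AE t in lborel. norm (g t * H (q k t)) \<le> cmod (g t) * (C * 2 ^ m * (1 + norm t) ^ m)" for k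
    proof (rule AE_I2)
      fix t
      have "1 + norm (q k t) \<le> 2 * (1 + norm t)" using qb[of k t] by simp
      then have "(1 + norm (q k t)) ^ m \<le> 2 ^ m * (1 + norm t) ^ m"
        unfolding power_mult_distrib[symmetric] by (intro power_mono) auto
      then have "cmod (H (q k t)) \<le> C * (2 ^ m * (1 + norm t) ^ m)"
        using Hb[of "q k t"] C by (meson mult_left_mono order_trans)
      then show "norm (g t * H (q k t)) \<le> cmod (g t) * (C * 2 ^ m * (1 + norm t) ^ m)"
        by (simp add: norm_mult mult_left_mono mult.assoc)
    qed
  qed auto
  have lim2: "(\<lambda>k. L (riemann_sum g \<phi> (q k))) \<longlonglongrightarrow> L (convolution g \<phi>)"
  proof (rule metric_tendsto_imp_tendsto)
    have "(\<lambda>k. \<bar>K\<bar> * schwartz_norm m (\<lambda>x. convolution g \<phi> x - riemann_sum g \<phi> (q k) x)) \<longlonglongrightarrow> \<bar>K\<bar> * 0"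
      by (intro tendsto_mult tendsto_const riemann_sum_tendsto[OF g \<phi> q])
    then show "(\<lambda>k. \<bar>K\<bar> * schwartz_norm m (\<lambda>x. convolution g \<phi> x - riemann_sum g \<phi> (q k) x)) \<longlonglongrightarrow> 0" by simp
    show "\<forall>\<^sub>F k in sequentially. dist (L (riemann_sum g \<phi> (q k))) (L (convolution g \<phi>)) \<le>
      dist (\<bar>K\<bar> * schwartz_norm m (\<lambda>x. convolution g \<phi> x - riemann_sum g \<phi> (q k) x)) 0"
    proof (rule always_eventually, rule allI)
      fix k
      let ?d = "\<lambda>x. convolution g \<phi> x - riemann_sum g \<phi> (q k) x"
      note cs = convolution_schwartz[OF g \<phi>] and rs = riemann_sum_schwartz[OF \<phi>, of g "q k"]
      have "dist (L (riemann_sum g \<phi> (q k))) (L (convolution g \<phi>)) = cmod (L ?d)"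
        using SW.linear_on_diff[OF L cs rs] by (simp add: dist_norm norm_minus_commute fun_diff_def)
      also have "\<dots> \<le> K * schwartz_norm m ?d" by (intro K schwartz_diff cs rs)
      also have "\<dots> \<le> dist (\<bar>K\<bar> * schwartz_norm m ?d) 0"
        using schwartz_norm_nonneg[OF schwartz_diff[OF cs rs], of m] by (simp add: abs_mult mult_right_mono)
      finally show "dist (L (riemann_sum g \<phi> (q k))) (L (convolution g \<phi>)) \<le> dist (\<bar>K\<bar> * schwartz_norm m ?d) 0" .
    qed
  qed
  have "(\<lambda>k. LINT t|lborel. g t * H (q k t)) \<longlonglongrightarrow> L (convolution g \<phi>)" using lim2 unfolding R .
  from LIMSEQ_unique[OF this lim1]
  show "L (convolution g \<phi>) = (LINT t|lborel. g t * L (\<lambda>x. \<phi> (x - t)))"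
    by (simp only: H_def)
  have "integrable lborel (\<lambda>t. H t * g t)"
    by (rule integrable_schwartz_mult(1)[OF g _ Hb]) measurable
  then show "integrable lborel (\<lambda>t. g t * L (\<lambda>x. \<phi> (x - t)))"
    unfolding H_def[symmetric] by (simp add: mult.commute)
qed

lemma squeeze_zero:
  fixes f g :: "'a \<Rightarrow> real"
  assumes "\<And>k. 0 \<le> f k" "\<And>k. f k \<le> g k" "(g \<longlongrightarrow> 0) F"
  shows "(f \<longlongrightarrow> 0) F"
  by (rule tendsto_sandwich[OF _ _ tendsto_const assms(3)]) (use assms in auto)

lemma partial_derivs_const: "partial_derivs js (\<lambda>x. c) = (\<lambda>x. if js = [] then c else 0)"
  by (induction js) (simp_all add: partial_derivs_Cons partial_deriv_const)

section \<open>Test functions\<close>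

subsection \<open>A bump function\<close>

text \<open>The recursion comes from differentiating \<open>p (1 / t) * exp (- (1 / t))\<close>,
  which multiplies the exponential by \<open>(p - p') (1 / t) / t\<^sup>2\<close>.\<close>

fun bump_poly :: "nat \<Rightarrow> real poly" where
  "bump_poly 0 = 1"
| "bump_poly (Suc k) = monom 1 2 * (bump_poly k - pderiv (bump_poly k))"

text \<open>The \<open>k\<close>-th derivative of \<open>exp (- 1 / t)\<close>, extended by 0 to \<open>t \<le> 0\<close>.\<close>

definition exp_inv :: "nat \<Rightarrow> real \<Rightarrow> real" where
  "exp_inv k t = (if t \<le> 0 then 0 else poly (bump_poly k) (1 / t) * exp (- (1 / t)))"

lemma poly_times_exp_inv_tendsto:
  "((\<lambda>t. poly p (1 / t) * exp (- (1 / t))) \<longlongrightarrow> (0::real)) (at_right 0)"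
proof -
  have "((\<lambda>s. poly p s * exp (- s)) \<longlongrightarrow> 0) at_top"
  proof (induction p)
    case (pCons a p)
    have "((\<lambda>s. coeff p i * (s ^ Suc i / exp s)) \<longlongrightarrow> coeff p i * 0) at_top" for i
      by (intro tendsto_mult tendsto_const tendsto_power_div_exp_0)
    then have "((\<lambda>s. \<Sum>i\<le>degree p. coeff p i * (s ^ Suc i / exp s)) \<longlongrightarrow> (\<Sum>i\<le>degree p. coeff p i * 0)) at_top"
      by (intro tendsto_sum)
    moreover have "((\<lambda>s. a * (s ^ 0 / exp s)) \<longlongrightarrow> a * 0) at_top"
      by (intro tendsto_mult tendsto_const tendsto_power_div_exp_0)
    ultimately have "((\<lambda>s. a * (s ^ 0 / exp s) + (\<Sum>i\<le>degree p. coeff p i * (s ^ Suc i / exp s))) \<longlongrightarrow> 0) at_top"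
      using tendsto_add by fastforce
    moreover have "a * (s ^ 0 / exp s) + (\<Sum>i\<le>degree p. coeff p i * (s ^ Suc i / exp s)) = poly (pCons a p) s * exp (- s)" for s
      by (simp add: poly_altdef[of p] exp_minus field_simps sum_distrib_left sum_distrib_right sum_divide_distrib)
    ultimately show ?case by simp
  qed simp
  then show ?thesis
    using filterlim_inverse_at_top_right
    by (auto simp: inverse_eq_divide intro: filterlim_compose)
qed

lemma exp_inv_derivative: "(exp_inv k has_real_derivative exp_inv (Suc k) t) (at t)"
proof -
  consider "t < 0" | "t > 0" | "t = 0" by linarith
  then show ?thesis
  proof cases
    case 1
    have "((\<lambda>_. 0) has_real_derivative exp_inv (Suc k) t) (at t)" using 1 by (simp add: exp_inv_def)
    then show ?thesis
      by (rule has_field_derivative_transform_within_open[of _ _ _ "{..<0}"]) (use 1 in \<open>auto simp: exp_inv_def\<close>)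
  next
    case 2
    let ?p = "bump_poly k"
    have "((\<lambda>t. poly ?p (1 / t) * exp (- (1 / t))) has_real_derivative exp_inv (Suc k) t) (at t)"
      using 2 by (auto intro!: derivative_eq_intros DERIV_chain2[OF poly_DERIV]
          simp: exp_inv_def poly_monom power2_eq_square field_simps)
    then show ?thesis
      by (rule has_field_derivative_transform_within_open[of _ _ _ "{0<..}"]) (use 2 in \<open>auto simp: exp_inv_def\<close>)
  next
    case 3
    have "((\<lambda>h. (exp_inv k (0 + h) - exp_inv k 0) / h) \<longlongrightarrow> 0) (at 0)"
    proof (subst filterlim_at_split, rule conjI)
      have "\<forall>\<^sub>F h in at_left 0. 0 = (exp_inv k (0 + h) - exp_inv k 0) / h"
        by (rule eventually_at_leftI[of "-1"]) (auto simp: exp_inv_def)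
      then show "((\<lambda>h. (exp_inv k (0 + h) - exp_inv k 0) / h) \<longlongrightarrow> 0) (at_left 0)"
        by (rule Lim_transform_eventually[OF tendsto_const])
      \<comment> \<open>\<open>pCons 0\<close> multiplies the polynomial by its variable, that is by
        \<open>1 / h\<close>, which absorbs the denominator of the difference quotient.\<close>
      have "\<forall>\<^sub>F h in at_right 0. poly (pCons 0 (bump_poly k)) (1 / h) * exp (- (1 / h)) = (exp_inv k (0 + h) - exp_inv k 0) / h"
        by (rule eventually_at_rightI[of _ 1]) (auto simp: exp_inv_def)
      then show "((\<lambda>h. (exp_inv k (0 + h) - exp_inv k 0) / h) \<longlongrightarrow> 0) (at_right 0)"
        by (rule Lim_transform_eventually[OF poly_times_exp_inv_tendsto])
    qed
    then show ?thesis using 3 by (simp add: DERIV_def exp_inv_def)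
  qed
qed

lemma exp_inv_affine_derivative:
  "((\<lambda>t. c ^ k * exp_inv k (1 + c * t)) has_real_derivative c ^ Suc k * exp_inv (Suc k) (1 + c * t)) (at t)"
  by (auto intro!: derivative_eq_intros DERIV_chain2[OF exp_inv_derivative])

text \<open>In each coordinate the factors are the flat function at \<open>1 + t\<close> and at
  \<open>1 - t\<close>, which confines the support to the unit cube. The powers of
  \<open>- 1\<close> belong to the derivatives of the reflected factor and equal 1 at order
  0.\<close>

definition bump :: "'n::finite test_fun" where
  "bump x = tensor_fun (\<lambda>k t. exp_inv k (1 + t)) (\<lambda>_. 0) x * tensor_fun (\<lambda>k t. (- 1) ^ k * exp_inv k (1 - t)) (\<lambda>_. 0) x"

lemma smooth_bump: "smooth bump"
  unfolding bump_def[abs_def]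
  using exp_inv_affine_derivative[of 1] exp_inv_affine_derivative[of "-1"]
  by (intro smooth_mult tensor_fun_derivs(1)) simp_all

lemma bump_eq:
  "bump x = of_real (\<Prod>i\<in>UNIV. exp_inv 0 (1 + x $ i) * exp_inv 0 (1 - x $ i))"
  by (simp add: bump_def tensor_fun_def prod.distrib)

lemma exp_inv_nonneg: "exp_inv 0 t \<ge> 0"
  by (simp add: exp_inv_def)

lemma bump_nonneg: "bump x = of_real (cmod (bump x))"
  unfolding bump_eq norm_of_real
  by (subst abs_of_nonneg) (auto intro!: prod_nonneg mult_nonneg_nonneg exp_inv_nonneg)

lemma bump_0: "bump 0 \<noteq> 0"
  by (simp add: bump_eq exp_inv_def)

lemma bump_support: "bump x \<noteq> 0 \<Longrightarrow> x \<in> cbox (- 1) 1"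
proof -
  assume "bump x \<noteq> 0"
  then have nz: "exp_inv 0 (1 + x $ i) * exp_inv 0 (1 - x $ i) \<noteq> 0" for i
    unfolding bump_eq of_real_eq_0_iff by (simp add: prod_zero_iff)
  have "- 1 \<le> x $ i \<and> x $ i \<le> 1" for i
    using nz[of i] by (auto simp: exp_inv_def split: if_splits)
  then show ?thesis by (simp add: mem_box_cart)
qed

lemma bump_test_function: "bump \<in> test_functions"
  unfolding test_functions_def using smooth_bump bump_support compact_cbox by blast

subsection \<open>Test functions are dense\<close>

lemma test_functions_partial_deriv:
  assumes "f \<in> test_functions"
  shows "partial_deriv j f \<in> test_functions"
proof -
  obtain K where K: "compact K" "\<And>x. x \<notin> K \<Longrightarrow> f x = 0" and f: "smooth f"
    using assms by (auto simp: test_functions_def)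
  have "partial_deriv j f x = 0" if "x \<notin> K" for x
  proof -
    have "(f has_derivative (\<lambda>_. 0)) (at x)"
      by (rule has_derivative_transform_within_open[of "\<lambda>_. 0" _ _ _ "- K"])
        (use K that compact_imp_closed in \<open>auto simp: open_Compl\<close>)
    from partial_derivI[OF this] show ?thesis by simp
  qed
  then show ?thesis using K f by (auto simp: test_functions_def smooth_partial_deriv)
qed

lemma test_functions_partial_derivs: "f \<in> test_functions \<Longrightarrow> partial_derivs js f \<in> test_functions"
  by (induction js) (auto simp: partial_derivs_Cons test_functions_partial_deriv)

lemma test_functions_bounded:
  fixes f :: "'n::finite test_fun"
  assumes "f \<in> test_functions"
  shows "\<exists>B. \<forall>x. (1 + norm x) ^ k * cmod (f x) \<le> B"
proof -
  obtain K where K: "compact K" "\<And>x. x \<notin> K \<Longrightarrow> f x = 0" and f: "smooth f"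
    using assms by (auto simp: test_functions_def)
  have "continuous_on K (\<lambda>x. (1 + norm x) ^ k * cmod (f x))"
    by (intro continuous_intros smooth_continuous f)
  then have "bounded ((\<lambda>x. (1 + norm x) ^ k * cmod (f x)) ` K)"
    using K(1) compact_continuous_image compact_imp_bounded by blast
  then obtain B where B: "\<And>x. x \<in> K \<Longrightarrow> norm ((1 + norm x) ^ k * cmod (f x)) \<le> B"
    by (auto simp: bounded_iff)
  have "(1 + norm x) ^ k * cmod (f x) \<le> max B 0" for x
    using B[of x] K(2)[of x] by (cases "x \<in> K") auto
  then show ?thesis by blast
qed

lemma test_functions_subset_schwartz: "test_functions \<subseteq> schwartz"
  using test_functions_bounded[OF test_functions_partial_derivs]
  by (intro subsetI schwartzI) (simp_all add: test_functions_def)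

text \<open>A Leibniz rule with a rate. The factors \<open>c k\<close> will be cutoffs minus 1,
  which are small like \<open>1 / (1 + k)\<close> up to a growth \<open>1 + norm x\<close> that the
  decay of \<open>\<phi>\<close> absorbs. Peeling off the innermost derivative gives two products of
  the same kind, so the induction runs over all \<open>\<phi>\<close> and \<open>c\<close>.\<close>

lemma smooth_schwartz_mult_bound:
  fixes c :: "nat \<Rightarrow> 'n::finite test_fun"
  assumes "\<phi> \<in> schwartz" "\<And>k. smooth (c k)"
    and "\<And>js. \<exists>C. \<forall>k x. cmod (partial_derivs js (c k) x) \<le> C * (1 + norm x) / (1 + real k)"
  shows "\<exists>C. \<forall>k x. (1 + norm x) ^ m * cmod (partial_derivs js (\<lambda>x. \<phi> x * c k x) x) \<le> C / (1 + real k)"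
  using assms
proof (induction js arbitrary: \<phi> c rule: rev_induct)
  case Nil
  obtain C where C: "\<And>k x. cmod (c k x) \<le> C * (1 + norm x) / (1 + real k)"
    using Nil(3)[of "[]"] by auto
  have "(1 + norm x) ^ m * cmod (\<phi> x * c k x) \<le> schwartz_norm (Suc m) \<phi> * C / (1 + real k)" for k x
  proof -
    have "0 \<le> C * (1 + norm x) / (1 + real k)" using C[of k x] norm_ge_zero order_trans by blast
    have C0: "C \<ge> 0" using order_trans[OF norm_ge_zero C[of 0 0]] by simp
    have "(1 + norm x) ^ m * cmod (\<phi> x * c k x) \<le> (1 + norm x) ^ m * (cmod (\<phi> x) * (C * (1 + norm x) / (1 + real k)))"
      unfolding norm_mult by (intro mult_left_mono C) auto
    also have "\<dots> = ((1 + norm x) ^ Suc m * cmod (\<phi> x)) * (C / (1 + real k))" by simp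
    also have "\<dots> \<le> schwartz_norm (Suc m) \<phi> * (C / (1 + real k))"
      using C0 by (intro mult_right_mono schwartz_pointwise Nil(1)) auto
    finally show ?thesis by simp
  qed
  then show ?case by auto
next
  case (snoc j js)
  have \<phi>: "smooth \<phi>" using snoc.prems(1) by (rule schwartz_smooth)
  let ?a = "\<lambda>k x. partial_deriv j \<phi> x * c k x" and ?b = "\<lambda>k x. \<phi> x * partial_deriv j (c k) x"
  have sm: "smooth (?a k)" "smooth (?b k)" for k
    using \<phi> snoc.prems(2) by (auto intro: smooth_mult smooth_partial_deriv)
  obtain C1 where C1: "\<And>k x. (1 + norm x) ^ m * cmod (partial_derivs js (?a k) x) \<le> C1 / (1 + real k)"
    using snoc.IH[OF schwartz_partial_deriv(1)[OF snoc.prems(1), of j] snoc.prems(2,3)] by blast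
  have "\<exists>C. \<forall>k x. cmod (partial_derivs ks (partial_deriv j (c k)) x) \<le> C * (1 + norm x) / (1 + real k)" for ks
    using snoc.prems(3)[of "ks @ [j]"] by (simp add: partial_derivs_append partial_derivs_Cons)
  then obtain C2 where C2: "\<And>k x. (1 + norm x) ^ m * cmod (partial_derivs js (?b k) x) \<le> C2 / (1 + real k)"
    using snoc.IH[of \<phi> "\<lambda>k. partial_deriv j (c k)"] snoc.prems(1) smooth_partial_deriv[OF snoc.prems(2)] by blast
  have "(1 + norm x) ^ m * cmod (partial_derivs (js @ [j]) (\<lambda>x. \<phi> x * c k x) x) \<le> (C1 + C2) / (1 + real k)" for k x
  proof -
    have "partial_deriv j (\<lambda>x. \<phi> x * c k x) = (\<lambda>x. ?a k x + ?b k x)"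
      using \<phi> snoc.prems(2) by (intro ext partial_deriv_mult smooth_differentiable)
    then have "partial_derivs (js @ [j]) (\<lambda>x. \<phi> x * c k x) x = partial_derivs js (?a k) x + partial_derivs js (?b k) x"
      by (simp add: partial_derivs_append partial_derivs_Cons partial_derivs_add[OF sm])
    then have "(1 + norm x) ^ m * cmod (partial_derivs (js @ [j]) (\<lambda>x. \<phi> x * c k x) x) \<le>
      (1 + norm x) ^ m * (cmod (partial_derivs js (?a k) x) + cmod (partial_derivs js (?b k) x))"
      by (simp add: norm_triangle_ineq mult_left_mono)
    also have "\<dots> \<le> (C1 + C2) / (1 + real k)"
      using C1[of x k] C2[of x k] by (simp add: distrib_left add_divide_distrib)
    finally show ?thesis .
  qed
  then show ?case by blast
qed

theorem test_functions_dense: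
  fixes \<phi> :: "'n::finite test_fun"
  assumes \<phi>: "\<phi> \<in> schwartz"
  shows "\<exists>\<psi>. (\<forall>k. \<psi> k \<in> test_functions) \<and> (\<forall>m. (\<lambda>k. schwartz_norm m (\<lambda>x. \<psi> k x - \<phi> x)) \<longlonglongrightarrow> 0)"
proof -
  define \<eta> :: "'n test_fun" where "\<eta> = (\<lambda>x. inverse (bump (0 :: real ^ 'n)) * bump x)"
  define e where "e k = 1 / (1 + real k)" for k
  have e: "0 < e k" "e k \<le> 1" for k by (auto simp: e_def)
  have \<eta>s: "smooth \<eta>" unfolding \<eta>_def by (intro smooth_cmult smooth_bump)
  have \<eta>0: "\<eta> 0 = 1" unfolding \<eta>_def by (rule left_inverse[OF bump_0])
  have \<eta>S: "\<eta> \<in> schwartz"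
    unfolding \<eta>_def using bump_test_function test_functions_subset_schwartz by (intro schwartz_cmult) blast
  define c :: "nat \<Rightarrow> 'n test_fun" where "c k = (\<lambda>x. \<eta> (e k *\<^sub>R x + 0) + (- 1))" for k
  have cs: "smooth (c k)" for k unfolding c_def by (rule smooth_add[OF smooth_affine[OF \<eta>s] smooth_const])
  \<comment> \<open>At order zero the rate comes from \<open>\<eta> 0 = 1\<close> and a Lipschitz
    bound, at higher orders from the chain-rule factors \<open>e k\<close>.\<close>
  have "\<exists>C. \<forall>k x. cmod (partial_derivs js (c k) x) \<le> C * (1 + norm x) / (1 + real k)" for js
  proof (cases js)
    case Nil
    have "cmod (c k x) \<le> real CARD('n) * schwartz_norm 1 \<eta> * (1 + norm x) / (1 + real k)" for k x
    proof -
      have "cmod (\<eta> (0 + e k *\<^sub>R x) - \<eta> 0 - (\<Sum>j\<in>UNIV. of_real ((e k *\<^sub>R x) $ j) * 0)) \<le> real CARD('n) * schwartz_norm 1 \<eta> * norm (e k *\<^sub>R x)"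
        by (rule smooth_increment[OF \<eta>s])
          (use order_trans[OF schwartz_pointwise(3)[OF schwartz_partial_deriv(1)[OF \<eta>S]]
              schwartz_partial_deriv(2)[OF \<eta>S, of 0]] in simp)
      also have "\<dots> \<le> real CARD('n) * schwartz_norm 1 \<eta> * ((1 + norm x) * e k)"
        using e[of k] schwartz_norm_nonneg[OF \<eta>S, of 1] by (intro mult_left_mono) (auto simp: algebra_simps)
      finally show ?thesis by (simp add: c_def \<eta>0 e_def)
    qed
    then show ?thesis using Nil by auto
  next
    case (Cons j ks)
    have "cmod (partial_derivs js (c k) x) \<le> schwartz_norm (length js) \<eta> * (1 + norm x) / (1 + real k)" for k x
    proof -
      have "partial_derivs js (\<lambda>x::real^'n. - 1) = (\<lambda>x. 0)"
        by (simp add: Cons partial_derivs_const)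
      then have "partial_derivs js (c k) x = of_real (e k) ^ length js * partial_derivs js \<eta> (e k *\<^sub>R x)"
        unfolding c_def
        using partial_derivs_affine[OF \<eta>s, of js "e k" 0]
        by (subst partial_derivs_add[OF smooth_affine[OF \<eta>s] smooth_const]) simp
      then have "cmod (partial_derivs js (c k) x) = e k ^ length js * cmod (partial_derivs js \<eta> (e k *\<^sub>R x))"
        using e[of k] by (simp add: norm_mult norm_power)
      also have "\<dots> \<le> e k ^ length js * schwartz_norm (length js) \<eta>"
        using schwartz_pointwise(3)[OF schwartz_partial_derivs(1)[OF \<eta>S], of js "e k *\<^sub>R x" 0] schwartz_partial_derivs(2)[OF \<eta>S, of 0 js] e[of k]
        by (intro mult_left_mono) auto
      also have "\<dots> \<le> e k * schwartz_norm (length js) \<eta>"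
        using e[of k] power_decreasing[of 1 "length js" "e k"] Cons
        by (intro mult_right_mono schwartz_norm_nonneg \<eta>S) auto
      also have "\<dots> \<le> e k * schwartz_norm (length js) \<eta> * (1 + norm x)"
        using e[of k] schwartz_norm_nonneg[OF \<eta>S, of "length js"] by (simp add: distrib_left)
      finally show ?thesis by (simp add: e_def mult_ac)
    qed
    then show ?thesis by blast
  qed
  note bound = smooth_schwartz_mult_bound[OF \<phi> cs this]
  define \<psi> where "\<psi> k = (\<lambda>x. \<phi> x * \<eta> (e k *\<^sub>R x + 0))" for k
  have \<psi>T: "\<psi> k \<in> test_functions" for k
      unfolding test_functions_def
    proof (intro CollectI conjI exI[of _ "cbox (- (1 / e k) *\<^sub>R 1) ((1 / e k) *\<^sub>R 1)"] allI impI)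
      show "smooth (\<psi> k)" unfolding \<psi>_def by (rule smooth_mult[OF schwartz_smooth[OF \<phi>] smooth_affine[OF \<eta>s]])
      fix x :: "real^'n" assume x: "x \<notin> cbox (- (1 / e k) *\<^sub>R 1) ((1 / e k) *\<^sub>R 1)"
      have "e k *\<^sub>R x \<notin> cbox (- 1) 1"
        using x e[of k] by (auto simp: mem_box_cart field_simps)
      then have "bump (e k *\<^sub>R x) = 0" using bump_support by blast
      then show "\<psi> k x = 0" by (simp add: \<psi>_def \<eta>_def)
    qed simp
  show ?thesis
  proof (intro exI[of _ \<psi>] conjI allI \<psi>T)
    fix m
    have "\<forall>js. \<exists>C. \<forall>k x. (1 + norm x) ^ m * cmod (partial_derivs js (\<lambda>x. \<phi> x * c k x) x) \<le> C / (1 + real k)"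
      using bound by blast
    then obtain C where C: "\<And>js k x. (1 + norm x) ^ m * cmod (partial_derivs js (\<lambda>x. \<phi> x * c k x) x) \<le> C js / (1 + real k)"
      by metis
    define D where "D = Max (C ` {js :: 'n list. length js \<le> m})"
    have "schwartz_norm m (\<lambda>x. \<psi> k x - \<phi> x) \<le> D * e k" for k
    proof (rule schwartz_norm_le)
      fix js :: "'n list" and x :: "real^'n" assume js: "length js \<le> m"
      have "C js \<le> D" unfolding D_def using js by (intro Max_ge finite_imageI finite_lists_le) auto
      then have "C js / (1 + real k) \<le> D * e k" by (simp add: e_def divide_right_mono)
      moreover have "(\<lambda>x. \<psi> k x - \<phi> x) = (\<lambda>x. \<phi> x * c k x)" by (simp add: \<psi>_def c_def algebra_simps)
      ultimately show "(1 + norm x) ^ m * cmod (partial_derivs js (\<lambda>x. \<psi> k x - \<phi> x) x) \<le> D * e k"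
        using C[of x js k] by simp
    qed
    moreover have "(\<lambda>k. D * e k) \<longlonglongrightarrow> D * 0"
      unfolding e_def by (intro tendsto_mult tendsto_const) (use LIMSEQ_inverse_real_of_nat in \<open>simp add: inverse_eq_divide\<close>)
    moreover have "0 \<le> schwartz_norm m (\<lambda>x. \<psi> k x - \<phi> x)" for k
    proof -
      have "\<psi> k \<in> schwartz"
        using \<psi>T test_functions_subset_schwartz by blast
      then show ?thesis by (intro schwartz_norm_nonneg schwartz_diff \<phi>)
    qed
    ultimately show "(\<lambda>k. schwartz_norm m (\<lambda>x. \<psi> k x - \<phi> x)) \<longlonglongrightarrow> 0"
      by (intro squeeze_zero[of "\<lambda>k. schwartz_norm m (\<lambda>x. \<psi> k x - \<phi> x)" "\<lambda>k. D * e k"]) simp_all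
  qed
qed

section \<open>The kernel sech\<close>

text \<open>Rests on \<open>(1 + x / k) ^ k \<le> exp x\<close>, after \<open>1 + x\<close> has been
  compared with \<open>1 + x / k\<close>.\<close>

lemma power_le_exp:
  fixes x :: real
  assumes "0 \<le> x"
  shows "(1 + x) ^ k \<le> (1 + real k) ^ k * exp x"
proof (cases "k = 0")
  case False
  have "1 + x \<le> (1 + real k) * (1 + x / real k)"
    using False assms by (simp add: field_simps)
  then have "(1 + x) ^ k \<le> ((1 + real k) * (1 + x / real k)) ^ k" using assms by (intro power_mono) auto
  also have "\<dots> = (1 + real k) ^ k * (1 + x / real k) ^ k" by (rule power_mult_distrib)
  also have "\<dots> \<le> (1 + real k) ^ k * exp x"
    using False assms by (intro mult_left_mono exp_ge_one_plus_x_over_n_power_n) (auto intro: order_trans[of _ 0])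
  finally show ?thesis .
qed (use assms in simp)

fun sech_poly :: "nat \<Rightarrow> real poly" where
  "sech_poly 0 = 1"
| "sech_poly (Suc k) = pderiv (sech_poly k) * (1 - monom 1 2) - monom 1 1 * sech_poly k"

text \<open>The \<open>k\<close>-th derivative of \<open>1 / cosh\<close> is a polynomial in \<open>tanh\<close> times \<open>1 / cosh\<close>.\<close>

definition sech_deriv :: "nat \<Rightarrow> real \<Rightarrow> real" where
  "sech_deriv k t = poly (sech_poly k) (tanh t) / cosh t"

lemma sech_deriv_derivative: "(sech_deriv k has_real_derivative sech_deriv (Suc k) t) (at t)"
proof -
  have c: "cosh t \<noteq> 0" for t :: real using cosh_real_pos[of t] by simp
  have p: "((\<lambda>t. poly (sech_poly k) (tanh t)) has_real_derivative
      poly (pderiv (sech_poly k)) (tanh t) * (1 - (tanh t)\<^sup>2)) (at t)"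
    by (rule DERIV_chain2[OF poly_DERIV]) (use c in \<open>auto intro!: derivative_eq_intros\<close>)
  have "((\<lambda>t. poly (sech_poly k) (tanh t) / cosh t) has_real_derivative
     (poly (pderiv (sech_poly k)) (tanh t) * (1 - (tanh t)\<^sup>2) * cosh t - poly (sech_poly k) (tanh t) * sinh t) / (cosh t * cosh t)) (at t)"
    by (rule DERIV_divide[OF p _ c]) (auto intro!: derivative_eq_intros)
  moreover have "(poly (pderiv (sech_poly k)) (tanh t) * (1 - (tanh t)\<^sup>2) * cosh t - poly (sech_poly k) (tanh t) * sinh t) / (cosh t * cosh t)
      = sech_deriv (Suc k) t"
    using c[of t] by (simp add: sech_deriv_def poly_monom tanh_def diff_divide_distrib)
  ultimately show ?thesis unfolding sech_deriv_def[abs_def] by simp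
qed

lemma sech_deriv_bound: "\<exists>C>0. \<forall>t. \<bar>sech_deriv k t\<bar> \<le> C * exp (- \<bar>t\<bar>)"
proof -
  have "bounded (poly (sech_poly k) ` {-1..1})"
    by (intro compact_imp_bounded compact_continuous_image continuous_intros compact_Icc)
  then obtain B where B: "\<And>u. u \<in> {-1..1} \<Longrightarrow> \<bar>poly (sech_poly k) u\<bar> \<le> B"
    unfolding bounded_iff real_norm_def by blast
  have "\<bar>sech_deriv k t\<bar> \<le> (2 * \<bar>B\<bar> + 1) * exp (- \<bar>t\<bar>)" for t
  proof -
    have "tanh t \<in> {-1..1}" using tanh_real_lt_1[of t] tanh_real_gt_neg1[of t] by (simp add: less_imp_le)
    then have 1: "\<bar>poly (sech_poly k) (tanh t)\<bar> \<le> \<bar>B\<bar>" using B[of "tanh t"] by linarith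
    have "cosh t = cosh \<bar>t\<bar>" by (simp add: abs_if)
    also have "\<dots> \<ge> exp \<bar>t\<bar> / 2" by (simp add: cosh_def)
    finally have c: "cosh t \<ge> exp \<bar>t\<bar> / 2" .
    have "\<bar>sech_deriv k t\<bar> = \<bar>poly (sech_poly k) (tanh t)\<bar> / cosh t"
      using cosh_real_pos[of t] by (simp add: sech_deriv_def)
    also have "\<dots> \<le> \<bar>B\<bar> / (exp \<bar>t\<bar> / 2)"
      using c 1 by (intro frac_le) auto
    also have "\<dots> = 2 * \<bar>B\<bar> * exp (- \<bar>t\<bar>)" by (simp add: exp_minus field_simps)
    also have "\<dots> \<le> (2 * \<bar>B\<bar> + 1) * exp (- \<bar>t\<bar>)" by (intro mult_right_mono) auto
    finally show ?thesis .
  qed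
  then show ?thesis by (intro exI[of _ "2 * \<bar>B\<bar> + 1"]) auto
qed

text \<open>In each coordinate, \<open>1 / (4 cosh (\<pi> t / 2))\<close> is the density of harmonic
  measure on one boundary line of the strip of half-width 1, seen from its centre; each of the two
  lines has mass 1/2. The powers of \<open>pi / 2\<close> are the chain-rule factors of the
  derivatives.\<close>

definition unit_kernel :: "'n::finite test_fun" where
  "unit_kernel = tensor_fun (\<lambda>k t. (1 / 4) * (pi / 2) ^ k * sech_deriv k (pi / 2 * t)) (\<lambda>_. 0)"

lemma unit_kernel_schwartz: "unit_kernel \<in> (schwartz :: 'n::finite test_fun set)"
proof (rule schwartzI)
  define q where "q = (\<lambda>k t. (1 / 4) * (pi / 2) ^ k * sech_deriv k (pi / 2 * t))"
  have q: "(q k has_real_derivative q (Suc k) t) (at t)" for k t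
    unfolding q_def by (auto intro!: derivative_eq_intros DERIV_chain2[OF sech_deriv_derivative])
  note T = tensor_fun_derivs[of q, OF q]
  show "smooth (unit_kernel :: 'n test_fun)" unfolding unit_kernel_def q_def[symmetric] by (rule T)
  fix js :: "'n list" and k :: nat
  obtain \<beta> where \<beta>: "partial_derivs js unit_kernel = (tensor_fun q \<beta> :: 'n test_fun)"
    using T(2)[of js "\<lambda>_. 0"] unfolding unit_kernel_def q_def[symmetric] by blast
  have "\<exists>C>0. \<forall>t. \<bar>q l t\<bar> \<le> C * exp (- \<bar>t\<bar>)" for l
  proof -
    obtain C where C: "C > 0" "\<And>t. \<bar>sech_deriv l t\<bar> \<le> C * exp (- \<bar>t\<bar>)" using sech_deriv_bound by blast
    have "\<bar>q l t\<bar> \<le> ((1 / 4) * (pi / 2) ^ l * C) * exp (- \<bar>t\<bar>)" for t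
    proof -
      have "1 * \<bar>t\<bar> \<le> pi / 2 * \<bar>t\<bar>" using pi_ge_two by (intro mult_right_mono) auto
      then have "C * exp (- \<bar>pi / 2 * t\<bar>) \<le> C * exp (- \<bar>t\<bar>)" using C by (simp add: abs_mult)
      then have "\<bar>sech_deriv l (pi / 2 * t)\<bar> \<le> C * exp (- \<bar>t\<bar>)" using C(2)[of "pi / 2 * t"] by linarith
      then have "(1 / 4) * (pi / 2) ^ l * \<bar>sech_deriv l (pi / 2 * t)\<bar> \<le> (1 / 4) * (pi / 2) ^ l * (C * exp (- \<bar>t\<bar>))"
        by (intro mult_left_mono) auto
      then show ?thesis by (simp add: q_def abs_mult)
    qed
    then show ?thesis using C by (intro exI[of _ "(1 / 4) * (pi / 2) ^ l * C"]) auto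
  qed
  then obtain C where C: "\<And>l. C l > 0" "\<And>l t. \<bar>q l t\<bar> \<le> C l * exp (- \<bar>t\<bar>)" by metis
  define D where "D = (\<Prod>i\<in>UNIV. C (\<beta> i))"
  have D: "D > 0" unfolding D_def using C by (intro prod_pos) auto
  have "(1 + norm x) ^ k * cmod (partial_derivs js unit_kernel x) \<le> (1 + real k) ^ k * D" for x :: "real^'n"
  proof -
    have "cmod (tensor_fun q \<beta> x) \<le> (\<Prod>i\<in>UNIV. C (\<beta> i) * exp (- \<bar>x $ i\<bar>))"
      unfolding tensor_fun_def prod_norm[symmetric] norm_of_real by (intro prod_mono) (auto intro: C)
    also have "\<dots> = D * exp (- (\<Sum>i\<in>UNIV. \<bar>x $ i\<bar>))"
      by (simp add: prod.distrib D_def exp_sum sum_negf[symmetric])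
    also have "\<dots> \<le> D * exp (- norm x)" using norm_le_l1_cart[of x] D by simp
    finally have 1: "cmod (partial_derivs js unit_kernel x) \<le> D * exp (- norm x)" unfolding \<beta> .
    have 2: "(1 + norm x) ^ k \<le> (1 + real k) ^ k * exp (norm x)" by (rule power_le_exp) simp
    have "(1 + norm x) ^ k * cmod (partial_derivs js unit_kernel x) \<le> ((1 + real k) ^ k * exp (norm x)) * (D * exp (- norm x))"
      using 1 2 D by (intro mult_mono) auto
    also have "\<dots> = (1 + real k) ^ k * D" by (simp add: exp_minus field_simps)
    finally show ?thesis .
  qed
  then show "\<exists>B. \<forall>x. (1 + norm x) ^ k * cmod (partial_derivs js (unit_kernel :: 'n test_fun) x) \<le> B" by blast
qed

definition sech_kernel :: "real \<Rightarrow> 'n::finite test_fun" where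
  "sech_kernel a = (\<lambda>x. of_real ((1 / a) ^ CARD('n)) * unit_kernel ((1 / a) *\<^sub>R x))"

lemma sech_kernel_schwartz: "a > 0 \<Longrightarrow> sech_kernel a \<in> schwartz"
  using schwartz_affine[OF unit_kernel_schwartz, of "1 / a" 0] unfolding sech_kernel_def
  by (intro schwartz_cmult) simp

lemma sech_kernel_eq:
  "sech_kernel a x = (\<Prod>i\<in>UNIV. of_real (1 / (4 * a) / cosh (pi / (2 * a) * (x $ i))))"
  for x :: "real ^ 'n::finite"
proof -
  have "sech_kernel a x = (\<Prod>i\<in>(UNIV::'n set). of_real (1 / a)) * (\<Prod>i\<in>UNIV. of_real (1 / 4 / cosh (pi / 2 * ((1 / a) * x $ i))))"
    by (simp add: sech_kernel_def unit_kernel_def tensor_fun_def sech_deriv_def mult.commute[of a 2])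
  also have "\<dots> = (\<Prod>i\<in>UNIV. of_real (1 / a) * of_real (1 / 4 / cosh (pi / 2 * ((1 / a) * x $ i))))"
    by (rule prod.distrib[symmetric])
  also have "\<dots> = (\<Prod>i\<in>UNIV. of_real (1 / (4 * a) / cosh (pi / (2 * a) * (x $ i))))"
    by (intro prod.cong refl) (simp add: mult.commute)
  finally show ?thesis .
qed

lemma sech_kernel_even: "sech_kernel a (- x) = sech_kernel a x"
  by (simp add: sech_kernel_eq)

text \<open>Derivatives of the dilated kernel produce powers of \<open>1 / a\<close>. The decay is
  available in \<open>x / a\<close>, and since \<open>a \<le> A\<close> with
  \<open>1 \<le> A\<close>, the weight of \<open>x\<close> is at most \<open>A\<close> times the
  weight of \<open>x / a\<close>.\<close>

lemma sech_kernel_bound: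
  fixes x :: "real ^ 'n::finite"
  assumes a: "0 < a" "a \<le> A" and A: "1 \<le> A"
  shows "cmod (partial_derivs js (sech_kernel a) x) \<le>
    A ^ m * schwartz_norm (m + length js) (unit_kernel :: 'n test_fun) * (1 / a) ^ (CARD('n) + length js) / (1 + norm x) ^ m"
proof -
  let ?u = "unit_kernel :: 'n test_fun"
  have us: "smooth ?u" by (intro schwartz_smooth unit_kernel_schwartz)
  have us': "smooth (\<lambda>x. ?u ((1 / a) *\<^sub>R x))" using smooth_affine[OF us, of "1 / a" 0] by simp
  have "partial_derivs js (sech_kernel a) x = of_real ((1 / a) ^ CARD('n)) * (of_real (1 / a) ^ length js * partial_derivs js ?u ((1 / a) *\<^sub>R x))"
    unfolding sech_kernel_def using partial_derivs_affine[OF us, of js "1 / a" 0]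
    by (simp add: partial_derivs_cmult[OF us'])
  then have "cmod (partial_derivs js (sech_kernel a) x) = (1 / a) ^ (CARD('n) + length js) * cmod (partial_derivs js ?u ((1 / a) *\<^sub>R x))"
    using a by (simp add: norm_mult norm_power power_add norm_divide power_divide)
  also have "\<dots> \<le> (1 / a) ^ (CARD('n) + length js) * (A ^ m * schwartz_norm (m + length js) ?u / (1 + norm x) ^ m)"
  proof (rule mult_left_mono)
    let ?y = "(1 / a) *\<^sub>R x"
    have "a * norm ?y \<le> A * norm ?y" using a by (intro mult_right_mono) auto
    then have "1 + norm x \<le> A * (1 + norm ?y)" using a A by (simp add: distrib_left)
    then have "(1 + norm x) ^ m \<le> A ^ m * (1 + norm ?y) ^ m"
      unfolding power_mult_distrib[symmetric] by (intro power_mono) auto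
    then have "(1 + norm x) ^ m * cmod (partial_derivs js ?u ?y) \<le> (A ^ m * (1 + norm ?y) ^ m) * cmod (partial_derivs js ?u ?y)"
      by (rule mult_right_mono) simp
    also have "\<dots> = A ^ m * ((1 + norm ?y) ^ m * cmod (partial_derivs js ?u ?y))" by simp
    also have "\<dots> \<le> A ^ m * schwartz_norm m (partial_derivs js ?u)"
      using A by (intro mult_left_mono schwartz_pointwise schwartz_partial_derivs unit_kernel_schwartz) auto
    also have "\<dots> \<le> A ^ m * schwartz_norm (m + length js) ?u"
      using A by (intro mult_left_mono schwartz_partial_derivs unit_kernel_schwartz) auto
    finally show "cmod (partial_derivs js ?u ?y) \<le> A ^ m * schwartz_norm (m + length js) ?u / (1 + norm x) ^ m"
      by (simp add: pos_le_divide_eq mult.commute add_pos_nonneg)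
  qed (use a in auto)
  finally show ?thesis by (simp add: mult_ac)
qed

section \<open>Reproducing formula in a strip\<close>

text \<open>Off the real axis one of the two exponentials in \<open>sin\<close> dominates the other.
  The resulting growth makes the horizontal sides of the long rectangles negligible.\<close>

lemma norm_sin_ge: "(exp \<bar>Im z\<bar> - 1) / 2 \<le> cmod (sin z)"
proof -
  have 1: "cmod (exp (\<i> * z)) = exp (- Im z)" "cmod (exp (- (\<i> * z))) = exp (Im z)"
    by (simp_all add: norm_exp_eq_Re)
  have "exp \<bar>Im z\<bar> - 1 \<le> \<bar>exp (- Im z) - exp (Im z)\<bar>"
    by (cases "Im z \<ge> 0") (auto simp: abs_if not_le)
  also have "\<dots> \<le> cmod (exp (\<i> * z) - exp (- (\<i> * z)))"
    using norm_triangle_ineq3[of "exp (\<i> * z)" "exp (- (\<i> * z))"] unfolding 1 .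
  also have "\<dots> = 2 * cmod (sin z)"
    by (simp add: sin_exp_eq norm_divide norm_mult)
  finally show ?thesis by simp
qed

lemma sin_zero_strip:
  assumes c: "c > 0" and z: "\<bar>Re z\<bar> < pi / c" and 0: "sin (of_real c * z) = 0"
  shows "z = 0"
proof -
  obtain n :: int where n: "of_real c * z = of_real (of_int n * pi)"
    using 0 by (auto simp: sin_eq_0)
  have "c * Re z = of_int n * pi" "c * Im z = 0"
    using arg_cong[OF n, of Re] arg_cong[OF n, of Im] by simp_all
  moreover have "\<bar>c * Re z\<bar> < pi" using z c by (simp add: abs_mult field_simps)
  ultimately have "\<bar>of_int n * pi\<bar> < 1 * pi" "Im z = 0" using c by auto
  then have "\<bar>of_int n :: real\<bar> < 1" by (simp add: abs_mult)
  then have "n = 0" by linarith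
  with n c show "z = 0" by simp
qed


definition strip_kernel :: "real \<Rightarrow> real \<Rightarrow> real" where
  "strip_kernel a s = 1 / (4 * a) / cosh (pi / (2 * a) * s)"

lemma strip_kernel_nonneg: "a > 0 \<Longrightarrow> 0 \<le> strip_kernel a s"
  by (simp add: strip_kernel_def)

lemma strip_kernel_measurable [measurable]: "strip_kernel a \<in> borel_measurable borel"
proof -
  have "cosh t \<noteq> 0" for t :: real using cosh_real_pos[of t] by simp
  then show ?thesis
    unfolding strip_kernel_def[abs_def] by (intro borel_measurable_continuous_onI continuous_intros) auto
qed

text \<open>One constant for two purposes: the first estimate gives integrability against
  polynomials, the second is used on the horizontal sides of the rectangles.\<close>

lemma strip_kernel_bound:
  assumes "a > 0"
  obtains D where "D > 0" "\<And>s. strip_kernel a s * (1 + \<bar>s\<bar>) ^ k \<le> D"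
    "\<And>s. (1 + \<bar>s\<bar>) ^ k \<le> D * exp (pi / (2 * a) * \<bar>s\<bar>)"
proof -
  define c where "c = pi / (2 * a)"
  have c: "c > 0" using assms by (simp add: c_def)
  define D where "D = (1 + 1 / c) ^ k * (1 + real k) ^ k"
  have D: "D > 0" unfolding D_def using c by (intro mult_pos_pos zero_less_power add_pos_nonneg) auto
  have 1: "(1 + \<bar>s\<bar>) ^ k \<le> D * exp (c * \<bar>s\<bar>)" for s
  proof -
    have "1 + \<bar>s\<bar> \<le> (1 + 1 / c) * (1 + c * \<bar>s\<bar>)" using c by (simp add: field_simps)
    then have "(1 + \<bar>s\<bar>) ^ k \<le> (1 + 1 / c) ^ k * (1 + c * \<bar>s\<bar>) ^ k"
      unfolding power_mult_distrib[symmetric] by (intro power_mono) auto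
    also have "\<dots> \<le> (1 + 1 / c) ^ k * ((1 + real k) ^ k * exp (c * \<bar>s\<bar>))"
      using c by (intro mult_left_mono power_le_exp) auto
    finally show ?thesis by (simp add: D_def mult.assoc)
  qed
  have 2: "strip_kernel a s * (1 + \<bar>s\<bar>) ^ k \<le> D / (2 * a)" for s
  proof -
    have "cosh (c * s) = cosh (\<bar>c * s\<bar>)" by (simp add: abs_if)
    also have "\<dots> \<ge> exp (\<bar>c * s\<bar>) / 2" by (simp add: cosh_def)
    finally have ch: "exp (c * \<bar>s\<bar>) \<le> 2 * cosh (c * s)" using c by (simp add: abs_mult)
    have "(1 + \<bar>s\<bar>) ^ k \<le> D * (2 * cosh (c * s))"
      using 1[of s] mult_left_mono[OF ch less_imp_le[OF D]] by linarith
    then have "(1 + \<bar>s\<bar>) ^ k / cosh (c * s) \<le> 2 * D"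
      using cosh_real_pos[of "c * s"] by (simp add: pos_divide_le_eq mult_ac)
    then have "1 / (4 * a) * ((1 + \<bar>s\<bar>) ^ k / cosh (c * s)) \<le> 1 / (4 * a) * (2 * D)"
      using assms by (intro mult_left_mono) auto
    then show ?thesis using assms by (simp add: strip_kernel_def c_def field_simps)
  qed
  show ?thesis
  proof (rule that[of "max D (D / (2 * a))"])
    show "strip_kernel a s * (1 + \<bar>s\<bar>) ^ k \<le> max D (D / (2 * a))" for s using 2[of s] by linarith
    show "(1 + \<bar>s\<bar>) ^ k \<le> max D (D / (2 * a)) * exp (pi / (2 * a) * \<bar>s\<bar>)" for s
      using 1[of s] by (rule order_trans) (simp add: c_def)
  qed (use D in simp)
qed

lemma strip_kernel_integrable:
  assumes "a > 0"
  shows "integrable lborel (\<lambda>s. strip_kernel a s * (1 + \<bar>s\<bar>) ^ k)"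
proof -
  obtain D where D: "D > 0" "\<And>s. strip_kernel a s * (1 + \<bar>s\<bar>) ^ (k + 3) \<le> D"
    using strip_kernel_bound[OF assms, of "k + 3"] by metis
  have I: "integrable lborel (\<lambda>s::real. D * (1 / (1 + norm s) ^ 3))"
    using integrable_weight_euclidean[where 'a=real] by (intro integrable_mult_right) (simp add: numeral_3_eq_3)
  show ?thesis
  proof (rule Bochner_Integration.integrable_bound[OF I])
    show "AE s in lborel. norm (strip_kernel a s * (1 + \<bar>s\<bar>) ^ k) \<le> norm (D * (1 / (1 + norm s) ^ 3))"
    proof (rule AE_I2)
      fix s :: real
      have "strip_kernel a s * (1 + \<bar>s\<bar>) ^ k * (1 + \<bar>s\<bar>) ^ 3 \<le> D"
        using D(2)[of s] by (simp add: power_add mult.assoc)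
      then have "strip_kernel a s * (1 + \<bar>s\<bar>) ^ k \<le> D / (1 + \<bar>s\<bar>) ^ 3"
        by (subst pos_le_divide_eq) auto
      then show "norm (strip_kernel a s * (1 + \<bar>s\<bar>) ^ k) \<le> norm (D * (1 / (1 + norm s) ^ 3))"
        using D(1) strip_kernel_nonneg[OF assms, of s] by (simp add: abs_mult)
    qed
  qed measurable
qed

text \<open>The residue theorem on long rectangles, applied to the kernel \<open>1 / sin\<close> with its pole at 0.\<close>

lemma vertical_strip_formula:
  fixes \<Psi> :: "complex \<Rightarrow> complex"
  assumes a: "0 < a" "a < d" and hol: "\<Psi> holomorphic_on {z. \<bar>Re z\<bar> < d}"
    and B: "\<And>z. \<bar>Re z\<bar> \<le> a \<Longrightarrow> cmod (\<Psi> z) \<le> B * (1 + \<bar>Im z\<bar>) ^ m"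
  shows "\<Psi> 0 = (LINT s|lborel. of_real (strip_kernel a s) * (\<Psi> (Complex a s) + \<Psi> (Complex (- a) s)))"
proof -
  define c where "c = pi / (2 * a)"
  have c: "c > 0" "c * a = pi / 2" using a by (simp_all add: c_def)
  have c': "c = 2 * pi * (1 / (4 * a))" by (simp add: c_def)
  have B0: "0 \<le> B" using order_trans[OF norm_ge_zero B[of 0]] a by simp
  \<comment> \<open>Inside the domain of \<open>\<Psi>\<close> and short of the next zeros
    \<open>\<plusminus>2 * a\<close> of \<open>sin (c * z)\<close>, so that 0 is the only
    pole.\<close>
  define S where "S = {z. \<bar>Re z\<bar> < min d (2 * a)}"
  have S_eq: "S = {z. - min d (2 * a) < Re z} \<inter> {z. Re z < min d (2 * a)}" by (auto simp: S_def)
  have S: "open S" "convex S" "0 \<in> S"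
  proof -
    show "open S" unfolding S_eq by (intro open_Int open_halfspace_Re_gt open_halfspace_Re_lt)
    show "convex S" unfolding S_eq by (intro convex_Int convex_halfspace_Re_gt convex_halfspace_Re_lt)
    show "0 \<in> S" using a by (simp add: S_def)
  qed
  \<comment> \<open>This is \<open>sin (c * z) / z\<close> with its removable singularity filled in.
    Cauchy's formula for \<open>\<Psi> / k\<close> at 0 then plays the role of the residue of
    \<open>\<Psi> / sin\<close>.\<close>
  define k where "k z = (if z = 0 then deriv (\<lambda>z. sin (of_real c * z)) 0 else (sin (of_real c * z) - sin (of_real c * 0)) / (z - 0))" for z :: complex
  have kh: "k holomorphic_on S"
    unfolding k_def[abs_def] by (rule pole_lemma_open) (auto intro!: holomorphic_intros S)
  have k0: "k 0 = of_real c"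
  proof -
    have "((\<lambda>z::complex. sin (of_real c * z)) has_field_derivative of_real c) (at 0)"
      by (auto intro!: derivative_eq_intros)
    then show ?thesis by (simp add: k_def DERIV_imp_deriv)
  qed
  have kn: "k z \<noteq> 0" if "z \<in> S" for z
  proof (cases "z = 0")
    case False
    have "sin (of_real c * z) \<noteq> 0"
      using sin_zero_strip[OF c(1), of z] that False a by (auto simp: S_def c_def)
    then show ?thesis using False by (simp add: k_def)
  qed (use k0 c in simp)
  define f where "f z = \<Psi> z / k z" for z
  have fh: "f holomorphic_on S"
    unfolding f_def by (intro holomorphic_intros kh holomorphic_on_subset[OF hol] kn) (auto simp: S_def)
  define H where "H z = \<Psi> z / sin (of_real c * z)" for z
  have H_eq: "f z / (z - 0) = H z" if "z \<noteq> 0" for z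
    using that by (simp add: f_def H_def k_def)
  define I where "I R = integral {- R..R} (\<lambda>s. H (Complex a s)) + integral {- R..R} (\<lambda>s. - H (Complex (- a) s))" for R
  \<comment> \<open>Two horizontal sides of length \<open>2 * a\<close>, with the polynomial bound
    of \<open>\<Psi>\<close> in the numerator and the lower bound for the sine in the
    denominator.\<close>
  define M where "M R = 2 * (B * (1 + R) ^ m * 2 / (exp (c * R) - 1) * (2 * a))" for R
  have rect: "cmod (2 * pi * \<i> * (\<Psi> 0 / of_real c) - \<i> * I R) \<le> M R" if R: "R > 0" for R
  proof -
    define z1 z2 z3 z4 where "z1 = Complex (- a) (- R)" and "z2 = Complex a (- R)" and "z3 = Complex a R" and "z4 = Complex (- a) R"
    have rp: "rectpath z1 z3 = linepath z1 z2 +++ linepath z2 z3 +++ linepath z3 z4 +++ linepath z4 z1"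
      by (simp add: rectpath_def Let_def z1_def z2_def z3_def z4_def)
    have pi_rect: "path_image (rectpath z1 z3) \<subseteq> S - {0}"
      using R a by (subst path_image_rectpath) (auto simp: z1_def z3_def S_def complex_eq_iff)
    have "((\<lambda>z. f z / (z - 0)) has_contour_integral (2 * pi * \<i> * winding_number (rectpath z1 z3) 0 * f 0)) (rectpath z1 z3)"
      using S pi_rect by (intro Cauchy_integral_formula_convex_simple[OF S(2) fh]) (auto simp: interior_open)
    moreover have "winding_number (rectpath z1 z3) 0 = 1"
      using R a by (intro winding_number_rectpath) (auto simp: in_box_complex_iff z1_def z3_def)
    ultimately have "((\<lambda>z. f z / (z - 0)) has_contour_integral (2 * pi * \<i> * (\<Psi> 0 / of_real c))) (rectpath z1 z3)"
      by (simp add: f_def k0)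
    then have tot: "(H has_contour_integral (2 * pi * \<i> * (\<Psi> 0 / of_real c))) (rectpath z1 z3)"
      by (rule has_contour_integral_eq) (use pi_rect H_eq in auto)
    have int: "H contour_integrable_on linepath z1 z2" "H contour_integrable_on linepath z2 z3"
      "H contour_integrable_on linepath z3 z4" "H contour_integrable_on linepath z4 z1"
      using contour_integrable_joinD1[of H] contour_integrable_joinD2[of H] tot
      unfolding rp contour_integrable_on_def by (metis valid_path_join valid_path_linepath pathfinish_linepath pathstart_linepath pathstart_join)+
    have "2 * pi * \<i> * (\<Psi> 0 / of_real c) = contour_integral (rectpath z1 z3) H"
      using contour_integral_unique[OF tot] by simp
    also have "\<dots> = contour_integral (linepath z1 z2) H + (contour_integral (linepath z2 z3) H +
        (contour_integral (linepath z3 z4) H + contour_integral (linepath z4 z1) H))"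
      unfolding rp using int by (simp add: contour_integrable_join)
    finally have sum: "2 * pi * \<i> * (\<Psi> 0 / of_real c) = contour_integral (linepath z1 z2) H + (contour_integral (linepath z2 z3) H +
        (contour_integral (linepath z3 z4) H + contour_integral (linepath z4 z1) H))" .
    have right: "contour_integral (linepath z2 z3) H = \<i> * integral {- R..R} (\<lambda>s. H (Complex a s))"
      using R by (intro contour_integral_linepath_same_Re) (auto simp: z2_def z3_def)
    have "contour_integral (linepath z4 z1) H = - contour_integral (linepath z1 z4) H"
      using contour_integral_reversepath[of "linepath z1 z4" H] by simp
    also have "contour_integral (linepath z1 z4) H = \<i> * integral {- R..R} (\<lambda>s. H (Complex (- a) s))"
      using R by (intro contour_integral_linepath_same_Re) (auto simp: z1_def z4_def)
    finally have left: "contour_integral (linepath z4 z1) H = \<i> * integral {- R..R} (\<lambda>s. - H (Complex (- a) s))" by simp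
    have eR: "exp (c * R) - 1 > 0" using R c by simp
    have Hb: "cmod (H z) \<le> B * (1 + R) ^ m * 2 / (exp (c * R) - 1)" if "\<bar>Re z\<bar> \<le> a" "\<bar>Im z\<bar> = R" for z
    proof -
      have s: "(exp (c * R) - 1) / 2 \<le> cmod (sin (of_real c * z))"
        using norm_sin_ge[of "of_real c * z"] that c by (simp add: abs_mult)
      have "cmod (H z) = cmod (\<Psi> z) / cmod (sin (of_real c * z))" by (simp add: H_def norm_divide)
      also have "\<dots> \<le> (B * (1 + R) ^ m) / ((exp (c * R) - 1) / 2)"
        using B[OF that(1)] that(2) s eR by (intro frac_le) (auto intro: order_trans[OF norm_ge_zero])
      finally show ?thesis by simp
    qed
    have bnn: "0 \<le> B * (1 + R) ^ m * 2 / (exp (c * R) - 1)" using B0 R eR by simp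
    have bot: "cmod (contour_integral (linepath z1 z2) H) \<le> B * (1 + R) ^ m * 2 / (exp (c * R) - 1) * (2 * a)"
    proof -
      have "norm (z2 - z1) = 2 * a" using a by (simp add: z1_def z2_def cmod_def real_sqrt_mult)
      moreover have "cmod (H z) \<le> B * (1 + R) ^ m * 2 / (exp (c * R) - 1)" if "z \<in> closed_segment z1 z2" for z
        using that a R by (intro Hb) (auto simp: z1_def z2_def closed_segment_same_Im closed_segment_eq_real_ivl)
      ultimately show ?thesis
        using contour_integral_bound_linepath[OF int(1) bnn] by metis
    qed
    have top: "cmod (contour_integral (linepath z3 z4) H) \<le> B * (1 + R) ^ m * 2 / (exp (c * R) - 1) * (2 * a)"
    proof -
      have "norm (z4 - z3) = 2 * a" using a by (simp add: z3_def z4_def cmod_def real_sqrt_mult)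
      moreover have "cmod (H z) \<le> B * (1 + R) ^ m * 2 / (exp (c * R) - 1)" if "z \<in> closed_segment z3 z4" for z
        using that a R by (intro Hb) (auto simp: z3_def z4_def closed_segment_same_Im closed_segment_eq_real_ivl)
      ultimately show ?thesis
        using contour_integral_bound_linepath[OF int(3) bnn] by metis
    qed
    have "2 * pi * \<i> * (\<Psi> 0 / of_real c) - \<i> * I R = contour_integral (linepath z1 z2) H + contour_integral (linepath z3 z4) H"
      unfolding sum right left I_def by (simp add: algebra_simps)
    also have "cmod \<dots> \<le> M R"
      using order_trans[OF norm_triangle_ineq add_mono[OF bot top]]
      unfolding M_def mult_2[of "B * (1 + R) ^ m * 2 / (exp (c * R) - 1) * (2 * a)"] .
    finally show ?thesis .
  qed
  \<comment> \<open>The frequency was chosen with \<open>c * a = pi / 2\<close>, so on the two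
    vertical sides the sine becomes real. The opposite signs match the opposite orientations, and
    both sides contribute with the same positive kernel.\<close>
  have sinp: "sin (of_real c * Complex a s) = of_real (cosh (c * s))" "sin (of_real c * Complex (- a) s) = - of_real (cosh (c * s))" for s
  proof -
    have 1: "of_real c * Complex a s = of_real (pi / 2) + \<i> * of_real (c * s)"
      "of_real c * Complex (- a) s = - of_real (pi / 2) + \<i> * of_real (c * s)"
      using c(2) by (simp_all add: complex_eq_iff)
    have 2: "cos (\<i> * of_real (c * s)) = complex_of_real (cosh (c * s))"
      unfolding cosh_conv_cos[symmetric] cosh_def
      by (simp add: exp_of_real[symmetric] scaleR_conv_of_real)
    have 3: "sin (complex_of_real (pi / 2)) = 1" "cos (complex_of_real (pi / 2)) = 0"
      by (simp_all only: sin_of_real cos_of_real sin_pi_half cos_pi_half of_real_1 of_real_0)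
    show "sin (of_real c * Complex a s) = of_real (cosh (c * s))" "sin (of_real c * Complex (- a) s) = - of_real (cosh (c * s))"
      unfolding 1 sin_add sin_minus cos_minus 2 3 by simp_all
  qed
  define h where "h s = of_real (strip_kernel a s) * (\<Psi> (Complex a s) + \<Psi> (Complex (- a) s))" for s
  have \<Psi>c: "continuous_on UNIV (\<lambda>s. \<Psi> (Complex t s))" if "\<bar>t\<bar> \<le> a" for t
    by (rule continuous_on_compose2[OF holomorphic_on_imp_continuous_on[OF hol]])
      (use that a in \<open>auto intro!: continuous_intros\<close>)
  have skc: "continuous_on A (strip_kernel a)" for A
  proof -
    have "cosh t \<noteq> 0" for t :: real using cosh_real_pos[of t] by simp
    then show ?thesis unfolding strip_kernel_def[abs_def] using a by (intro continuous_intros) auto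
  qed
  have hc: "continuous_on UNIV h"
    unfolding h_def using a by (intro continuous_intros skc \<Psi>c) auto
  have hi: "integrable lborel h"
  proof (rule Bochner_Integration.integrable_bound[OF integrable_mult_left[OF strip_kernel_integrable[OF a(1), of m], of "2 * B"]])
    show "h \<in> borel_measurable lborel" using hc by (simp add: borel_measurable_continuous_onI)
    show "AE s in lborel. norm (h s) \<le> norm (strip_kernel a s * (1 + \<bar>s\<bar>) ^ m * (2 * B))"
    proof (rule AE_I2)
      fix s
      have "cmod (\<Psi> (Complex a s) + \<Psi> (Complex (- a) s)) \<le> (1 + \<bar>s\<bar>) ^ m * (2 * B)"
        using norm_triangle_ineq[of "\<Psi> (Complex a s)" "\<Psi> (Complex (- a) s)"] B[of "Complex a s"] B[of "Complex (- a) s"] a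
        by (simp add: algebra_simps)
      then have "norm (h s) \<le> strip_kernel a s * ((1 + \<bar>s\<bar>) ^ m * (2 * B))"
        using strip_kernel_nonneg[OF a(1), of s] by (simp add: h_def norm_mult mult_left_mono)
      then show "norm (h s) \<le> norm (strip_kernel a s * (1 + \<bar>s\<bar>) ^ m * (2 * B))"
        by (simp add: mult.assoc)
    qed
  qed
  have I_eq: "I R = (2 * pi / of_real c) * (LINT s|lborel. indicator {- R..R} s *\<^sub>R h s)" for R
  proof -
    have e1: "H (Complex a s) = (4 * a) * (of_real (strip_kernel a s) * \<Psi> (Complex a s))"
      "- H (Complex (- a) s) = (4 * a) * (of_real (strip_kernel a s) * \<Psi> (Complex (- a) s))" for s
      using a unfolding H_def sinp strip_kernel_def c_def[symmetric] by simp_all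
    have "I R = integral {- R..R} (\<lambda>s. (4 * a) * h s)"
      unfolding I_def e1 h_def distrib_left using a
      by (intro integral_add[symmetric] integrable_continuous_interval continuous_intros continuous_on_subset[OF \<Psi>c] skc) auto
    also have "\<dots> = (4 * a) * integral {- R..R} h" by (rule integral_mult_right)
    also have "integral {- R..R} h = (LINT s:{- R..R}|lborel. h s)"
      using set_borel_integral_eq_integral(2)[OF set_integrable_subset[of lborel UNIV h "{- R..R}"]] hi by (simp add: set_integrable_def)
    finally show ?thesis using c c' by (simp add: set_lebesgue_integral_def c_def field_simps)
  qed
  have lim1: "(\<lambda>n. LINT s|lborel. indicator {- real n..real n} s *\<^sub>R h s) \<longlonglongrightarrow> (LINT s|lborel. h s)"
  proof (rule integral_dominated_convergence[where w="\<lambda>s. norm (h s)"])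
    show "AE s in lborel. (\<lambda>n. indicator {- real n..real n} s *\<^sub>R h s) \<longlonglongrightarrow> h s"
    proof (rule AE_I2, rule tendsto_eventually)
      fix s :: real
      obtain N where "\<bar>s\<bar> \<le> real N" using real_arch_simple by blast
      then show "\<forall>\<^sub>F n in sequentially. indicator {- real n..real n} s *\<^sub>R h s = h s"
        by (intro eventually_sequentiallyI[of N]) (auto simp: indicator_def)
    qed
  qed (use hi in \<open>auto simp: indicator_def\<close>)
  have lim2: "(\<lambda>n. M (real n)) \<longlonglongrightarrow> 0"
  proof -
    \<comment> \<open>One power more than the growth of \<open>\<Psi>\<close> leaves the factor
      \<open>1 / (1 + n)\<close>, which tends to 0.\<close>
    obtain D where D: "D > 0" "\<And>s. (1 + \<bar>s\<bar>) ^ Suc m \<le> D * exp (c * \<bar>s\<bar>)"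
      using strip_kernel_bound[OF a(1), of "Suc m"] unfolding c_def by metis
    have "(\<lambda>n. 16 * a * B * D * (1 / (1 + real n))) \<longlonglongrightarrow> 16 * a * B * D * 0"
      using LIMSEQ_inverse_real_of_nat by (intro tendsto_mult tendsto_const) (simp add: inverse_eq_divide)
    then have lim: "(\<lambda>n. 16 * a * B * D * (1 / (1 + real n))) \<longlonglongrightarrow> 0" by simp
    obtain N where N: "1 \<le> c * real N"
      using real_arch_simple[of "1 / c"] c by (auto simp: field_simps)
    have "\<forall>n\<ge>N. 0 \<le> M (real n) \<and> M (real n) \<le> 16 * a * B * D * (1 / (1 + real n))"
    proof (intro allI impI)
      fix n assume n: "n \<ge> N"
      have "c * real N \<le> c * real n" using n c by (intro mult_left_mono) auto
      then have e2: "exp (c * real n) \<ge> 2" using N exp_ge_add_one_self[of "c * real n"] by linarith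
      have "(1 + real n) ^ Suc m \<le> D * exp (c * real n)" using D(2)[of "real n"] by simp
      also have "\<dots> \<le> D * (2 * (exp (c * real n) - 1))" using e2 D by (intro mult_left_mono) auto
      finally have le: "(1 + real n) ^ Suc m \<le> D * (2 * (exp (c * real n) - 1))" .
      have "(1 + real n) ^ m / (exp (c * real n) - 1) \<le> 2 * D * (1 / (1 + real n))"
      proof -
        obtain e where e: "exp (c * real n) - 1 = e" by blast
        have "e > 0" using e2 e by linarith
        moreover have "(1 + real n) ^ m * (1 + real n) \<le> 2 * D * e" using le unfolding e by (simp add: mult_ac)
        ultimately show ?thesis unfolding e by (simp add: pos_divide_le_eq pos_le_divide_eq)
      qed
      then have "(8 * a * B) * ((1 + real n) ^ m / (exp (c * real n) - 1)) \<le> (8 * a * B) * (2 * D * (1 / (1 + real n)))"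
        using a B0 by (intro mult_left_mono) auto
      moreover have "M (real n) = (8 * a * B) * ((1 + real n) ^ m / (exp (c * real n) - 1))" by (simp add: M_def)
      ultimately show "0 \<le> M (real n) \<and> M (real n) \<le> 16 * a * B * D * (1 / (1 + real n))"
        using a B0 e2 c(1) by (auto intro!: divide_nonneg_nonneg mult_nonneg_nonneg)
    qed
    then show ?thesis
      by (intro tendsto_sandwich[OF _ _ tendsto_const lim]) (auto simp: eventually_sequentially)
  qed
  have "(\<lambda>n. 2 * pi * \<i> * (\<Psi> 0 / of_real c) - \<i> * I (real n)) \<longlonglongrightarrow> 0"
  proof (rule Lim_null_comparison[OF _ lim2])
    show "\<forall>\<^sub>F n in sequentially. norm (2 * pi * \<i> * (\<Psi> 0 / of_real c) - \<i> * I (real n)) \<le> M (real n)"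
      by (rule eventually_sequentiallyI[of 1], rule rect) simp
  qed
  moreover have "(\<lambda>n. 2 * pi * \<i> * (\<Psi> 0 / of_real c) - \<i> * I (real n)) \<longlonglongrightarrow>
    2 * pi * \<i> * (\<Psi> 0 / of_real c) - \<i> * ((2 * pi / of_real c) * (LINT s|lborel. h s))"
    unfolding I_eq by (intro tendsto_intros lim1)
  ultimately have "2 * pi * \<i> * (\<Psi> 0 / of_real c) - \<i> * ((2 * pi / of_real c) * (LINT s|lborel. h s)) = 0"
    using LIMSEQ_unique by blast
  then have "\<Psi> 0 = (LINT s|lborel. h s)" using c by (simp add: field_simps)
  then show ?thesis by (simp only: h_def)
qed

lemma strip_formula:
  fixes \<Phi> :: "complex \<Rightarrow> complex"
  assumes a: "0 < a" "a < d" and hol: "\<Phi> holomorphic_on {w. \<bar>Im w\<bar> < d}"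
    and B: "\<And>w. \<bar>Im w\<bar> \<le> a \<Longrightarrow> cmod (\<Phi> w) \<le> B * (1 + \<bar>Re w\<bar>) ^ m"
  shows "\<Phi> 0 = (LINT s|lborel. of_real (strip_kernel a s) * (\<Phi> (Complex s a) + \<Phi> (Complex s (- a))))"
proof -
  let ?\<Psi> = "\<lambda>z. \<Phi> (- \<i> * z)"
  have "?\<Psi> 0 = (LINT s|lborel. of_real (strip_kernel a s) * (?\<Psi> (Complex a s) + ?\<Psi> (Complex (- a) s)))"
  proof (rule vertical_strip_formula[OF a, where B=B and m=m])
    have "(\<Phi> \<circ> (\<lambda>z. - \<i> * z)) holomorphic_on {z. \<bar>Re z\<bar> < d}"
      by (rule holomorphic_on_compose_gen[OF _ hol]) (auto intro!: holomorphic_intros)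
    then show "?\<Psi> holomorphic_on {z. \<bar>Re z\<bar> < d}" by (simp add: o_def)
    show "cmod (?\<Psi> z) \<le> B * (1 + \<bar>Im z\<bar>) ^ m" if "\<bar>Re z\<bar> \<le> a" for z
      using B[of "- \<i> * z"] that by simp
  qed
  moreover have "- \<i> * Complex a s = Complex s (- a)" "- \<i> * Complex (- a) s = Complex s a" for s
    by (simp_all add: complex_eq_iff)
  ultimately show ?thesis by (simp add: add.commute)
qed


lemma one_plus_sum_le_prod:
  fixes f :: "'b \<Rightarrow> real"
  assumes "finite J" "\<And>b. b \<in> J \<Longrightarrow> 0 \<le> f b"
  shows "1 + (\<Sum>b\<in>J. f b) \<le> (\<Prod>b\<in>J. 1 + f b)"
  using assms
proof (induction J)
  case (insert b J)
  have "0 \<le> f b" "0 \<le> (\<Sum>b\<in>J. f b)" "1 + (\<Sum>b\<in>J. f b) \<le> (\<Prod>b\<in>J. 1 + f b)"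
    using insert by (auto intro: sum_nonneg)
  then have "(1 + f b) * (1 + (\<Sum>b\<in>J. f b)) \<le> (1 + f b) * (\<Prod>b\<in>J. 1 + f b)"
    by (intro mult_left_mono) auto
  moreover have "1 + (f b + (\<Sum>b\<in>J. f b)) \<le> (1 + f b) * (1 + (\<Sum>b\<in>J. f b))"
    using \<open>0 \<le> f b\<close> \<open>0 \<le> (\<Sum>b\<in>J. f b)\<close> by (simp add: distrib_left distrib_right)
  ultimately show ?case using insert by simp
qed simp

text \<open>The one-dimensional formula will be iterated over the coordinates; \<open>T\<close> records the
  coordinates in which the imaginary part is \<open>a\<close> rather than \<open>- a\<close>.\<close>

definition corner :: "'a::euclidean_space set \<Rightarrow> real \<Rightarrow> 'a set \<Rightarrow> 'a" where
  "corner J a T = (\<Sum>b\<in>J. (if b \<in> T then a else - a) *\<^sub>R b)"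

lemma corner_inner:
  assumes "J \<subseteq> Basis" "u \<in> Basis"
  shows "corner J a T \<bullet> u = (if u \<in> J then (if u \<in> T then a else - a) else 0)"
proof -
  have fin: "finite J" using assms finite_subset finite_Basis by blast
  have "corner J a T \<bullet> u = (\<Sum>b\<in>J. (if b \<in> T then a else - a) * (b \<bullet> u))"
    by (simp add: corner_def inner_sum_left)
  also have "\<dots> = (\<Sum>b\<in>J. if b = u then (if u \<in> T then a else - a) else 0)"
    using assms by (intro sum.cong) (auto simp: inner_Basis)
  finally show ?thesis using fin by simp
qed

text \<open>\<open>G s \<sigma>\<close> stands for a pairing displaced by \<open>s\<close> in the
  real and by \<open>\<sigma>\<close> in the imaginary directions. Holomorphy is asked along
  coordinate directions only, one for each application of the strip formula; the polynomial bound
  makes Fubini applicable.\<close>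

theorem tube_formula:
  fixes G :: "'a::euclidean_space \<Rightarrow> 'a \<Rightarrow> complex"
  assumes a: "0 < a" "a < d"
    and hol: "\<And>p \<sigma> b. b \<in> Basis \<Longrightarrow> (\<And>u. u \<in> Basis \<Longrightarrow> \<bar>\<sigma> \<bullet> u\<bar> \<le> a) \<Longrightarrow> \<sigma> \<bullet> b = 0 \<Longrightarrow>
      (\<lambda>w. G (p + Re w *\<^sub>R b) (\<sigma> + Im w *\<^sub>R b)) holomorphic_on {w. \<bar>Im w\<bar> < d}"
    and cont: "\<And>\<sigma>. (\<And>u. u \<in> Basis \<Longrightarrow> \<bar>\<sigma> \<bullet> u\<bar> \<le> a) \<Longrightarrow> continuous_on UNIV (\<lambda>s. G s \<sigma>)"
    and bound: "\<And>s \<sigma>. (\<And>u. u \<in> Basis \<Longrightarrow> \<bar>\<sigma> \<bullet> u\<bar> \<le> a) \<Longrightarrow> cmod (G s \<sigma>) \<le> B * (1 + norm s) ^ m"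
  shows "G 0 0 = (\<Sum>T\<in>Pow Basis. LINT s|lborel. of_real (\<Prod>b\<in>Basis. strip_kernel a (s \<bullet> b)) * G s (corner Basis a T))"
proof -
  interpret product_sigma_finite "\<lambda>_::'a. lborel :: real measure" ..
  let ?P = "\<lambda>J. \<Pi>\<^sub>M b\<in>J. (lborel :: real measure)"
  define emb where "emb J x = (\<Sum>b\<in>J. x b *\<^sub>R b)" for J and x :: "'a \<Rightarrow> real"
  define K where "K J x = (\<Prod>b\<in>J. strip_kernel a (x b))" for J and x :: "'a \<Rightarrow> real"
  define F where "F J T x = of_real (K J x) * G (emb J x) (corner J a T)" for J T and x :: "'a \<Rightarrow> real"
  have B0: "0 \<le> B" using order_trans[OF norm_ge_zero bound[of 0 0]] a by simp
  have cb: "\<bar>corner J a T \<bullet> u\<bar> \<le> a" if "J \<subseteq> Basis" "u \<in> Basis" for J T u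
    using a by (simp add: corner_inner[OF that])
  have Kn: "0 \<le> K J x" for J x unfolding K_def by (intro prod_nonneg ballI strip_kernel_nonneg a)
  have emb_meas: "emb J \<in> borel_measurable (?P J)" for J
    unfolding emb_def[abs_def] by measurable
  have K_meas: "K J \<in> borel_measurable (?P J)" for J
    unfolding K_def[abs_def] by measurable
  have F_meas: "F J T \<in> borel_measurable (?P J)" if "J \<subseteq> Basis" for J T
  proof -
    have "(\<lambda>s. G s (corner J a T)) \<in> borel_measurable borel"
      by (rule borel_measurable_continuous_onI[OF cont]) (rule cb[OF that])
    from measurable_compose[OF emb_meas this] K_meas show ?thesis
      unfolding F_def[abs_def] by measurable
  qed
  have F_int: "integrable (?P J) (F J T)" if J: "J \<subseteq> Basis" for J T
  proof -
    have fin: "finite J" using J finite_subset finite_Basis by blast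
    \<comment> \<open>The weight \<open>1 + norm\<close> of a vector is at most the product of the
      weights of its coordinates, so a majorant can be taken as a product of integrable functions of
      one variable.\<close>
    have I: "integrable (?P J) (\<lambda>x. B * (\<Prod>b\<in>J. strip_kernel a (x b) * (1 + \<bar>x b\<bar>) ^ m))"
      by (intro integrable_mult_right product_integrable_prod fin strip_kernel_integrable a)
    show ?thesis
    proof (rule Bochner_Integration.integrable_bound[OF I F_meas[OF J]], rule AE_I2)
      fix x :: "'a \<Rightarrow> real"
      have "norm (emb J x) \<le> (\<Sum>b\<in>J. \<bar>x b\<bar>)"
        unfolding emb_def using J by (intro sum_norm_le) auto
      then have "1 + norm (emb J x) \<le> (\<Prod>b\<in>J. 1 + \<bar>x b\<bar>)"
        using one_plus_sum_le_prod[OF fin, of "\<lambda>b. \<bar>x b\<bar>"] by simp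
      then have "(1 + norm (emb J x)) ^ m \<le> (\<Prod>b\<in>J. 1 + \<bar>x b\<bar>) ^ m" by (intro power_mono) auto
      also have "\<dots> = (\<Prod>b\<in>J. (1 + \<bar>x b\<bar>) ^ m)" by (rule prod_power_distrib)
      finally have "cmod (G (emb J x) (corner J a T)) \<le> B * (\<Prod>b\<in>J. (1 + \<bar>x b\<bar>) ^ m)"
        using bound[OF cb[OF J], of "emb J x" T] B0 by (meson mult_left_mono order_trans)
      then have "norm (F J T x) \<le> K J x * (B * (\<Prod>b\<in>J. (1 + \<bar>x b\<bar>) ^ m))"
        using Kn[of J x] by (simp add: F_def norm_mult mult_left_mono)
      also have "\<dots> = B * (\<Prod>b\<in>J. strip_kernel a (x b) * (1 + \<bar>x b\<bar>) ^ m)"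
        by (simp add: K_def prod.distrib)
      finally show "norm (F J T x) \<le> norm (B * (\<Prod>b\<in>J. strip_kernel a (x b) * (1 + \<bar>x b\<bar>) ^ m))"
        by simp
    qed
  qed
  \<comment> \<open>Coordinates outside \<open>J\<close> are still at 0. Adding \<open>i\<close> to
    \<open>J\<close> applies the strip formula to that coordinate and splits the term of
    \<open>T\<close> into those of \<open>T\<close> and \<open>insert i T\<close>.\<close>
  have step: "G 0 0 = (\<Sum>T\<in>Pow J. LINT x|?P J. F J T x)" if "finite J" "J \<subseteq> Basis" for J
    using that
  proof (induction J)
    case empty
    then show ?case by (simp add: F_def K_def emb_def corner_def PiM_empty lebesgue_integral_count_space_finite)
  next
    case (insert i J)
    have J: "J \<subseteq> Basis" "i \<in> Basis" "i \<notin> J" "finite J" and iJ: "insert i J \<subseteq> Basis" using insert by auto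
    have one: "(LINT x|?P J. F J T x) = (LINT x|?P (insert i J). F (insert i J) T x) + (LINT x|?P (insert i J). F (insert i J) (insert i T) x)"
      if T: "T \<subseteq> J" for T
    proof -
      have cor: "corner (insert i J) a (insert i T) = corner J a T + a *\<^sub>R i" "corner (insert i J) a T = corner J a T + (- a) *\<^sub>R i"
      proof -
        have "(\<Sum>b\<in>J. (if b \<in> insert i T then a else - a) *\<^sub>R b) = (\<Sum>b\<in>J. (if b \<in> T then a else - a) *\<^sub>R b)"
          using J by (intro sum.cong) auto
        then show "corner (insert i J) a (insert i T) = corner J a T + a *\<^sub>R i"
          using J by (simp add: corner_def)
        have "i \<notin> T" using T J by blast
        then show "corner (insert i J) a T = corner J a T + (- a) *\<^sub>R i"
          using J by (simp add: corner_def)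
      qed
      have emb: "emb (insert i J) (x(i := s)) = emb J x + s *\<^sub>R i" for x s
      proof -
        have "(\<Sum>b\<in>J. (x(i := s)) b *\<^sub>R b) = (\<Sum>b\<in>J. x b *\<^sub>R b)"
          using J by (intro sum.cong) auto
        then show ?thesis using J by (simp add: emb_def)
      qed
      have KK: "K (insert i J) (x(i := s)) = K J x * strip_kernel a s" for x s
      proof -
        have "(\<Prod>b\<in>J. strip_kernel a ((x(i := s)) b)) = (\<Prod>b\<in>J. strip_kernel a (x b))"
          using J by (intro prod.cong) auto
        then show ?thesis using J by (simp add: K_def)
      qed
      have "(LINT x|?P (insert i J). F (insert i J) T x) + (LINT x|?P (insert i J). F (insert i J) (insert i T) x) =
        (LINT x|?P (insert i J). F (insert i J) T x + F (insert i J) (insert i T) x)"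
        using F_int[OF iJ] by simp
      also have "\<dots> = (LINT x|?P J. LINT s|lborel. F (insert i J) T (x(i := s)) + F (insert i J) (insert i T) (x(i := s)))"
        using F_int[OF iJ] J by (intro product_integral_insert) auto
      also have "\<dots> = (LINT x|?P J. F J T x)"
      proof (rule Bochner_Integration.integral_cong[OF refl])
        fix x :: "'a \<Rightarrow> real"
        let ?\<Phi> = "\<lambda>w. G (emb J x + Re w *\<^sub>R i) (corner J a T + Im w *\<^sub>R i)"
        let ?B = "B * (1 + norm (emb J x)) ^ m"
        have ci: "corner J a T \<bullet> i = 0" using J by (simp add: corner_inner)
        have "?\<Phi> 0 = (LINT s|lborel. of_real (strip_kernel a s) * (?\<Phi> (Complex s a) + ?\<Phi> (Complex s (- a))))"
        proof (rule strip_formula[OF a, where B="?B" and m=m])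
          show "?\<Phi> holomorphic_on {w. \<bar>Im w\<bar> < d}"
            by (rule hol[OF J(2) cb[OF J(1)] ci])
          fix w assume w: "\<bar>Im w\<bar> \<le> a"
          have "\<bar>(corner J a T + Im w *\<^sub>R i) \<bullet> u\<bar> \<le> a" if "u \<in> Basis" for u
            using w ci cb[OF J(1) that, of T] J(2) that
            by (cases "u = i") (auto simp: inner_add_left inner_Basis)
          then have "cmod (?\<Phi> w) \<le> B * (1 + norm (emb J x + Re w *\<^sub>R i)) ^ m" by (rule bound)
          also have "\<dots> \<le> B * ((1 + norm (emb J x)) * (1 + \<bar>Re w\<bar>)) ^ m"
            using weight_submult[of "emb J x" "Re w *\<^sub>R i"] J(2) B0 by (intro mult_left_mono power_mono) auto
          finally show "cmod (?\<Phi> w) \<le> ?B * (1 + \<bar>Re w\<bar>) ^ m" by (simp add: power_mult_distrib mult.assoc)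
        qed
        then have "F J T x = of_real (K J x) * (LINT s|lborel. of_real (strip_kernel a s) * (?\<Phi> (Complex s a) + ?\<Phi> (Complex s (- a))))"
          by (simp add: F_def)
        also have "\<dots> = (LINT s|lborel. of_real (K J x) * (of_real (strip_kernel a s) * (?\<Phi> (Complex s a) + ?\<Phi> (Complex s (- a)))))"
          by (rule integral_mult_right_zero[symmetric])
        also have "\<dots> = (LINT s|lborel. F (insert i J) T (x(i := s)) + F (insert i J) (insert i T) (x(i := s)))"
          unfolding F_def emb KK cor
          by (intro Bochner_Integration.integral_cong refl) (simp add: algebra_simps)
        finally show "(LINT s|lborel. F (insert i J) T (x(i := s)) + F (insert i J) (insert i T) (x(i := s))) = F J T x" ..
      qed
      finally show ?thesis ..
    qed
    have "G 0 0 = (\<Sum>T\<in>Pow J. (LINT x|?P (insert i J). F (insert i J) T x) + (LINT x|?P (insert i J). F (insert i J) (insert i T) x))"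
      unfolding insert.IH[OF J(1)] by (intro sum.cong refl one) auto
    also have "\<dots> = (\<Sum>T\<in>Pow J. LINT x|?P (insert i J). F (insert i J) T x) + (\<Sum>T\<in>insert i ` Pow J. LINT x|?P (insert i J). F (insert i J) T x)"
    proof -
      have "inj_on (insert i) (Pow J)" using J(3) by (auto simp: inj_on_def)
      then show ?thesis by (simp add: sum.distrib sum.reindex)
    qed
    also have "\<dots> = (\<Sum>T\<in>Pow (insert i J). LINT x|?P (insert i J). F (insert i J) T x)"
      unfolding Pow_insert using J(3,4) by (intro sum.union_disjoint[symmetric]) auto
    finally show ?case .
  qed
  have "(LINT x|?P Basis. F Basis T x) = (LINT s|lborel. of_real (\<Prod>b\<in>Basis. strip_kernel a (s \<bullet> b)) * G s (corner Basis a T))" for T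
  proof -
    have Gm: "(\<lambda>s. G s (corner Basis a T)) \<in> borel_measurable borel"
      by (rule borel_measurable_continuous_onI[OF cont]) (rule cb[OF subset_refl])
    then have meas: "(\<lambda>s::'a. of_real (\<Prod>b\<in>Basis. strip_kernel a (s \<bullet> b)) * G s (corner Basis a T)) \<in> borel_measurable borel"
      by measurable
    have emb_eq: "(\<lambda>f. \<Sum>b\<in>Basis. f b *\<^sub>R b) = emb Basis" by (simp add: emb_def fun_eq_iff)
    have "(LINT s|lborel. of_real (\<Prod>b\<in>Basis. strip_kernel a (s \<bullet> b)) * G s (corner Basis a T)) =
      (LINT x|?P Basis. of_real (\<Prod>b\<in>Basis. strip_kernel a (emb Basis x \<bullet> b)) * G (emb Basis x) (corner Basis a T))"
      unfolding lborel_eq[where 'a='a] emb_eq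
      by (rule integral_distr[OF emb_meas meas])
    also have "\<dots> = (LINT x|?P Basis. F Basis T x)"
      by (intro Bochner_Integration.integral_cong refl) (simp add: F_def K_def emb_def)
    finally show ?thesis ..
  qed
  then show ?thesis using step[OF finite_Basis subset_refl] by simp
qed

section \<open>Distributions defined by Schwartz functions\<close>

lemma schwartz_dist_apply: "\<psi> \<in> schwartz \<Longrightarrow> schwartz_dist \<phi> \<psi> = (LINT x|lborel. \<phi> x * \<psi> x)"
  by (simp add: schwartz_dist_def)

lemma schwartz_dist_commute: "\<phi> \<in> schwartz \<Longrightarrow> \<psi> \<in> schwartz \<Longrightarrow> schwartz_dist \<phi> \<psi> = schwartz_dist \<psi> \<phi>"
  by (simp add: schwartz_dist_apply mult.commute)

lemma schwartz_dist_add: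
  "\<phi> \<in> schwartz \<Longrightarrow> \<psi> \<in> schwartz \<Longrightarrow> schwartz_dist (\<phi> + \<psi>) = schwartz_dist \<phi> + schwartz_dist \<psi>"
  by (auto simp: schwartz_dist_def fun_eq_iff distrib_right schwartz_bounded_mult_integrable)

lemma schwartz_dist_diff:
  "\<phi> \<in> schwartz \<Longrightarrow> \<psi> \<in> schwartz \<Longrightarrow> schwartz_dist (\<phi> - \<psi>) = schwartz_dist \<phi> - schwartz_dist \<psi>"
  by (auto simp: schwartz_dist_def fun_eq_iff left_diff_distrib schwartz_bounded_mult_integrable)

lemma schwartz_dist_cmult: "schwartz_dist (\<lambda>x. c * \<phi> x) = (\<lambda>\<psi>. c * schwartz_dist \<phi> \<psi>)"
  by (auto simp: schwartz_dist_def fun_eq_iff mult.assoc)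

lemma schwartz_dist_linear:
  assumes "\<phi> \<in> schwartz"
  shows "clinear_functional_on schwartz (schwartz_dist \<phi>)"
  unfolding clinear_functional_on_def
  using assms by (auto simp: schwartz_dist_def distrib_left schwartz_bounded_mult_integrable
      SW.add_mem schwartz_cmult mult.left_commute)

lemma schwartz_dist_bound:
  assumes "\<phi> \<in> schwartz"
  obtains K m where "\<And>\<psi>. \<psi> \<in> schwartz \<Longrightarrow> cmod (schwartz_dist \<phi> \<psi>) \<le> K * schwartz_norm m \<psi>"
proof -
  have "cmod (\<phi> x) \<le> schwartz_norm 0 \<phi> * (1 + norm x) ^ 0" for x
    using schwartz_pointwise(3)[OF assms] by simp
  from integrable_schwartz_mult(2)[OF _ schwartz_measurable[OF assms] this]
  show ?thesis
    by (intro that[of "schwartz_norm 0 \<phi> * (LINT x:: real ^ 'a|lborel. 1 / (1 + norm x) ^ (CARD('a) + 2))" "0 + CARD('a) + 2"])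
      (simp only: schwartz_dist_apply mult_ac)
qed

lemma transl_schwartz_dist:
  assumes "\<phi> \<in> schwartz"
  shows "transl h (schwartz_dist \<phi>) = schwartz_dist (\<lambda>x. \<phi> (x + h))"
proof
  fix \<psi> :: "'a test_fun"
  have iff: "(\<lambda>x. \<psi> (x - h)) \<in> schwartz \<longleftrightarrow> \<psi> \<in> schwartz"
    using schwartz_shift[of \<psi> h] schwartz_shift_plus[of "\<lambda>x. \<psi> (x - h)" h] by auto
  show "transl h (schwartz_dist \<phi>) \<psi> = schwartz_dist (\<lambda>x. \<phi> (x + h)) \<psi>"
  proof (cases "\<psi> \<in> schwartz")
    case True
    have [measurable]: "\<phi> \<in> borel_measurable borel" "\<psi> \<in> borel_measurable borel"
      using True assms by (auto intro: schwartz_measurable)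
    have "(LINT x|lborel. \<phi> x * \<psi> (x - h)) = (LINT x|lborel. \<phi> (x + h) * \<psi> (x + h - h))"
      by (rule lborel_shift[symmetric]) measurable
    then show ?thesis using True iff by (simp add: transl_def schwartz_dist_def)
  qed (use iff in \<open>simp add: transl_def schwartz_dist_def\<close>)
qed

lemma schwartz_dist_shift:
  "\<phi> \<in> schwartz \<Longrightarrow> schwartz_dist (\<lambda>x. \<phi> (x - t)) = transl (- t) (schwartz_dist \<phi>)"
  by (simp add: transl_schwartz_dist)

text \<open>Translation invariance of Lebesgue measure moves a shift by \<open>s\<close> from one
  factor to the opposite shift of the other. Comparing the terms of first order in \<open>s\<close>,
  with quadratic remainders, gives the identity.\<close>

lemma integral_by_parts:
  fixes \<phi> \<psi> :: "'n::finite test_fun"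
  assumes \<phi>: "\<phi> \<in> schwartz" and \<psi>: "\<psi> \<in> schwartz"
  shows "(LINT x|lborel. partial_deriv j \<phi> x * \<psi> x) = - (LINT x|lborel. \<phi> x * partial_deriv j \<psi> x)"
proof -
  have tay: "\<exists>C. \<forall>s. cmod ((LINT x|lborel. g x * f (x + s *\<^sub>R axis j 1)) - (LINT x|lborel. g x * f x)
      - of_real s * (LINT x|lborel. g x * partial_deriv j f x)) \<le> C * s\<^sup>2"
    if f: "f \<in> schwartz" and g: "g \<in> schwartz" for f g :: "'n test_fun"
  proof -
    let ?e = "axis j 1 :: real^'n"
    have sum: "(\<Sum>i\<in>UNIV. of_real ((s *\<^sub>R ?e) $ i) * partial_deriv i f x) = of_real s * partial_deriv j f x" for s x
    proof -
      have "(\<Sum>i\<in>UNIV. of_real ((s *\<^sub>R ?e) $ i) * partial_deriv i f x) = (\<Sum>i\<in>UNIV. if i = j then of_real s * partial_deriv j f x else 0)"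
        by (intro sum.cong) (auto simp: axis_def)
      then show ?thesis by simp
    qed
    let ?C = "(real CARD('n))\<^sup>2 * schwartz_norm 2 f"
    have I: "integrable lborel (\<lambda>x. g x * f (x + s *\<^sub>R ?e))" "integrable lborel (\<lambda>x. g x * f x)"
      "integrable lborel (\<lambda>x. g x * partial_deriv j f x)" for s
      using f g by (auto intro!: schwartz_bounded_mult_integrable schwartz_shift_plus schwartz_partial_deriv)
    have Ig: "integrable lborel (\<lambda>x. cmod (g x))" using g by (intro integrable_norm schwartz_integrable)
    have "cmod ((LINT x|lborel. g x * f (x + s *\<^sub>R ?e)) - (LINT x|lborel. g x * f x)
      - of_real s * (LINT x|lborel. g x * partial_deriv j f x)) \<le> ((LINT x|lborel. cmod (g x)) * ?C) * s\<^sup>2" for s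
    proof -
      have "(LINT x|lborel. g x * f (x + s *\<^sub>R ?e)) - (LINT x|lborel. g x * f x) - of_real s * (LINT x|lborel. g x * partial_deriv j f x)
        = (LINT x|lborel. g x * f (x + s *\<^sub>R ?e) - g x * f x - of_real s * (g x * partial_deriv j f x))"
        by (simp add: I)
      also have "cmod \<dots> \<le> (LINT x|lborel. cmod (g x) * (?C * s\<^sup>2))"
      proof (rule integral_norm_le)
        show "integrable lborel (\<lambda>x. cmod (g x) * (?C * s\<^sup>2))" by (intro integrable_mult_left Ig)
        fix x
        have "g x * f (x + s *\<^sub>R ?e) - g x * f x - of_real s * (g x * partial_deriv j f x)
          = g x * (f (x + s *\<^sub>R ?e) - f x - of_real s * partial_deriv j f x)" by (simp add: algebra_simps)
        moreover have "cmod (f (x + s *\<^sub>R ?e) - f x - of_real s * partial_deriv j f x) \<le> ?C * s\<^sup>2"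
          using schwartz_taylor[OF f, of x "s *\<^sub>R ?e"] unfolding sum by (simp add: mult_ac)
        ultimately show "norm (g x * f (x + s *\<^sub>R ?e) - g x * f x - of_real s * (g x * partial_deriv j f x)) \<le> cmod (g x) * (?C * s\<^sup>2)"
          by (simp add: norm_mult mult_left_mono)
      qed
      finally show ?thesis by (simp add: mult.assoc)
    qed
    then show ?thesis by blast
  qed
  obtain C1 where C1: "\<And>s. cmod ((LINT x|lborel. \<psi> x * \<phi> (x + s *\<^sub>R axis j 1)) - (LINT x|lborel. \<psi> x * \<phi> x)
      - of_real s * (LINT x|lborel. \<psi> x * partial_deriv j \<phi> x)) \<le> C1 * s\<^sup>2" using tay[OF \<phi> \<psi>] by blast
  obtain C2 where C2: "\<And>s. cmod ((LINT x|lborel. \<phi> x * \<psi> (x + s *\<^sub>R axis j 1)) - (LINT x|lborel. \<phi> x * \<psi> x)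
      - of_real s * (LINT x|lborel. \<phi> x * partial_deriv j \<psi> x)) \<le> C2 * s\<^sup>2" using tay[OF \<psi> \<phi>] by blast
  let ?S = "(LINT x|lborel. \<psi> x * partial_deriv j \<phi> x) + (LINT x|lborel. \<phi> x * partial_deriv j \<psi> x)"
  have "cmod ?S \<le> (C1 + C2) * s" if s: "s > 0" for s
  proof -
    let ?A = "(LINT x|lborel. \<psi> x * \<phi> (x + s *\<^sub>R axis j 1)) - (LINT x|lborel. \<psi> x * \<phi> x)"
    let ?B = "(LINT x|lborel. \<phi> x * \<psi> (x + (- s) *\<^sub>R axis j 1)) - (LINT x|lborel. \<phi> x * \<psi> x)"
    have [measurable]: "\<phi> \<in> borel_measurable borel" "\<psi> \<in> borel_measurable borel"
      using \<phi> \<psi> by (auto intro: schwartz_measurable)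
    have "(LINT x|lborel. \<phi> x * \<psi> (x - s *\<^sub>R axis j 1)) = (LINT x|lborel. \<phi> (x + s *\<^sub>R axis j 1) * \<psi> (x + s *\<^sub>R axis j 1 - s *\<^sub>R axis j 1))"
      by (rule lborel_shift[symmetric]) measurable
    then have AB: "?A = ?B" by (simp add: mult.commute)
    have "of_real s * ?S = (?B + of_real s * (LINT x|lborel. \<phi> x * partial_deriv j \<psi> x)) - (?A - of_real s * (LINT x|lborel. \<psi> x * partial_deriv j \<phi> x))"
      unfolding AB by (simp add: algebra_simps)
    also have "cmod \<dots> \<le> C2 * s\<^sup>2 + C1 * s\<^sup>2"
      using C1[of s] C2[of "- s"]
        norm_triangle_ineq4[of "?B + of_real s * (LINT x|lborel. \<phi> x * partial_deriv j \<psi> x)" "?A - of_real s * (LINT x|lborel. \<psi> x * partial_deriv j \<phi> x)"]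
      by simp
    also have "\<dots> = s * ((C1 + C2) * s)" by (simp add: power2_eq_square algebra_simps)
    finally have "s * cmod ?S \<le> s * ((C1 + C2) * s)"
      using s unfolding norm_mult norm_of_real by simp
    then show ?thesis using s by simp
  qed
  then have "\<forall>\<^sub>F s in at_right 0. cmod ?S \<le> (C1 + C2) * s"
    by (auto simp: eventually_at_filter)
  moreover have "((\<lambda>s. (C1 + C2) * s) \<longlongrightarrow> (C1 + C2) * 0) (at_right 0)" by (intro tendsto_intros)
  ultimately have "cmod ?S \<le> (C1 + C2) * 0"
    by (intro tendsto_lowerbound[where F="at_right 0"]) auto
  then have "?S = 0" by simp
  then show ?thesis by (simp add: mult.commute eq_neg_iff_add_eq_0)
qed

lemma dist_derivs_Nil [simp]: "dist_derivs [] u = u"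
  and dist_derivs_Cons: "dist_derivs (j # js) u = dist_deriv j (dist_derivs js u)"
  by (simp_all add: dist_derivs_def)

lemma dist_derivs_schwartz_dist:
  assumes "\<phi> \<in> schwartz"
  shows "dist_derivs js (schwartz_dist \<phi>) = schwartz_dist (partial_derivs js \<phi>)"
proof (induction js)
  case (Cons j js)
  have "dist_deriv j (schwartz_dist f) = schwartz_dist (partial_deriv j f)" if "f \<in> schwartz" for f
    using that by (auto simp: dist_deriv_def schwartz_dist_def fun_eq_iff integral_by_parts schwartz_partial_deriv)
  then show ?case using Cons schwartz_partial_derivs(1)[OF assms] by (simp add: dist_derivs_Cons partial_derivs_Cons)
qed simp

lemma dist_derivs_add: "dist_derivs js (u + v) = dist_derivs js u + dist_derivs js v"
proof (induction js)
  case (Cons j js)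
  then show ?case by (auto simp: dist_derivs_Cons dist_deriv_def fun_eq_iff)
qed simp

lemma dist_derivs_cmult: "dist_derivs js (\<lambda>x. c * u x) = (\<lambda>x. c * dist_derivs js u x)"
proof (induction js)
  case (Cons j js)
  then show ?case by (auto simp: dist_derivs_Cons dist_deriv_def fun_eq_iff)
qed simp

section \<open>Convolution on a translation-invariant Banach space\<close>

context transl_inv_banach
begin

sublocale ES: directed_seminormed_space E "{nE}"
  using banach by unfold_locales (auto simp: cbanach_on_def)

abbreviation weight :: "real ^ 'n \<Rightarrow> real" where "weight \<equiv> transl_weight E nE"

lemma nE_zero_iff: "f \<in> E \<Longrightarrow> nE f = 0 \<longleftrightarrow> f = 0"
  using banach by (simp add: cbanach_on_def)

lemma nE_nonneg: "f \<in> E \<Longrightarrow> 0 \<le> nE f"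
  using ES.nonneg[of nE f] by simp

lemma nE_zero: "nE 0 = 0"
  and nE_triangle: "f \<in> E \<Longrightarrow> g \<in> E \<Longrightarrow> nE (f + g) \<le> nE f + nE g"
  and nE_triangle_diff: "f \<in> E \<Longrightarrow> g \<in> E \<Longrightarrow> nE (f - g) \<le> nE f + nE g"
  and nE_scale: "f \<in> E \<Longrightarrow> nE (\<lambda>x. c * f x) = cmod c * nE f"
  and nE_minus_swap: "f \<in> E \<Longrightarrow> g \<in> E \<Longrightarrow> nE (f - g) = nE (g - f)"
  using ES.zero_eq[of nE] ES.triangle[of nE f g] ES.triangle_diff[of nE f g] ES.scale[of nE f c]
    ES.minus_swap[of nE f g]
  by simp_all

lemma nE_sum: "(\<And>i. i \<in> I \<Longrightarrow> f i \<in> E) \<Longrightarrow> nE (sum f I) \<le> (\<Sum>i\<in>I. nE (f i))"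
  using ES.sum_le[of nE I f] by simp

lemma complete:
  assumes "\<And>k. s k \<in> E" "\<And>e. e > 0 \<Longrightarrow> \<exists>N. \<forall>m\<ge>N. \<forall>k\<ge>N. nE (s m - s k) < e"
  shows "\<exists>f\<in>E. (\<lambda>k. nE (s k - f)) \<longlonglongrightarrow> 0"
  using banach assms unfolding cbanach_on_def by blast

lemma dist_mem: "\<phi> \<in> schwartz \<Longrightarrow> schwartz_dist \<phi> \<in> E"
  using schwartz_incl by blast

lemma schwartz_dist_0: "schwartz_dist 0 = (0 :: 'n tdist)"
  by (simp add: schwartz_dist_def fun_eq_iff)

lemma schwartz_embedding:
  obtains K m where "K \<ge> 0" "\<And>\<phi>. \<phi> \<in> schwartz \<Longrightarrow> nE (schwartz_dist \<phi>) \<le> K * schwartz_norm m \<phi>"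
proof -
  have "openin (lc_topology schwartz schwartz_seminorms)
    {\<phi> \<in> topspace (lc_topology schwartz schwartz_seminorms). schwartz_dist \<phi> \<in> {g \<in> E. nE (g - 0) < 1}}"
    by (rule openin_continuous_map_preimage[OF schwartz_cont]) (rule ES.openin_ball[OF ES.zero_mem singletonI zero_less_one])
  moreover have "0 \<in> {\<phi> \<in> topspace (lc_topology schwartz schwartz_seminorms). schwartz_dist \<phi> \<in> {g \<in> E. nE (g - 0) < 1}}"
    using SW.zero_mem ES.zero_mem ES.zero_eq[of nE] by (simp add: SW.topspace_lc schwartz_dist_0)
  ultimately obtain p \<epsilon> where p: "p \<in> schwartz_seminorms" "\<epsilon> > 0"
    "{g \<in> schwartz. p (g - 0) < \<epsilon>} \<subseteq> {\<phi> \<in> topspace (lc_topology schwartz schwartz_seminorms). schwartz_dist \<phi> \<in> {g \<in> E. nE (g - 0) < 1}}"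
    using SW.openin_contains_ball[of _ 0] by blast
  obtain m where m: "p = schwartz_norm m" using p(1) by blast
  have "nE (schwartz_dist \<phi>) \<le> 2 / \<epsilon> * p \<phi>" if "\<phi> \<in> schwartz" for \<phi>
  proof (rule SW.bound_of_ball[OF p(1,2), where q="\<lambda>\<phi>. nE (schwartz_dist \<phi>)"])
    show "nE (schwartz_dist (\<lambda>x. c * f x)) = cmod c * nE (schwartz_dist f)" if "f \<in> schwartz" for c f
      unfolding schwartz_dist_cmult by (rule nE_scale[OF dist_mem[OF that]])
    show "nE (schwartz_dist f) \<le> 1" if "f \<in> schwartz" "p f < \<epsilon>" for f
      using p(3) that by auto
  qed (rule that)
  then show ?thesis using p(2) unfolding m by (intro that[of "2 / \<epsilon>" m]) auto
qed

text \<open>The singleton of \<open>\<phi>\<close> is bounded, and its strong seminorm is the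
  modulus of the evaluation at \<open>\<phi>\<close>.\<close>

lemma tempered_embedding:
  assumes \<phi>: "\<phi> \<in> schwartz"
  obtains K where "\<And>f. f \<in> E \<Longrightarrow> cmod (f \<phi>) \<le> K * nE f"
proof -
  interpret SD: seminormed_space "tempered :: 'n tdist set" "strong_seminorms schwartz schwartz_seminorms"
    unfolding tempered_def by (rule SW.strong_dual_seminormed)
  define p where "p = (\<lambda>L :: 'n tdist. SUP f\<in>{\<phi>}. cmod (L f))"
  have "lc_bounded schwartz schwartz_seminorms {\<phi>}" using \<phi> by (auto simp: lc_bounded_def)
  then have p: "p \<in> strong_seminorms schwartz schwartz_seminorms"
    unfolding strong_seminorms_def p_def by blast
  have "openin (strong_dual_topology schwartz schwartz_seminorms) {g \<in> tempered. p (g - 0) < 1}"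
    unfolding strong_dual_topology_def tempered_def[symmetric] by (rule SD.openin_ball[OF SD.zero_mem p]) simp
  from openin_continuous_map_preimage[OF tempered_cont this]
  have "openin (lc_topology E {nE}) {f \<in> E. f \<in> {g \<in> tempered. p (g - 0) < 1}}"
    by (simp add: ES.topspace_lc)
  moreover have "0 \<in> {f \<in> E. f \<in> {g \<in> tempered. p (g - 0) < 1}}"
    using ES.zero_mem SD.zero_mem by (simp add: p_def)
  ultimately obtain \<epsilon> where \<epsilon>: "\<epsilon> > 0" "{g \<in> E. nE (g - 0) < \<epsilon>} \<subseteq> {f \<in> E. f \<in> {g \<in> tempered. p (g - 0) < 1}}"
    using ES.openin_contains_ball[of _ 0] by blast
  have "cmod (f \<phi>) \<le> 2 / \<epsilon> * nE f" if "f \<in> E" for f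
    using \<epsilon> by (intro ES.bound_of_ball[where q="\<lambda>f. cmod (f \<phi>)" and p=nE] that) (auto simp: norm_mult p_def less_imp_le)
  then show ?thesis by (rule that)
qed

lemma tempered_limit:
  assumes "\<phi> \<in> schwartz" "f \<in> E" "\<And>k. s k \<in> E" "(\<lambda>k. nE (s k - f)) \<longlonglongrightarrow> 0"
  shows "(\<lambda>k. s k \<phi>) \<longlonglongrightarrow> f \<phi>"
proof -
  obtain K where K: "\<And>f. f \<in> E \<Longrightarrow> cmod (f \<phi>) \<le> K * nE f" using tempered_embedding[OF assms(1)] by blast
  have lim: "(\<lambda>k. K * nE (s k - f)) \<longlonglongrightarrow> 0"
    using tendsto_mult[OF tendsto_const[of K] assms(4)] by simp
  have "norm (s k \<phi> - f \<phi>) \<le> K * nE (s k - f)" for k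
    using K[OF ES.diff_mem[OF assms(3)[of k] assms(2)]] by simp
  then have "(\<lambda>k. s k \<phi> - f \<phi>) \<longlonglongrightarrow> 0"
    by (intro Lim_null_comparison[OF always_eventually lim]) simp
  then show ?thesis by (simp add: LIM_zero_iff)
qed

lemma dense:
  assumes f: "f \<in> E" and e: "e > 0"
  obtains \<psi> where "\<psi> \<in> schwartz" "nE (schwartz_dist \<psi> - f) < e"
proof -
  have cl: "\<exists>y\<in>schwartz_dist ` schwartz. y \<in> T" if "f \<in> T" "openin (lc_topology E {nE}) T" for T
    using schwartz_dense f that unfolding set_eq_iff in_closure_of by auto
  have "openin (lc_topology E {nE}) {g \<in> E. nE (g - f) < e}" using f e by (intro ES.openin_ball) auto
  moreover have "f \<in> {g \<in> E. nE (g - f) < e}" using f e nE_zero by simp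
  ultimately have "\<exists>y\<in>schwartz_dist ` schwartz. y \<in> {g \<in> E. nE (g - f) < e}" by (intro cl)
  then show ?thesis using that by auto
qed

lemma dense_sequence:
  assumes f: "f \<in> E"
  obtains \<psi> where "\<And>k. \<psi> k \<in> schwartz" "(\<lambda>k. nE (schwartz_dist (\<psi> k) - f)) \<longlonglongrightarrow> 0"
proof -
  have "\<exists>\<psi>. \<psi> \<in> schwartz \<and> nE (schwartz_dist \<psi> - f) < 1 / real (Suc k)" for k
    using dense[OF f, of "1 / real (Suc k)"] by (metis of_nat_0_less_iff zero_less_Suc zero_less_divide_1_iff)
  then obtain \<psi> where \<psi>: "\<And>k. \<psi> k \<in> schwartz" "\<And>k. nE (schwartz_dist (\<psi> k) - f) < 1 / real (Suc k)" by metis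
  have "(\<lambda>k. nE (schwartz_dist (\<psi> k) - f)) \<longlonglongrightarrow> 0"
  proof (rule squeeze_zero[where g="\<lambda>k. 1 / real (Suc k)"])
    show "(\<lambda>k. 1 / real (Suc k)) \<longlonglongrightarrow> 0" using LIMSEQ_inverse_real_of_nat by (simp add: inverse_eq_divide)
    show "0 \<le> nE (schwartz_dist (\<psi> k) - f)" for k by (rule nE_nonneg[OF ES.diff_mem[OF dist_mem[OF \<psi>(1)] f]])
    show "nE (schwartz_dist (\<psi> k) - f) \<le> 1 / real (Suc k)" for k using \<psi>(2)[of k] by (rule less_imp_le)
  qed
  with \<psi>(1) show ?thesis by (rule that)
qed

lemma tempered_functional:
  assumes "f \<in> E"
  obtains K m where "clinear_functional_on schwartz f" "\<And>\<phi>. \<phi> \<in> schwartz \<Longrightarrow> cmod (f \<phi>) \<le> K * schwartz_norm m \<phi>"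
proof -
  have f: "f \<in> lc_dual schwartz schwartz_seminorms" using assms sub_tempered by (auto simp: tempered_def)
  show ?thesis
  proof (rule SW.dual_bound[OF f])
    fix p K assume p: "p \<in> schwartz_seminorms" "\<And>\<phi>. \<phi> \<in> schwartz \<Longrightarrow> cmod (f \<phi>) \<le> K * p \<phi>"
    from p(1) obtain m where "p = schwartz_norm m" by auto
    with p(2) show ?thesis using that[OF lc_dualD(1)[OF f], of K m] by simp
  qed
qed

lemma outside: "f \<in> E \<Longrightarrow> \<phi> \<notin> schwartz \<Longrightarrow> f \<phi> = 0"
  using sub_tempered by (auto simp: tempered_def lc_dual_def)

subsection \<open>The weight\<close>

lemma transl_mem: "f \<in> E \<Longrightarrow> transl h f \<in> E"
  using transl_invariant by blast

lemma transl_diff: "transl h (f - g) = transl h f - transl h g"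
  and transl_cmult: "transl h (\<lambda>x. c * f x) = (\<lambda>x. c * transl h f x)"
  and transl_transl: "transl h (transl k f) = transl (h + k) f"
  by (auto simp: transl_def fun_eq_iff algebra_simps)

lemma weight_ge: "f \<in> E \<Longrightarrow> nE f \<le> 1 \<Longrightarrow> nE (transl (- h) f) \<le> weight h"
  unfolding transl_weight_def by (rule cSUP_upper[OF _ transl_bounded]) simp

lemma weight_le: "(\<And>f. f \<in> E \<Longrightarrow> nE f \<le> 1 \<Longrightarrow> nE (transl (- h) f) \<le> B) \<Longrightarrow> weight h \<le> B"
  unfolding transl_weight_def by (rule cSUP_least) (use ES.zero_mem nE_zero in auto)

lemma weight_nonneg: "0 \<le> weight h"
proof -
  have "0 \<le> nE (transl (- h) 0)" by (intro nE_nonneg transl_mem ES.zero_mem)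
  also have "\<dots> \<le> weight h" by (intro weight_ge ES.zero_mem) (simp add: nE_zero)
  finally show ?thesis .
qed

lemma transl_bound:
  assumes "f \<in> E"
  shows "nE (transl (- h) f) \<le> weight h * nE f"
proof (cases "nE f = 0")
  case True
  then have f: "f = 0" using assms nE_zero_iff by simp
  have "transl (- h) f = 0" unfolding f by (simp add: transl_def fun_eq_iff)
  then show ?thesis using f nE_zero by simp
next
  case False
  then have pos: "nE f > 0" using nE_nonneg[OF assms] by simp
  let ?c = "of_real (1 / nE f) :: complex"
  have "nE (transl (- h) (\<lambda>x. ?c * f x)) \<le> weight h"
    using pos by (intro weight_ge ES.scale_mem assms) (simp only: nE_scale[OF assms], simp add: norm_divide)
  also have "nE (transl (- h) (\<lambda>x. ?c * f x)) = 1 / nE f * nE (transl (- h) f)"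
    unfolding transl_cmult using pos nE_scale[OF transl_mem[OF assms], of ?c "- h"] by (simp add: norm_divide)
  finally show ?thesis using pos by (simp add: field_simps)
qed

lemma shift_bound: "\<phi> \<in> schwartz \<Longrightarrow> nE (schwartz_dist (\<lambda>x. \<phi> (x - t))) \<le> weight t * nE (schwartz_dist \<phi>)"
  using transl_bound[OF dist_mem] by (simp add: schwartz_dist_shift)

lemma weight_submult: "weight (s + t) \<le> weight s * weight t"
proof (rule weight_le)
  fix f assume f: "f \<in> E" "nE f \<le> 1"
  have "nE (transl (- (s + t)) f) = nE (transl (- s) (transl (- t) f))" by (simp add: transl_transl)
  also have "\<dots> \<le> weight s * nE (transl (- t) f)" by (intro transl_bound transl_mem f)
  also have "\<dots> \<le> weight s * weight t" by (intro mult_left_mono weight_ge weight_nonneg f)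
  finally show "nE (transl (- (s + t)) f) \<le> weight s * weight t" .
qed

lemma weight_polynomial: "\<exists>W k. W > 0 \<and> (\<forall>t. weight t \<le> W * (1 + norm t) ^ k)"
proof -
  obtain M \<tau> where M: "M > 0" "\<tau> \<ge> 0" "\<And>t. weight t \<le> M * (1 + norm t) powr \<tau>" using weight_growth by blast
  have "weight t \<le> M * (1 + norm t) ^ nat \<lceil>\<tau>\<rceil>" for t
  proof -
    have "(1 + norm t) powr \<tau> \<le> (1 + norm t) powr real (nat \<lceil>\<tau>\<rceil>)"
      using M(2) by (intro powr_mono) (auto simp: real_nat_ceiling_ge)
    also have "\<dots> = (1 + norm t) ^ nat \<lceil>\<tau>\<rceil>" by (rule powr_realpow) (simp add: add_pos_nonneg)
    finally have "M * (1 + norm t) powr \<tau> \<le> M * (1 + norm t) ^ nat \<lceil>\<tau>\<rceil>" using M(1) by simp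
    then show ?thesis using M(3)[of t] by linarith
  qed
  then show ?thesis using M(1) by blast
qed

text \<open>Chosen once, so that later estimates can name their constants. The real exponent of the
  growth condition is rounded up to an integer, which keeps the weights of the form
  \<open>(1 + norm t) ^ k\<close>.\<close>

definition wconst :: real where "wconst = (SOME W. W > 0 \<and> (\<exists>k. \<forall>t. weight t \<le> W * (1 + norm t) ^ k))"
definition wdeg :: nat where "wdeg = (SOME k. \<forall>t. weight t \<le> wconst * (1 + norm t) ^ k)"

lemma wconst_pos: "wconst > 0" and weight_bound: "weight t \<le> wconst * (1 + norm t) ^ wdeg"
proof -
  have 1: "wconst > 0 \<and> (\<exists>k. \<forall>t. weight t \<le> wconst * (1 + norm t) ^ k)"
    unfolding wconst_def by (rule someI_ex) (use weight_polynomial in blast)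
  then show "wconst > 0" by blast
  have "\<forall>t. weight t \<le> wconst * (1 + norm t) ^ wdeg"
    unfolding wdeg_def by (rule someI_ex) (use 1 in blast)
  then show "weight t \<le> wconst * (1 + norm t) ^ wdeg" by blast
qed

text \<open>For Schwartz functions the continuity comes from the embedding into \<open>E\<close>. It
  passes to all of \<open>E\<close> because the weight is bounded near \<open>s\<close>, so that the
  error of an approximation stays small under all nearby translations.\<close>

lemma transl_continuous:
  assumes f: "f \<in> E" and e: "e > 0"
  shows "\<forall>\<^sub>F t in at s. nE (transl (- t) f - transl (- s) f) < e"
proof -
  define C where "C = wconst * (2 + norm s) ^ wdeg"
  have C: "C > 0" unfolding C_def using wconst_pos by (intro mult_pos_pos zero_less_power) (auto simp: add_pos_nonneg)
  have wC: "weight t \<le> C" if "norm (t - s) < 1" for t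
  proof -
    have "norm t \<le> norm s + 1" using norm_triangle_ineq[of "t - s" s] that by simp
    then have "wconst * (1 + norm t) ^ wdeg \<le> C"
      unfolding C_def using wconst_pos by (intro mult_left_mono power_mono) auto
    then show ?thesis using weight_bound[of t] by linarith
  qed
  obtain \<psi> where \<psi>: "\<psi> \<in> schwartz" "nE (schwartz_dist \<psi> - f) < e / (4 * C)"
    using dense[OF f, of "e / (4 * C)"] e C by auto
  let ?g = "schwartz_dist \<psi>"
  have g: "?g \<in> E" "f - ?g \<in> E" using f \<psi> by (auto intro: dist_mem ES.diff_mem)
  have gb: "nE (f - ?g) < e / (4 * C)" using \<psi>(2) nE_minus_swap[of f ?g] f dist_mem[OF \<psi>(1)] by simp
  obtain K m where K: "K \<ge> 0" "\<And>\<phi>. \<phi> \<in> schwartz \<Longrightarrow> nE (schwartz_dist \<phi>) \<le> K * schwartz_norm m \<phi>"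
    using schwartz_embedding by blast
  let ?w = "\<lambda>t. K * (real CARD('n) * norm (t - s) * (1 + norm (t - s)) ^ m * schwartz_norm (Suc m) \<psi> * (1 + norm s) ^ m)"
  have "(?w \<longlongrightarrow> K * (real CARD('n) * norm (s - s) * (1 + norm (s - s)) ^ m * schwartz_norm (Suc m) \<psi> * (1 + norm s) ^ m)) (at s)"
    by (intro tendsto_intros)
  then have "(?w \<longlongrightarrow> 0) (at s)" by simp
  then have ev: "\<forall>\<^sub>F t in at s. ?w t < e / 4" using e by (auto dest: order_tendstoD(2)[of _ _ _ "e / 4"])
  have ev2: "\<forall>\<^sub>F t in at s. norm (t - s) < 1"
    unfolding eventually_at by (intro exI[of _ 1]) (auto simp: dist_norm)
  show ?thesis
    using eventually_conj[OF ev ev2]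
  proof (rule eventually_mono)
    fix t assume t: "?w t < e / 4 \<and> norm (t - s) < 1"
    have half: "nE (transl (- u) (f - ?g)) < e / 4" if "norm (u - s) < 1" for u
    proof -
      have "nE (transl (- u) (f - ?g)) \<le> weight u * nE (f - ?g)" by (rule transl_bound[OF g(2)])
      also have "\<dots> \<le> C * nE (f - ?g)" by (intro mult_right_mono wC that nE_nonneg g)
      also have "\<dots> < e / 4" using gb C by (simp add: field_simps)
      finally show ?thesis .
    qed
    have "nE (schwartz_dist (\<lambda>x. \<psi> (x - t) - \<psi> (x - s))) \<le> K * schwartz_norm m (\<lambda>x. \<psi> (x - t) - \<psi> (x - s))"
      by (intro K schwartz_diff schwartz_shift \<psi>)
    also have "\<dots> \<le> ?w t" by (intro mult_left_mono K schwartz_norm_shift_shift \<psi>)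
    finally have mid: "nE (transl (- t) ?g - transl (- s) ?g) < e / 4"
      using t schwartz_dist_diff[OF schwartz_shift[OF \<psi>(1), of t] schwartz_shift[OF \<psi>(1), of s]]
      by (simp add: fun_diff_def schwartz_dist_shift[OF \<psi>(1)])
    define a b c where "a = transl (- t) (f - ?g)" and "b = transl (- t) ?g - transl (- s) ?g" and "c = transl (- s) (f - ?g)"
    have abc: "a \<in> E" "b \<in> E" "c \<in> E"
      unfolding a_def b_def c_def using g by (simp_all add: transl_mem ES.diff_mem)
    have "nE (transl (- t) f - transl (- s) f) = nE (a + (b - c))" by (simp add: a_def b_def c_def transl_diff)
    also have "\<dots> \<le> nE a + nE (b - c)" by (rule nE_triangle[OF abc(1) ES.diff_mem[OF abc(2,3)]])
    also have "\<dots> \<le> nE a + (nE b + nE c)" by (rule add_left_mono[OF nE_triangle_diff[OF abc(2,3)]])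
    also have "\<dots> < e" unfolding a_def b_def c_def using half[of t] half[of s] mid t e by simp
    finally show "nE (transl (- t) f - transl (- s) f) < e" .
  qed
qed

text \<open>As a supremum of continuous functions the weight is lower semicontinuous.\<close>

lemma weight_measurable [measurable]: "weight \<in> borel_measurable borel"
proof -
  have "open {t. c < weight t}" for c
  proof (subst open_subopen, intro ballI)
    fix s assume s: "s \<in> {t. c < weight t}"
    have "\<exists>f\<in>E. nE f \<le> 1 \<and> c < nE (transl (- s) f)"
      using weight_le[of s c] s by (meson mem_Collect_eq not_le)
    then obtain f where f: "f \<in> E" "nE f \<le> 1" "c < nE (transl (- s) f)" by blast
    have "\<forall>\<^sub>F t in at s. nE (transl (- t) f - transl (- s) f) < nE (transl (- s) f) - c"
      using f by (intro transl_continuous) auto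
    then have "\<forall>\<^sub>F t in at s. c < weight t"
    proof (rule eventually_mono)
      fix t assume t: "nE (transl (- t) f - transl (- s) f) < nE (transl (- s) f) - c"
      have tE: "transl (- t) f \<in> E" "transl (- s) f \<in> E" using f by (auto intro: transl_mem)
      have "nE (transl (- s) f) \<le> nE (transl (- t) f) + nE (transl (- t) f - transl (- s) f)"
        using nE_triangle_diff[of "transl (- t) f" "transl (- t) f - transl (- s) f"] tE by (simp add: ES.diff_mem)
      then show "c < weight t" using weight_ge[OF f(1,2), of t] t by linarith
    qed
    then have "\<forall>\<^sub>F t in nhds s. c < weight t" using s by (simp add: eventually_nhds_conv_at)
    then show "\<exists>T. open T \<and> s \<in> T \<and> T \<subseteq> {t. c < weight t}"
      unfolding eventually_nhds by blast
  qed
  then show ?thesis unfolding borel_measurable_iff_greater by (simp add: borel_open)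
qed

lemma weighted_integrable: "g \<in> schwartz \<Longrightarrow> integrable lborel (\<lambda>t. cmod (g t) * weight t)"
  by (rule schwartz_weighted_integrable[where B=wconst and k=wdeg]) (auto simp: weight_nonneg weight_bound)

text \<open>Taken over \<open>lborel\<close>, whereas \<open>weighted_L1_norm\<close> uses the
  completed measure; for Borel functions the values coincide.\<close>

definition wnorm :: "'n test_fun \<Rightarrow> real" where "wnorm g = (LINT t|lborel. cmod (g t) * weight t)"

lemma wnorm_nonneg: "0 \<le> wnorm g"
  unfolding wnorm_def by (intro integral_nonneg_AE AE_I2) (simp add: weight_nonneg)

lemma wnorm_eq: "g \<in> borel_measurable borel \<Longrightarrow> weighted_L1_norm weight g = wnorm g"
  unfolding weighted_L1_norm_def wnorm_def by (subst integral_completion) auto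

lemma dist_riemann_sum:
  fixes \<phi> :: "'n test_fun"
  assumes \<phi>: "\<phi> \<in> schwartz"
  shows "schwartz_dist (riemann_sum g \<phi> q) = (\<Sum>v\<in>range q. schwartz_dist (\<lambda>x. (LINT t|lborel. g t * indicator (q -` {v}) t) * \<phi> (x - v)))"
proof
  fix \<psi> :: "'n test_fun"
  have "integrable lborel (\<lambda>x. ((LINT t|lborel. g t * indicator (q -` {v}) t) * \<phi> (x - v)) * \<psi> x)" if "\<psi> \<in> schwartz" for v
    using that by (intro schwartz_bounded_mult_integrable schwartz_cmult schwartz_shift \<phi>)
  then show "schwartz_dist (riemann_sum g \<phi> q) \<psi> = (\<Sum>v\<in>range q. schwartz_dist (\<lambda>x. (LINT t|lborel. g t * indicator (q -` {v}) t) * \<phi> (x - v))) \<psi>"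
    by (auto simp: sum_fun_apply schwartz_dist_def riemann_sum_def sum_distrib_right Bochner_Integration.integral_sum)
qed

text \<open>Each Riemann sum is estimated by the triangle inequality and the translation bound. The
  sums converge to the convolution in the Schwartz norm that dominates the norm of \<open>E\<close>,
  so the estimate survives in the limit.\<close>

theorem convolution_estimate:
  assumes g: "g \<in> schwartz" and \<phi>: "\<phi> \<in> schwartz"
  shows "nE (schwartz_dist (convolution g \<phi>)) \<le> wconst * wnorm g * nE (schwartz_dist \<phi>)"
proof -
  obtain q where q: "quantizers (q :: nat \<Rightarrow> real^'n \<Rightarrow> real^'n)" using quantizers_exist by blast
  have sf: "simple_function lborel (q k)" and lim: "(\<lambda>k. q k t) \<longlonglongrightarrow> t" and qb: "norm (q k t) \<le> 2 * norm t" for k t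
    using q by (auto simp: quantizers_def)
  have qm [measurable]: "q k \<in> borel_measurable borel" for k
    using borel_measurable_simple_function[OF sf[of k]] by simp
  have gm [measurable]: "g \<in> borel_measurable borel" by (rule schwartz_measurable[OF g])
  have Ig: "integrable lborel (\<lambda>t. cmod (g t))" by (intro integrable_norm schwartz_integrable g)
  let ?n = "nE (schwartz_dist \<phi>)"
  have n0: "0 \<le> ?n" by (intro nE_nonneg dist_mem \<phi>)
  \<comment> \<open>The weight is only semicontinuous, so \<open>weight (q k t)\<close> need not
    tend to \<open>weight t\<close>. Submultiplicativity bounds it by \<open>weight t\<close> times
    the weight of \<open>q k t - t\<close>, and the polynomial bound for the latter tends to
    \<open>wconst\<close>. This is the origin of the factor \<open>wconst\<close> in the
    estimate.\<close>
  define u where "u k t = wconst * (cmod (g t) * weight t) * (1 + norm (q k t - t)) ^ wdeg" for k t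
  define w where "w t = wconst * wconst * 3 ^ wdeg * (cmod (g t) * (1 + norm t) ^ (wdeg + wdeg))" for t
  have u_le: "u k t \<le> w t" and u0: "0 \<le> u k t" for k t
  proof -
    have "norm (q k t - t) \<le> 3 * norm t" using norm_triangle_ineq4[of "q k t" t] qb[of k t] by linarith
    then have "1 + norm (q k t - t) \<le> 3 * (1 + norm t)" by simp
    then have "(1 + norm (q k t - t)) ^ wdeg \<le> 3 ^ wdeg * (1 + norm t) ^ wdeg"
      unfolding power_mult_distrib[symmetric] by (intro power_mono) auto
    then have "u k t \<le> wconst * (cmod (g t) * (wconst * (1 + norm t) ^ wdeg)) * (3 ^ wdeg * (1 + norm t) ^ wdeg)"
      unfolding u_def using wconst_pos weight_bound[of t] weight_nonneg[of t]
      by (intro mult_mono mult_left_mono mult_nonneg_nonneg) auto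
    then show "u k t \<le> w t" by (simp add: w_def power_add mult_ac)
    show "0 \<le> u k t" unfolding u_def using wconst_pos weight_nonneg[of t] by (intro mult_nonneg_nonneg) auto
  qed
  have um [measurable]: "u k \<in> borel_measurable borel" for k unfolding u_def[abs_def] by measurable
  have Iw: "integrable lborel w"
    unfolding w_def using schwartz_weighted_integrable[OF g, of "\<lambda>t. (1 + norm t) ^ (wdeg + wdeg)" 1 "wdeg + wdeg"]
    by (intro integrable_mult_right) auto
  have Iu: "integrable lborel (u k)" for k
    by (rule Bochner_Integration.integrable_bound[OF Iw]) (auto intro!: AE_I2 order_trans[OF u_le] simp: u0)
  have R: "nE (schwartz_dist (riemann_sum g \<phi> (q k))) \<le> (LINT t|lborel. u k t) * ?n" for k
  proof -
    let ?c = "\<lambda>v. LINT t|lborel. g t * indicator (q k -` {v}) t"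
    have cb: "cmod (?c v) \<le> (LINT t|lborel. cmod (g t) * indicator (q k -` {v}) t)" for v
    proof -
      have "cmod (g t * indicator (q k -` {v}) t) = cmod (g t) * indicator (q k -` {v}) t" for t
        by (simp add: norm_mult indicator_def)
      then show ?thesis using integral_norm_bound[of lborel "\<lambda>t. g t * indicator (q k -` {v}) t"] by simp
    qed
    have "nE (schwartz_dist (riemann_sum g \<phi> (q k))) \<le> (\<Sum>v\<in>range (q k). nE (schwartz_dist (\<lambda>x. ?c v * \<phi> (x - v))))"
      unfolding dist_riemann_sum[OF \<phi>] by (intro nE_sum dist_mem schwartz_cmult schwartz_shift \<phi>)
    also have "\<dots> \<le> (\<Sum>v\<in>range (q k). (LINT t|lborel. cmod (g t) * indicator (q k -` {v}) t) * (weight v * ?n))"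
    proof (rule sum_mono)
      fix v
      have "nE (schwartz_dist (\<lambda>x. ?c v * \<phi> (x - v))) = cmod (?c v) * nE (schwartz_dist (\<lambda>x. \<phi> (x - v)))"
        unfolding schwartz_dist_cmult by (intro nE_scale dist_mem schwartz_shift \<phi>)
      also have "\<dots> \<le> (LINT t|lborel. cmod (g t) * indicator (q k -` {v}) t) * (weight v * ?n)"
        by (intro mult_mono cb shift_bound \<phi> nE_nonneg dist_mem schwartz_shift integral_nonneg_AE AE_I2) auto
      finally show "nE (schwartz_dist (\<lambda>x. ?c v * \<phi> (x - v))) \<le> (LINT t|lborel. cmod (g t) * indicator (q k -` {v}) t) * (weight v * ?n)" .
    qed
    also have "\<dots> = (\<Sum>v\<in>range (q k). (LINT t|lborel. cmod (g t) * indicator (q k -` {v}) t) * weight v) * ?n"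
      by (simp add: sum_distrib_right mult.assoc)
    also have "\<dots> = (LINT t|lborel. cmod (g t) * weight (q k t)) * ?n"
      using simple_function_integral_sum(1)[OF Ig sf, of k weight] by simp
    also have "\<dots> \<le> (LINT t|lborel. u k t) * ?n"
    proof (intro mult_right_mono n0 integral_mono Iu)
      show "integrable lborel (\<lambda>t. cmod (g t) * weight (q k t))"
        by (rule simple_function_integral_sum(2)[OF Ig sf])
      fix t
      have "weight (q k t) = weight (t + (q k t - t))" by simp
      also have "\<dots> \<le> weight t * (wconst * (1 + norm (q k t - t)) ^ wdeg)"
        using weight_submult[of t "q k t - t"] mult_left_mono[OF weight_bound[of "q k t - t"] weight_nonneg[of t]] by linarith
      finally have "cmod (g t) * weight (q k t) \<le> cmod (g t) * (weight t * (wconst * (1 + norm (q k t - t)) ^ wdeg))"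
        by (rule mult_left_mono) simp
      then show "cmod (g t) * weight (q k t) \<le> u k t" by (simp add: u_def mult_ac)
    qed
    finally show ?thesis .
  qed
  have lim1: "(\<lambda>k. LINT t|lborel. u k t) \<longlonglongrightarrow> (LINT t|lborel. wconst * (cmod (g t) * weight t))"
  proof (rule integral_dominated_convergence[OF _ _ Iw])
    show "AE t in lborel. (\<lambda>k. u k t) \<longlonglongrightarrow> wconst * (cmod (g t) * weight t)"
    proof (rule AE_I2)
      fix t
      have "(\<lambda>k. u k t) \<longlonglongrightarrow> wconst * (cmod (g t) * weight t) * (1 + norm (t - t)) ^ wdeg"
        unfolding u_def by (intro tendsto_intros lim)
      then show "(\<lambda>k. u k t) \<longlonglongrightarrow> wconst * (cmod (g t) * weight t)" by simp
    qed
    show "AE t in lborel. norm (u k t) \<le> w t" for k using u_le u0 by (intro AE_I2) simp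
  qed auto
  obtain K m where K: "K \<ge> 0" "\<And>\<phi>. \<phi> \<in> schwartz \<Longrightarrow> nE (schwartz_dist \<phi>) \<le> K * schwartz_norm m \<phi>"
    using schwartz_embedding by blast
  note cs = convolution_schwartz[OF g \<phi>] and rs = riemann_sum_schwartz[OF \<phi>, of g]
  have "nE (schwartz_dist (convolution g \<phi>)) \<le>
    K * schwartz_norm m (\<lambda>x. convolution g \<phi> x - riemann_sum g \<phi> (q k) x) + (LINT t|lborel. u k t) * ?n" for k
  proof -
    have d: "schwartz_dist (\<lambda>x. convolution g \<phi> x - riemann_sum g \<phi> (q k) x) = schwartz_dist (convolution g \<phi>) - schwartz_dist (riemann_sum g \<phi> (q k))"
      using schwartz_dist_diff[OF cs rs] by (simp add: fun_diff_def)
    have "nE (schwartz_dist (convolution g \<phi>)) = nE ((schwartz_dist (convolution g \<phi>) - schwartz_dist (riemann_sum g \<phi> (q k))) + schwartz_dist (riemann_sum g \<phi> (q k)))"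
      by simp
    also have "\<dots> \<le> nE (schwartz_dist (convolution g \<phi>) - schwartz_dist (riemann_sum g \<phi> (q k))) + nE (schwartz_dist (riemann_sum g \<phi> (q k)))"
      by (intro nE_triangle ES.diff_mem dist_mem cs rs)
    also have "\<dots> \<le> K * schwartz_norm m (\<lambda>x. convolution g \<phi> x - riemann_sum g \<phi> (q k) x) + (LINT t|lborel. u k t) * ?n"
      unfolding d[symmetric] by (intro add_mono K R schwartz_diff cs rs)
    finally show ?thesis .
  qed
  moreover have "(\<lambda>k. K * schwartz_norm m (\<lambda>x. convolution g \<phi> x - riemann_sum g \<phi> (q k) x) + (LINT t|lborel. u k t) * ?n)
    \<longlonglongrightarrow> K * 0 + (LINT t|lborel. wconst * (cmod (g t) * weight t)) * ?n"
    by (intro tendsto_intros lim1 riemann_sum_tendsto g \<phi> q)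
  ultimately have "nE (schwartz_dist (convolution g \<phi>)) \<le> K * 0 + (LINT t|lborel. wconst * (cmod (g t) * weight t)) * ?n"
    by (intro tendsto_lowerbound[where F=sequentially]) auto
  then show ?thesis by (simp add: wnorm_def)
qed

end

context transl_inv_banach
begin

text \<open>Convolution with a Schwartz function is defined on all distributions by transposition, whereas
  \<open>conv_ext\<close> is a definite description that has to be shown to denote.\<close>

definition cv :: "'n test_fun \<Rightarrow> 'n tdist \<Rightarrow> 'n tdist" where
  "cv g f = (\<lambda>\<phi>. if \<phi> \<in> schwartz then f (convolution (\<lambda>x. g (- x)) \<phi>) else 0)"

lemma cv_diff: "cv g (f - h) = cv g f - cv g h"
  and cv_add: "cv g (f + h) = cv g f + cv g h"
  and cv_cmult: "cv g (\<lambda>x. c * f x) = (\<lambda>x. c * cv g f x)"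
  by (auto simp: cv_def fun_eq_iff)

text \<open>Either side is the double integral of \<open>g t * \<psi> (x - t) * \<phi> x\<close>.
  \<open>functional_convolution\<close> is used once with \<open>\<phi>\<close> and once with
  \<open>\<psi>\<close> as the translated function, with the substitution of \<open>- t\<close> for
  \<open>t\<close> in between.\<close>

lemma cv_schwartz_dist:
  assumes g: "g \<in> schwartz" and \<psi>: "\<psi> \<in> schwartz"
  shows "cv g (schwartz_dist \<psi>) = schwartz_dist (convolution g \<psi>)"
proof
  fix \<phi> :: "'n test_fun"
  show "cv g (schwartz_dist \<psi>) \<phi> = schwartz_dist (convolution g \<psi>) \<phi>"
  proof (cases "\<phi> \<in> schwartz")
    case \<phi>: True
    obtain K m where K: "\<And>\<eta>. \<eta> \<in> schwartz \<Longrightarrow> cmod (schwartz_dist \<phi> \<eta>) \<le> K * schwartz_norm m \<eta>"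
      using schwartz_dist_bound[OF \<phi>] by metis
    obtain K' m' where K': "\<And>\<eta>. \<eta> \<in> schwartz \<Longrightarrow> cmod (schwartz_dist \<psi> \<eta>) \<le> K' * schwartz_norm m' \<eta>"
      using schwartz_dist_bound[OF \<psi>] by metis
    define h where "h t = g t * schwartz_dist \<psi> (\<lambda>x. \<phi> (x + t))" for t
    have "continuous_on UNIV (\<lambda>t. schwartz_dist \<psi> (\<lambda>x. \<phi> (x - t)))"
      by (rule shift_functional_continuous(1)[OF \<phi> schwartz_dist_linear[OF \<psi>] K'])
    then have "continuous_on UNIV ((\<lambda>t. schwartz_dist \<psi> (\<lambda>x. \<phi> (x - t))) \<circ> uminus)"
      by (intro continuous_on_compose continuous_intros) (auto intro: continuous_on_subset)
    then have c: "continuous_on UNIV (\<lambda>t. schwartz_dist \<psi> (\<lambda>x. \<phi> (x + t)))" by (simp add: o_def)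
    have hm: "h \<in> borel_measurable borel"
      unfolding h_def by (rule borel_measurable_times[OF schwartz_measurable[OF g] borel_measurable_continuous_onI[OF c]])
    have sh: "schwartz_dist \<psi> (\<lambda>x. \<phi> (x + t)) = schwartz_dist \<phi> (\<lambda>x. \<psi> (x - t))" for t
    proof -
      have [measurable]: "\<phi> \<in> borel_measurable borel" "\<psi> \<in> borel_measurable borel"
        using \<phi> \<psi> by (auto intro: schwartz_measurable)
      have "(LINT x|lborel. \<psi> (x + t - t) * \<phi> (x + t)) = (LINT x|lborel. \<psi> (x - t) * \<phi> x)"
        by (rule lborel_shift) measurable
      then show ?thesis
        using \<phi> \<psi> by (simp add: schwartz_dist_apply schwartz_shift schwartz_shift_plus mult.commute)
    qed
    have "cv g (schwartz_dist \<psi>) \<phi> = schwartz_dist \<psi> (convolution (\<lambda>x. g (- x)) \<phi>)" using \<phi> by (simp add: cv_def)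
    also have "\<dots> = (LINT t|lborel. g (- t) * schwartz_dist \<psi> (\<lambda>x. \<phi> (x - t)))"
      by (rule functional_convolution(1)[OF schwartz_reflect[OF g] \<phi> schwartz_dist_linear[OF \<psi>] K'])
    also have "\<dots> = (LINT t|lborel. h (0 - t))" by (simp add: h_def)
    also have "\<dots> = (LINT t|lborel. h t)" by (rule lborel_reflect_shift(2)[OF hm])
    also have "\<dots> = (LINT t|lborel. g t * schwartz_dist \<phi> (\<lambda>x. \<psi> (x - t)))" by (simp add: h_def sh)
    also have "\<dots> = schwartz_dist \<phi> (convolution g \<psi>)"
      by (rule functional_convolution(1)[OF g \<psi> schwartz_dist_linear[OF \<phi>] K, symmetric])
    also have "\<dots> = schwartz_dist (convolution g \<psi>) \<phi>"
      by (rule schwartz_dist_commute[OF \<phi> convolution_schwartz[OF g \<psi>]])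
    finally show ?thesis .
  qed (simp add: cv_def schwartz_dist_def)
qed

text \<open>The images of a Schwartz approximation of \<open>f\<close> form a Cauchy sequence by
  \<open>convolution_estimate\<close>. Its limit in \<open>E\<close> is identified with
  \<open>cv g f\<close> by evaluation at Schwartz functions.\<close>

lemma cv_mem_bound:
  assumes g: "g \<in> schwartz" and f: "f \<in> E"
  shows "cv g f \<in> E" "nE (cv g f) \<le> wconst * wnorm g * nE f"
proof -
  obtain \<psi> where \<psi>: "\<And>k. \<psi> k \<in> schwartz" "(\<lambda>k. nE (schwartz_dist (\<psi> k) - f)) \<longlonglongrightarrow> 0"
    using dense_sequence[OF f] by metis
  define C where "C = wconst * wnorm g"
  have C: "C \<ge> 0" unfolding C_def using wconst_pos wnorm_nonneg by (intro mult_nonneg_nonneg) auto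
  define s where "s k = schwartz_dist (convolution g (\<psi> k))" for k
  have sE: "s k \<in> E" for k unfolding s_def by (intro dist_mem convolution_schwartz g \<psi>)
  have dE: "schwartz_dist (\<psi> k) - f \<in> E" for k by (rule ES.diff_mem[OF dist_mem[OF \<psi>(1)] f])
  have s_bound: "nE (s m - s k) \<le> C * (nE (schwartz_dist (\<psi> m) - f) + nE (schwartz_dist (\<psi> k) - f))" for m k
  proof -
    have "s m - s k = schwartz_dist (convolution g (\<lambda>x. \<psi> m x - \<psi> k x))"
      using schwartz_dist_diff[OF convolution_schwartz[OF g \<psi>(1)] convolution_schwartz[OF g \<psi>(1)], of m k]
      by (simp add: s_def convolution_diff_right g \<psi> fun_diff_def)
    then have "nE (s m - s k) \<le> C * nE (schwartz_dist (\<lambda>x. \<psi> m x - \<psi> k x))"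
      using convolution_estimate[OF g schwartz_diff[OF \<psi>(1)[of m] \<psi>(1)[of k]]] by (simp add: C_def)
    also have "schwartz_dist (\<lambda>x. \<psi> m x - \<psi> k x) = (schwartz_dist (\<psi> m) - f) - (schwartz_dist (\<psi> k) - f)"
      using schwartz_dist_diff[OF \<psi>(1)[of m] \<psi>(1)[of k]] by (simp add: fun_diff_def)
    finally show ?thesis using mult_left_mono[OF nE_triangle_diff[OF dE dE] C, of m k] by linarith
  qed
  have "\<exists>N. \<forall>m\<ge>N. \<forall>k\<ge>N. nE (s m - s k) < e" if e: "e > 0" for e
  proof -
    have "\<forall>\<^sub>F k in sequentially. nE (schwartz_dist (\<psi> k) - f) < e / (2 * C + 2)"
      using order_tendstoD(2)[OF \<psi>(2), of "e / (2 * C + 2)"] e C by simp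
    then obtain N where N: "\<And>k. k \<ge> N \<Longrightarrow> nE (schwartz_dist (\<psi> k) - f) < e / (2 * C + 2)"
      by (auto simp: eventually_sequentially)
    show ?thesis
    proof (intro exI[of _ N] allI impI)
      fix m k assume "N \<le> m" "N \<le> k"
      then have "nE (schwartz_dist (\<psi> m) - f) + nE (schwartz_dist (\<psi> k) - f) \<le> 2 * (e / (2 * C + 2))"
        using N[of m] N[of k] by linarith
      then have "nE (s m - s k) \<le> C * (2 * (e / (2 * C + 2)))"
        using s_bound[of m k] mult_left_mono[OF _ C] order_trans by blast
      also have "\<dots> < e" using e C by (simp add: field_simps)
      finally show "nE (s m - s k) < e" .
    qed
  qed
  then obtain h where h: "h \<in> E" "(\<lambda>k. nE (s k - h)) \<longlonglongrightarrow> 0" using complete[of s] sE by metis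
  have "h = cv g f"
  proof
    fix \<phi> :: "'n test_fun"
    show "h \<phi> = cv g f \<phi>"
    proof (cases "\<phi> \<in> schwartz")
      case True
      have c: "convolution (\<lambda>x. g (- x)) \<phi> \<in> schwartz" by (intro convolution_schwartz schwartz_reflect g True)
      have "(\<lambda>k. s k \<phi>) \<longlonglongrightarrow> h \<phi>" by (rule tempered_limit[OF True h(1) sE h(2)])
      moreover have "s k \<phi> = schwartz_dist (\<psi> k) (convolution (\<lambda>x. g (- x)) \<phi>)" for k
        unfolding s_def cv_schwartz_dist[OF g \<psi>(1), symmetric] using True by (simp add: cv_def)
      ultimately have "(\<lambda>k. schwartz_dist (\<psi> k) (convolution (\<lambda>x. g (- x)) \<phi>)) \<longlonglongrightarrow> h \<phi>" by simp
      from LIMSEQ_unique[OF this tempered_limit[OF c f dist_mem[OF \<psi>(1)] \<psi>(2)]]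
      show ?thesis using True by (simp add: cv_def)
    qed (use outside[OF h(1)] in \<open>simp add: cv_def\<close>)
  qed
  then show "cv g f \<in> E" using h by simp
  have "nE h \<le> nE (s k - h) + C * (nE (schwartz_dist (\<psi> k) - f) + nE f)" for k
  proof -
    have "nE h \<le> nE (s k) + nE (s k - h)"
      using nE_triangle_diff[OF sE[of k] ES.diff_mem[OF sE[of k] h(1)]] by simp
    moreover have "nE (s k) \<le> C * nE (schwartz_dist (\<psi> k))"
      unfolding s_def C_def by (rule convolution_estimate[OF g \<psi>(1)])
    moreover have "nE (schwartz_dist (\<psi> k)) \<le> nE (schwartz_dist (\<psi> k) - f) + nE f"
      using nE_triangle[OF dE[of k] f] by simp
    ultimately show ?thesis using mult_left_mono[OF _ C] by (smt (verit))
  qed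
  moreover have "(\<lambda>k. nE (s k - h) + C * (nE (schwartz_dist (\<psi> k) - f) + nE f)) \<longlonglongrightarrow> 0 + C * (0 + nE f)"
    by (intro tendsto_intros h \<psi>)
  ultimately have "nE h \<le> 0 + C * (0 + nE f)"
    by (intro tendsto_lowerbound[where F=sequentially]) auto
  then show "nE (cv g f) \<le> wconst * wnorm g * nE f" using \<open>h = cv g f\<close> by (simp add: C_def)
qed

lemma cv_dist_derivs_right: "g \<in> schwartz \<Longrightarrow> dist_derivs js (cv g f) = cv g (dist_derivs js f)"
proof (induction js)
  case (Cons j js)
  have "dist_deriv j (cv g u) = cv g (dist_deriv j u)" for u
    using Cons.prems
    by (auto simp: dist_deriv_def cv_def fun_eq_iff convolution_schwartz schwartz_reflect schwartz_partial_deriv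
        convolution_partial_deriv)
  with Cons show ?case by (simp add: dist_derivs_Cons)
qed simp

lemma cv_dist_derivs_left:
  assumes "g \<in> schwartz" and f: "f \<in> E"
  shows "dist_derivs js (cv g f) = cv (partial_derivs js g) f"
proof (induction js)
  case (Cons j js)
  obtain K m where lin: "clinear_functional_on schwartz f" by (rule tempered_functional[OF f])
  have "dist_deriv j (cv h f) = cv (partial_deriv j h) f" if h: "h \<in> schwartz" for h
  proof
    fix \<phi> :: "'n test_fun"
    show "dist_deriv j (cv h f) \<phi> = cv (partial_deriv j h) f \<phi>"
    proof (cases "\<phi> \<in> schwartz")
      case True
      let ?h' = "\<lambda>x. partial_deriv j h (- x)"
      note hs = schwartz_reflect[OF h]
      \<comment> \<open>The sign from differentiating the reflected function cancels the one in
        \<open>dist_deriv\<close>.\<close>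
      have "partial_deriv j (\<lambda>x. h (- x)) = (\<lambda>x. - 1 * ?h' x)"
        using partial_derivs_affine[OF schwartz_smooth[OF h], of "[j]" "-1" 0] by (simp add: partial_derivs_Cons)
      then have "convolution (\<lambda>x. h (- x)) (partial_deriv j \<phi>) = (\<lambda>x. - 1 * convolution ?h' \<phi> x)"
        using convolution_partial_deriv[OF hs True, of j] convolution_partial_derivs_left[OF hs True, of "[j]"]
          convolution_cmult_left[of "-1" ?h' \<phi>] by (simp add: partial_derivs_Cons)
      moreover have "f (\<lambda>x. - 1 * convolution ?h' \<phi> x) = - 1 * f (convolution ?h' \<phi>)"
        using lin convolution_schwartz[OF schwartz_reflect[OF schwartz_partial_deriv(1)[OF h, of j]] True]
        unfolding clinear_functional_on_def by blast
      ultimately show ?thesis using True schwartz_partial_deriv(1)[OF True] by (simp add: dist_deriv_def cv_def)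
    qed (simp add: dist_deriv_def cv_def)
  qed
  with Cons schwartz_partial_derivs(1)[OF assms(1)] show ?case
    by (simp add: dist_derivs_Cons partial_derivs_Cons)
qed simp

section \<open>The space of smooth vectors\<close>

lemma DE_D: "u \<in> DE_space E \<Longrightarrow> dist_derivs js u \<in> E"
  by (simp add: DE_space_def)

lemma DE_subset: "u \<in> DE_space E \<Longrightarrow> u \<in> E"
  by (simp add: DE_space_def)

lemma DE_norm_ge: "length js \<le> N \<Longrightarrow> nE (dist_derivs js u) \<le> DE_norm nE N u"
  unfolding DE_norm_def by (intro Max_ge finite_imageI finite_lists_le) auto

lemma DE_norm_le: "(\<And>js. length js \<le> N \<Longrightarrow> nE (dist_derivs js u) \<le> B) \<Longrightarrow> DE_norm nE N u \<le> B"
  unfolding DE_norm_def by (intro Max.boundedI finite_imageI finite_lists_le) (auto intro: exI[of _ "[]"])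

text \<open>The maximum over finitely many lists is attained, which preserves strictness.\<close>

lemma DE_norm_less: "(\<And>js. length js \<le> N \<Longrightarrow> nE (dist_derivs js u) < B) \<Longrightarrow> DE_norm nE N u < B"
proof -
  assume B: "\<And>js. length js \<le> N \<Longrightarrow> nE (dist_derivs js u) < B"
  have "Max ((\<lambda>js. nE (dist_derivs js u)) ` {js :: 'n list. length js \<le> N}) \<in> (\<lambda>js. nE (dist_derivs js u)) ` {js. length js \<le> N}"
    by (intro Max_in finite_imageI finite_lists_le) (auto intro: exI[of _ "[]"])
  then show "DE_norm nE N u < B" using B by (auto simp: DE_norm_def)
qed

lemma DE_norm_mono: "M \<le> N \<Longrightarrow> DE_norm nE M u \<le> DE_norm nE N u"
  by (rule DE_norm_le) (rule DE_norm_ge, simp)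

lemma DE_norm_scale:
  assumes u: "u \<in> DE_space E"
  shows "DE_norm nE N (\<lambda>x. c * u x) = cmod c * DE_norm nE N u"
proof -
  have e: "nE (dist_derivs js (\<lambda>x. c * u x)) = cmod c * nE (dist_derivs js u)" for js
    unfolding dist_derivs_cmult by (rule nE_scale[OF DE_D[OF u]])
  show ?thesis
  proof (rule antisym)
    show "DE_norm nE N (\<lambda>x. c * u x) \<le> cmod c * DE_norm nE N u"
      by (rule DE_norm_le) (simp add: e DE_norm_ge mult_left_mono)
    show "cmod c * DE_norm nE N u \<le> DE_norm nE N (\<lambda>x. c * u x)"
    proof (cases "c = 0")
      case True
      have "0 \<le> nE (dist_derivs [] (\<lambda>x. c * u x))" unfolding e by (intro mult_nonneg_nonneg nE_nonneg DE_D u) simp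
      also have "\<dots> \<le> DE_norm nE N (\<lambda>x. c * u x)" by (rule DE_norm_ge) simp
      finally show ?thesis using True by simp
    next
      case False
      have "DE_norm nE N u \<le> DE_norm nE N (\<lambda>x. c * u x) / cmod c"
      proof (rule DE_norm_le)
        fix js :: "'n list" assume "length js \<le> N"
        from DE_norm_ge[OF this, of "\<lambda>x. c * u x"]
        show "nE (dist_derivs js u) \<le> DE_norm nE N (\<lambda>x. c * u x) / cmod c"
          unfolding e using False by (simp add: field_simps)
      qed
      then show ?thesis using False by (simp add: field_simps)
    qed
  qed
qed

lemma DE_norm_triangle:
  assumes "u \<in> DE_space E" "v \<in> DE_space E"
  shows "DE_norm nE N (u + v) \<le> DE_norm nE N u + DE_norm nE N v"
proof (rule DE_norm_le)
  fix js :: "'n list" assume js: "length js \<le> N"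
  show "nE (dist_derivs js (u + v)) \<le> DE_norm nE N u + DE_norm nE N v"
    unfolding dist_derivs_add
    using nE_triangle[OF DE_D[OF assms(1)] DE_D[OF assms(2)], of js js] DE_norm_ge[OF js, of u] DE_norm_ge[OF js, of v]
    by linarith
qed

sublocale DS: directed_seminormed_space "DE_space E" "DE_seminorms nE"
proof
  show "csubspace (DE_space E)"
    unfolding csubspace_def
  proof (intro conjI ballI allI)
    have "dist_derivs js (\<lambda>x. 0 * (0::'n tdist) x) = (\<lambda>x. 0 * dist_derivs js 0 x)" for js by (rule dist_derivs_cmult)
    then have "dist_derivs js (0::'n tdist) = 0" for js by (simp add: zero_fun_def)
    then show "0 \<in> DE_space E" by (simp add: DE_space_def ES.zero_mem)
  next
    fix u v assume "u \<in> DE_space E" "v \<in> DE_space E"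
    then show "u + v \<in> DE_space E" unfolding DE_space_def by (simp add: dist_derivs_add ES.add_mem del: plus_fun_apply)
  next
    fix c u assume "u \<in> DE_space E"
    then show "(\<lambda>x. c * u x) \<in> DE_space E" unfolding DE_space_def by (simp add: dist_derivs_cmult ES.scale_mem)
  qed
next
  fix p q assume "p \<in> DE_seminorms nE" "q \<in> DE_seminorms nE"
  then obtain M N where pq: "p = DE_norm nE M" "q = DE_norm nE N" by blast
  then show "\<exists>s\<in>DE_seminorms nE. \<forall>f\<in>DE_space E. p f \<le> s f \<and> q f \<le> s f"
    by (intro bexI[of _ "DE_norm nE (max M N)"]) (auto intro: DE_norm_mono)
qed (auto simp: DE_norm_triangle DE_norm_scale)

lemma DE_norm_nonneg: "u \<in> DE_space E \<Longrightarrow> 0 \<le> DE_norm nE N u"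
  using DS.nonneg[of "DE_norm nE N" u] by simp

lemma dist_DE: "\<phi> \<in> schwartz \<Longrightarrow> schwartz_dist \<phi> \<in> DE_space E"
  by (simp add: DE_space_def dist_mem dist_derivs_schwartz_dist schwartz_partial_derivs)

lemma DE_embedding: "\<exists>K m. K \<ge> 0 \<and> (\<forall>\<phi>\<in>schwartz. DE_norm nE N (schwartz_dist \<phi>) \<le> K * schwartz_norm m \<phi>)"
proof -
  obtain K m where K: "K \<ge> 0" "\<And>\<phi>. \<phi> \<in> schwartz \<Longrightarrow> nE (schwartz_dist \<phi>) \<le> K * schwartz_norm m \<phi>"
    using schwartz_embedding by blast
  have "DE_norm nE N (schwartz_dist \<phi>) \<le> K * schwartz_norm (m + N) \<phi>" if \<phi>: "\<phi> \<in> schwartz" for \<phi>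
  proof (rule DE_norm_le)
    fix js :: "'n list" assume js: "length js \<le> N"
    have "nE (dist_derivs js (schwartz_dist \<phi>)) \<le> K * schwartz_norm m (partial_derivs js \<phi>)"
      unfolding dist_derivs_schwartz_dist[OF \<phi>] by (intro K schwartz_partial_derivs \<phi>)
    also have "\<dots> \<le> K * schwartz_norm (m + N) \<phi>"
      using schwartz_partial_derivs(2)[OF \<phi>, of m js] schwartz_norm_mono[OF \<phi>, of "m + length js" "m + N"] js K(1)
      by (intro mult_left_mono) auto
    finally show "nE (dist_derivs js (schwartz_dist \<phi>)) \<le> K * schwartz_norm (m + N) \<phi>" .
  qed
  with K(1) show ?thesis by blast
qed

text \<open>All derivatives fall on \<open>g\<close>, so only the norm of \<open>f\<close> in
  \<open>E\<close> enters. This regularisation is what later converts estimates on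
  \<open>D\<^sub>E\<close> into estimates on \<open>E\<close>.\<close>

lemma cv_DE:
  assumes g: "g \<in> schwartz" and f: "f \<in> E"
  shows "cv g f \<in> DE_space E"
    "(\<And>js. length js \<le> N \<Longrightarrow> wnorm (partial_derivs js g) \<le> C) \<Longrightarrow> DE_norm nE N (cv g f) \<le> wconst * C * nE f"
proof -
  have *: "dist_derivs js (cv g f) \<in> E" "nE (dist_derivs js (cv g f)) \<le> wconst * wnorm (partial_derivs js g) * nE f" for js
    unfolding cv_dist_derivs_left[OF g f] by (intro cv_mem_bound schwartz_partial_derivs g f)+
  show "cv g f \<in> DE_space E" using *(1) cv_mem_bound(1)[OF g f] by (simp add: DE_space_def)
  assume C: "\<And>js. length js \<le> N \<Longrightarrow> wnorm (partial_derivs js g) \<le> C"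
  show "DE_norm nE N (cv g f) \<le> wconst * C * nE f"
  proof (rule DE_norm_le)
    fix js :: "'n list" assume "length js \<le> N"
    from C[OF this] have "wconst * wnorm (partial_derivs js g) * nE f \<le> wconst * C * nE f"
      using wconst_pos nE_nonneg[OF f] by (intro mult_right_mono mult_left_mono) auto
    with *(2)[of js] show "nE (dist_derivs js (cv g f)) \<le> wconst * C * nE f" by linarith
  qed
qed

end

subsection \<open>Mollifiers\<close>

lemma bump_integral_nonzero:
  fixes c :: real
  assumes "c > 0"
  shows "(LINT x:: real ^ 'n::finite|lborel. cmod (bump (c *\<^sub>R x))) > 0"
proof -
  let ?b = "\<lambda>x:: real ^ 'n. bump (c *\<^sub>R x)"
  have S: "?b \<in> schwartz"
    using schwartz_affine[of bump c 0] bump_test_function test_functions_subset_schwartz assms by auto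
  have I: "integrable lborel (\<lambda>x. cmod (?b x))" by (intro integrable_norm schwartz_integrable S)
  have cont: "continuous_on UNIV ?b" by (rule smooth_continuous[OF schwartz_smooth[OF S]])
  have "(LINT x|lborel. cmod (?b x)) \<noteq> 0"
  proof
    assume "(LINT x|lborel. cmod (?b x)) = 0"
    then have ae: "AE x in lborel. cmod (?b x) = 0"
      using integral_nonneg_eq_0_iff_AE[OF I] by simp
    have op: "open {x. ?b x \<noteq> 0}"
      using open_vimage[OF open_Compl[OF closed_singleton] cont, of 0] by (simp add: vimage_def)
    have "{x. ?b x \<noteq> 0} \<in> null_sets lborel"
      using ae op by (subst AE_iff_null_sets) (auto simp: borel_open)
    then have "negligible {x. ?b x \<noteq> 0}"
      unfolding negligible_iff_null_sets by (rule null_sets_completionI)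
    moreover have "0 \<in> {x. ?b x \<noteq> 0}" using bump_0 by simp
    ultimately show False using open_not_negligible[OF op] by blast
  qed
  moreover have "(LINT x|lborel. cmod (?b x)) \<ge> 0" by (intro integral_nonneg_AE AE_I2) simp
  ultimately show ?thesis by linarith
qed

definition mollifier :: "nat \<Rightarrow> 'n::finite test_fun" where
  "mollifier k = (\<lambda>x. of_real (inverse (LINT x:: real ^ 'n|lborel. cmod (bump (real (Suc k) *\<^sub>R x)))) * bump (real (Suc k) *\<^sub>R x))"

lemma mollifier:
  fixes x :: "real ^ 'n::finite"
  shows "mollifier k \<in> (schwartz :: 'n test_fun set)"
    "(LINT x:: real ^ 'n|lborel. mollifier k x) = 1" "(LINT x:: real ^ 'n|lborel. cmod (mollifier k x)) = 1"
    "mollifier k x \<noteq> 0 \<Longrightarrow> norm x \<le> real CARD('n) / real (Suc k)"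
proof -
  let ?c = "real (Suc k)"
  let ?I = "LINT x:: real ^ 'n|lborel. cmod (bump (?c *\<^sub>R x))"
  have I: "?I > 0" by (rule bump_integral_nonzero) simp
  show "mollifier k \<in> (schwartz :: 'n test_fun set)"
    unfolding mollifier_def
    using schwartz_affine[of bump ?c 0] bump_test_function test_functions_subset_schwartz
    by (intro schwartz_cmult) auto
  have "(LINT x:: real ^ 'n|lborel. bump (?c *\<^sub>R x)) = (LINT x:: real ^ 'n|lborel. complex_of_real (cmod (bump (?c *\<^sub>R x))))"
    by (simp only: bump_nonneg[symmetric])
  also have "\<dots> = of_real ?I" by (rule integral_complex_of_real)
  finally have b: "(LINT x:: real ^ 'n|lborel. bump (?c *\<^sub>R x)) = of_real ?I" .
  show "(LINT x:: real ^ 'n|lborel. mollifier k x) = 1"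
    unfolding mollifier_def integral_mult_right_zero b of_real_mult[symmetric] using I by simp
  show "(LINT x:: real ^ 'n|lborel. cmod (mollifier k x)) = 1"
    unfolding mollifier_def norm_mult norm_of_real integral_mult_right_zero using I by simp
  assume "mollifier k x \<noteq> 0"
  then have "bump (?c *\<^sub>R x) \<noteq> 0" by (auto simp: mollifier_def)
  then have "?c *\<^sub>R x \<in> cbox (- 1) 1" by (rule bump_support)
  then have "\<bar>?c * x $ i\<bar> \<le> 1" for i by (simp add: mem_box_cart abs_le_iff minus_le_iff)
  then have "?c * \<bar>x $ i\<bar> \<le> 1" for i by (simp add: abs_mult)
  then have "\<bar>x $ i\<bar> \<le> 1 / ?c" for i by (simp add: field_simps)
  then have "(\<Sum>i\<in>UNIV. \<bar>x $ i\<bar>) \<le> (\<Sum>i\<in>(UNIV::'n set). 1 / ?c)" by (intro sum_mono)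
  then show "norm x \<le> real CARD('n) / ?c" using norm_le_l1_cart[of x] by simp
qed

context transl_inv_banach
begin

text \<open>Uniform in \<open>k\<close>, because all mollifiers have mass 1 and live in one fixed
  ball, on which the weight is bounded.\<close>

lemma wnorm_mollifier: "wnorm (mollifier k) \<le> wconst * (1 + real CARD('n)) ^ wdeg"
proof -
  let ?C = "wconst * (1 + real CARD('n)) ^ wdeg"
  have I: "integrable lborel (\<lambda>t::real^'n. cmod (mollifier k t))"
    by (intro integrable_norm schwartz_integrable mollifier)
  have "wnorm (mollifier k) \<le> (LINT t::real^'n|lborel. cmod (mollifier k t) * ?C)"
    unfolding wnorm_def
  proof (rule integral_mono)
    fix t :: "real^'n"
    show "cmod (mollifier k t) * weight t \<le> cmod (mollifier k t) * ?C"
    proof (cases "mollifier k t = 0")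
      case False
      have "norm t \<le> real CARD('n) / real (Suc k)" by (rule mollifier(4)[OF False])
      also have "\<dots> \<le> real CARD('n)" by (simp add: field_simps)
      finally have "wconst * (1 + norm t) ^ wdeg \<le> ?C"
        using wconst_pos by (intro mult_left_mono power_mono) auto
      then have "weight t \<le> ?C" using weight_bound[of t] by linarith
      then show ?thesis by (rule mult_left_mono) simp
    qed simp
  qed (intro weighted_integrable mollifier integrable_mult_left I)+
  also have "\<dots> = ?C" by (simp only: integral_mult_left_zero mollifier(3) mult_1)
  finally show ?thesis .
qed

lemma mollifier_schwartz_norm:
  fixes \<psi> :: "'n test_fun"
  assumes \<psi>: "\<psi> \<in> schwartz"
  shows "(\<lambda>k. schwartz_norm m (\<lambda>x. convolution (mollifier k) \<psi> x - \<psi> x)) \<longlonglongrightarrow> (0 :: real)"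
proof (rule squeeze_zero)
  let ?n = "real CARD('n)"
  let ?D = "?n * (1 + ?n) ^ m * schwartz_norm (Suc m) \<psi>"
  fix k
  show "0 \<le> schwartz_norm m (\<lambda>x. convolution (mollifier k) \<psi> x - \<psi> x)"
    by (intro schwartz_norm_nonneg schwartz_diff convolution_schwartz mollifier \<psi>)
  define w where "w t = ?n * norm t * (1 + norm t) ^ m * schwartz_norm (Suc m) \<psi>" for t :: "real^'n"
  have sn: "schwartz_norm (Suc m) \<psi> \<ge> 0" by (rule schwartz_norm_nonneg[OF \<psi>])
  have sf: "simple_function lborel (\<lambda>_. 0 :: real^'n)" by simp
  have wm: "w \<in> borel_measurable borel" unfolding w_def by measurable
  have wb: "w t \<le> ?n * schwartz_norm (Suc m) \<psi> * (1 + norm t) ^ Suc m" for t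
  proof -
    have "w t = ?n * schwartz_norm (Suc m) \<psi> * (norm t * (1 + norm t) ^ m)" by (simp add: w_def mult_ac)
    also have "\<dots> \<le> ?n * schwartz_norm (Suc m) \<psi> * ((1 + norm t) * (1 + norm t) ^ m)"
      using sn by (intro mult_left_mono mult_right_mono) auto
    finally show ?thesis by simp
  qed
  \<comment> \<open>With a single node at 0 the only coefficient is the total mass 1, so the error
    of the Riemann sum is the error of the mollification.\<close>
  have rs: "riemann_sum (mollifier k) \<psi> (\<lambda>_. 0) = \<psi>"
    by (simp add: riemann_sum_def fun_eq_iff mollifier(2))
  have "schwartz_norm m (\<lambda>x. convolution (mollifier k) \<psi> x - riemann_sum (mollifier k) \<psi> (\<lambda>_. 0) x)
    \<le> (LINT t|lborel. cmod (mollifier k t) * w t)"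
    using schwartz_norm_shift_diff[OF \<psi>, of m]
    by (intro riemann_sum_error[OF mollifier(1) \<psi> sf wm wb]) (simp add: w_def)
  also have "\<dots> \<le> (LINT t::real^'n|lborel. cmod (mollifier k t) * (?D * (?n / real (Suc k))))"
  proof (rule integral_mono)
    have w0: "0 \<le> w t" for t unfolding w_def using sn by (intro mult_nonneg_nonneg) auto
    show "integrable lborel (\<lambda>t. cmod (mollifier k t) * w t)"
      by (rule schwartz_weighted_integrable[OF mollifier(1) wm w0 wb])
    show "integrable lborel (\<lambda>t::real^'n. cmod (mollifier k t) * (?D * (?n / real (Suc k))))"
      by (intro integrable_mult_left integrable_norm schwartz_integrable mollifier)
    fix t :: "real^'n"
    show "cmod (mollifier k t) * w t \<le> cmod (mollifier k t) * (?D * (?n / real (Suc k)))"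
    proof (cases "mollifier k t = 0")
      case False
      have 1: "norm t \<le> ?n / real (Suc k)" by (rule mollifier(4)[OF False])
      also have "\<dots> \<le> ?n" by (simp add: field_simps)
      finally have "?n * norm t * (1 + norm t) ^ m * schwartz_norm (Suc m) \<psi> \<le>
          ?n * (?n / real (Suc k)) * (1 + ?n) ^ m * schwartz_norm (Suc m) \<psi>"
        using 1 sn by (intro mult_right_mono mult_mono mult_left_mono power_mono) auto
      then have "w t \<le> ?D * (?n / real (Suc k))" by (simp add: w_def mult_ac)
      then show ?thesis by (rule mult_left_mono) simp
    qed simp
  qed
  also have "\<dots> = ?D * (?n / real (Suc k))" by (simp only: integral_mult_left_zero mollifier(3) mult_1)
  finally show "schwartz_norm m (\<lambda>x. convolution (mollifier k) \<psi> x - \<psi> x) \<le> ?D * (?n / real (Suc k))" unfolding rs .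
next
  let ?n = "real CARD('n)"
  let ?D = "?n * (1 + ?n) ^ m * schwartz_norm (Suc m) \<psi>"
  have "(\<lambda>k. ?D * (?n * inverse (real (Suc k)))) \<longlonglongrightarrow> ?D * (?n * 0)"
    by (intro tendsto_mult tendsto_const LIMSEQ_inverse_real_of_nat)
  then show "(\<lambda>k. ?D * (?n / real (Suc k))) \<longlonglongrightarrow> 0" by (simp add: divide_inverse)
qed

text \<open>The operators \<open>cv (mollifier k)\<close> are uniformly bounded on \<open>E\<close>,
  which reduces the claim to Schwartz functions.\<close>

lemma mollifier_approximates:
  assumes f: "f \<in> E"
  shows "(\<lambda>k. nE (cv (mollifier k) f - f)) \<longlonglongrightarrow> 0"
proof (rule LIMSEQ_I)
  fix e :: real assume e: "e > 0"
  define C where "C = wconst * (wconst * (1 + real CARD('n)) ^ wdeg)"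
  have C: "C > 0" unfolding C_def using wconst_pos by (intro mult_pos_pos zero_less_power) auto
  obtain \<psi> where \<psi>: "\<psi> \<in> schwartz" "nE (schwartz_dist \<psi> - f) < e / (2 * (C + 1))"
    using dense[OF f, of "e / (2 * (C + 1))"] e C by auto
  let ?g = "schwartz_dist \<psi>"
  have g: "?g \<in> E" "?g - f \<in> E" using f \<psi> by (auto intro: dist_mem ES.diff_mem)
  obtain K m where K: "K \<ge> 0" "\<And>\<phi>. \<phi> \<in> schwartz \<Longrightarrow> nE (schwartz_dist \<phi>) \<le> K * schwartz_norm m \<phi>"
    using schwartz_embedding by blast
  have "(\<lambda>k. K * schwartz_norm m (\<lambda>x. convolution (mollifier k) \<psi> x - \<psi> x)) \<longlonglongrightarrow> K * 0"
    by (intro tendsto_mult tendsto_const mollifier_schwartz_norm \<psi>)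
  then have "\<forall>\<^sub>F k in sequentially. K * schwartz_norm m (\<lambda>x. convolution (mollifier k) \<psi> x - \<psi> x) < e / 2"
    using order_tendstoD(2)[of _ 0 sequentially "e / 2"] e by simp
  then obtain N where N: "\<And>k. k \<ge> N \<Longrightarrow> K * schwartz_norm m (\<lambda>x. convolution (mollifier k) \<psi> x - \<psi> x) < e / 2"
    by (auto simp: eventually_sequentially)
  show "\<exists>N. \<forall>k\<ge>N. norm (nE (cv (mollifier k) f - f) - 0) < e"
  proof (intro exI[of _ N] allI impI)
    fix k assume k: "k \<ge> N"
    note ms = mollifier(1)[of k]
    have cs: "convolution (mollifier k) \<psi> \<in> schwartz" by (intro convolution_schwartz ms \<psi>)
    define a b c where "a = cv (mollifier k) (?g - f)" and "b = schwartz_dist (\<lambda>x. convolution (mollifier k) \<psi> x - \<psi> x)" and "c = ?g - f"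
    have abc: "a \<in> E" "b \<in> E" "c \<in> E"
      unfolding a_def b_def c_def by (rule cv_mem_bound(1)[OF ms g(2)], rule dist_mem[OF schwartz_diff[OF cs \<psi>(1)]], rule g(2))
    have b_eq: "b = cv (mollifier k) ?g - ?g"
      unfolding b_def cv_schwartz_dist[OF ms \<psi>(1)] using schwartz_dist_diff[OF cs \<psi>(1)] by (simp add: fun_diff_def)
    have "cv (mollifier k) f - f = (b + c) - a"
      unfolding b_eq by (simp add: a_def c_def cv_diff)
    then have "nE (cv (mollifier k) f - f) = nE ((b + c) - a)" by simp
    also have "\<dots> \<le> nE (b + c) + nE a" by (rule nE_triangle_diff[OF ES.add_mem[OF abc(2,3)] abc(1)])
    also have "\<dots> \<le> (nE b + nE c) + nE a" by (rule add_right_mono[OF nE_triangle[OF abc(2,3)]])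
    also have "nE a \<le> C * nE c"
    proof -
      have "nE a \<le> wconst * wnorm (mollifier k) * nE c" unfolding a_def c_def by (rule cv_mem_bound(2)[OF ms g(2)])
      also have "\<dots> \<le> C * nE c"
        unfolding C_def using wconst_pos nE_nonneg[OF abc(3)] by (intro mult_right_mono mult_left_mono wnorm_mollifier) auto
      finally show ?thesis .
    qed
    also have "nE b < e / 2"
      unfolding b_def using K(2)[OF schwartz_diff[OF cs \<psi>(1)]] N[OF k] by linarith
    finally have "nE (cv (mollifier k) f - f) < e / 2 + (1 + C) * nE c" by (simp add: algebra_simps)
    also have "(1 + C) * nE c < e / 2" using \<psi>(2) C unfolding c_def by (simp add: field_simps)
    finally have "nE (cv (mollifier k) f - f) < e" by simp
    then show "norm (nE (cv (mollifier k) f - f) - 0) < e"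
      using nE_nonneg[OF ES.diff_mem[OF cv_mem_bound(1)[OF ms f] f]] by simp
  qed
qed

text \<open>Mollification commutes with derivatives, so a single \<open>k\<close> serves all orders
  up to \<open>N\<close>. With this \<open>k\<close> fixed, it suffices to approximate
  \<open>u\<close> by a Schwartz function in the norm of \<open>E\<close> alone, because the
  mollifier turns that into closeness in \<open>DE_norm\<close>. Cutting off costs the last third of
  \<open>e\<close>.\<close>

theorem DE_dense:
  assumes u: "u \<in> DE_space E" and e: "e > 0"
  shows "\<exists>\<eta>\<in>test_functions. DE_norm nE N (schwartz_dist \<eta> - u) < e"
proof -
  have uE: "u \<in> E" using u by (rule DE_subset)
  have "\<forall>\<^sub>F k in sequentially. \<forall>js\<in>{js :: 'n list. length js \<le> N}. nE (cv (mollifier k) (dist_derivs js u) - dist_derivs js u) < e / 3"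
  proof (rule eventually_ball_finite[OF finite_lists_le], intro ballI)
    fix js :: "'n list"
    show "\<forall>\<^sub>F k in sequentially. nE (cv (mollifier k) (dist_derivs js u) - dist_derivs js u) < e / 3"
      using order_tendstoD(2)[OF mollifier_approximates[OF DE_D[OF u]], of "e / 3"] e by simp
  qed
  then obtain k where k: "\<And>js :: 'n list. length js \<le> N \<Longrightarrow> nE (cv (mollifier k) (dist_derivs js u) - dist_derivs js u) < e / 3"
    by (auto simp: eventually_sequentially)
  let ?w = "mollifier k :: 'n test_fun"
  have ws: "?w \<in> schwartz" by (rule mollifier)
  have dd: "dist_derivs js (f - g) = dist_derivs js f - dist_derivs js g" for js and f g :: "'n tdist"
    using dist_derivs_add[of js f "\<lambda>x. - 1 * g x"] dist_derivs_cmult[of js "- 1" g]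
    by (simp add: fun_eq_iff fun_diff_def plus_fun_def)
  have wu: "cv ?w u \<in> DE_space E" by (rule cv_DE(1)[OF ws uE])
  have 1: "DE_norm nE N (cv ?w u - u) < e / 3"
    by (rule DE_norm_less) (simp only: dd cv_dist_derivs_right[OF ws] k)
  \<comment> \<open>The added constant range puts 0 into the finite set and thereby makes
    \<open>C\<close> nonnegative.\<close>
  define C where "C = Max (range (\<lambda>js. 0) \<union> (\<lambda>js. wnorm (partial_derivs js ?w)) ` {js. length js \<le> N})"
  have C0: "C \<ge> 0" unfolding C_def by (intro Max_ge) (auto intro: finite_lists_le)
  have C: "wnorm (partial_derivs js ?w) \<le> C" if "length js \<le> N" for js
    unfolding C_def using that by (intro Max_ge) (auto intro: finite_lists_le)
  obtain \<psi> where \<psi>: "\<psi> \<in> schwartz" "nE (schwartz_dist \<psi> - u) < e / (3 * (wconst * C + 1))"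
    using dense[OF uE, of "e / (3 * (wconst * C + 1))"] e C0 wconst_pos by (auto simp: add_nonneg_pos)
  have du: "schwartz_dist \<psi> - u \<in> E" by (rule ES.diff_mem[OF dist_mem[OF \<psi>(1)] uE])
  have 2: "DE_norm nE N (cv ?w (schwartz_dist \<psi> - u)) < e / 3"
  proof -
    have "DE_norm nE N (cv ?w (schwartz_dist \<psi> - u)) \<le> wconst * C * nE (schwartz_dist \<psi> - u)"
      by (rule cv_DE(2)[OF ws du C])
    also have "\<dots> \<le> (wconst * C + 1) * nE (schwartz_dist \<psi> - u)"
      using nE_nonneg[OF du] by (intro mult_right_mono) auto
    also have "\<dots> < (wconst * C + 1) * (e / (3 * (wconst * C + 1)))"
      using \<psi>(2) C0 wconst_pos by (intro mult_strict_left_mono) (auto simp: add_nonneg_pos)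
    also have "\<dots> = e / 3"
    proof -
      have "wconst * C + 1 \<noteq> 0" using C0 wconst_pos by (smt (verit) mult_nonneg_nonneg)
      then show ?thesis by (metis mult.commute nonzero_mult_divide_mult_cancel_left times_divide_eq_right)
    qed
    finally show ?thesis .
  qed
  let ?c = "convolution ?w \<psi>"
  have cs: "?c \<in> schwartz" by (intro convolution_schwartz ws \<psi>)
  obtain K m where K: "K \<ge> 0" "\<And>\<phi>. \<phi> \<in> schwartz \<Longrightarrow> DE_norm nE N (schwartz_dist \<phi>) \<le> K * schwartz_norm m \<phi>"
    using DE_embedding[of N] by blast
  obtain \<eta> where "\<forall>i. \<eta> i \<in> test_functions" "\<forall>m. (\<lambda>i. schwartz_norm m (\<lambda>x. \<eta> i x - ?c x)) \<longlonglongrightarrow> 0"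
    using test_functions_dense[OF cs] by auto
  then have \<eta>: "\<eta> i \<in> test_functions" "(\<lambda>i. schwartz_norm m (\<lambda>x. \<eta> i x - ?c x)) \<longlonglongrightarrow> 0" for i m by auto
  have "(\<lambda>i. K * schwartz_norm m (\<lambda>x. \<eta> i x - ?c x)) \<longlonglongrightarrow> K * 0" by (intro tendsto_mult tendsto_const \<eta>)
  then have "\<forall>\<^sub>F i in sequentially. K * schwartz_norm m (\<lambda>x. \<eta> i x - ?c x) < e / 3"
    using order_tendstoD(2)[of _ 0 sequentially "e / 3"] e by simp
  then obtain i where i: "K * schwartz_norm m (\<lambda>x. \<eta> i x - ?c x) < e / 3"
    by (auto simp: eventually_sequentially)
  have \<eta>S: "\<eta> i \<in> schwartz" using \<eta>(1) test_functions_subset_schwartz by blast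
  define a b c where "a = schwartz_dist (\<lambda>x. \<eta> i x - ?c x)" and "b = cv ?w (schwartz_dist \<psi> - u)" and "c = cv ?w u - u"
  have abc: "a \<in> DE_space E" "b \<in> DE_space E" "c \<in> DE_space E"
    unfolding a_def b_def c_def by (rule dist_DE[OF schwartz_diff[OF \<eta>S cs]], rule cv_DE(1)[OF ws du], rule DS.diff_mem[OF wu u])
  have a_eq: "a = schwartz_dist (\<eta> i) - schwartz_dist ?c"
    unfolding a_def using schwartz_dist_diff[OF \<eta>S cs] by (simp add: fun_diff_def)
  have "schwartz_dist (\<eta> i) - u = a + (b + c)"
    unfolding a_eq b_def c_def cv_diff cv_schwartz_dist[OF ws \<psi>(1)] by simp
  then have "DE_norm nE N (schwartz_dist (\<eta> i) - u) = DE_norm nE N (a + (b + c))" by simp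
  also have "\<dots> \<le> DE_norm nE N a + DE_norm nE N (b + c)"
    by (rule DE_norm_triangle[OF abc(1) DS.add_mem[OF abc(2,3)]])
  also have "\<dots> \<le> DE_norm nE N a + (DE_norm nE N b + DE_norm nE N c)"
    by (rule add_left_mono[OF DE_norm_triangle[OF abc(2,3)]])
  also have "DE_norm nE N a < e / 3"
    unfolding a_def using K(2)[OF schwartz_diff[OF \<eta>S cs]] i by linarith
  finally have "DE_norm nE N (schwartz_dist (\<eta> i) - u) < e" using 1 2 unfolding b_def c_def by linarith
  with \<eta>(1) show ?thesis by blast
qed

end

section \<open>Dual spaces\<close>

context transl_inv_banach
begin

text \<open>Existence is the bilinear estimate in the weighted \<open>L\<^sup>1\<close> norm and the
  norm of \<open>E\<close>. For uniqueness, the constant sequence \<open>g\<close> and any Schwartz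
  approximation of \<open>f\<close> are inserted; two limits in \<open>E\<close> agree because
  evaluations at Schwartz functions separate them.\<close>

lemma conv_ext_eq_cv:
  assumes g: "g \<in> schwartz" and f: "f \<in> E"
  shows "conv_ext E nE g f = cv g f"
  unfolding conv_ext_def
proof (rule the_equality)
  note gf = cv_mem_bound(1)[OF g f]
  have conv: "(\<lambda>k. nE (schwartz_dist (convolution (\<phi> k) (\<psi> k)) - cv g f)) \<longlonglongrightarrow> 0"
    if S: "\<And>k. \<phi> k \<in> schwartz" "\<And>k. \<psi> k \<in> schwartz"
      and \<phi>: "(\<lambda>k. weighted_L1_norm weight (\<phi> k - g)) \<longlonglongrightarrow> 0"
      and \<psi>: "(\<lambda>k. nE (schwartz_dist (\<psi> k) - f)) \<longlonglongrightarrow> 0" for \<phi> \<psi> :: "nat \<Rightarrow> 'n test_fun"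
  proof (rule squeeze_zero)
    fix k
    have c: "convolution (\<phi> k) (\<psi> k) \<in> schwartz" by (rule convolution_schwartz[OF S(1) S(2)])
    have d: "(\<lambda>x. \<phi> k x - g x) \<in> schwartz" by (rule schwartz_diff[OF S(1) g])
    have e: "schwartz_dist (\<psi> k) - f \<in> E" by (rule ES.diff_mem[OF dist_mem[OF S(2)] f])
    show "0 \<le> nE (schwartz_dist (convolution (\<phi> k) (\<psi> k)) - cv g f)"
      by (rule nE_nonneg[OF ES.diff_mem[OF dist_mem[OF c] gf]])
    let ?a = "schwartz_dist (convolution (\<lambda>x. \<phi> k x - g x) (\<psi> k))" and ?b = "cv g (schwartz_dist (\<psi> k) - f)"
    have ab: "?a \<in> E" "?b \<in> E" by (rule dist_mem[OF convolution_schwartz[OF d S(2)]], rule cv_mem_bound(1)[OF g e])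
    have "?a = schwartz_dist (convolution (\<phi> k) (\<psi> k)) - schwartz_dist (convolution g (\<psi> k))"
      using schwartz_dist_diff[OF c convolution_schwartz[OF g S(2)]]
      by (simp add: convolution_diff_left[OF S(1) g S(2)] fun_diff_def)
    then have "schwartz_dist (convolution (\<phi> k) (\<psi> k)) - cv g f = ?a + ?b"
      by (simp add: cv_diff cv_schwartz_dist[OF g S(2)])
    then have 0: "nE (schwartz_dist (convolution (\<phi> k) (\<psi> k)) - cv g f) \<le> nE ?a + nE ?b"
      using nE_triangle[OF ab] by (simp only:)
    have w: "wnorm (\<lambda>x. \<phi> k x - g x) = weighted_L1_norm weight (\<phi> k - g)"
      using wnorm_eq[OF schwartz_measurable[OF d]] by (simp add: fun_diff_def)
    have "nE ?a \<le> wconst * wnorm (\<lambda>x. \<phi> k x - g x) * nE (schwartz_dist (\<psi> k))"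
      by (rule convolution_estimate[OF d S(2)])
    also have "\<dots> \<le> wconst * wnorm (\<lambda>x. \<phi> k x - g x) * (nE (schwartz_dist (\<psi> k) - f) + nE f)"
      using nE_triangle[OF e f] wconst_pos wnorm_nonneg by (intro mult_left_mono mult_nonneg_nonneg) auto
    finally have 1: "nE ?a \<le> wconst * weighted_L1_norm weight (\<phi> k - g) * (nE (schwartz_dist (\<psi> k) - f) + nE f)"
      unfolding w .
    have 2: "nE ?b \<le> wconst * wnorm g * nE (schwartz_dist (\<psi> k) - f)" by (rule cv_mem_bound(2)[OF g e])
    show "nE (schwartz_dist (convolution (\<phi> k) (\<psi> k)) - cv g f) \<le>
      wconst * weighted_L1_norm weight (\<phi> k - g) * (nE (schwartz_dist (\<psi> k) - f) + nE f)
      + wconst * wnorm g * nE (schwartz_dist (\<psi> k) - f)"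
      using 0 1 2 by linarith
  next
    have "(\<lambda>k. wconst * weighted_L1_norm weight (\<phi> k - g) * (nE (schwartz_dist (\<psi> k) - f) + nE f)
      + wconst * wnorm g * nE (schwartz_dist (\<psi> k) - f)) \<longlonglongrightarrow> wconst * 0 * (0 + nE f) + wconst * wnorm g * 0"
      by (intro tendsto_intros \<phi> \<psi>)
    then show "(\<lambda>k. wconst * weighted_L1_norm weight (\<phi> k - g) * (nE (schwartz_dist (\<psi> k) - f) + nE f)
      + wconst * wnorm g * nE (schwartz_dist (\<psi> k) - f)) \<longlonglongrightarrow> 0" by simp
  qed
  show "cv g f \<in> E \<and> (\<forall>\<phi> \<psi>. (\<forall>k. \<phi> k \<in> schwartz \<and> \<psi> k \<in> schwartz) \<and>
      (\<lambda>k. weighted_L1_norm weight (\<phi> k - g)) \<longlonglongrightarrow> 0 \<and> (\<lambda>k. nE (schwartz_dist (\<psi> k) - f)) \<longlonglongrightarrow> 0 \<longrightarrow>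
      (\<lambda>k. nE (schwartz_dist (convolution (\<phi> k) (\<psi> k)) - cv g f)) \<longlonglongrightarrow> 0)"
    using gf conv by simp
  fix h
  assume h: "h \<in> E \<and> (\<forall>\<phi> \<psi>. (\<forall>k. \<phi> k \<in> schwartz \<and> \<psi> k \<in> schwartz) \<and>
      (\<lambda>k. weighted_L1_norm weight (\<phi> k - g)) \<longlonglongrightarrow> 0 \<and> (\<lambda>k. nE (schwartz_dist (\<psi> k) - f)) \<longlonglongrightarrow> 0 \<longrightarrow>
      (\<lambda>k. nE (schwartz_dist (convolution (\<phi> k) (\<psi> k)) - h)) \<longlonglongrightarrow> 0)"
  obtain \<psi> where \<psi>: "\<And>k. \<psi> k \<in> schwartz" "(\<lambda>k. nE (schwartz_dist (\<psi> k) - f)) \<longlonglongrightarrow> 0"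
    using dense_sequence[OF f] by metis
  have w0: "(\<lambda>k::nat. weighted_L1_norm weight (g - g)) \<longlonglongrightarrow> 0" by (simp add: weighted_L1_norm_def)
  define s where "s k = schwartz_dist (convolution g (\<psi> k))" for k
  have sE: "s k \<in> E" for k unfolding s_def by (rule dist_mem[OF convolution_schwartz[OF g \<psi>(1)]])
  have l1: "(\<lambda>k. nE (s k - h)) \<longlonglongrightarrow> 0"
    unfolding s_def using h[THEN conjunct2, rule_format, of "\<lambda>_. g" \<psi>] g \<psi> w0 by simp
  have l2: "(\<lambda>k. nE (s k - cv g f)) \<longlonglongrightarrow> 0"
    unfolding s_def using conv[of "\<lambda>_. g" \<psi>] g \<psi> w0 by simp
  have hE: "h \<in> E" using h by blast
  show "h = cv g f"
  proof
    fix \<phi> :: "'n test_fun"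
    show "h \<phi> = cv g f \<phi>"
    proof (cases "\<phi> \<in> schwartz")
      case True
      show ?thesis by (rule LIMSEQ_unique[OF tempered_limit[OF True hE sE l1] tempered_limit[OF True gf sE l2]])
    qed (simp add: outside[OF hE] outside[OF gf])
  qed
qed

section \<open>Functionals on \<open>D\<^sub>E\<close> and on \<open>E\<close>\<close>

lemma DE_dual_bound:
  assumes "L \<in> DE_dual E nE"
  shows "\<exists>K N. K \<ge> 0 \<and> (\<forall>u\<in>DE_space E. cmod (L u) \<le> K * DE_norm nE N u)"
proof (rule DS.dual_bound[OF assms[unfolded DE_dual_def]])
  fix p K assume p: "p \<in> DE_seminorms nE" "K \<ge> 0" "\<And>f. f \<in> DE_space E \<Longrightarrow> cmod (L f) \<le> K * p f"
  from p(1) obtain N where "p = DE_norm nE N" by auto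
  with p(2,3) show ?thesis by auto
qed

lemma DE_dual_diff: "L \<in> DE_dual E nE \<Longrightarrow> M \<in> DE_dual E nE \<Longrightarrow> L - M \<in> DE_dual E nE"
  unfolding DE_dual_def by (rule seminormed_space.diff_mem[OF DS.strong_dual_seminormed])

lemma DE_dual_linear: "L \<in> DE_dual E nE \<Longrightarrow> clinear_functional_on (DE_space E) L"
  unfolding DE_dual_def by (rule lc_dualD(1))

lemma DE_dual_outside: "L \<in> DE_dual E nE \<Longrightarrow> u \<notin> DE_space E \<Longrightarrow> L u = 0"
  using lc_dualD(2)[of L "DE_space E" "DE_seminorms nE" u] by (simp add: DE_dual_def)

text \<open>The continuity of \<open>L\<close> comes with an unrelated constant and order, which
  serve only to carry the estimate across the dense set. The constants \<open>K\<close> and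
  \<open>N\<close> themselves survive unchanged, which matters for uniformity in
  \<open>y\<close>.\<close>

lemma DE_dual_extend_bound:
  assumes L: "L \<in> DE_dual E nE" and K: "K \<ge> 0"
    and le: "\<And>\<psi>. \<psi> \<in> test_functions \<Longrightarrow> cmod (L (schwartz_dist \<psi>)) \<le> K * DE_norm nE N (schwartz_dist \<psi>)"
    and u: "u \<in> DE_space E"
  shows "cmod (L u) \<le> K * DE_norm nE N u"
proof -
  obtain K' N' where K': "K' \<ge> 0" "\<And>v. v \<in> DE_space E \<Longrightarrow> cmod (L v) \<le> K' * DE_norm nE N' v"
    using DE_dual_bound[OF L] by auto
  show ?thesis
  proof (rule field_le_epsilon)
    fix e :: real assume e: "e > 0"
    define \<delta> where "\<delta> = e / (K + K' + 1)"
    have \<delta>: "\<delta> > 0" unfolding \<delta>_def using e K K' by simp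
    obtain \<psi> where \<psi>: "\<psi> \<in> test_functions" "DE_norm nE (max N N') (schwartz_dist \<psi> - u) < \<delta>"
      using DE_dense[OF u \<delta>] by blast
    have D: "schwartz_dist \<psi> \<in> DE_space E" using \<psi>(1) test_functions_subset_schwartz by (intro dist_DE) blast
    let ?d = "schwartz_dist \<psi> - u"
    have d: "?d \<in> DE_space E" by (rule DS.diff_mem[OF D u])
    have n: "DE_norm nE N ?d \<le> \<delta>" "DE_norm nE N' ?d \<le> \<delta>"
      using \<psi>(2) DE_norm_mono[of N "max N N'" ?d] DE_norm_mono[of N' "max N N'" ?d] by linarith+
    have "L u = L (schwartz_dist \<psi>) - L ?d" using DS.linear_on_diff[OF DE_dual_linear[OF L] D u] by simp
    then have "cmod (L u) \<le> cmod (L (schwartz_dist \<psi>)) + cmod (L ?d)" by (simp add: norm_triangle_ineq4)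
    also have "\<dots> \<le> K * DE_norm nE N (schwartz_dist \<psi>) + K' * \<delta>"
      using le[OF \<psi>(1)] K'(2)[OF d] mult_left_mono[OF n(2) K'(1)] by linarith
    also have "DE_norm nE N (schwartz_dist \<psi>) \<le> DE_norm nE N u + \<delta>"
      using DE_norm_triangle[OF d u, of N] n(1) by simp
    finally have "cmod (L u) \<le> K * (DE_norm nE N u + \<delta>) + K' * \<delta>" using K by (simp add: mult_left_mono)
    also have "\<dots> \<le> K * DE_norm nE N u + (K + K' + 1) * \<delta>" using \<delta> by (simp add: algebra_simps)
    also have "(K + K' + 1) * \<delta> = e" using K K' by (simp add: \<delta>_def add_nonneg_pos less_imp_neq[symmetric])
    finally show "cmod (L u) \<le> K * DE_norm nE N u + e" .
  qed
qed

text \<open>Agreement on test functions is the case of constant 0 of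
  \<open>DE_dual_extend_bound\<close>, applied to the difference.\<close>

lemma DE_dual_unique:
  assumes L: "L \<in> DE_dual E nE" "represents L g" and M: "M \<in> DE_dual E nE" "represents M g"
  shows "L = M"
proof
  fix u
  show "L u = M u"
  proof (cases "u \<in> DE_space E")
    case True
    have "cmod ((L - M) u) \<le> 0 * DE_norm nE 0 u"
    proof (rule DE_dual_extend_bound[OF DE_dual_diff[OF L(1) M(1)] order_refl _ True])
      fix \<psi> :: "'n test_fun" assume "\<psi> \<in> test_functions"
      then have "L (schwartz_dist \<psi>) = M (schwartz_dist \<psi>)" using L(2) M(2) by (simp add: represents_def)
      then show "cmod ((L - M) (schwartz_dist \<psi>)) \<le> 0 * DE_norm nE 0 (schwartz_dist \<psi>)" by simp
    qed
    then show ?thesis by simp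
  qed (simp add: DE_dual_outside L M)
qed

lemma func_in_DE_dual_eq: "L \<in> DE_dual E nE \<Longrightarrow> represents L g \<Longrightarrow> func_in (DE_dual E nE) g = L"
  unfolding func_in_def using DE_dual_unique by (intro the_equality) auto

lemma func_in_DE_dual:
  assumes "belongs g (DE_dual E nE)"
  shows "func_in (DE_dual E nE) g \<in> DE_dual E nE" "represents (func_in (DE_dual E nE) g) g"
  using assms func_in_DE_dual_eq by (auto simp: belongs_def)

lemma dual_space_linear: "L \<in> dual_space E nE \<Longrightarrow> clinear_functional_on E L"
  unfolding dual_space_def by (rule lc_dualD(1))

lemma dual_space_outside: "L \<in> dual_space E nE \<Longrightarrow> u \<notin> E \<Longrightarrow> L u = 0"
  using lc_dualD(2)[of L E "{nE}" u] by (simp add: dual_space_def)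

lemma dual_space_bdd:
  assumes "L \<in> dual_space E nE"
  shows "bdd_above ((\<lambda>f. cmod (L f)) ` {f \<in> E. nE f \<le> 1})"
  by (rule ES.dual_bounded_on[OF assms[unfolded dual_space_def]]) (auto simp: lc_bounded_def)

lemma dual_norm_bound:
  assumes L: "L \<in> dual_space E nE" and f: "f \<in> E"
  shows "cmod (L f) \<le> dual_norm E nE L * nE f"
proof (cases "nE f = 0")
  case True
  then have "f = 0" using nE_zero_iff[OF f] by simp
  then show ?thesis using linear_on_zero[OF dual_space_linear[OF L] ES.zero_mem] True by simp
next
  case False
  then have pos: "nE f > 0" using nE_nonneg[OF f] by simp
  let ?c = "of_real (1 / nE f) :: complex"
  have "nE (\<lambda>x. ?c * f x) \<le> 1" using pos by (simp only: nE_scale[OF f]) (simp add: norm_divide)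
  then have "(\<lambda>x. ?c * f x) \<in> {f \<in> E. nE f \<le> 1}" using ES.scale_mem[OF f, of ?c] by blast
  from cSUP_upper[OF this dual_space_bdd[OF L]] have "cmod (L (\<lambda>x. ?c * f x)) \<le> dual_norm E nE L"
    unfolding dual_norm_def .
  moreover have "L (\<lambda>x. ?c * f x) = ?c * L f"
    using dual_space_linear[OF L] f unfolding clinear_functional_on_def by blast
  ultimately have "cmod (?c * L f) \<le> dual_norm E nE L" by simp
  then show ?thesis using pos by (simp add: norm_mult norm_divide field_simps)
qed

lemma dual_norm_le:
  assumes "B \<ge> 0" "\<And>f. f \<in> E \<Longrightarrow> cmod (L f) \<le> B * nE f"
  shows "dual_norm E nE L \<le> B"
  unfolding dual_norm_def
proof (rule cSUP_least)
  show "{f \<in> E. nE f \<le> 1} \<noteq> {}" using ES.zero_mem nE_zero by auto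
  fix f assume "f \<in> {f \<in> E. nE f \<le> 1}"
  then have "cmod (L f) \<le> B * nE f" "B * nE f \<le> B * 1"
    using assms(2)[of f] mult_left_mono[OF _ assms(1), of "nE f" 1] by auto
  then show "cmod (L f) \<le> B" by simp
qed

text \<open>Functionals vanish outside their space by convention, so an element of the dual of
  \<open>E\<close> must be reset to 0 off \<open>D\<^sub>E\<close> before it can be compared with
  \<open>u y\<close>.\<close>

definition restr :: "('n tdist \<Rightarrow> complex) \<Rightarrow> ('n tdist \<Rightarrow> complex)" where
  "restr L = (\<lambda>u. if u \<in> DE_space E then L u else 0)"

lemma restr_DE_dual:
  assumes L: "L \<in> dual_space E nE"
  shows "restr L \<in> DE_dual E nE"
  unfolding DE_dual_def
proof (rule DS.dualI)
  show "restr L u = 0" if "u \<notin> DE_space E" for u using that by (simp add: restr_def)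
  show "clinear_functional_on (DE_space E) (restr L)"
    using dual_space_linear[OF L] DS.add_mem DS.scale_mem DE_subset
    unfolding clinear_functional_on_def restr_def by simp
  show "DE_norm nE 0 \<in> DE_seminorms nE" by simp
  fix u assume u: "u \<in> DE_space E"
  have "0 \<le> dual_norm E nE L"
    unfolding dual_norm_def using cSUP_upper[OF _ dual_space_bdd[OF L], of 0] ES.zero_mem nE_zero
    by (auto intro: order_trans[OF norm_ge_zero])
  then have "dual_norm E nE L * nE u \<le> dual_norm E nE L * DE_norm nE 0 u"
    using DE_norm_ge[of "[]" 0 u] by (intro mult_left_mono) auto
  then show "cmod (restr L u) \<le> dual_norm E nE L * DE_norm nE 0 u"
    using dual_norm_bound[OF L DE_subset[OF u]] u by (simp add: restr_def)
qed

lemma restr_represents: "represents L g \<Longrightarrow> represents (restr L) g"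
  using dist_DE test_functions_subset_schwartz unfolding represents_def restr_def by (auto simp: subset_iff)

text \<open>Uniqueness in the dual of \<open>D\<^sub>E\<close> gives equality on Schwartz functions;
  their density in \<open>E\<close> and norm continuity do the rest.\<close>

lemma dual_space_unique:
  assumes L: "L \<in> dual_space E nE" "represents L g" and M: "M \<in> dual_space E nE" "represents M g"
  shows "L = M"
proof
  have eq: "restr L = restr M"
    by (rule DE_dual_unique[OF restr_DE_dual[OF L(1)] restr_represents[OF L(2)] restr_DE_dual[OF M(1)] restr_represents[OF M(2)]])
  fix f
  show "L f = M f"
  proof (cases "f \<in> E")
    case f: True
    obtain \<psi> where \<psi>: "\<And>k. \<psi> k \<in> schwartz" "(\<lambda>k. nE (schwartz_dist (\<psi> k) - f)) \<longlonglongrightarrow> 0"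
      using dense_sequence[OF f] by metis
    have lim: "(\<lambda>k. Q (schwartz_dist (\<psi> k))) \<longlonglongrightarrow> Q f" if Q: "Q \<in> dual_space E nE" for Q
    proof -
      have l: "(\<lambda>k. dual_norm E nE Q * nE (schwartz_dist (\<psi> k) - f)) \<longlonglongrightarrow> 0"
        using tendsto_mult[OF tendsto_const \<psi>(2), of "dual_norm E nE Q"] by simp
      have "norm (Q (schwartz_dist (\<psi> k)) - Q f) \<le> dual_norm E nE Q * nE (schwartz_dist (\<psi> k) - f)" for k
        using dual_norm_bound[OF Q ES.diff_mem[OF dist_mem[OF \<psi>(1)[of k]] f]]
          ES.linear_on_diff[OF dual_space_linear[OF Q] dist_mem[OF \<psi>(1)[of k]] f] by simp
      then have "(\<lambda>k. Q (schwartz_dist (\<psi> k)) - Q f) \<longlonglongrightarrow> 0"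
        by (intro Lim_null_comparison[OF always_eventually l]) simp
      then show ?thesis by (simp add: LIM_zero_iff)
    qed
    have "L (schwartz_dist (\<psi> k)) = M (schwartz_dist (\<psi> k))" for k
      using fun_cong[OF eq, of "schwartz_dist (\<psi> k)"] dist_DE[OF \<psi>(1)] by (simp add: restr_def)
    then have "(\<lambda>k. M (schwartz_dist (\<psi> k))) \<longlonglongrightarrow> L f" using lim[OF L(1)] by simp
    from LIMSEQ_unique[OF this lim[OF M(1)]] show ?thesis .
  qed (simp add: dual_space_outside L M)
qed

lemma func_in_dual_space_eq: "L \<in> dual_space E nE \<Longrightarrow> represents L g \<Longrightarrow> func_in (dual_space E nE) g = L"
  unfolding func_in_def using dual_space_unique by (intro the_equality) auto

lemma DE_dual_tempered:
  assumes L: "L \<in> DE_dual E nE"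
  shows "clinear_functional_on schwartz (\<lambda>\<phi>. L (schwartz_dist \<phi>))"
    "\<exists>K m. \<forall>\<phi>\<in>schwartz. cmod (L (schwartz_dist \<phi>)) \<le> K * schwartz_norm m \<phi>"
proof -
  show "clinear_functional_on schwartz (\<lambda>\<phi>. L (schwartz_dist \<phi>))"
    using DE_dual_linear[OF L] dist_DE
    unfolding clinear_functional_on_def by (simp add: schwartz_dist_add schwartz_dist_cmult)
  obtain K N where K: "K \<ge> 0" "\<And>u. u \<in> DE_space E \<Longrightarrow> cmod (L u) \<le> K * DE_norm nE N u"
    using DE_dual_bound[OF L] by auto
  obtain K' m where K': "\<And>\<phi>. \<phi> \<in> schwartz \<Longrightarrow> DE_norm nE N (schwartz_dist \<phi>) \<le> K' * schwartz_norm m \<phi>"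
    using DE_embedding[of N] by auto
  have "cmod (L (schwartz_dist \<phi>)) \<le> (K * K') * schwartz_norm m \<phi>" if "\<phi> \<in> schwartz" for \<phi>
    using K(2)[OF dist_DE[OF that]] mult_left_mono[OF K'[OF that] K(1)] by (simp add: mult.assoc)
  then show "\<exists>K m. \<forall>\<phi>\<in>schwartz. cmod (L (schwartz_dist \<phi>)) \<le> K * schwartz_norm m \<phi>" by auto
qed

lemma DE_norm_shift:
  assumes \<phi>: "\<phi> \<in> schwartz"
  shows "DE_norm nE N (schwartz_dist (\<lambda>x. \<phi> (x - t))) \<le> weight t * DE_norm nE N (schwartz_dist \<phi>)"
proof (rule DE_norm_le)
  fix js :: "'n list" assume js: "length js \<le> N"
  have "nE (dist_derivs js (schwartz_dist (\<lambda>x. \<phi> (x - t)))) = nE (schwartz_dist (\<lambda>x. partial_derivs js \<phi> (x - t)))"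
    by (simp add: dist_derivs_schwartz_dist[OF schwartz_shift[OF \<phi>]] partial_derivs_shift[OF schwartz_smooth[OF \<phi>]])
  also have "\<dots> \<le> weight t * nE (schwartz_dist (partial_derivs js \<phi>))"
    by (rule shift_bound[OF schwartz_partial_derivs(1)[OF \<phi>]])
  also have "\<dots> \<le> weight t * DE_norm nE N (schwartz_dist \<phi>)"
    using DE_norm_ge[OF js, of "schwartz_dist \<phi>"] weight_nonneg
    unfolding dist_derivs_schwartz_dist[OF \<phi>] by (intro mult_left_mono) auto
  finally show "nE (dist_derivs js (schwartz_dist (\<lambda>x. \<phi> (x - t)))) \<le> weight t * DE_norm nE N (schwartz_dist \<phi>)" .
qed

text \<open>The power of \<open>1 / a\<close> here becomes the exponent \<open>\<kappa>\<close> of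
  the growth estimate. Because \<open>1 \<le> A / a\<close>, derivatives of lower order fit under
  the same power, at the cost of \<open>A ^ N\<close>.\<close>

lemma wnorm_sech_kernel:
  assumes A: "1 \<le> A"
  shows "\<exists>Q\<ge>0. \<forall>a js. 0 < a \<longrightarrow> a \<le> A \<longrightarrow> length js \<le> N \<longrightarrow>
    wnorm (partial_derivs js (sech_kernel a)) \<le> Q * (1 / a) ^ (CARD('n) + N)"
proof -
  let ?u = "unit_kernel :: 'n test_fun"
  \<comment> \<open>Decay of order \<open>wdeg\<close> compensates the weight of \<open>E\<close>;
    the remaining \<open>CARD('n) + 2\<close> powers give integrability.\<close>
  define m where "m = wdeg + (CARD('n) + 2)"
  define I0 where "I0 = (LINT x:: real ^ 'n|lborel. 1 / (1 + norm x) ^ (CARD('n) + 2))"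
  define S where "S = schwartz_norm (m + N) ?u"
  define Q where "Q = A ^ m * S * wconst * I0 * A ^ N"
  have S: "S \<ge> 0" unfolding S_def by (rule schwartz_norm_nonneg[OF unit_kernel_schwartz])
  have I0: "I0 \<ge> 0" unfolding I0_def by (intro integral_nonneg_AE AE_I2) simp
  have "wnorm (partial_derivs js (sech_kernel a)) \<le> Q * (1 / a) ^ (CARD('n) + N)"
    if a: "0 < a" "a \<le> A" and js: "length js \<le> N" for a and js :: "'n list"
  proof -
    let ?c = "A ^ m * S * (1 / a) ^ (CARD('n) + length js)"
    have c: "?c \<ge> 0" using A a S by (intro mult_nonneg_nonneg) auto
    have "wnorm (partial_derivs js (sech_kernel a)) \<le> (LINT x:: real ^ 'n|lborel. ?c * wconst * (1 / (1 + norm x) ^ (CARD('n) + 2)))"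
      unfolding wnorm_def
    proof (rule integral_mono)
      show "integrable lborel (\<lambda>t. cmod (partial_derivs js (sech_kernel a) t) * weight t)"
        by (intro weighted_integrable schwartz_partial_derivs sech_kernel_schwartz a)
      show "integrable lborel (\<lambda>x:: real ^ 'n. ?c * wconst * (1 / (1 + norm x) ^ (CARD('n) + 2)))"
        by (intro integrable_mult_right integrable_weight)
      fix x :: "real ^ 'n"
      have p: "1 + norm x > 0" by (simp add: add_pos_nonneg)
      have "schwartz_norm (m + length js) ?u \<le> S"
        unfolding S_def using js by (intro schwartz_norm_mono unit_kernel_schwartz) simp
      then have "A ^ m * schwartz_norm (m + length js) ?u * (1 / a) ^ (CARD('n) + length js) / (1 + norm x) ^ m \<le> ?c / (1 + norm x) ^ m"
        using A a by (intro divide_right_mono mult_right_mono mult_left_mono) auto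
      then have "cmod (partial_derivs js (sech_kernel a) x) \<le> ?c / (1 + norm x) ^ m"
        using sech_kernel_bound[OF a A, of js x m] by linarith
      then have "cmod (partial_derivs js (sech_kernel a) x) * weight x \<le> ?c / (1 + norm x) ^ m * (wconst * (1 + norm x) ^ wdeg)"
        using weight_bound[of x] weight_nonneg[of x] c by (intro mult_mono) auto
      also have "\<dots> = ?c * wconst * (1 / (1 + norm x) ^ (CARD('n) + 2))"
      proof -
        obtain b where b: "(1 + norm x) ^ (CARD('n) + 2) = b" by blast
        obtain e where e: "(1 + norm x) ^ wdeg = e" by blast
        have e0: "e > 0" unfolding e[symmetric] using p by (rule zero_less_power)
        have "(1 + norm x) ^ m = e * b" unfolding m_def power_add[of _ wdeg "CARD('n) + 2"] b e ..
        then show ?thesis unfolding b e using e0 by simp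
      qed
      finally show "cmod (partial_derivs js (sech_kernel a) x) * weight x \<le> ?c * wconst * (1 / (1 + norm x) ^ (CARD('n) + 2))" .
    qed
    also have "\<dots> = ?c * wconst * I0" by (simp only: integral_mult_right_zero I0_def)
    also have "\<dots> = A ^ m * S * wconst * I0 * (1 / a) ^ CARD('n) * (1 / a) ^ length js" by (simp only: power_add mult_ac)
    also have "\<dots> \<le> A ^ m * S * wconst * I0 * (1 / a) ^ CARD('n) * (A ^ N * (1 / a) ^ N)"
    proof (rule mult_left_mono)
      have "(1 / a) ^ length js \<le> (A * (1 / a)) ^ length js"
        using a A divide_right_mono[of 1 A a] by (intro power_mono) auto
      also have "\<dots> \<le> (A * (1 / a)) ^ N" using a js by (intro power_increasing) auto
      finally show "(1 / a) ^ length js \<le> A ^ N * (1 / a) ^ N" by (simp only: power_mult_distrib)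
    qed (use A S I0 wconst_pos a in \<open>intro mult_nonneg_nonneg, auto\<close>)
    also have "\<dots> = Q * (1 / a) ^ (CARD('n) + N)" by (simp only: Q_def power_add mult_ac)
    finally show ?thesis .
  qed
  moreover have "Q \<ge> 0" unfolding Q_def using A S I0 wconst_pos by (intro mult_nonneg_nonneg) auto
  ultimately show ?thesis by blast
qed

end

section \<open>Holomorphic dependence on a parameter\<close>

text \<open>Difference quotients in \<open>w\<close> converge pointwise in \<open>x\<close>, and the
  integral follows by dominated convergence because everything happens over the compact set
  \<open>K\<close>.\<close>

lemma holomorphic_integral:
  fixes f :: "complex \<Rightarrow> 'a::euclidean_space \<Rightarrow> complex"
  assumes W: "open W" and K: "compact K" and cont: "continuous_on (W \<times> UNIV) (\<lambda>(w, x). f w x)"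
    and hol: "\<And>x. (\<lambda>w. f w x) holomorphic_on W"
    and \<psi>: "continuous_on UNIV \<psi>" "\<And>x. x \<notin> K \<Longrightarrow> \<psi> x = 0"
  shows "(\<lambda>w. LINT x|lborel. f w x * \<psi> x) holomorphic_on W"
  unfolding holomorphic_on_def
proof
  fix w0 assume w0: "w0 \<in> W"
  obtain \<rho> where \<rho>: "\<rho> > 0" "cball w0 \<rho> \<subseteq> W" using W w0 open_contains_cball by metis
  have "compact (cball w0 \<rho> \<times> K)" using K by (intro compact_Times) auto
  moreover have "continuous_on (cball w0 \<rho> \<times> K) (\<lambda>(w, x). f w x)"
    using cont by (rule continuous_on_subset) (use \<rho> in auto)
  ultimately have "bounded ((\<lambda>(w, x). f w x) ` (cball w0 \<rho> \<times> K))"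
    using compact_continuous_image compact_imp_bounded by metis
  then obtain B where B: "\<And>w x. w \<in> cball w0 \<rho> \<Longrightarrow> x \<in> K \<Longrightarrow> cmod (f w x) \<le> B"
    unfolding bounded_iff by (metis (mono_tags, lifting) SigmaI case_prod_conv imageI)
  define D where "D x = deriv (\<lambda>w. f w x) w0" for x
  let ?q = "\<lambda>w x. (f w x * \<psi> x - f w0 x * \<psi> x) / (w - w0)"
  have Fm: "(\<lambda>x. f w x * \<psi> x) \<in> borel_measurable borel" if "w \<in> W" for w
  proof -
    have "continuous_on UNIV (\<lambda>x::'a. (w, x))" by (intro continuous_intros)
    then have "continuous_on UNIV (\<lambda>x. f w x)"
      using continuous_on_compose2[OF cont, of UNIV "\<lambda>x. (w, x)"] that by auto
    then show ?thesis using \<psi>(1) by (intro borel_measurable_continuous_onI continuous_intros)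
  qed
  have "bounded (\<psi> ` K)"
    using K \<psi>(1) by (intro compact_imp_bounded compact_continuous_image continuous_on_subset[OF \<psi>(1)]) auto
  then obtain P where P: "\<And>x. x \<in> K \<Longrightarrow> cmod (\<psi> x) \<le> P" unfolding bounded_iff by auto
  define M where "M = 2 * (\<bar>B\<bar> / \<rho>) * \<bar>P\<bar>"
  have Kint: "integrable lborel (\<lambda>x. indicator K x * c)" for c :: real
    using K emeasure_compact_finite[OF K] by (intro integrable_mult_left integrable_real_indicator) (auto simp: borel_compact less_top)
  have Fint: "integrable lborel (\<lambda>x. f w x * \<psi> x)" if w: "w \<in> cball w0 \<rho>" for w
  proof (rule Bochner_Integration.integrable_bound[OF Kint[of "\<bar>B\<bar> * \<bar>P\<bar>"]])
    show "(\<lambda>x. f w x * \<psi> x) \<in> borel_measurable lborel" using Fm w \<rho> by auto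
    show "AE x in lborel. norm (f w x * \<psi> x) \<le> norm (indicator K x * (\<bar>B\<bar> * \<bar>P\<bar>))"
    proof (rule AE_I2)
      fix x
      show "norm (f w x * \<psi> x) \<le> norm (indicator K x * (\<bar>B\<bar> * \<bar>P\<bar>))"
      proof (cases "x \<in> K")
        case True
        have "cmod (f w x) * cmod (\<psi> x) \<le> \<bar>B\<bar> * \<bar>P\<bar>"
          using B[OF w True] P[OF True] by (intro mult_mono) auto
        then show ?thesis using True by (simp add: norm_mult)
      qed (simp add: \<psi>)
    qed
  qed
  \<comment> \<open>Discs of radius \<open>\<rho> / 2\<close> about points of the half-size disc
    stay where \<open>f\<close> is bounded by \<open>B\<close>. Cauchy's inequality there yields a
    Lipschitz constant independent of \<open>x\<close>, hence the dominating function.\<close>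
  have lip: "cmod (?q w x) \<le> indicator K x * M" if w: "w \<in> ball w0 (\<rho> / 2) - {w0}" for w x
  proof (cases "x \<in> K")
    case True
    have der: "cmod (deriv (\<lambda>w. f w x) z) \<le> \<bar>B\<bar> / (\<rho> / 2)" if z: "z \<in> ball w0 (\<rho> / 2)" for z
    proof -
      have sub: "cball z (\<rho> / 2) \<subseteq> cball w0 \<rho>"
        using z by (simp add: cball_subset_cball_iff dist_commute)
      have h: "(\<lambda>w. f w x) holomorphic_on cball z (\<rho> / 2)" using hol sub \<rho> by (meson holomorphic_on_subset subset_trans)
      have "cmod ((deriv ^^ 1) (\<lambda>w. f w x) z) \<le> fact 1 * \<bar>B\<bar> / (\<rho> / 2) ^ 1"
      proof (rule Cauchy_inequality)
        show "(\<lambda>w. f w x) holomorphic_on ball z (\<rho> / 2)" using h by (rule holomorphic_on_subset) auto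
        show "continuous_on (cball z (\<rho> / 2)) (\<lambda>w. f w x)" by (rule holomorphic_on_imp_continuous_on[OF h])
        show "cmod (f w x) \<le> \<bar>B\<bar>" if "norm (z - w) = \<rho> / 2" for w
          using B[of w x] True sub that by (force simp: dist_norm)
      qed (use \<rho> in simp)
      then show ?thesis by simp
    qed
    have "cmod (f w x - f w0 x) \<le> (\<bar>B\<bar> / (\<rho> / 2)) * cmod (w - w0)"
    proof (rule field_differentiable_bound[where S="ball w0 (\<rho> / 2)" and f="\<lambda>w. f w x" and f'="deriv (\<lambda>w. f w x)"])
      fix z assume z: "z \<in> ball w0 (\<rho> / 2)"
      then have "z \<in> W" using \<rho> by auto
      then have "((\<lambda>w. f w x) has_field_derivative deriv (\<lambda>w. f w x) z) (at z)"
        by (rule holomorphic_derivI[OF hol W])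
      then show "((\<lambda>w. f w x) has_field_derivative deriv (\<lambda>w. f w x) z) (at z within ball w0 (\<rho> / 2))"
        by (rule has_field_derivative_at_within)
      show "cmod (deriv (\<lambda>w. f w x) z) \<le> \<bar>B\<bar> / (\<rho> / 2)" by (rule der[OF z])
    qed (use w \<rho> in auto)
    then have "cmod (f w x - f w0 x) * cmod (\<psi> x) \<le> ((\<bar>B\<bar> / (\<rho> / 2)) * cmod (w - w0)) * \<bar>P\<bar>"
      using P[OF True] \<rho> by (intro mult_mono) auto
    moreover have "cmod (?q w x) = cmod (f w x - f w0 x) * cmod (\<psi> x) / cmod (w - w0)"
      by (simp only: norm_divide left_diff_distrib[symmetric] norm_mult)
    ultimately show ?thesis using w True by (simp add: M_def pos_divide_le_eq mult_ac)
  qed (simp add: \<psi>)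
  have lim: "((\<lambda>w. ?q w x) \<longlongrightarrow> D x * \<psi> x) (at w0)" for x
  proof -
    have "((\<lambda>w. f w x) has_field_derivative D x) (at w0)"
      unfolding D_def by (rule holomorphic_derivI[OF hol W w0])
    then have "((\<lambda>w. (f w x - f w0 x) / (w - w0) * \<psi> x) \<longlongrightarrow> D x * \<psi> x) (at w0)"
      unfolding has_field_derivative_iff by (intro tendsto_intros)
    then show ?thesis by (simp add: left_diff_distrib diff_divide_distrib)
  qed
  have "((\<lambda>w. ((LINT x|lborel. f w x * \<psi> x) - (LINT x|lborel. f w0 x * \<psi> x)) / (w - w0)) \<longlongrightarrow> (LINT x|lborel. D x * \<psi> x)) (at w0 within ball w0 (\<rho> / 2))"
    unfolding tendsto_at_iff_sequentially
  proof (intro allI impI)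
    fix X assume X: "\<forall>i. X i \<in> ball w0 (\<rho> / 2) - {w0}" "X \<longlonglongrightarrow> w0"
    have Xat: "filterlim X (at w0) sequentially"
      using X by (auto simp: filterlim_at intro!: always_eventually)
    have Xc: "X i \<in> cball w0 \<rho>" for i using X(1)[rule_format, of i] \<rho> by auto
    have w0c: "w0 \<in> cball w0 \<rho>" using \<rho> by simp
    have lX: "(\<lambda>i. ?q (X i) x) \<longlonglongrightarrow> D x * \<psi> x" for x by (rule filterlim_compose[OF lim Xat])
    have qm: "(\<lambda>x. ?q (X i) x) \<in> borel_measurable lborel" for i
      using Fm[of "X i"] Fm[OF w0] Xc[of i] \<rho>(2) by (intro borel_measurable_divide borel_measurable_diff) auto
    have "(\<lambda>i. LINT x|lborel. ?q (X i) x) \<longlonglongrightarrow> (LINT x|lborel. D x * \<psi> x)"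
    proof (rule integral_dominated_convergence[OF _ qm Kint[of M]])
      show "(\<lambda>x. D x * \<psi> x) \<in> borel_measurable lborel"
        by (rule borel_measurable_LIMSEQ_metric[OF qm]) (rule lX)
      show "AE x in lborel. (\<lambda>i. ?q (X i) x) \<longlonglongrightarrow> D x * \<psi> x" using lX by simp
      show "AE x in lborel. norm (?q (X i) x) \<le> indicator K x * M" for i
        using lip[OF X(1)[rule_format]] by simp
    qed
    moreover have "((\<lambda>w. ((LINT x|lborel. f w x * \<psi> x) - (LINT x|lborel. f w0 x * \<psi> x)) / (w - w0)) \<circ> X) = (\<lambda>i. LINT x|lborel. ?q (X i) x)"
      using Fint[OF Xc] Fint[OF w0c] by (intro ext) simp
    ultimately show "((\<lambda>w. ((LINT x|lborel. f w x * \<psi> x) - (LINT x|lborel. f w0 x * \<psi> x)) / (w - w0)) \<circ> X) \<longlonglongrightarrow> (LINT x|lborel. D x * \<psi> x)"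
      by (rule subst[where P="\<lambda>g. g \<longlonglongrightarrow> (LINT x|lborel. D x * \<psi> x)", OF sym, rotated])
  qed
  then have "((\<lambda>w. LINT x|lborel. f w x * \<psi> x) has_field_derivative (LINT x|lborel. D x * \<psi> x)) (at w0 within ball w0 (\<rho> / 2))"
    unfolding has_field_derivative_iff .
  then have "((\<lambda>w. LINT x|lborel. f w x * \<psi> x) has_field_derivative (LINT x|lborel. D x * \<psi> x)) (at w0)"
    using at_within_open[OF centre_in_ball[THEN iffD2] open_ball, of "\<rho> / 2" w0] \<rho>(1) by (simp only: half_gt_zero)
  then show "(\<lambda>w. LINT x|lborel. f w x * \<psi> x) field_differentiable at w0 within W"
    unfolding field_differentiable_def using has_field_derivative_at_within by blast
qed

section \<open>Holomorphic functions with values in the dual of the smooth vectors\<close>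

lemma test_functions_shift:
  fixes \<psi> :: "'n::finite test_fun"
  assumes "\<psi> \<in> test_functions"
  shows "(\<lambda>x. \<psi> (x - s)) \<in> test_functions"
proof -
  obtain K where K: "compact K" "\<And>x. x \<notin> K \<Longrightarrow> \<psi> x = 0" and sm: "smooth \<psi>"
    using assms by (auto simp: test_functions_def)
  have "compact ((\<lambda>x. x + s) ` K)" by (intro compact_continuous_image K(1) continuous_intros)
  moreover have "\<psi> (x - s) = 0" if "x \<notin> (\<lambda>x. x + s) ` K" for x
  proof (rule K(2), rule notI)
    assume "x - s \<in> K"
    then have "x - s + s \<in> (\<lambda>x. x + s) ` K" by (rule imageI)
    with that show False by simp
  qed
  ultimately show ?thesis using smooth_shift[OF sm] by (auto simp: test_functions_def)
qed

lemma test_functions_cmult: "\<psi> \<in> test_functions \<Longrightarrow> (\<lambda>x. c * \<psi> x) \<in> test_functions"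
  using smooth_cmult by (fastforce simp: test_functions_def)

lemma test_functions_add:
  assumes "\<phi> \<in> test_functions" "\<psi> \<in> test_functions"
  shows "(\<lambda>x. \<phi> x + \<psi> x) \<in> test_functions"
proof -
  obtain K where K: "compact K" "\<And>x. x \<notin> K \<Longrightarrow> \<phi> x = 0" "smooth \<phi>"
    using assms by (auto simp: test_functions_def)
  obtain L where L: "compact L" "\<And>x. x \<notin> L \<Longrightarrow> \<psi> x = 0" "smooth \<psi>"
    using assms by (auto simp: test_functions_def)
  have "compact (K \<union> L)" "\<forall>x. x \<notin> K \<union> L \<longrightarrow> \<phi> x + \<psi> x = 0" using K L by auto
  then show ?thesis using smooth_add[OF K(3) L(3)] by (auto simp: test_functions_def simp del: Un_iff)
qed

lemma test_functions_zero: "(\<lambda>x. 0) \<in> test_functions"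
  unfolding test_functions_def using smooth_const compact_empty by blast

lemma test_functions_sum: "(\<And>i. i \<in> I \<Longrightarrow> f i \<in> test_functions) \<Longrightarrow> (\<lambda>x. \<Sum>i\<in>I. f i x) \<in> test_functions"
proof (induction I rule: infinite_finite_induct)
  case (insert i I)
  then show ?case using test_functions_add[of "f i" "\<lambda>x. \<Sum>i\<in>I. f i x"] by simp
qed (simp_all add: test_functions_zero)

lemma test_functions_schwartz: "\<psi> \<in> test_functions \<Longrightarrow> \<psi> \<in> schwartz"
  using test_functions_subset_schwartz by blast

definition dirderiv :: "real ^ 'n \<Rightarrow> 'n::finite test_fun \<Rightarrow> 'n test_fun" where
  "dirderiv v \<psi> = (\<lambda>x. \<Sum>j\<in>UNIV. of_real (v $ j) * partial_deriv j \<psi> x)"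

lemma dirderiv_test: "\<psi> \<in> test_functions \<Longrightarrow> dirderiv v \<psi> \<in> test_functions"
  unfolding dirderiv_def by (intro test_functions_sum test_functions_cmult test_functions_partial_deriv)

lemma (in transl_inv_banach) DE_norm_dirderiv:
  assumes \<psi>: "\<psi> \<in> test_functions"
  shows "DE_norm nE N (schwartz_dist (dirderiv v \<psi>)) \<le> real CARD('n) * norm v * DE_norm nE (Suc N) (schwartz_dist \<psi>)"
proof (rule DE_norm_le)
  fix js :: "'n list" assume js: "length js \<le> N"
  have S: "\<psi> \<in> schwartz" using \<psi> by (rule test_functions_schwartz)
  let ?g = "\<lambda>j. partial_derivs (js @ [j]) \<psi>"
  have g: "?g j \<in> schwartz" for j by (rule schwartz_partial_derivs(1)[OF S])
  have sm: "smooth (partial_deriv j \<psi>)" for j by (rule smooth_partial_deriv[OF schwartz_smooth[OF S]])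
  have dS: "dirderiv v \<psi> \<in> schwartz" by (rule test_functions_schwartz[OF dirderiv_test[OF \<psi>]])
  have "partial_derivs js (dirderiv v \<psi>) = (\<lambda>x. \<Sum>j\<in>UNIV. of_real (v $ j) * ?g j x)"
    unfolding dirderiv_def
    by (subst partial_derivs_sum[OF smooth_cmult[OF sm]])
      (simp add: partial_derivs_cmult[OF sm] partial_derivs_append partial_derivs_Cons)
  moreover have "schwartz_dist (\<lambda>x. \<Sum>j\<in>UNIV. of_real (v $ j) * ?g j x) = (\<Sum>j\<in>UNIV. schwartz_dist (\<lambda>x. of_real (v $ j) * ?g j x))"
  proof
    fix \<eta> :: "'n test_fun"
    have I: "integrable lborel (\<lambda>x. of_real (v $ j) * ?g j x * \<eta> x)" if "\<eta> \<in> schwartz" for j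
      by (rule schwartz_bounded_mult_integrable[OF that schwartz_cmult[OF g]])
    show "schwartz_dist (\<lambda>x. \<Sum>j\<in>UNIV. of_real (v $ j) * ?g j x) \<eta> = (\<Sum>j\<in>UNIV. schwartz_dist (\<lambda>x. of_real (v $ j) * ?g j x)) \<eta>"
    proof (cases "\<eta> \<in> schwartz")
      case True
      have "(LINT x|lborel. (\<Sum>j\<in>UNIV. of_real (v $ j) * ?g j x * \<eta> x)) = (\<Sum>j\<in>UNIV. LINT x|lborel. of_real (v $ j) * ?g j x * \<eta> x)"
        by (rule Bochner_Integration.integral_sum) (rule I[OF True])
      then show ?thesis using True by (simp only: sum_fun_apply schwartz_dist_apply sum_distrib_right)
    qed (simp add: sum_fun_apply schwartz_dist_def)
  qed
  ultimately have "nE (dist_derivs js (schwartz_dist (dirderiv v \<psi>))) = nE (\<Sum>j\<in>UNIV. schwartz_dist (\<lambda>x. of_real (v $ j) * ?g j x))"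
    unfolding dist_derivs_schwartz_dist[OF dS] by simp
  also have "\<dots> \<le> (\<Sum>j\<in>UNIV. nE (schwartz_dist (\<lambda>x. of_real (v $ j) * ?g j x)))"
    by (rule nE_sum) (rule dist_mem[OF schwartz_cmult[OF g]])
  also have "\<dots> \<le> (\<Sum>j\<in>(UNIV::'n set). norm v * DE_norm nE (Suc N) (schwartz_dist \<psi>))"
  proof (rule sum_mono)
    fix j
    have "nE (schwartz_dist (\<lambda>x. of_real (v $ j) * ?g j x)) = \<bar>v $ j\<bar> * nE (schwartz_dist (?g j))"
      unfolding schwartz_dist_cmult nE_scale[OF dist_mem[OF g]] by simp
    also have "\<dots> \<le> norm v * DE_norm nE (Suc N) (schwartz_dist \<psi>)"
      using DE_norm_ge[of "js @ [j]" "Suc N" "schwartz_dist \<psi>"] js component_le_norm_cart[of v j]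
      unfolding dist_derivs_schwartz_dist[OF S] by (intro mult_mono nE_nonneg dist_mem g) auto
    finally show "nE (schwartz_dist (\<lambda>x. of_real (v $ j) * ?g j x)) \<le> norm v * DE_norm nE (Suc N) (schwartz_dist \<psi>)" .
  qed
  finally show "nE (dist_derivs js (schwartz_dist (dirderiv v \<psi>))) \<le> real CARD('n) * norm v * DE_norm nE (Suc N) (schwartz_dist \<psi>)"
    by simp
qed

lemma cvec_line: "cvec (x + Re w *\<^sub>R v) (y + Im w *\<^sub>R v) = cvec x y + w *s (\<chi> i. of_real (v $ i))"
  by (simp add: cvec_def vec_eq_iff complex_eq_iff)

lemma cvec_tube: "cvec x y \<in> tube V \<longleftrightarrow> y \<in> V"
proof -
  have "(\<chi> i. Im (cvec x y $ i)) = y" by (simp add: cvec_def vec_eq_iff)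
  then show ?thesis by (simp add: tube_def)
qed

section \<open>Pairings of \<open>F\<close> with test functions\<close>

locale tube_function = transl_inv_banach E nE
  for E :: "'n::finite tdist set" and nE +
  fixes C :: "(real ^ 'n) set" and r :: real and F :: "complex ^ 'n \<Rightarrow> complex"
  assumes cone: "open_convex_cone C" and r: "r > 0"
    and holo: "holomorphic_several_on F (tube (cone_trunc C r))"
    and mem: "\<And>y. y \<in> cone_trunc C r \<Longrightarrow> belongs (hslice F y) (DE_dual E nE)"
begin

abbreviation V where "V \<equiv> cone_trunc C r"

definition u :: "real ^ 'n \<Rightarrow> 'n tdist \<Rightarrow> complex" where
  "u y = func_in (DE_dual E nE) (hslice F y)"

lemma V_eq: "V = C \<inter> ball 0 r"
  by (auto simp: cone_trunc_def)

lemma open_V: "open V" and convex_V: "convex V"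
  using cone unfolding V_eq open_convex_cone_def by (auto intro: convex_Int)

lemma u_dual: "y \<in> V \<Longrightarrow> u y \<in> DE_dual E nE"
  and u_rep: "y \<in> V \<Longrightarrow> represents (u y) (hslice F y)"
  unfolding u_def by (simp_all add: func_in_DE_dual mem)

lemma u_eq: "y \<in> V \<Longrightarrow> \<psi> \<in> test_functions \<Longrightarrow> u y (schwartz_dist \<psi>) = (LINT x|lborel. F (cvec x y) * \<psi> x)"
  and u_int: "y \<in> V \<Longrightarrow> \<psi> \<in> test_functions \<Longrightarrow> integrable lborel (\<lambda>x. F (cvec x y) * \<psi> x)"
  using u_rep unfolding represents_def hslice_def by auto

lemma F_continuous: "continuous_on (tube V) F"
proof (rule continuous_at_imp_continuous_on, rule ballI)
  fix z assume "z \<in> tube V"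
  then obtain F' where "(F has_derivative F') (at z)" using holo unfolding holomorphic_several_on_def by blast
  then show "isCont F z" by (rule has_derivative_continuous)
qed

lemma line_open: "open {w. y + Im w *\<^sub>R v \<in> V}"
  using open_vimage[OF open_V, of "\<lambda>w. y + Im w *\<^sub>R v"] by (simp add: vimage_def continuous_intros)

lemma line_continuous:
  "continuous_on ({w. y + Im w *\<^sub>R v \<in> V} \<times> UNIV) (\<lambda>(w, x). F (cvec (x + Re w *\<^sub>R v) (y + Im w *\<^sub>R v)))"
proof -
  have "continuous_on ({w. y + Im w *\<^sub>R v \<in> V} \<times> UNIV) (\<lambda>p. cvec (snd p + Re (fst p) *\<^sub>R v) (y + Im (fst p) *\<^sub>R v))"
    unfolding cvec_def Complex_eq by (intro continuous_intros)
  then have "continuous_on ({w. y + Im w *\<^sub>R v \<in> V} \<times> UNIV) (\<lambda>p. F (cvec (snd p + Re (fst p) *\<^sub>R v) (y + Im (fst p) *\<^sub>R v)))"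
    by (rule continuous_on_compose2[OF F_continuous]) (auto simp: cvec_tube)
  then show ?thesis by (simp add: case_prod_beta)
qed

text \<open>Along a complex line with real direction \<open>v\<close> the derivative of
  \<open>F\<close> acts on complex multiples of one vector, and its complex homogeneity is the
  Cauchy-Riemann condition in \<open>w\<close>.\<close>

lemma line_holomorphic:
  "(\<lambda>w. F (cvec (x + Re w *\<^sub>R v) (y + Im w *\<^sub>R v))) holomorphic_on {w. y + Im w *\<^sub>R v \<in> V}"
  unfolding holomorphic_on_def
proof
  fix w assume "w \<in> {w. y + Im w *\<^sub>R v \<in> V}"
  then have z: "cvec (x + Re w *\<^sub>R v) (y + Im w *\<^sub>R v) \<in> tube V" by (simp add: cvec_tube)
  let ?v = "(\<chi> i. of_real (v $ i)) :: complex ^ 'n"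
  let ?g = "\<lambda>w. cvec x y + w *s ?v"
  obtain F' where F': "(F has_derivative F') (at (?g w))" "\<And>c v. F' (c *s v) = c * F' v"
    using holo z unfolding holomorphic_several_on_def cvec_line by blast
  have "linear (\<lambda>h. h *s ?v)"
    by (rule linearI) (simp_all add: vec_eq_iff algebra_simps)
  then have "((\<lambda>h. h *s ?v) has_derivative (\<lambda>h. h *s ?v)) (at w)"
    by (simp add: linear_conv_bounded_linear bounded_linear_imp_has_derivative)
  then have "(?g has_derivative (\<lambda>h. h *s ?v)) (at w)"
    using has_derivative_add[OF has_derivative_const[of "cvec x y"]] by fastforce
  from has_derivative_compose[OF this F'(1)]
  have "((\<lambda>w. F (?g w)) has_derivative (\<lambda>h. F' (h *s ?v))) (at w)" .
  then have "((\<lambda>w. F (?g w)) has_field_derivative F' ?v) (at w)"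
    unfolding has_field_derivative_def F'(2) mult_commute_abs .
  then show "(\<lambda>w. F (cvec (x + Re w *\<^sub>R v) (y + Im w *\<^sub>R v))) field_differentiable at w within {w. y + Im w *\<^sub>R v \<in> V}"
    unfolding cvec_line using field_differentiable_at_within field_differentiable_def by blast
qed

lemma slice_continuous: "y \<in> V \<Longrightarrow> continuous_on UNIV (\<lambda>x. F (cvec x y))"
  unfolding cvec_def Complex_eq
  by (rule continuous_on_compose2[OF F_continuous])
    (auto intro!: continuous_intros simp: cvec_tube[unfolded cvec_def Complex_eq])

text \<open>The real part of \<open>w\<close> translates the test function, the imaginary part moves
  \<open>y\<close>. A change of variables shows both to be one complex translation of
  \<open>F\<close>, integrated against the fixed function \<open>\<psi>\<close>.\<close>

lemma pairing_holomorphic: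
  assumes \<psi>: "\<psi> \<in> test_functions"
  shows "(\<lambda>w. u (y + Im w *\<^sub>R v) (schwartz_dist (\<lambda>x. \<psi> (x - Re w *\<^sub>R v)))) holomorphic_on {w. y + Im w *\<^sub>R v \<in> V}"
proof -
  obtain K where K: "compact K" "\<And>x. x \<notin> K \<Longrightarrow> \<psi> x = 0" and sm: "smooth \<psi>"
    using \<psi> by (auto simp: test_functions_def)
  have "(\<lambda>w. LINT x|lborel. F (cvec (x + Re w *\<^sub>R v) (y + Im w *\<^sub>R v)) * \<psi> x) holomorphic_on {w. y + Im w *\<^sub>R v \<in> V}"
    by (rule holomorphic_integral[OF line_open K(1) line_continuous line_holomorphic smooth_continuous[OF sm] K(2)])
  then show ?thesis
  proof (rule holomorphic_transform)
    fix w assume "w \<in> {w. y + Im w *\<^sub>R v \<in> V}"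
    then have w: "y + Im w *\<^sub>R v \<in> V" by simp
    let ?s = "Re w *\<^sub>R v"
    have "(\<lambda>x. F (cvec x (y + Im w *\<^sub>R v)) * \<psi> (x - ?s)) \<in> borel_measurable borel"
      by (intro borel_measurable_continuous_onI continuous_on_mult slice_continuous w smooth_continuous smooth_shift sm)
    from lborel_shift[OF this, of ?s]
    show "(LINT x|lborel. F (cvec (x + Re w *\<^sub>R v) (y + Im w *\<^sub>R v)) * \<psi> x) = u (y + Im w *\<^sub>R v) (schwartz_dist (\<lambda>x. \<psi> (x - Re w *\<^sub>R v)))"
      by (simp add: u_eq[OF w test_functions_shift[OF \<psi>]])
  qed
qed

text \<open>Once the pairing is holomorphic, its derivative may be computed along real
  \<open>w\<close>. There only the test function moves, so Taylor's formula for
  \<open>\<psi>\<close> suffices and \<open>F\<close> is never differentiated.\<close>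

lemma pairing_derivative_0:
  assumes \<psi>: "\<psi> \<in> test_functions" and y: "y \<in> V"
  shows "((\<lambda>w. u (y + Im w *\<^sub>R v) (schwartz_dist (\<lambda>x. \<psi> (x - Re w *\<^sub>R v)))) has_field_derivative
    - u y (schwartz_dist (dirderiv v \<psi>))) (at 0)"
proof -
  define \<Phi> where "\<Phi> w = u (y + Im w *\<^sub>R v) (schwartz_dist (\<lambda>x. \<psi> (x - Re w *\<^sub>R v)))" for w
  define D where "D = deriv \<Phi> 0"
  have D: "(\<Phi> has_field_derivative D) (at 0)"
    unfolding D_def \<Phi>_def using y by (intro holomorphic_derivI[OF pairing_holomorphic[OF \<psi>] line_open]) simp
  obtain K where K: "compact K" "\<And>x. x \<notin> K \<Longrightarrow> \<psi> x = 0" and sm: "smooth \<psi>"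
    using \<psi> by (auto simp: test_functions_def)
  obtain R where R: "\<And>x. x \<in> K \<Longrightarrow> norm x \<le> R"
    using compact_imp_bounded[OF K(1)] by (auto simp: bounded_iff)
  have S: "\<psi> \<in> schwartz" using \<psi> by (rule test_functions_schwartz)
  \<comment> \<open>Contains the supports of all translates of \<open>\<psi>\<close> by
    \<open>s *\<^sub>R v\<close> with \<open>\<bar>s\<bar> \<le> 1\<close>.\<close>
  let ?J = "cball 0 (R + norm v) :: (real ^ 'n) set"
  have "bounded ((\<lambda>x. F (cvec x y)) ` ?J)"
    by (intro compact_imp_bounded compact_continuous_image continuous_on_subset[OF slice_continuous[OF y]]) auto
  then obtain B where "\<forall>z\<in>(\<lambda>x. F (cvec x y)) ` ?J. cmod z \<le> B" unfolding bounded_iff by blast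
  then have B: "cmod (F (cvec x y)) \<le> B" if "x \<in> ?J" for x using that by blast
  define M where "M = \<bar>B\<bar> * ((real CARD('n))\<^sup>2 * (norm v)\<^sup>2 * schwartz_norm 2 \<psi>)"
  have M: "M \<ge> 0" unfolding M_def by (intro mult_nonneg_nonneg schwartz_norm_nonneg S) auto
  have Jint: "integrable lborel (\<lambda>x. indicator ?J x * c)" for c :: real
    using emeasure_compact_finite[of ?J]
    by (intro integrable_mult_left integrable_real_indicator) (auto simp: borel_compact less_top)
  let ?A = "u y (schwartz_dist (dirderiv v \<psi>))"
  define m where "m = (LINT x|lborel. indicator ?J x * M)"
  have est: "cmod (\<Phi> (of_real s) - \<Phi> 0 + of_real s * ?A) \<le> m * s\<^sup>2" if s: "\<bar>s\<bar> \<le> 1" for s :: real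
  proof -
    note T = test_functions_shift[OF \<psi>, of "s *\<^sub>R v"] \<psi> dirderiv_test[OF \<psi>, of v]
    note I = u_int[OF y T(1)] u_int[OF y T(2)] u_int[OF y T(3)]
    have "\<Phi> (of_real s) - \<Phi> 0 + of_real s * ?A = (LINT x|lborel. F (cvec x y) * \<psi> (x - s *\<^sub>R v)) - (LINT x|lborel. F (cvec x y) * \<psi> x)
        + of_real s * (LINT x|lborel. F (cvec x y) * dirderiv v \<psi> x)"
      by (simp add: \<Phi>_def u_eq[OF y T(1)] u_eq[OF y T(2)] u_eq[OF y T(3)])
    also have "\<dots> = (LINT x|lborel. F (cvec x y) * \<psi> (x - s *\<^sub>R v) - F (cvec x y) * \<psi> x + of_real s * (F (cvec x y) * dirderiv v \<psi> x))"
      using I by simp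
    also have "cmod \<dots> \<le> (LINT x|lborel. indicator ?J x * (M * s\<^sup>2))"
    proof (rule integral_norm_le[OF Jint])
      fix x
      let ?e = "\<psi> (x - s *\<^sub>R v) - \<psi> x + of_real s * dirderiv v \<psi> x"
      have eq: "F (cvec x y) * \<psi> (x - s *\<^sub>R v) - F (cvec x y) * \<psi> x + of_real s * (F (cvec x y) * dirderiv v \<psi> x) = F (cvec x y) * ?e"
        by (simp add: algebra_simps)
      show "norm (F (cvec x y) * \<psi> (x - s *\<^sub>R v) - F (cvec x y) * \<psi> x + of_real s * (F (cvec x y) * dirderiv v \<psi> x)) \<le> indicator ?J x * (M * s\<^sup>2)"
      proof (cases "x \<in> ?J")
        case True
        have t: "cmod (\<psi> (x + - (s *\<^sub>R v)) - \<psi> x - (\<Sum>j\<in>UNIV. of_real ((- (s *\<^sub>R v)) $ j) * partial_deriv j \<psi> x)) \<le>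
          (real CARD('n))\<^sup>2 * (norm (- (s *\<^sub>R v)))\<^sup>2 * schwartz_norm 2 \<psi>" by (rule schwartz_taylor[OF S])
        have "(\<Sum>j\<in>UNIV. of_real ((- (s *\<^sub>R v)) $ j) * partial_deriv j \<psi> x) = - (of_real s * dirderiv v \<psi> x)"
          by (simp add: dirderiv_def sum_distrib_left sum_negf mult.assoc)
        with t have "cmod ?e \<le> (real CARD('n))\<^sup>2 * (norm v)\<^sup>2 * schwartz_norm 2 \<psi> * s\<^sup>2"
          by (simp add: power_mult_distrib mult_ac)
        then have "cmod (F (cvec x y)) * cmod ?e \<le> \<bar>B\<bar> * ((real CARD('n))\<^sup>2 * (norm v)\<^sup>2 * schwartz_norm 2 \<psi> * s\<^sup>2)"
          using B[OF True] by (intro mult_mono) auto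
        then show ?thesis unfolding eq using True by (simp add: norm_mult M_def mult_ac)
      next
        case False
        then have far: "norm x > R + norm v" by simp
        have "norm x \<le> norm (x - s *\<^sub>R v) + norm (s *\<^sub>R v)" using norm_triangle_ineq[of "x - s *\<^sub>R v" "s *\<^sub>R v"] by simp
        moreover have "norm (s *\<^sub>R v) \<le> norm v" using s by (simp add: mult_left_le_one_le)
        ultimately have "x - s *\<^sub>R v \<notin> K" "x \<notin> K" using far R[of "x - s *\<^sub>R v"] R[of x] norm_ge_zero[of v] by linarith+
        then have 1: "\<psi> (x - s *\<^sub>R v) = 0" "\<psi> x = 0" using K(2) by auto
        have "partial_deriv j \<psi> x = 0" for j
        proof -
          have "(\<psi> has_derivative (\<lambda>_. 0)) (at x)"
            by (rule has_derivative_transform_within_open[of "\<lambda>_. 0" _ _ _ "- K"])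
              (use K \<open>x \<notin> K\<close> compact_imp_closed in \<open>auto simp: open_Compl\<close>)
          from partial_derivI[OF this] show ?thesis by simp
        qed
        then have "dirderiv v \<psi> x = 0" by (simp add: dirderiv_def)
        then show ?thesis using 1 False by simp
      qed
    qed
    also have "\<dots> = m * s\<^sup>2"
    proof -
      have "(LINT x|lborel. indicator ?J x * (M * s\<^sup>2)) = (LINT x|lborel. (indicator ?J x * M) * s\<^sup>2)" by (simp only: mult.assoc)
      then show ?thesis unfolding m_def by (simp only: integral_mult_left_zero)
    qed
    finally show ?thesis .
  qed
  have "((\<lambda>s::real. (\<Phi> (of_real s) - \<Phi> 0) / of_real s) \<longlongrightarrow> D) (at 0)"
  proof -
    have l: "((\<lambda>w. (\<Phi> w - \<Phi> 0) / w) \<longlongrightarrow> D) (at 0)" using D unfolding has_field_derivative_iff by simp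
    have "((\<lambda>s::real. complex_of_real s) \<longlongrightarrow> of_real 0) (at 0)" by (intro tendsto_intros)
    then have "filterlim (\<lambda>s::real. complex_of_real s) (at 0) (at 0)"
      by (auto simp: filterlim_at eventually_at intro!: exI[of _ 1])
    from filterlim_compose[OF l this] show ?thesis .
  qed
  moreover have "((\<lambda>s::real. (\<Phi> (of_real s) - \<Phi> 0) / of_real s) \<longlongrightarrow> - ?A) (at 0)"
  proof -
    have "((\<lambda>s::real. (\<Phi> (of_real s) - \<Phi> 0) / of_real s - (- ?A)) \<longlongrightarrow> 0) (at 0)"
    proof (rule Lim_null_comparison)
      have "((\<lambda>s. m * \<bar>s\<bar>) \<longlongrightarrow> m * \<bar>0\<bar>) (at 0)" by (intro tendsto_intros)
      then show "((\<lambda>s. m * \<bar>s\<bar>) \<longlongrightarrow> 0) (at 0)" by simp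
      show "\<forall>\<^sub>F s in at 0. norm ((\<Phi> (of_real s) - \<Phi> 0) / of_real s - (- ?A)) \<le> m * \<bar>s\<bar>"
        unfolding eventually_at
      proof (intro exI[of _ 1] conjI ballI impI)
        fix s :: real assume s: "s \<noteq> 0 \<and> dist s 0 < 1"
        have "(\<Phi> (of_real s) - \<Phi> 0) / of_real s - (- ?A) = (\<Phi> (of_real s) - \<Phi> 0 + of_real s * ?A) / of_real s"
          using s by (simp add: field_simps)
        then have "norm ((\<Phi> (of_real s) - \<Phi> 0) / of_real s - (- ?A)) = cmod (\<Phi> (of_real s) - \<Phi> 0 + of_real s * ?A) / \<bar>s\<bar>"
          by (simp only: norm_divide norm_of_real)
        also have "\<dots> \<le> m * s\<^sup>2 / \<bar>s\<bar>" using est[of s] s by (intro divide_right_mono) auto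
        also have "\<dots> = m * \<bar>s\<bar>"
        proof -
          have "s\<^sup>2 = \<bar>s\<bar> * \<bar>s\<bar>" by (simp add: power2_eq_square)
          then have "m * s\<^sup>2 / \<bar>s\<bar> = m * (\<bar>s\<bar> * \<bar>s\<bar>) / \<bar>s\<bar>" by (simp only:)
          also have "\<dots> = m * \<bar>s\<bar>" using s by (simp del: abs_mult_self_eq)
          finally show ?thesis .
        qed
        finally show "norm ((\<Phi> (of_real s) - \<Phi> 0) / of_real s - (- ?A)) \<le> m * \<bar>s\<bar>" .
      qed simp
    qed
    then show ?thesis by (simp only: LIM_zero_iff)
  qed
  ultimately have "D = - ?A" using tendsto_unique[OF at_neq_bot] by blast
  then show ?thesis using D unfolding \<Phi>_def[abs_def] by simp
qed

text \<open>The Cauchy-Riemann relation: the derivative in the imaginary direction is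
  \<open>\<i>\<close> times the one along real \<open>w\<close>.\<close>

lemma pairing_derivative:
  assumes \<psi>: "\<psi> \<in> test_functions" and y: "y + t *\<^sub>R v \<in> V"
  shows "((\<lambda>t. u (y + t *\<^sub>R v) (schwartz_dist \<psi>)) has_vector_derivative
    - \<i> * u (y + t *\<^sub>R v) (schwartz_dist (dirderiv v \<psi>))) (at t)"
proof -
  let ?y = "y + t *\<^sub>R v"
  let ?\<Phi> = "\<lambda>w. u (?y + Im w *\<^sub>R v) (schwartz_dist (\<lambda>x. \<psi> (x - Re w *\<^sub>R v)))"
  have h: "((\<lambda>s. \<i> * of_real (s - t)) has_vector_derivative \<i>) (at t)"
    by (auto intro!: derivative_eq_intros simp: has_vector_derivative_def scaleR_conv_of_real)
  have "(?\<Phi> has_field_derivative - u ?y (schwartz_dist (dirderiv v \<psi>))) (at (\<i> * of_real (t - t)))"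
    using pairing_derivative_0[OF \<psi> y] by simp
  from field_vector_diff_chain_at[OF h this]
  have "((\<lambda>s. ?\<Phi> (\<i> * of_real (s - t))) has_vector_derivative \<i> * - u ?y (schwartz_dist (dirderiv v \<psi>))) (at t)"
    by (simp add: o_def)
  moreover have "?\<Phi> (\<i> * of_real (s - t)) = u (y + s *\<^sub>R v) (schwartz_dist \<psi>)" for s
    by (simp add: algebra_simps)
  ultimately show ?thesis by simp
qed


section \<open>Lipschitz dependence and boundary values\<close>

lemma DE_dual_bounded_equicontinuous:
  assumes "DE_dual_bounded E nE B"
  shows "\<exists>K N. K \<ge> 0 \<and> (\<forall>L\<in>B. \<forall>f\<in>DE_space E. cmod (L f) \<le> K * DE_norm nE N f)"
proof (rule DS.strong_bounded_equicontinuous[of "DE_norm nE" B])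
  show "strong_dual_bounded (DE_space E) (DE_seminorms nE) B" using assms by (simp add: DE_dual_bounded_def)
  fix N K assume "0 \<le> K" "\<And>L f. L \<in> B \<Longrightarrow> f \<in> DE_space E \<Longrightarrow> cmod (L f) \<le> K * DE_norm nE N f"
  then show ?thesis by auto
qed (auto intro: DE_norm_mono)

lemma DE_dual_boundedI:
  assumes "B \<subseteq> DE_dual E nE" "\<And>L f. L \<in> B \<Longrightarrow> f \<in> DE_space E \<Longrightarrow> cmod (L f) \<le> K * DE_norm nE N f"
  shows "DE_dual_bounded E nE B"
  unfolding DE_dual_bounded_def
  using assms by (intro DS.strong_boundedI[of B "DE_norm nE N" K]) (auto simp: DE_dual_def)

lemma lipschitz:
  assumes K: "K \<ge> 0" "\<And>y f. y \<in> V \<Longrightarrow> f \<in> DE_space E \<Longrightarrow> cmod (u y f) \<le> K * DE_norm nE N f"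
    and y: "y \<in> V" "z \<in> V" and f: "f \<in> DE_space E"
  shows "cmod (u y f - u z f) \<le> (K * real CARD('n) * norm (y - z)) * DE_norm nE (Suc N) f"
proof -
  let ?M = "K * real CARD('n) * norm (y - z)"
  have "cmod ((u y - u z) f) \<le> ?M * DE_norm nE (Suc N) f"
  proof (rule DE_dual_extend_bound[OF DE_dual_diff[OF u_dual[OF y(1)] u_dual[OF y(2)]] _ _ f])
    show "0 \<le> ?M" using K by simp
    fix \<psi> :: "'n test_fun" assume \<psi>: "\<psi> \<in> test_functions"
    let ?v = "y - z" and ?X = "DE_norm nE (Suc N) (schwartz_dist \<psi>)"
    have in_V: "z + t *\<^sub>R ?v \<in> V" if "t \<in> {0..1}" for t
    proof -
      have "z + t *\<^sub>R ?v = (1 - t) *\<^sub>R z + t *\<^sub>R y" by (simp add: algebra_simps)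
      then show ?thesis using convexD[OF convex_V y(2,1), of "1 - t" t] that by simp
    qed
    let ?D = "\<lambda>t. - \<i> * u (z + t *\<^sub>R ?v) (schwartz_dist (dirderiv ?v \<psi>))"
    have "norm (u (z + 1 *\<^sub>R ?v) (schwartz_dist \<psi>) - u (z + 0 *\<^sub>R ?v) (schwartz_dist \<psi>)) \<le> (?M * ?X) * norm (1 - 0 :: real)"
    proof (rule differentiable_bound[where S="{0..1}" and f="\<lambda>t. u (z + t *\<^sub>R ?v) (schwartz_dist \<psi>)" and f'="\<lambda>t s. s *\<^sub>R ?D t"])
      fix t :: real assume t: "t \<in> {0..1}"
      show "((\<lambda>t. u (z + t *\<^sub>R ?v) (schwartz_dist \<psi>)) has_derivative (\<lambda>s. s *\<^sub>R ?D t)) (at t within {0..1})"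
        using has_vector_derivative_at_within[OF pairing_derivative[OF \<psi> in_V[OF t]]]
        by (simp add: has_vector_derivative_def)
      have "cmod (?D t) = cmod (u (z + t *\<^sub>R ?v) (schwartz_dist (dirderiv ?v \<psi>)))" by (simp add: norm_mult)
      also have "\<dots> \<le> K * DE_norm nE N (schwartz_dist (dirderiv ?v \<psi>))"
        by (intro K in_V t dist_DE test_functions_schwartz dirderiv_test \<psi>)
      also have "\<dots> \<le> K * (real CARD('n) * norm ?v * ?X)" by (intro mult_left_mono DE_norm_dirderiv \<psi> K)
      finally have "cmod (?D t) \<le> ?M * ?X" by (simp add: mult.assoc)
      then show "onorm (\<lambda>s. s *\<^sub>R ?D t) \<le> ?M * ?X"
        by (subst onorm_scaleR_left) (auto simp: onorm_id bounded_linear_ident intro: order_trans)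
    qed auto
    then show "cmod ((u y - u z) (schwartz_dist \<psi>)) \<le> ?M * ?X" by simp
  qed
  then show ?thesis by simp
qed

lemma V_nonempty_sequence:
  assumes "C \<noteq> {}"
  shows "\<exists>s. (\<forall>k::nat. s k \<in> V) \<and> s \<longlonglongrightarrow> 0"
proof -
  obtain \<theta> where \<theta>: "\<theta> \<in> C" using assms by blast
  define c where "c k = r / (norm \<theta> + 1) * inverse (real (Suc k))" for k
  have "c k *\<^sub>R \<theta> \<in> V" for k
  proof -
    have p: "norm \<theta> + 1 > 0" by (simp add: add_nonneg_pos)
    have c: "c k > 0" unfolding c_def using r p by (intro mult_pos_pos divide_pos_pos) auto
    have "c k \<le> r / (norm \<theta> + 1) * 1" unfolding c_def using r p by (intro mult_left_mono) (auto simp: field_simps)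
    then have "c k * norm \<theta> \<le> r / (norm \<theta> + 1) * norm \<theta>" by (intro mult_right_mono) auto
    also have "\<dots> < r" using r p by (simp add: field_simps)
    finally have "norm (c k *\<^sub>R \<theta>) < r" using c by simp
    then show ?thesis using cone \<theta> c unfolding open_convex_cone_def cone_trunc_def by blast
  qed
  moreover have "(\<lambda>k. c k *\<^sub>R \<theta>) \<longlonglongrightarrow> (r / (norm \<theta> + 1) * 0) *\<^sub>R \<theta>"
    unfolding c_def by (intro tendsto_scaleR tendsto_mult tendsto_const LIMSEQ_inverse_real_of_nat)
  ultimately show ?thesis by (intro exI[of _ "\<lambda>k. c k *\<^sub>R \<theta>"]) simp
qed

text \<open>The limit along one sequence defines the candidate. Letting the second point of the
  Lipschitz estimate run through that sequence compares every \<open>u y\<close> with it at the rate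
  \<open>norm y\<close>, without a value at 0, and uniformly on sets bounded in
  \<open>DE_norm nE (Suc N)\<close>. That is strong convergence.\<close>

lemma boundary_value:
  assumes K: "K \<ge> 0" "\<And>y f. y \<in> V \<Longrightarrow> f \<in> DE_space E \<Longrightarrow> cmod (u y f) \<le> K * DE_norm nE N f"
    and ne: "C \<noteq> {}"
  shows "\<exists>f \<in> DE_dual E nE. limitin (DE_dual_topology E nE) u f (at 0 within C)"
proof -
  obtain s where s: "\<And>k::nat. s k \<in> V" "s \<longlonglongrightarrow> 0" using V_nonempty_sequence[OF ne] by auto
  define K' where "K' = K * real CARD('n)"
  have K': "K' \<ge> 0" using K by (simp add: K'_def)
  have lip: "cmod (u y f - u z f) \<le> K' * norm (y - z) * DE_norm nE (Suc N) f"
    if "y \<in> V" "z \<in> V" "f \<in> DE_space E" for y z f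
    unfolding K'_def by (rule lipschitz[where N=N]) (use K that in auto)
  have conv: "convergent (\<lambda>k. u (s k) f)" if f: "f \<in> DE_space E" for f
  proof (rule Cauchy_convergent, rule CauchyI)
    fix e :: real assume e: "e > 0"
    define X where "X = K' * DE_norm nE (Suc N) f"
    have X: "X \<ge> 0" unfolding X_def using K' DE_norm_nonneg[OF f] by simp
    have "Cauchy s" using s(2) by (rule LIMSEQ_imp_Cauchy)
    then obtain M where M: "\<And>m n. m \<ge> M \<Longrightarrow> n \<ge> M \<Longrightarrow> norm (s m - s n) < e / (X + 1)"
      using CauchyD[of s "e / (X + 1)"] e X by auto
    show "\<exists>M. \<forall>m\<ge>M. \<forall>n\<ge>M. norm (u (s m) f - u (s n) f) < e"
    proof (intro exI[of _ M] allI impI)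
      fix m n assume "m \<ge> M" "n \<ge> M"
      then have "X * norm (s m - s n) \<le> X * (e / (X + 1))" using M[of m n] X by (intro mult_left_mono) auto
      also have "\<dots> < e" using e X by (simp add: field_simps)
      finally have "K' * norm (s m - s n) * DE_norm nE (Suc N) f < e" by (simp add: X_def mult_ac)
      with lip[OF s(1)[of m] s(1)[of n] f] show "norm (u (s m) f - u (s n) f) < e" by linarith
    qed
  qed
  define L where "L f = (if f \<in> DE_space E then lim (\<lambda>k. u (s k) f) else 0)" for f
  have lim: "(\<lambda>k. u (s k) f) \<longlonglongrightarrow> L f" if "f \<in> DE_space E" for f
    using conv[OF that] that by (simp add: L_def convergent_LIMSEQ_iff)
  have L: "L \<in> DE_dual E nE"
    unfolding DE_dual_def
  proof (rule DS.dualI)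
    show "L f = 0" if "f \<notin> DE_space E" for f using that by (simp add: L_def)
    show "DE_norm nE N \<in> DE_seminorms nE" by simp
    show "cmod (L f) \<le> K * DE_norm nE N f" if f: "f \<in> DE_space E" for f
      by (rule tendsto_upperbound[OF tendsto_norm[OF lim[OF f]]]) (auto intro!: always_eventually K(2)[OF s(1) f])
    show "clinear_functional_on (DE_space E) L"
      unfolding clinear_functional_on_def
    proof (intro conjI ballI allI)
      fix f g assume fg: "f \<in> DE_space E" "g \<in> DE_space E"
      have "u (s k) (f + g) = u (s k) f + u (s k) g" for k
        using DE_dual_linear[OF u_dual[OF s(1)]] fg unfolding clinear_functional_on_def by blast
      then have "(\<lambda>k. u (s k) f + u (s k) g) \<longlonglongrightarrow> L (f + g)" using lim[OF DS.add_mem[OF fg]] by (simp only:)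
      from LIMSEQ_unique[OF this tendsto_add[OF lim[OF fg(1)] lim[OF fg(2)]]] show "L (f + g) = L f + L g" .
    next
      fix c f assume f: "f \<in> DE_space E"
      have "u (s k) (\<lambda>x. c * f x) = c * u (s k) f" for k
        using DE_dual_linear[OF u_dual[OF s(1)]] f unfolding clinear_functional_on_def by blast
      then have "(\<lambda>k. c * u (s k) f) \<longlonglongrightarrow> L (\<lambda>x. c * f x)" using lim[OF DS.scale_mem[OF f, of c]] by (simp only:)
      from LIMSEQ_unique[OF this tendsto_mult[OF tendsto_const lim[OF f]]] show "L (\<lambda>x. c * f x) = c * L f" .
    qed
  qed
  have close: "cmod (u y f - L f) \<le> K' * norm y * DE_norm nE (Suc N) f" if y: "y \<in> V" and f: "f \<in> DE_space E" for y f
  proof (rule LIMSEQ_le)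
    show "(\<lambda>k. cmod (u y f - u (s k) f)) \<longlonglongrightarrow> cmod (u y f - L f)" by (intro tendsto_intros lim f)
    have "(\<lambda>k. K' * norm (y - s k) * DE_norm nE (Suc N) f) \<longlonglongrightarrow> K' * norm (y - 0) * DE_norm nE (Suc N) f"
      by (intro tendsto_intros s)
    then show "(\<lambda>k. K' * norm (y - s k) * DE_norm nE (Suc N) f) \<longlonglongrightarrow> K' * norm y * DE_norm nE (Suc N) f" by simp
    show "\<exists>M. \<forall>k\<ge>M. cmod (u y f - u (s k) f) \<le> K' * norm (y - s k) * DE_norm nE (Suc N) f"
      using lip[OF y s(1) f] by blast
  qed
  interpret SD: seminormed_space "DE_dual E nE" "strong_seminorms (DE_space E) (DE_seminorms nE)"
    unfolding DE_dual_def by (rule DS.strong_dual_seminormed)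
  have "limitin (DE_dual_topology E nE) u L (at 0 within C)"
    unfolding DE_dual_topology_def strong_dual_topology_def DE_dual_def[symmetric]
  proof (rule SD.limitin_lc[OF L])
    fix p \<epsilon> assume p: "p \<in> strong_seminorms (DE_space E) (DE_seminorms nE)" and \<epsilon>: "\<epsilon> > (0::real)"
    from p obtain B where B: "p = (\<lambda>L. SUP f\<in>B. cmod (L f))" "lc_bounded (DE_space E) (DE_seminorms nE) B" "B \<noteq> {}"
      by (auto simp: strong_seminorms_def)
    have BE: "B \<subseteq> DE_space E" and "bdd_above (DE_norm nE (Suc N) ` B)" using B(2) by (auto simp: lc_bounded_def)
    then obtain M where M: "\<And>f. f \<in> B \<Longrightarrow> DE_norm nE (Suc N) f \<le> M" unfolding bdd_above_def by (metis imageI)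
    have M0: "M \<ge> 0" using B(3) M DE_norm_nonneg BE by (meson ex_in_conv order_trans subsetD)
    \<comment> \<open>\<open>r\<close> keeps \<open>y\<close> inside \<open>V\<close>; the added 1
      makes the denominator positive even when \<open>K' * M\<close> vanishes.\<close>
    define \<delta> where "\<delta> = min r (\<epsilon> / (K' * M + 1))"
    have \<delta>: "\<delta> > 0" unfolding \<delta>_def using r \<epsilon> K' M0 by (simp add: add_nonneg_pos)
    show "\<forall>\<^sub>F y in at 0 within C. u y \<in> DE_dual E nE \<and> p (u y - L) < \<epsilon>"
      unfolding eventually_at
    proof (intro exI[of _ \<delta>] conjI \<delta> ballI impI)
      fix y assume y: "y \<in> C" "y \<noteq> 0 \<and> dist y 0 < \<delta>"
      then have yV: "y \<in> V" by (simp add: cone_trunc_def \<delta>_def)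
      show "u y \<in> DE_dual E nE" by (rule u_dual[OF yV])
      have "p (u y - L) \<le> K' * norm y * M"
        unfolding B(1)
      proof (rule cSUP_least[OF B(3)])
        fix f assume f: "f \<in> B"
        have "cmod (u y f - L f) \<le> K' * norm y * DE_norm nE (Suc N) f" using close[OF yV] f BE by blast
        also have "\<dots> \<le> K' * norm y * M" using M[OF f] K' by (intro mult_left_mono) auto
        finally show "cmod ((u y - L) f) \<le> K' * norm y * M" by simp
      qed
      also have "\<dots> \<le> (K' * M) * (\<epsilon> / (K' * M + 1))"
      proof -
        have "norm y \<le> \<epsilon> / (K' * M + 1)" using y(2) by (simp add: \<delta>_def)
        then have "(K' * M) * norm y \<le> (K' * M) * (\<epsilon> / (K' * M + 1))" using K' M0 by (intro mult_left_mono) auto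
        then show ?thesis by (simp add: mult_ac)
      qed
      also have "\<dots> < \<epsilon>"
      proof -
        obtain a where a: "K' * M = a" by blast
        have "a \<ge> 0" using K' M0 a by auto
        then show ?thesis unfolding a using \<epsilon> by (simp add: field_simps)
      qed
      finally show "p (u y - L) < \<epsilon>" .
    qed
  qed
  with L show ?thesis by blast
qed

text \<open>Each strong seminorm is treated separately: near 0 it is at most 1 plus its value at the
  limit, and the remaining points lie in an annulus. The size of the neighbourhood may depend on the
  seminorm.\<close>

lemma bounded_of_boundary_value:
  assumes annulus: "\<And>r'. r' > 0 \<Longrightarrow> DE_dual_bounded E nE {u y | y. r' < norm y \<and> norm y < r \<and> y \<in> C}"
    and L: "limitin (DE_dual_topology E nE) u L (at 0 within C)"
  shows "DE_dual_bounded E nE {u y | y. y \<in> V}"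
  unfolding DE_dual_bounded_def strong_dual_bounded_def lc_bounded_def DE_dual_def[symmetric]
proof (intro conjI ballI)
  show "{u y |y. y \<in> V} \<subseteq> DE_dual E nE" using u_dual by blast
  interpret SD: seminormed_space "DE_dual E nE" "strong_seminorms (DE_space E) (DE_seminorms nE)"
    unfolding DE_dual_def by (rule DS.strong_dual_seminormed)
  fix p assume p: "p \<in> strong_seminorms (DE_space E) (DE_seminorms nE)"
  have lim: "limitin (lc_topology (DE_dual E nE) (strong_seminorms (DE_space E) (DE_seminorms nE))) u L (at 0 within C)"
    using L by (simp add: DE_dual_topology_def strong_dual_topology_def DE_dual_def)
  note ev = SD.limitin_lcD[OF lim p zero_less_one]
  obtain \<delta> where \<delta>: "\<delta> > 0" "\<And>y. y \<in> C \<Longrightarrow> y \<noteq> 0 \<Longrightarrow> norm y < \<delta> \<Longrightarrow> u y \<in> DE_dual E nE \<and> p (u y - L) < 1"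
    using ev(2) unfolding eventually_at by auto
  have "bdd_above (p ` {u y | y. \<delta> / 2 < norm y \<and> norm y < r \<and> y \<in> C})"
    using annulus[of "\<delta> / 2"] \<delta>(1) p unfolding DE_dual_bounded_def strong_dual_bounded_def lc_bounded_def by simp
  then obtain M where M: "\<And>y. \<delta> / 2 < norm y \<Longrightarrow> norm y < r \<Longrightarrow> y \<in> C \<Longrightarrow> p (u y) \<le> M"
    unfolding bdd_above_def by blast
  \<comment> \<open>If the cone is the whole space, then \<open>0\<close> belongs to
    \<open>V\<close>, but neither the limit nor the annulus sees it, so \<open>p (u 0)\<close> is
    added by hand. In the other cases this is just some number that enlarges the bound.\<close>
  have "p (u y) \<le> max (max M (1 + p L)) (p (u 0))" if y: "y \<in> V" for y
  proof (cases "y = 0")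
    case False
    show ?thesis
    proof (cases "norm y < \<delta>")
      case True
      have yC: "y \<in> C" using y by (simp add: cone_trunc_def)
      have d: "u y \<in> DE_dual E nE" "p (u y - L) < 1" using \<delta>(2)[OF yC False True] by auto
      have "p (u y - L + L) \<le> p (u y - L) + p L" by (rule SD.triangle[OF p SD.diff_mem[OF d(1) ev(1)] ev(1)])
      then show ?thesis using d(2) by simp
    next
      case False
      then have "p (u y) \<le> M" using y \<delta>(1) by (intro M) (auto simp: cone_trunc_def)
      then show ?thesis by simp
    qed
  qed simp
  then show "bdd_above (p ` {u y |y. y \<in> V})" unfolding bdd_above_def by blast
qed

end

text \<open>A ball is connected, so if it meets \<open>W\<close> without being contained in it, it
  meets the frontier. Boundedness of \<open>W\<close> keeps the frontier nonempty; the distance to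
  an empty set would be 0 by convention.\<close>

lemma bdry_dist_ge_iff:
  fixes W :: "'a::euclidean_space set"
  assumes W: "open W" "bounded W" and x: "x \<in> W"
  shows "d \<le> bdry_dist W x \<longleftrightarrow> ball x d \<subseteq> W"
proof -
  have ne: "frontier W \<noteq> {}" using W(2) x frontier_eq_empty[of W] not_bounded_UNIV by auto
  have dist: "bdry_dist W x = (INF a\<in>frontier W. dist x a)" using ne by (simp add: bdry_dist_def infdist_def)
  show ?thesis
  proof
    assume d: "d \<le> bdry_dist W x"
    show "ball x d \<subseteq> W"
    proof (rule ccontr)
      assume n: "\<not> ball x d \<subseteq> W"
      then have "d > 0" by (metis ball_empty empty_subsetI not_less)
      then have "x \<in> ball x d \<inter> W" using x by simp
      then have "ball x d \<inter> W \<noteq> {}" by blast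
      then have "ball x d \<inter> frontier W \<noteq> {}"
        using connected_Int_frontier[OF connected_ball, of x d W] n by blast
      then obtain a where a: "a \<in> frontier W" "dist x a < d" by auto
      have "bdry_dist W x \<le> dist x a" unfolding bdry_dist_def by (rule infdist_le[OF a(1)])
      with a(2) d show False by simp
    qed
  next
    assume b: "ball x d \<subseteq> W"
    show "d \<le> bdry_dist W x"
      unfolding dist
    proof (rule cINF_greatest[OF ne])
      fix a assume "a \<in> frontier W"
      then have "a \<notin> W" using W(1) by (simp add: frontier_def interior_open)
      then have "a \<notin> ball x d" using b by blast
      then show "d \<le> dist x a" by simp
    qed
  qed
qed

section \<open>From growth near the boundary to equicontinuity\<close>

context tube_function
begin

lemma cone_add: "x \<in> C \<Longrightarrow> y \<in> C \<Longrightarrow> x + y \<in> C"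
proof -
  assume xy: "x \<in> C" "y \<in> C"
  have "(1/2) *\<^sub>R x + (1/2) *\<^sub>R y \<in> C" using cone xy unfolding open_convex_cone_def convex_def by simp
  then have "2 *\<^sub>R ((1/2) *\<^sub>R x + (1/2) *\<^sub>R y) \<in> C" using cone unfolding open_convex_cone_def by simp
  then show ?thesis by (simp add: scaleR_add_right)
qed

text \<open>The budget \<open>r / 2\<close> leaves room for base points with
  \<open>norm y < r / 2\<close> to move along \<open>\<theta>\<close> up to \<open>t = 1\<close>
  without leaving \<open>V\<close>.\<close>

lemma cone_direction:
  assumes "C \<noteq> {}"
  shows "\<exists>\<theta> \<epsilon>. \<epsilon> > 0 \<and> norm \<theta> + \<epsilon> \<le> r / 2 \<and> ball \<theta> \<epsilon> \<subseteq> C"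
proof -
  obtain \<eta> where \<eta>: "\<eta> \<in> C" using assms by blast
  then obtain \<delta> where \<delta>: "\<delta> > 0" "ball \<eta> \<delta> \<subseteq> C" using cone unfolding open_convex_cone_def open_contains_ball by blast
  define c where "c = r / 2 / (norm \<eta> + \<delta>)"
  have p: "norm \<eta> + \<delta> > 0" using \<delta> by (simp add: add_nonneg_pos)
  have c: "c > 0" unfolding c_def using r p by (intro divide_pos_pos) auto
  have "ball (c *\<^sub>R \<eta>) (c * \<delta>) \<subseteq> C"
  proof
    fix z assume "z \<in> ball (c *\<^sub>R \<eta>) (c * \<delta>)"
    then have z: "norm (c *\<^sub>R \<eta> - z) < c * \<delta>" by (simp add: dist_norm)
    have "c *\<^sub>R \<eta> - z = c *\<^sub>R (\<eta> - (1 / c) *\<^sub>R z)" using c by (simp add: scaleR_diff_right)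
    with z have "c * norm (\<eta> - (1 / c) *\<^sub>R z) < c * \<delta>" using c by simp
    then have "norm (\<eta> - (1 / c) *\<^sub>R z) < \<delta>" using c by simp
    then have "(1 / c) *\<^sub>R z \<in> C" using \<delta>(2) by (auto simp: dist_norm)
    then have "c *\<^sub>R ((1 / c) *\<^sub>R z) \<in> C" using cone c unfolding open_convex_cone_def by blast
    then show "z \<in> C" using c by simp
  qed
  moreover have "norm (c *\<^sub>R \<eta>) + c * \<delta> = r / 2"
  proof -
    have "norm (c *\<^sub>R \<eta>) + c * \<delta> = c * (norm \<eta> + \<delta>)" using c by (simp add: algebra_simps)
    moreover have "c * (norm \<eta> + \<delta>) = r / 2" unfolding c_def using p by (intro nonzero_divide_eq_eq[THEN iffD1, symmetric] refl) simp
    ultimately show ?thesis by simp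
  qed
  ultimately show ?thesis using c \<delta>(1) by (intro exI[of _ "c *\<^sub>R \<eta>"] exI[of _ "c * \<delta>"]) auto
qed

text \<open>Adding a scaled ball of cone directions to a point of the cone stays in the cone. So the
  distance of \<open>y + t *\<^sub>R \<theta>\<close> to the boundary is at least
  \<open>t * \<epsilon>\<close>, uniformly in \<open>y\<close>.\<close>

lemma ball_in_V:
  assumes \<epsilon>: "\<epsilon> > 0" "norm \<theta> + \<epsilon> \<le> r / 2" "ball \<theta> \<epsilon> \<subseteq> C"
    and y: "y \<in> C" "norm y < r / 2" and t: "0 < t" "t \<le> 1"
  shows "ball (y + t *\<^sub>R \<theta>) (t * \<epsilon>) \<subseteq> V"
proof
  fix z assume "z \<in> ball (y + t *\<^sub>R \<theta>) (t * \<epsilon>)"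
  then have z: "norm (y + t *\<^sub>R \<theta> - z) < t * \<epsilon>" by (simp add: dist_norm)
  define w where "w = (1 / t) *\<^sub>R (z - y)"
  have zw: "z = y + t *\<^sub>R w" unfolding w_def using t by simp
  have "y + t *\<^sub>R \<theta> - z = t *\<^sub>R (\<theta> - w)" unfolding zw by (simp add: scaleR_diff_right)
  with z t have w: "norm (\<theta> - w) < \<epsilon>" by simp
  then have "w \<in> C" using \<epsilon>(3) by (auto simp: dist_norm)
  then have "t *\<^sub>R w \<in> C" using cone t unfolding open_convex_cone_def by blast
  then have zC: "z \<in> C" unfolding zw by (intro cone_add y)
  have "norm w \<le> norm \<theta> + \<epsilon>" using norm_triangle_ineq3[of \<theta> w] w by linarith
  then have "norm w \<le> r / 2" using \<epsilon> by linarith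
  then have "t * norm w \<le> 1 * (r / 2)" using t r by (intro mult_mono) auto
  then have "norm z < r" unfolding zw using norm_triangle_ineq[of y "t *\<^sub>R w"] t y by simp
  with zC show "z \<in> V" by (simp add: cone_trunc_def)
qed

text \<open>Integrating the derivative in direction \<open>\<theta>\<close> up to \<open>t = 1\<close>, where the functionals are under control,
  improves the growth by one power of \<open>t\<close> at the cost of one derivative of the test function.\<close>

lemma growth_step:
  assumes p: "p \<noteq> 1" "p \<ge> 0" and V: "\<And>t. 0 < t \<Longrightarrow> t \<le> 1 \<Longrightarrow> y + t *\<^sub>R \<theta> \<in> V" and M: "M \<ge> 0"
    and bd: "\<And>t \<psi>. 0 < t \<Longrightarrow> t \<le> 1 \<Longrightarrow> \<psi> \<in> test_functions \<Longrightarrow>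
      cmod (u (y + t *\<^sub>R \<theta>) (schwartz_dist \<psi>)) \<le> M * t powr (- p) * DE_norm nE N (schwartz_dist \<psi>)"
    and t: "0 < t" "t \<le> 1" and \<psi>: "\<psi> \<in> test_functions"
  shows "cmod (u (y + t *\<^sub>R \<theta>) (schwartz_dist \<psi>))
    \<le> (M + M * (real CARD('n) * norm \<theta>) / \<bar>1 - p\<bar>) * t powr (- max (p - 1) 0) * DE_norm nE (Suc N) (schwartz_dist \<psi>)"
proof -
  define X where "X = DE_norm nE (Suc N) (schwartz_dist \<psi>)"
  define M' where "M' = M * (real CARD('n) * norm \<theta>)"
  \<comment> \<open>The integral of \<open>s powr (- p)\<close> from \<open>t\<close> to 1 is
    bounded for \<open>p < 1\<close> and of order \<open>t powr (1 - p)\<close> for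
    \<open>p > 1\<close>; \<open>q\<close> records both cases.\<close>
  define q where "q = max (p - 1) 0"
  let ?f = "\<lambda>s. u (y + s *\<^sub>R \<theta>) (schwartz_dist \<psi>)"
  let ?f' = "\<lambda>s. - \<i> * u (y + s *\<^sub>R \<theta>) (schwartz_dist (dirderiv \<theta> \<psi>))"
  let ?\<phi> = "\<lambda>s. M' * X * (s powr (1 - p) / (1 - p))"
  have S: "\<psi> \<in> schwartz" by (rule test_functions_schwartz[OF \<psi>])
  have X: "X \<ge> 0" unfolding X_def by (rule DE_norm_nonneg[OF dist_DE[OF S]])
  have M': "M' \<ge> 0" unfolding M'_def using M by simp
  have tq: "1 \<le> t powr (- q)"
  proof -
    have "t powr 0 \<le> t powr (- q)" using t by (intro powr_mono') (auto simp: q_def)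
    then show ?thesis using t by simp
  qed
  have D: "(?f has_vector_derivative ?f' s) (at s)" if "0 < s" "s \<le> 1" for s
    by (rule pairing_derivative[OF \<psi> V[OF that]])
  have one: "cmod (?f 1) \<le> M * X"
  proof -
    have "cmod (?f 1) \<le> M * 1 powr (- p) * DE_norm nE N (schwartz_dist \<psi>)" by (rule bd) (auto simp: \<psi>)
    also have "\<dots> \<le> M * X" unfolding X_def using M DE_norm_mono[of N "Suc N"] by (simp add: mult_left_mono)
    finally show ?thesis .
  qed
  have "cmod (?f 1 - ?f t) \<le> M' * X / \<bar>1 - p\<bar> * t powr (- q)"
  proof (cases "t = 1")
    case True
    then show ?thesis using M' X by simp
  next
    case False
    then have t1: "t < 1" using t by simp
    have "norm (?f 1 - ?f t) \<le> ?\<phi> 1 - ?\<phi> t"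
    proof (rule differentiable_bound_general[OF t1, where f'="?f'" and \<phi>'="\<lambda>s. M' * X * s powr (- p)"])
      show "continuous_on {t..1} ?f"
      proof (rule continuous_at_imp_continuous_on, rule ballI)
        fix s assume "s \<in> {t..1}"
        then show "isCont ?f s" using t by (intro has_vector_derivative_continuous[OF D]) auto
      qed
      have der: "(?\<phi> has_vector_derivative M' * X * s powr (- p)) (at s)" if "0 < s" for s
      proof -
        have "((\<lambda>s. s powr (1 - p)) has_real_derivative (1 - p) * s powr (1 - p - 1)) (at s)"
          by (rule has_real_derivative_powr[OF that])
        from DERIV_cmult[OF DERIV_cdivide[OF this, of "1 - p"], of "M' * X"]
        have "(?\<phi> has_real_derivative M' * X * s powr (- p)) (at s)" using p by simp
        then show ?thesis by (simp add: has_real_derivative_iff_has_vector_derivative)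
      qed
      show "continuous_on {t..1} ?\<phi>"
      proof (rule continuous_at_imp_continuous_on, rule ballI)
        fix s assume "s \<in> {t..1}"
        then show "isCont ?\<phi> s" using t by (intro has_vector_derivative_continuous[OF der]) auto
      qed
      fix s assume s: "t < s" "s < 1"
      then have s0: "0 < s" using t by simp
      show "(?f has_vector_derivative ?f' s) (at s)" by (rule D[OF s0]) (use s in simp)
      show "(?\<phi> has_vector_derivative M' * X * s powr (- p)) (at s)" by (rule der[OF s0])
      have "norm (?f' s) = cmod (u (y + s *\<^sub>R \<theta>) (schwartz_dist (dirderiv \<theta> \<psi>)))" by (simp add: norm_mult)
      also have "\<dots> \<le> M * s powr (- p) * DE_norm nE N (schwartz_dist (dirderiv \<theta> \<psi>))"
        using s s0 by (intro bd dirderiv_test \<psi>) auto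
      also have "\<dots> \<le> M * s powr (- p) * (real CARD('n) * norm \<theta> * X)"
        unfolding X_def using M by (intro mult_left_mono DE_norm_dirderiv \<psi>) auto
      also have "\<dots> = M' * X * s powr (- p)" by (simp add: M'_def mult_ac)
      finally show "norm (?f' s) \<le> M' * X * s powr (- p)" .
    qed
    also have "\<dots> = M' * X * ((1 - t powr (1 - p)) / (1 - p))" by (simp add: diff_divide_distrib right_diff_distrib)
    also have "\<dots> \<le> M' * X * (t powr (- q) / \<bar>1 - p\<bar>)"
    proof (rule mult_left_mono)
      show "(1 - t powr (1 - p)) / (1 - p) \<le> t powr (- q) / \<bar>1 - p\<bar>"
      proof (cases "p < 1")
        case True
        have "(1 - t powr (1 - p)) / (1 - p) \<le> t powr (- q) / (1 - p)"
          using True tq powr_ge_zero[of t "1 - p"] by (intro divide_right_mono) linarith+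
        then show ?thesis using True by simp
      next
        case False
        then have p1: "p > 1" using p by simp
        have q: "- q = 1 - p" using p1 by (simp add: q_def)
        have "(1 - t powr (1 - p)) / (1 - p) = (t powr (1 - p) - 1) / (p - 1)"
          using p1 by (metis minus_diff_eq minus_divide_divide)
        also have "\<dots> \<le> t powr (1 - p) / (p - 1)" using p1 by (intro divide_right_mono) auto
        finally show ?thesis unfolding q using p1 by simp
      qed
    qed (use M' X in simp)
    finally show ?thesis by simp
  qed
  moreover have "M * X * 1 \<le> M * X * t powr (- q)" using M X tq by (intro mult_left_mono) auto
  ultimately have "cmod (?f t) \<le> M * X * t powr (- q) + M' * X / \<bar>1 - p\<bar> * t powr (- q)"
    using one norm_triangle_ineq4[of "?f 1" "?f 1 - ?f t"] by simp
  also have "\<dots> = (M + M' / \<bar>1 - p\<bar>) * t powr (- q) * X" by (simp add: algebra_simps)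
  finally show ?thesis unfolding M'_def X_def q_def .
qed

text \<open>Growth is measured in the parameter along one fixed direction, uniformly in the base
  point. Order and constant are quantified inside, so that they may change from one exponent to the
  next.\<close>

definition growth :: "real ^ 'n \<Rightarrow> real \<Rightarrow> bool" where
  "growth \<theta> p \<longleftrightarrow> (\<exists>N M. M \<ge> 0 \<and> (\<forall>y t \<psi>. y \<in> C \<longrightarrow> norm y < r / 2 \<longrightarrow> 0 < t \<longrightarrow> t \<le> 1 \<longrightarrow> \<psi> \<in> test_functions \<longrightarrow>
     cmod (u (y + t *\<^sub>R \<theta>) (schwartz_dist \<psi>)) \<le> M * t powr (- p) * DE_norm nE N (schwartz_dist \<psi>)))"

lemma growth_reduce:
  assumes V: "\<And>y t. y \<in> C \<Longrightarrow> norm y < r / 2 \<Longrightarrow> 0 < t \<Longrightarrow> t \<le> 1 \<Longrightarrow> y + t *\<^sub>R \<theta> \<in> V"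
    and p: "p \<noteq> 1" "p \<ge> 0" and g: "growth \<theta> p"
  shows "growth \<theta> (max (p - 1) 0)"
proof -
  obtain N M where M: "M \<ge> 0" and bd: "\<And>y t \<psi>. y \<in> C \<Longrightarrow> norm y < r / 2 \<Longrightarrow> 0 < t \<Longrightarrow> t \<le> 1 \<Longrightarrow> \<psi> \<in> test_functions \<Longrightarrow>
     cmod (u (y + t *\<^sub>R \<theta>) (schwartz_dist \<psi>)) \<le> M * t powr (- p) * DE_norm nE N (schwartz_dist \<psi>)"
    using g unfolding growth_def by blast
  show ?thesis
    unfolding growth_def
  proof (rule exI[of _ "Suc N"], rule exI[of _ "M + M * (real CARD('n) * norm \<theta>) / \<bar>1 - p\<bar>"], intro conjI allI impI)
    show "0 \<le> M + M * (real CARD('n) * norm \<theta>) / \<bar>1 - p\<bar>" using M by simp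
    fix y :: "real ^ 'n" and t :: real and \<psi> :: "'n test_fun" assume y: "y \<in> C" "norm y < r / 2" and t: "0 < t" "t \<le> 1" and \<psi>: "\<psi> \<in> test_functions"
    show "cmod (u (y + t *\<^sub>R \<theta>) (schwartz_dist \<psi>))
      \<le> (M + M * (real CARD('n) * norm \<theta>) / \<bar>1 - p\<bar>) * t powr (- max (p - 1) 0) * DE_norm nE (Suc N) (schwartz_dist \<psi>)"
      by (rule growth_step[OF p V[OF y] M bd[OF y] t \<psi>])
  qed
qed

text \<open>Half-integral exponents never meet \<open>p = 1\<close>, where the integral would be logarithmic.\<close>

lemma growth_zero:
  assumes V: "\<And>y t. y \<in> C \<Longrightarrow> norm y < r / 2 \<Longrightarrow> 0 < t \<Longrightarrow> t \<le> 1 \<Longrightarrow> y + t *\<^sub>R \<theta> \<in> V"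
  shows "growth \<theta> (real m + 1 / 2) \<Longrightarrow> growth \<theta> 0"
proof (induction m)
  case 0
  then show ?case using growth_reduce[OF V, of "1 / 2"] by simp
next
  case (Suc m)
  then have "growth \<theta> (max (real (Suc m) + 1 / 2 - 1) 0)" by (intro growth_reduce[OF V]) auto
  moreover have "max (real (Suc m) + 1 / 2 - 1) 0 = real m + 1 / 2" by (simp add: max_def)
  ultimately have "growth \<theta> (real m + 1 / 2)" by (simp only:)
  then show ?case by (rule Suc.IH)
qed

text \<open>With exponent 0 the estimate passes to \<open>t = 0\<close> on each test function, where
  the pairing is continuous, and then to \<open>D\<^sub>E\<close> by density. The points with
  \<open>norm y \<ge> r / 2\<close> lie in the annulus with inner radius
  \<open>r / 4\<close>.\<close>

lemma equicontinuous_of_growth: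
  assumes annulus: "\<And>r'. r' > 0 \<Longrightarrow> DE_dual_bounded E nE {u y | y. r' < norm y \<and> norm y < r \<and> y \<in> C}"
    and V: "\<And>y t. y \<in> C \<Longrightarrow> norm y < r / 2 \<Longrightarrow> 0 < t \<Longrightarrow> t \<le> 1 \<Longrightarrow> y + t *\<^sub>R \<theta> \<in> V"
    and g: "growth \<theta> 0"
  shows "\<exists>K N. K \<ge> 0 \<and> (\<forall>y\<in>V. \<forall>f\<in>DE_space E. cmod (u y f) \<le> K * DE_norm nE N f)"
proof -
  obtain N M where M: "M \<ge> 0" and bd: "\<And>y t \<psi>. y \<in> C \<Longrightarrow> norm y < r / 2 \<Longrightarrow> 0 < t \<Longrightarrow> t \<le> 1 \<Longrightarrow> \<psi> \<in> test_functions \<Longrightarrow>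
     cmod (u (y + t *\<^sub>R \<theta>) (schwartz_dist \<psi>)) \<le> M * t powr (- 0) * DE_norm nE N (schwartz_dist \<psi>)"
    using g unfolding growth_def by blast
  obtain K N' where K: "K \<ge> 0" "\<And>L f. L \<in> {u y | y. r / 4 < norm y \<and> norm y < r \<and> y \<in> C} \<Longrightarrow> f \<in> DE_space E \<Longrightarrow> cmod (L f) \<le> K * DE_norm nE N' f"
    using DE_dual_bounded_equicontinuous[OF annulus[of "r / 4"]] r by auto
  have "cmod (u y f) \<le> max M K * DE_norm nE (max N N') f" if y: "y \<in> V" and f: "f \<in> DE_space E" for y f
  proof (cases "norm y < r / 2")
    case True
    have yC: "y \<in> C" using y by (simp add: cone_trunc_def)
    have "cmod (u y f) \<le> M * DE_norm nE N f"
    proof (rule DE_dual_extend_bound[OF u_dual[OF y] M _ f])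
      fix \<psi> :: "'n test_fun" assume \<psi>: "\<psi> \<in> test_functions"
      have "((\<lambda>t. u (y + t *\<^sub>R \<theta>) (schwartz_dist \<psi>)) \<longlongrightarrow> u (y + 0 *\<^sub>R \<theta>) (schwartz_dist \<psi>)) (at 0)"
        using has_vector_derivative_continuous[OF pairing_derivative[OF \<psi>, of y 0 \<theta>]] y by (simp add: isCont_def)
      then have "((\<lambda>t. u (y + t *\<^sub>R \<theta>) (schwartz_dist \<psi>)) \<longlongrightarrow> u y (schwartz_dist \<psi>)) (at_right 0)"
        by (simp add: filterlim_at_split)
      from tendsto_norm[OF this]
      show "cmod (u y (schwartz_dist \<psi>)) \<le> M * DE_norm nE N (schwartz_dist \<psi>)"
      proof (rule tendsto_upperbound)
        show "\<forall>\<^sub>F t in at_right 0. cmod (u (y + t *\<^sub>R \<theta>) (schwartz_dist \<psi>)) \<le> M * DE_norm nE N (schwartz_dist \<psi>)"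
          unfolding eventually_at_right_field
          by (intro exI[of _ 1]) (use bd[OF yC True _ _ \<psi>] in auto)
      qed simp
    qed
    also have "\<dots> \<le> max M K * DE_norm nE (max N N') f"
      using M DE_norm_nonneg[OF f] by (intro mult_mono DE_norm_mono) auto
    finally show ?thesis .
  next
    case False
    then have "r / 4 < norm y" "norm y < r" "y \<in> C" using r y by (auto simp: cone_trunc_def)
    then have "cmod (u y f) \<le> K * DE_norm nE N' f" by (intro K(2) f) auto
    also have "\<dots> \<le> max M K * DE_norm nE (max N N') f"
      using M DE_norm_nonneg[OF f] by (intro mult_mono DE_norm_mono) auto
    finally show ?thesis .
  qed
  then show ?thesis using M by (intro exI[of _ "max M K"] exI[of _ "max N N'"]) auto
qed

lemma equicontinuous_of_dual_growth:
  assumes annulus: "\<And>r'. r' > 0 \<Longrightarrow> DE_dual_bounded E nE {u y | y. r' < norm y \<and> norm y < r \<and> y \<in> C}"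
    and mem: "\<And>y. y \<in> V \<Longrightarrow> belongs (hslice F y) (dual_space E nE)"
    and M: "M > 0" "\<kappa> \<ge> 0"
    and bound: "\<And>y. y \<in> V \<Longrightarrow> dual_norm E nE (func_in (dual_space E nE) (hslice F y)) \<le> M / (bdry_dist V y) powr \<kappa>"
  shows "\<exists>K N. K \<ge> 0 \<and> (\<forall>y\<in>V. \<forall>f\<in>DE_space E. cmod (u y f) \<le> K * DE_norm nE N f)"
proof (cases "C = {}")
  case True
  then show ?thesis by (intro exI[of _ 0]) (auto simp: cone_trunc_def)
next
  case False
  obtain \<theta> \<epsilon> where \<epsilon>: "\<epsilon> > 0" "norm \<theta> + \<epsilon> \<le> r / 2" "ball \<theta> \<epsilon> \<subseteq> C" using cone_direction[OF False] by auto
  have V: "y + t *\<^sub>R \<theta> \<in> V" if "y \<in> C" "norm y < r / 2" "0 < t" "t \<le> 1" for y t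
  proof -
    have "y + t *\<^sub>R \<theta> \<in> ball (y + t *\<^sub>R \<theta>) (t * \<epsilon>)" using \<epsilon> that by simp
    then show ?thesis using ball_in_V[OF \<epsilon> that] by blast
  qed
  have bV: "bounded V" unfolding V_eq by (simp add: bounded_Int)
  \<comment> \<open>The exponent is raised to a half-integer, as \<open>growth_zero\<close> demands;
    for \<open>t \<le> 1\<close> this only weakens the estimate.\<close>
  let ?p = "real (nat \<lceil>\<kappa>\<rceil>) + 1 / 2"
  have "growth \<theta> ?p"
    unfolding growth_def
  proof (rule exI[of _ 0], rule exI[of _ "M * \<epsilon> powr (- \<kappa>)"], intro conjI allI impI)
    show "0 \<le> M * \<epsilon> powr (- \<kappa>)" using M by simp
    fix y :: "real ^ 'n" and t :: real and \<psi> :: "'n test_fun" assume y: "y \<in> C" "norm y < r / 2" and t: "0 < t" "t \<le> 1" and \<psi>: "\<psi> \<in> test_functions"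
    let ?z = "y + t *\<^sub>R \<theta>"
    have z: "?z \<in> V" by (rule V[OF y t])
    have d: "t * \<epsilon> \<le> bdry_dist V ?z"
      using ball_in_V[OF \<epsilon> y t] by (simp add: bdry_dist_ge_iff[OF open_V bV z])
    have te: "t * \<epsilon> > 0" using t \<epsilon> by simp
    obtain L where L: "L \<in> dual_space E nE" "represents L (hslice F ?z)" using mem[OF z] unfolding belongs_def by blast
    have Dm: "schwartz_dist \<psi> \<in> E" by (rule dist_mem[OF test_functions_schwartz[OF \<psi>]])
    have "u ?z (schwartz_dist \<psi>) = L (schwartz_dist \<psi>)" using u_rep[OF z] L(2) \<psi> by (simp add: represents_def)
    then have "cmod (u ?z (schwartz_dist \<psi>)) \<le> dual_norm E nE L * nE (schwartz_dist \<psi>)"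
      using dual_norm_bound[OF L(1) Dm] by simp
    also have "\<dots> \<le> (M * \<epsilon> powr (- \<kappa>) * t powr (- ?p)) * nE (schwartz_dist \<psi>)"
    proof (rule mult_right_mono[OF _ nE_nonneg[OF Dm]])
      have "dual_norm E nE L \<le> M / (bdry_dist V ?z) powr \<kappa>" using bound[OF z] by (simp add: func_in_dual_space_eq[OF L])
      also have "\<dots> \<le> M / (t * \<epsilon>) powr \<kappa>"
        using d te M by (intro divide_left_mono powr_mono2 mult_pos_pos) auto
      also have "\<dots> = M * \<epsilon> powr (- \<kappa>) * t powr (- \<kappa>)" using t \<epsilon> by (simp add: powr_mult powr_minus field_simps)
      also have "\<dots> \<le> M * \<epsilon> powr (- \<kappa>) * t powr (- ?p)"
      proof (intro mult_left_mono powr_mono')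
        show "- ?p \<le> - \<kappa>" by linarith
      qed (use t M in auto)
      finally show "dual_norm E nE L \<le> M * \<epsilon> powr (- \<kappa>) * t powr (- ?p)" .
    qed
    also have "\<dots> \<le> (M * \<epsilon> powr (- \<kappa>) * t powr (- ?p)) * DE_norm nE 0 (schwartz_dist \<psi>)"
      using DE_norm_ge[of "[]" 0 "schwartz_dist \<psi>"] M by (intro mult_left_mono) (auto simp: dist_derivs_def)
    finally show "cmod (u ?z (schwartz_dist \<psi>)) \<le> M * \<epsilon> powr (- \<kappa>) * t powr (- ?p) * DE_norm nE 0 (schwartz_dist \<psi>)" .
  qed
  then have "growth \<theta> 0" using growth_zero[of \<theta> "nat \<lceil>\<kappa>\<rceil>"] V by blast
  from equicontinuous_of_growth[OF annulus V this] show ?thesis .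
qed

end

lemma prod_Basis_cart: "(\<Prod>b\<in>Basis. f (s \<bullet> b)) = (\<Prod>i\<in>UNIV. f (s $ i))" for s :: "real ^ 'n::finite"
proof -
  have B: "(Basis :: (real ^ 'n) set) = range (\<lambda>i. axis i 1)" by (auto simp: Basis_vec_def)
  have "inj (\<lambda>i::'n. axis i (1::real))" by (auto simp: inj_def axis_eq_axis)
  then show ?thesis unfolding B by (subst prod.reindex) (simp_all add: inner_axis)
qed

section \<open>From equicontinuity to growth estimates in \<open>E'\<close>\<close>

context tube_function
begin

text \<open>Origin of the radius \<open>2 * real CARD('n) * a\<close>: one coordinate may run
  through the strip of half-width \<open>2 * a\<close>, the margin in which the strip formula is
  applied, while the others stay within \<open>a\<close>.\<close>

lemma cube_norm:
  fixes \<sigma> :: "real ^ 'n"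
  assumes b: "b \<in> Basis" and \<sigma>: "\<And>e. e \<in> Basis \<Longrightarrow> \<bar>\<sigma> \<bullet> e\<bar> \<le> a" "\<sigma> \<bullet> b = 0" and h: "\<bar>h\<bar> < 2 * a"
  shows "norm (\<sigma> + h *\<^sub>R b) < 2 * real CARD('n) * a"
proof -
  have fin: "finite (Basis :: (real ^ 'n) set)" by simp
  have a: "a > 0" using h by simp
  have "norm (\<sigma> + h *\<^sub>R b) \<le> (\<Sum>e\<in>Basis. \<bar>(\<sigma> + h *\<^sub>R b) \<bullet> e\<bar>)" by (rule norm_le_l1)
  also have "\<dots> = \<bar>(\<sigma> + h *\<^sub>R b) \<bullet> b\<bar> + (\<Sum>e\<in>Basis - {b}. \<bar>(\<sigma> + h *\<^sub>R b) \<bullet> e\<bar>)" by (rule sum.remove[OF fin b])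
  also have "(\<Sum>e\<in>Basis - {b}. \<bar>(\<sigma> + h *\<^sub>R b) \<bullet> e\<bar>) \<le> (\<Sum>e\<in>(Basis :: (real ^ 'n) set) - {b}. a)"
    by (rule sum_mono) (use b \<sigma> in \<open>auto simp: inner_add_left inner_Basis\<close>)
  also have "\<bar>(\<sigma> + h *\<^sub>R b) \<bullet> b\<bar> < 2 * a" using \<sigma> b h by (simp add: inner_add_left)
  also have "2 * a + (\<Sum>e\<in>(Basis :: (real ^ 'n) set) - {b}. a) \<le> 2 * real CARD('n) * a"
  proof -
    have "real (card ((Basis :: (real ^ 'n) set) - {b})) = real CARD('n) - 1"
      using b by (simp add: card_Diff_singleton of_nat_diff Suc_le_eq)
    moreover have "a \<le> real CARD('n) * a" using a by (simp add: Suc_le_eq)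
    ultimately show ?thesis by (simp add: left_diff_distrib mult.commute[of a])
  qed
  finally show ?thesis by simp
qed

lemma corner_in_V:
  assumes a: "a > 0" and b: "ball y (2 * real CARD('n) * a) \<subseteq> V" and \<sigma>: "\<And>e. e \<in> Basis \<Longrightarrow> \<bar>\<sigma> \<bullet> e\<bar> \<le> a"
  shows "y + \<sigma> \<in> V"
proof -
  have "norm \<sigma> \<le> (\<Sum>e\<in>Basis. \<bar>\<sigma> \<bullet> e\<bar>)" by (rule norm_le_l1)
  also have "\<dots> \<le> (\<Sum>e\<in>(Basis :: (real ^ 'n) set). a)" by (rule sum_mono) (rule \<sigma>)
  also have "\<dots> < 2 * real CARD('n) * a" using a by simp
  finally have "y + \<sigma> \<in> ball y (2 * real CARD('n) * a)" by (simp add: dist_norm)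
  with b show ?thesis by blast
qed

lemma corner_vertex_in_V:
  assumes "a > 0" "ball y (2 * real CARD('n) * a) \<subseteq> V"
  shows "y + corner Basis a T \<in> V"
  by (rule corner_in_V[OF assms]) (use assms in \<open>simp add: corner_inner\<close>)

text \<open>\<open>tube_formula\<close> is applied to the pairing of \<open>u (y + \<sigma>)\<close>
  with the translate of \<open>\<psi>\<close> by \<open>s\<close>. The uniform estimate and the
  polynomial weight of \<open>E\<close> supply its growth bound;
  \<open>functional_convolution\<close> then collects the integral over translates into one
  convolution.\<close>

lemma corner_representation:
  assumes K: "K \<ge> 0" "\<And>y f. y \<in> V \<Longrightarrow> f \<in> DE_space E \<Longrightarrow> cmod (u y f) \<le> K * DE_norm nE N f"
    and a: "a > 0" "ball y (2 * real CARD('n) * a) \<subseteq> V" and \<psi>: "\<psi> \<in> test_functions"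
  shows "u y (schwartz_dist \<psi>) = (\<Sum>T\<in>Pow Basis. u (y + corner Basis a T) (schwartz_dist (convolution (sech_kernel a) \<psi>)))"
proof -
  have S: "\<psi> \<in> schwartz" by (rule test_functions_schwartz[OF \<psi>])
  define G where "G s \<sigma> = u (y + \<sigma>) (schwartz_dist (\<lambda>x. \<psi> (x - s)))" for s \<sigma>
  let ?k = "sech_kernel a :: 'n test_fun"
  have "G 0 0 = (\<Sum>T\<in>Pow Basis. LINT s|lborel. of_real (\<Prod>b\<in>Basis. strip_kernel a (s \<bullet> b)) * G s (corner Basis a T))"
  proof (rule tube_formula[where d="2 * a" and B="K * (wconst * DE_norm nE N (schwartz_dist \<psi>))" and m=wdeg])
    fix p \<sigma> b :: "real ^ 'n"
    assume b: "b \<in> Basis" and \<sigma>: "\<And>e. e \<in> Basis \<Longrightarrow> \<bar>\<sigma> \<bullet> e\<bar> \<le> a" "\<sigma> \<bullet> b = 0"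
    have sub: "{w. \<bar>Im w\<bar> < 2 * a} \<subseteq> {w. (y + \<sigma>) + Im w *\<^sub>R b \<in> V}"
    proof
      fix w assume "w \<in> {w. \<bar>Im w\<bar> < 2 * a}"
      then have "\<bar>Im w\<bar> < 2 * a" by (rule CollectD)
      from cube_norm[OF b \<sigma> this] have "norm (\<sigma> + Im w *\<^sub>R b) < 2 * real CARD('n) * a" .
      then have "y + (\<sigma> + Im w *\<^sub>R b) \<in> ball y (2 * real CARD('n) * a)"
        using norm_minus_cancel[of "\<sigma> + Im w *\<^sub>R b"] by (simp add: dist_norm)
      then have "y + (\<sigma> + Im w *\<^sub>R b) \<in> V" using a(2) by blast
      then show "w \<in> {w. (y + \<sigma>) + Im w *\<^sub>R b \<in> V}" by (simp add: add.assoc)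
    qed
    have "(\<lambda>w. u ((y + \<sigma>) + Im w *\<^sub>R b) (schwartz_dist (\<lambda>x. \<psi> ((x - Re w *\<^sub>R b) - p)))) holomorphic_on {w. (y + \<sigma>) + Im w *\<^sub>R b \<in> V}"
      by (rule pairing_holomorphic[OF test_functions_shift[OF \<psi>]])
    then have "(\<lambda>w. u ((y + \<sigma>) + Im w *\<^sub>R b) (schwartz_dist (\<lambda>x. \<psi> ((x - Re w *\<^sub>R b) - p)))) holomorphic_on {w. \<bar>Im w\<bar> < 2 * a}"
      by (rule holomorphic_on_subset[OF _ sub])
    then show "(\<lambda>w. G (p + Re w *\<^sub>R b) (\<sigma> + Im w *\<^sub>R b)) holomorphic_on {w. \<bar>Im w\<bar> < 2 * a}"
      by (simp add: G_def add.assoc diff_diff_eq add.commute[of p])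
  next
    fix \<sigma> :: "real ^ 'n" assume \<sigma>: "\<And>e. e \<in> Basis \<Longrightarrow> \<bar>\<sigma> \<bullet> e\<bar> \<le> a"
    note ud = u_dual[OF corner_in_V[OF a \<sigma>]]
    obtain K' m where K': "\<And>\<phi>. \<phi> \<in> schwartz \<Longrightarrow> cmod (u (y + \<sigma>) (schwartz_dist \<phi>)) \<le> K' * schwartz_norm m \<phi>"
      using DE_dual_tempered(2)[OF ud] by blast
    show "continuous_on UNIV (\<lambda>s. G s \<sigma>)"
      unfolding G_def by (rule shift_functional_continuous(1)[OF S DE_dual_tempered(1)[OF ud] K'])
  next
    fix s \<sigma> :: "real ^ 'n" assume \<sigma>: "\<And>e. e \<in> Basis \<Longrightarrow> \<bar>\<sigma> \<bullet> e\<bar> \<le> a"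
    let ?X = "DE_norm nE N (schwartz_dist \<psi>)"
    have X: "?X \<ge> 0" by (rule DE_norm_nonneg[OF dist_DE[OF S]])
    have "cmod (G s \<sigma>) \<le> K * DE_norm nE N (schwartz_dist (\<lambda>x. \<psi> (x - s)))"
      unfolding G_def by (rule K(2)[OF corner_in_V[OF a \<sigma>] dist_DE[OF schwartz_shift[OF S]]])
    also have "\<dots> \<le> K * (weight s * ?X)" by (intro mult_left_mono DE_norm_shift S K)
    also have "\<dots> \<le> K * ((wconst * (1 + norm s) ^ wdeg) * ?X)" by (intro mult_left_mono mult_right_mono weight_bound X K)
    also have "\<dots> = K * (wconst * ?X) * (1 + norm s) ^ wdeg" by (simp add: mult_ac)
    finally show "cmod (G s \<sigma>) \<le> K * (wconst * ?X) * (1 + norm s) ^ wdeg" .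
  qed (use a in auto)
  also have "\<dots> = (\<Sum>T\<in>Pow Basis. u (y + corner Basis a T) (schwartz_dist (convolution ?k \<psi>)))"
  proof (rule sum.cong[OF refl])
    fix T :: "(real ^ 'n) set"
    note ud = u_dual[OF corner_vertex_in_V[OF a, of T]]
    obtain K' m where K': "\<And>\<phi>. \<phi> \<in> schwartz \<Longrightarrow> cmod (u (y + corner Basis a T) (schwartz_dist \<phi>)) \<le> K' * schwartz_norm m \<phi>"
      using DE_dual_tempered(2)[OF ud] by blast
    have k: "of_real (\<Prod>b\<in>Basis. strip_kernel a (s \<bullet> b)) = ?k s" for s
      unfolding prod_Basis_cart[of "strip_kernel a"] by (simp only: sech_kernel_eq of_real_prod strip_kernel_def)
    show "(LINT s|lborel. of_real (\<Prod>b\<in>Basis. strip_kernel a (s \<bullet> b)) * G s (corner Basis a T))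
        = u (y + corner Basis a T) (schwartz_dist (convolution ?k \<psi>))"
      unfolding k G_def
      by (rule functional_convolution(1)[OF sech_kernel_schwartz[OF a(1)] S DE_dual_tempered(1)[OF ud] K', symmetric])
  qed
  finally show ?thesis by (simp add: G_def)
qed

text \<open>The candidate for \<open>u y\<close> as an element of the dual of \<open>E\<close>: the
  kernel carries all of \<open>E\<close> into \<open>D\<^sub>E\<close>, where the functionals at the
  corners are defined.\<close>

definition corner_functional :: "real \<Rightarrow> real ^ 'n \<Rightarrow> 'n tdist \<Rightarrow> complex" where
  "corner_functional a y f = (if f \<in> E then \<Sum>T\<in>Pow Basis. u (y + corner Basis a T) (cv (sech_kernel a) f) else 0)"

lemma corner_functional_bound:
  assumes K: "K \<ge> 0" "\<And>y f. y \<in> V \<Longrightarrow> f \<in> DE_space E \<Longrightarrow> cmod (u y f) \<le> K * DE_norm nE N f"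
    and a: "a > 0" "ball y (2 * real CARD('n) * a) \<subseteq> V"
    and Q: "\<And>js. length js \<le> N \<Longrightarrow> wnorm (partial_derivs js (sech_kernel a)) \<le> Q" and f: "f \<in> E"
  shows "cmod (corner_functional a y f) \<le> (2 ^ CARD('n) * K * wconst * Q) * nE f"
proof -
  note S = sech_kernel_schwartz[OF a(1)]
  have "cmod (corner_functional a y f) \<le> (\<Sum>T\<in>Pow (Basis :: (real ^ 'n) set). K * (wconst * Q * nE f))"
    unfolding corner_functional_def using f
  proof (simp only: if_True, intro order_trans[OF norm_sum] sum_mono)
    fix T :: "(real ^ 'n) set"
    have "cmod (u (y + corner Basis a T) (cv (sech_kernel a) f)) \<le> K * DE_norm nE N (cv (sech_kernel a) f)"
      by (rule K(2)[OF corner_vertex_in_V[OF a] cv_DE(1)[OF S f]])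
    also have "\<dots> \<le> K * (wconst * Q * nE f)" by (intro mult_left_mono cv_DE(2)[OF S f] Q K)
    finally show "cmod (u (y + corner Basis a T) (cv (sech_kernel a) f)) \<le> K * (wconst * Q * nE f)" .
  qed
  also have "\<dots> = (2 ^ CARD('n) * K * wconst * Q) * nE f" by (simp add: card_Pow)
  finally show ?thesis .
qed

lemma corner_functional_dual:
  assumes K: "K \<ge> 0" "\<And>y f. y \<in> V \<Longrightarrow> f \<in> DE_space E \<Longrightarrow> cmod (u y f) \<le> K * DE_norm nE N f"
    and a: "a > 0" "ball y (2 * real CARD('n) * a) \<subseteq> V"
    and Q: "\<And>js. length js \<le> N \<Longrightarrow> wnorm (partial_derivs js (sech_kernel a)) \<le> Q"
  shows "corner_functional a y \<in> dual_space E nE"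
  unfolding dual_space_def
proof (rule ES.dualI[where p=nE])
  note S = sech_kernel_schwartz[OF a(1)]
  note lin = DE_dual_linear[OF u_dual[OF corner_vertex_in_V[OF a]]]
  show "corner_functional a y f = 0" if "f \<notin> E" for f using that by (simp add: corner_functional_def)
  show "clinear_functional_on E (corner_functional a y)"
    unfolding clinear_functional_on_def
  proof (intro conjI ballI allI)
    fix f g assume fg: "f \<in> E" "g \<in> E"
    have "u (y + corner Basis a T) (cv (sech_kernel a) f + cv (sech_kernel a) g)
        = u (y + corner Basis a T) (cv (sech_kernel a) f) + u (y + corner Basis a T) (cv (sech_kernel a) g)" for T
      using lin cv_DE(1)[OF S fg(1)] cv_DE(1)[OF S fg(2)] unfolding clinear_functional_on_def by blast
    then show "corner_functional a y (f + g) = corner_functional a y f + corner_functional a y g"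
      unfolding corner_functional_def cv_add using fg ES.add_mem[OF fg] by (simp only: if_True sum.distrib)
  next
    fix c f assume f: "f \<in> E"
    have "u (y + corner Basis a T) (\<lambda>x. c * cv (sech_kernel a) f x) = c * u (y + corner Basis a T) (cv (sech_kernel a) f)" for T
      using lin cv_DE(1)[OF S f] unfolding clinear_functional_on_def by blast
    then show "corner_functional a y (\<lambda>x. c * f x) = c * corner_functional a y f"
      unfolding corner_functional_def cv_cmult using f ES.scale_mem[OF f, of c] by (simp only: if_True sum_distrib_left)
  qed
  show "cmod (corner_functional a y f) \<le> (2 ^ CARD('n) * K * wconst * Q) * nE f" if "f \<in> E" for f
    by (rule corner_functional_bound[where N=N]) (use K a Q that in auto)
qed simp

lemma corner_functional_represents:
  assumes K: "K \<ge> 0" "\<And>y f. y \<in> V \<Longrightarrow> f \<in> DE_space E \<Longrightarrow> cmod (u y f) \<le> K * DE_norm nE N f"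
    and a: "a > 0" "ball y (2 * real CARD('n) * a) \<subseteq> V"
  shows "represents (corner_functional a y) (hslice F y)"
  unfolding represents_def
proof
  fix \<phi> :: "'n test_fun" assume \<phi>: "\<phi> \<in> test_functions"
  have y: "y \<in> V" using corner_in_V[OF a, of 0] a by simp
  have S: "\<phi> \<in> schwartz" by (rule test_functions_schwartz[OF \<phi>])
  have "corner_functional a y (schwartz_dist \<phi>) = u y (schwartz_dist \<phi>)"
    unfolding corner_functional_def cv_schwartz_dist[OF sech_kernel_schwartz[OF a(1)] S]
    using corner_representation[where N=N, OF K(1) _ a \<phi>] K(2) dist_mem[OF S] by simp
  then show "integrable lborel (\<lambda>x. hslice F y x * \<phi> x) \<and> corner_functional a y (schwartz_dist \<phi>) = (LINT x|lborel. hslice F y x * \<phi> x)"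
    using u_rep[OF y] \<phi> unfolding represents_def by simp
qed

lemma sech_kernel_weighted:
  assumes a: "a > 0"
  shows "sech_kernel a \<in> weighted_L1 (\<lambda>x. weight (- x))"
proof -
  have S: "sech_kernel a \<in> (schwartz :: 'n test_fun set)" by (rule sech_kernel_schwartz[OF a])
  have m: "sech_kernel a \<in> borel_measurable (borel :: (real ^ 'n) measure)" by (rule schwartz_measurable[OF S])
  have w: "(\<lambda>x. weight (- x)) \<in> borel_measurable borel" by measurable
  have pm: "(\<lambda>x. cmod (sech_kernel a x) * weight (- x)) \<in> borel_measurable borel" using m w by measurable
  have "integrable lborel (\<lambda>x. cmod (sech_kernel a x) * weight (- x))"
    by (rule schwartz_weighted_integrable[OF S w, where B=wconst and k=wdeg])
      (use weight_bound[of "- x" for x] in \<open>auto simp: weight_nonneg\<close>)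
  then show ?thesis
    unfolding weighted_L1_def using m pm by (simp add: integrable_completion measurable_completion)
qed

text \<open>The corners are themselves points of \<open>V\<close>, so by assumption the functionals
  there extend to elements of the dual of \<open>E\<close>. The kernel is even, so the reflection in
  \<open>conv_dual\<close> has no effect, and the corner functional is the convolution of the kernel
  with the sum of these extensions.\<close>

lemma corner_functional_star:
  assumes a: "a > 0" "ball y (2 * real CARD('n) * a) \<subseteq> V"
    and mem: "\<And>z. z \<in> V \<Longrightarrow> belongs (hslice F z) (dual_space E nE)"
  shows "corner_functional a y \<in> dual_space_star E nE"
proof -
  note S = sech_kernel_schwartz[OF a(1)]
  have "\<exists>L\<in>dual_space E nE. \<forall>f\<in>DE_space E. u (y + corner Basis a T) f = L f" for T
  proof -
    let ?z = "y + corner Basis a T"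
    have z: "?z \<in> V" by (rule corner_vertex_in_V[OF a])
    obtain L where L: "L \<in> dual_space E nE" "represents L (hslice F ?z)" using mem[OF z] unfolding belongs_def by blast
    have "u ?z = restr L"
      by (rule DE_dual_unique[OF u_dual[OF z] u_rep[OF z] restr_DE_dual[OF L(1)] restr_represents[OF L(2)]])
    then show ?thesis using L(1) by (intro bexI[of _ L]) (simp_all add: restr_def)
  qed
  then obtain L where L: "\<And>T. L T \<in> dual_space E nE" "\<And>T f. f \<in> DE_space E \<Longrightarrow> u (y + corner Basis a T) f = L T f"
    by metis
  let ?L = "\<lambda>f. \<Sum>T\<in>Pow Basis. L T f"
  have "?L \<in> dual_space E nE"
    unfolding dual_space_def
  proof (rule ES.dualI[where p=nE])
    show "?L f = 0" if "f \<notin> E" for f by (simp add: dual_space_outside[OF L(1) that])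
    show "clinear_functional_on E ?L"
      using dual_space_linear[OF L(1)] unfolding clinear_functional_on_def
      by (simp add: sum.distrib sum_distrib_left)
    show "cmod (?L f) \<le> (\<Sum>T\<in>Pow Basis. dual_norm E nE (L T)) * nE f" if f: "f \<in> E" for f
      unfolding sum_distrib_right by (intro order_trans[OF norm_sum] sum_mono dual_norm_bound L f)
  qed simp
  moreover have "corner_functional a y = conv_dual E nE (sech_kernel a) ?L"
  proof
    fix f
    show "corner_functional a y f = conv_dual E nE (sech_kernel a) ?L f"
    proof (cases "f \<in> E")
      case True
      then show ?thesis
        unfolding corner_functional_def conv_dual_def sech_kernel_even
        by (simp only: if_True conv_ext_eq_cv[OF S True] L(2)[OF cv_DE(1)[OF S True]])
    qed (simp add: corner_functional_def conv_dual_def)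
  qed
  ultimately show ?thesis
    unfolding dual_space_star_def using sech_kernel_weighted[OF a(1)] by blast
qed

lemma dual_growth_of_equicontinuous:
  assumes K: "K \<ge> 0" "\<And>y f. y \<in> V \<Longrightarrow> f \<in> DE_space E \<Longrightarrow> cmod (u y f) \<le> K * DE_norm nE N f"
  shows "\<And>y. y \<in> V \<Longrightarrow> belongs (hslice F y) (dual_space E nE)"
    "\<And>y. y \<in> V \<Longrightarrow> belongs (hslice F y) (dual_space_star E nE)"
    "\<exists>M>0. \<exists>\<kappa>\<ge>0. \<forall>y\<in>V. dual_norm E nE (func_in (dual_space E nE) (hslice F y)) \<le> M / (bdry_dist V y) powr \<kappa>"
proof -
  let ?n = "real CARD('n)"
  have n: "?n \<ge> 1" by (simp add: Suc_le_eq)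
  have bV: "bounded V" unfolding V_eq by (simp add: bounded_Int)
  \<comment> \<open>With this half-width the ball required by the corner formula has the distance to
    the boundary as its radius.\<close>
  define \<alpha> where "\<alpha> y = bdry_dist V y / (2 * ?n)" for y
  have d: "bdry_dist V y > 0" if y: "y \<in> V" for y
  proof -
    obtain e where e: "e > 0" "ball y e \<subseteq> V" using open_V y unfolding open_contains_ball by blast
    then show ?thesis using bdry_dist_ge_iff[OF open_V bV y, of e] by simp
  qed
  have \<alpha>: "\<alpha> y > 0" "ball y (2 * ?n * \<alpha> y) \<subseteq> V" if y: "y \<in> V" for y
    using d[OF y] bdry_dist_ge_iff[OF open_V bV y, of "bdry_dist V y"] n by (simp_all add: \<alpha>_def)
  \<comment> \<open>The kernel estimates are uniform over bounded half-widths, and \<open>V\<close>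
    lies in a ball of radius \<open>r\<close>. The maximum with 1 meets the condition
    \<open>1 \<le> A\<close> of \<open>wnorm_sech_kernel\<close>.\<close>
  have \<alpha>_le: "\<alpha> y \<le> max 1 (2 * r)" if y: "y \<in> V" for y
  proof -
    obtain b :: "real ^ 'n" where b: "b \<in> Basis" using nonempty_Basis by blast
    have "bdry_dist V y \<le> 2 * r"
    proof (rule ccontr)
      assume "\<not> bdry_dist V y \<le> 2 * r"
      then have "y + (2 * r) *\<^sub>R b \<in> ball y (bdry_dist V y)" using b r by (simp add: dist_norm)
      then have "y + (2 * r) *\<^sub>R b \<in> V" using bdry_dist_ge_iff[OF open_V bV y, of "bdry_dist V y"] by blast
      then have "norm (y + (2 * r) *\<^sub>R b) < r" "norm y < r" using y by (auto simp: cone_trunc_def)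
      then have "norm ((2 * r) *\<^sub>R b) < 2 * r" using norm_triangle_ineq4[of "y + (2 * r) *\<^sub>R b" y] by simp
      then show False using b r by simp
    qed
    then have "\<alpha> y \<le> 2 * r / (2 * ?n)" unfolding \<alpha>_def using n by (intro divide_right_mono) auto
    also have "\<dots> \<le> 2 * r / 1"
    proof (rule divide_left_mono)
      show "1 \<le> 2 * ?n" using n by linarith
    qed (use n r in simp_all)
    finally show ?thesis by simp
  qed
  obtain Q where Q: "Q \<ge> 0" "\<And>a js. 0 < a \<Longrightarrow> a \<le> max 1 (2 * r) \<Longrightarrow> length js \<le> N \<Longrightarrow>
      wnorm (partial_derivs js (sech_kernel a)) \<le> Q * (1 / a) ^ (CARD('n) + N)"
    using wnorm_sech_kernel[of "max 1 (2 * r)" N] by auto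
  let ?L = "\<lambda>y. corner_functional (\<alpha> y) y"
  have dual: "?L y \<in> dual_space E nE" if y: "y \<in> V" for y
    by (rule corner_functional_dual[where N=N and Q="Q * (1 / \<alpha> y) ^ (CARD('n) + N)"])
      (use K \<alpha>[OF y] Q(2)[OF \<alpha>(1)[OF y] \<alpha>_le[OF y]] in auto)
  have rep: "represents (?L y) (hslice F y)" if y: "y \<in> V" for y
    by (rule corner_functional_represents[where N=N]) (use K \<alpha>[OF y] in auto)
  show mem: "belongs (hslice F y) (dual_space E nE)" if "y \<in> V" for y
    unfolding belongs_def using dual rep that by blast
  show "belongs (hslice F y) (dual_space_star E nE)" if y: "y \<in> V" for y
    unfolding belongs_def using corner_functional_star[OF \<alpha>[OF y] mem] rep[OF y] by blast
  \<comment> \<open>The power of \<open>1 / \<alpha> y\<close> in the kernel estimate.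
    \<open>M\<close> collects the remaining constants; it can be 0, whence \<open>M + 1\<close> in
    the final bound.\<close>
  define \<kappa> where "\<kappa> = CARD('n) + N"
  define M where "M = 2 ^ CARD('n) * K * wconst * Q * (2 * ?n) ^ \<kappa>"
  have M: "M \<ge> 0" unfolding M_def using K Q wconst_pos by simp
  have "dual_norm E nE (func_in (dual_space E nE) (hslice F y)) \<le> (M + 1) / (bdry_dist V y) powr real \<kappa>" if y: "y \<in> V" for y
  proof -
    let ?q = "Q * (1 / \<alpha> y) ^ \<kappa>"
    have q: "0 \<le> 2 ^ CARD('n) * K * wconst * ?q" using K Q wconst_pos \<alpha>(1)[OF y] by simp
    have "dual_norm E nE (?L y) \<le> 2 ^ CARD('n) * K * wconst * ?q"
    proof (rule dual_norm_le[OF q])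
      show "cmod (?L y f) \<le> 2 ^ CARD('n) * K * wconst * ?q * nE f" if "f \<in> E" for f
        by (rule corner_functional_bound[where N=N])
          (use K \<alpha>[OF y] Q(2)[OF \<alpha>(1)[OF y] \<alpha>_le[OF y]] that in \<open>auto simp: \<kappa>_def\<close>)
    qed
    also have "\<dots> = M / bdry_dist V y ^ \<kappa>"
      unfolding M_def \<alpha>_def by (simp add: power_divide)
    also have "\<dots> \<le> (M + 1) / bdry_dist V y ^ \<kappa>" using d[OF y] by (intro divide_right_mono) auto
    also have "bdry_dist V y ^ \<kappa> = bdry_dist V y powr real \<kappa>" using d[OF y] by (simp add: powr_realpow)
    finally show ?thesis by (simp add: func_in_dual_space_eq[OF dual[OF y] rep[OF y]])
  qed
  then show "\<exists>M>0. \<exists>\<kappa>\<ge>0. \<forall>y\<in>V. dual_norm E nE (func_in (dual_space E nE) (hslice F y)) \<le> M / (bdry_dist V y) powr \<kappa>"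
    using M by (intro exI[of _ "M + 1"] conjI exI[of _ "real \<kappa>"]) auto
qed

end

theorem theorem3p3:
  fixes E :: "('n::finite) tdist set" and nE :: "'n tdist \<Rightarrow> real"
    and C :: "(real ^ 'n) set" and r :: real
    and F :: "complex ^ 'n \<Rightarrow> complex"
  assumes E: "transl_inv_banach E nE"
    and C: "open_convex_cone C"
    and r: "r > 0"
    and holo: "holomorphic_several_on F (tube (cone_trunc C r))"
    and mem: "\<And>y. y \<in> cone_trunc C r \<Longrightarrow> belongs (hslice F y) (DE_dual E nE)"
    and bdd: "\<And>r'. r' > 0 \<Longrightarrow>
      DE_dual_bounded E nE {func_in (DE_dual E nE) (hslice F y) | y. r' < norm y \<and> norm y < r \<and> y \<in> C}"
  defines "cond_i \<equiv>
      (\<forall>y \<in> cone_trunc C r. belongs (hslice F y) (dual_space E nE)) \<and>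
      (\<exists>M>0. \<exists>\<kappa>\<ge>0. \<forall>y \<in> cone_trunc C r.
         dual_norm E nE (func_in (dual_space E nE) (hslice F y)) \<le> M / (bdry_dist (cone_trunc C r) y) powr \<kappa>)"
    and "cond_ii \<equiv>
      (\<exists>f \<in> DE_dual E nE.
         limitin (DE_dual_topology E nE) (\<lambda>y. func_in (DE_dual E nE) (hslice F y)) f (at 0 within C))"
    and "cond_iii \<equiv>
      DE_dual_bounded E nE {func_in (DE_dual E nE) (hslice F y) | y. y \<in> cone_trunc C r}"
  shows "(cond_i \<longleftrightarrow> cond_ii) \<and> (cond_ii \<longleftrightarrow> cond_iii) \<and>
    (cond_i \<or> cond_ii \<or> cond_iii \<longrightarrow> (\<forall>y \<in> cone_trunc C r. belongs (hslice F y) (dual_space_star E nE)))"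
proof -
  interpret tube_function E nE C r F
    by (intro tube_function.intro tube_function_axioms.intro E C r holo mem)
  \<comment> \<open>The pivot of the equivalences: it amounts to (iii), follows from (i), and yields
    (i), (ii) and the supplement. The implication from (ii) to (iii) closes the circle.\<close>
  define equi where "equi \<longleftrightarrow> (\<exists>K N. K \<ge> 0 \<and> (\<forall>y\<in>V. \<forall>f\<in>DE_space E. cmod (u y f) \<le> K * DE_norm nE N f))"
  have annulus: "DE_dual_bounded E nE {u y | y. r' < norm y \<and> norm y < r \<and> y \<in> C}" if "r' > 0" for r'
    unfolding u_def by (rule bdd[OF that])
  have ii: "cond_ii \<longleftrightarrow> (\<exists>f \<in> DE_dual E nE. limitin (DE_dual_topology E nE) u f (at 0 within C))"
    unfolding cond_ii_def u_def[abs_def] ..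
  have iii: "cond_iii \<longleftrightarrow> DE_dual_bounded E nE {u y | y. y \<in> V}"
    unfolding cond_iii_def u_def ..
  have "equi \<longleftrightarrow> cond_iii"
  proof
    assume equi
    then obtain K N where K: "K \<ge> 0" "\<And>y f. y \<in> V \<Longrightarrow> f \<in> DE_space E \<Longrightarrow> cmod (u y f) \<le> K * DE_norm nE N f"
      unfolding equi_def by auto
    show cond_iii unfolding iii by (rule DE_dual_boundedI[where K=K and N=N]) (use u_dual K in auto)
  next
    assume cond_iii
    then show equi unfolding iii equi_def using DE_dual_bounded_equicontinuous[of "{u y | y. y \<in> V}"] by blast
  qed
  moreover have "cond_i \<Longrightarrow> equi"
  proof -
    assume i: cond_i
    then obtain M \<kappa> where M: "M > 0" "\<kappa> \<ge> 0"
      "\<And>y. y \<in> V \<Longrightarrow> dual_norm E nE (func_in (dual_space E nE) (hslice F y)) \<le> M / (bdry_dist V y) powr \<kappa>"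
      unfolding cond_i_def by auto
    show equi
      unfolding equi_def
      by (rule equicontinuous_of_dual_growth[OF annulus _ M]) (use i in \<open>auto simp: cond_i_def\<close>)
  qed
  moreover have "equi \<Longrightarrow> cond_i \<and> cond_ii \<and> (\<forall>y\<in>V. belongs (hslice F y) (dual_space_star E nE))"
  proof -
    assume equi
    then obtain K N where K: "K \<ge> 0" "\<And>y f. y \<in> V \<Longrightarrow> f \<in> DE_space E \<Longrightarrow> cmod (u y f) \<le> K * DE_norm nE N f"
      unfolding equi_def by auto
    have cond_i unfolding cond_i_def using dual_growth_of_equicontinuous(1,3)[where N=N, OF K(1)] K(2) by blast
    moreover have "\<forall>y\<in>V. belongs (hslice F y) (dual_space_star E nE)"
      using dual_growth_of_equicontinuous(2)[where N=N, OF K(1)] K(2) by blast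
    moreover have cond_ii
    proof (cases "C = {}")
      \<comment> \<open>The filter \<open>at 0 within {}\<close> is trivial, so every element of the
        dual is a limit, and 0 serves.\<close>
      case True
      interpret SD: seminormed_space "DE_dual E nE" "strong_seminorms (DE_space E) (DE_seminorms nE)"
        unfolding DE_dual_def by (rule DS.strong_dual_seminormed)
      have "limitin (DE_dual_topology E nE) u 0 (at 0 within C)"
        unfolding DE_dual_topology_def strong_dual_topology_def DE_dual_def[symmetric]
        by (rule SD.limitin_lc[OF SD.zero_mem]) (simp add: True)
      then show ?thesis unfolding ii using SD.zero_mem by blast
    next
      case False
      show ?thesis unfolding ii by (rule boundary_value[where N=N, OF K(1) _ False]) (use K(2) in auto)
    qed
    ultimately show ?thesis by blast
  qed
  moreover have "cond_ii \<Longrightarrow> cond_iii"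
    unfolding ii iii using bounded_of_boundary_value[OF annulus] by blast
  ultimately show ?thesis by blast
qed

end
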